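(* Let $E$ be an $H_\infty$-ring spectrum, $G$ a finite group, $m\geq 1$, and let $H\triangleleft G$ be a normal subgroup. Suppose $m$ and $|G/H|$ are relatively prime. Then $J_H^G=I_{\mathrm{Tr}}$ as ideals of $E^0(BG\times B\Sigma_m)$.
   Context: Finite covers of spaces (in particular $B\Lambda\to B\Lambda'$ for $\Lambda\le\Lambda'$ finite groups) give additive transfer maps in $E$-cohomology. $I_{\mathrm{Tr}}\subseteq E^0(BG\times B\Sigma_m)$ is the ideal given by the image of the direct sum of the transfers along $G\times\Sigma_i\times\Sigma_j\le G\times\Sigma_m$ for $i+j=m$, $i,j>0$. The group $G\times\Sigma_m$ acts on $(G/H)^{\times m}$, $G$ diagonally and $\Sigma_m$ by permuting factors. Let $\Delta(G/H)=\{(gH,\dots,gH)\mid g\in G\}$ and $Z^{G,H}=(G/H)^{\times m}\setminus\Delta(G/H)$. $J_H^G\subseteq E^0(BG\times B\Sigma_m)$ is defined to be the ideal generated by the images of the transfers along (i) $G\times\Sigma_i\times\Sigma_j\subseteq G\times\Sigma_m$ for $i,j>0$, $i+j=m$, and (ii) the composite $Z^{G,H}_{h(G\times\Sigma_m)}\subseteq(G/H)^{\times m}_{h(G\times\Sigma_m)}\to BG\times B\Sigma_m$. *)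

theory Defs
  imports "HOL-Algebra.Sym_Groups" "HOL-Algebra.Ideal" "HOL-Algebra.Coset"
begin

text \<open>
  Spaces are simplicial sets, and the stable homotopy category is modelled by symmetric spectra of
  simplicial sets with the stable model structure of Hovey, Shipley and Smith. Its bifibrant objects
  represent all homotopy types of spectra; for a bifibrant \<open>E\<close> and a cofibrant \<open>D\<close>, maps from \<open>D\<close>
  to \<open>E\<close> in the stable homotopy category are homotopy classes of maps of symmetric spectra. In
  particular \<open>E\<^sup>0(X)\<close> is the set of homotopy classes of maps from \<open>X\<close> to the Kan complex \<open>E\<^sub>0\<close>.
\<close>

section \<open>Simplicial sets\<close>

text \<open>
  A morphism \<open>[m] \<rightarrow> [n]\<close> of the simplex category is the list of its \<open>m + 1\<close> values. A simplex
  carries its dimension, so that sets of simplices of different dimensions are disjoint.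
\<close>

definition ops :: "nat \<Rightarrow> nat \<Rightarrow> nat list set" where
  "ops m n = {\<theta>. length \<theta> = Suc m \<and> sorted \<theta> \<and> set \<theta> \<subseteq> {..n}}"

record 'a sset =
  cells :: "'a set"
  sdim :: "'a \<Rightarrow> nat"
  opr :: "nat list \<Rightarrow> 'a \<Rightarrow> 'a"

definition simp :: "'a sset \<Rightarrow> nat \<Rightarrow> 'a set" where
  "simp X n = {x \<in> cells X. sdim X x = n}"

definition is_sset :: "'a sset \<Rightarrow> bool" where
  "is_sset X \<longleftrightarrow>
     (\<forall>m n. \<forall>\<theta>\<in>ops m n. \<forall>x\<in>simp X n. opr X \<theta> x \<in> simp X m) \<and>
     (\<forall>n. \<forall>x\<in>simp X n. opr X [0..<Suc n] x = x) \<and>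
     (\<forall>l m n. \<forall>\<phi>\<in>ops l m. \<forall>\<theta>\<in>ops m n. \<forall>x\<in>simp X n.
        opr X (map ((!) \<theta>) \<phi>) x = opr X \<phi> (opr X \<theta> x))"

definition smap :: "'a sset \<Rightarrow> 'b sset \<Rightarrow> ('a \<Rightarrow> 'b) \<Rightarrow> bool" where
  "smap X Y f \<longleftrightarrow>
     (\<forall>n. \<forall>x\<in>simp X n. f x \<in> simp Y n) \<and>
     (\<forall>m n. \<forall>\<theta>\<in>ops m n. \<forall>x\<in>simp X n. f (opr X \<theta> x) = opr Y \<theta> (f x))"

definition sprod :: "'a sset \<Rightarrow> 'b sset \<Rightarrow> ('a \<times> 'b) sset" where
  "sprod X Y = \<lparr>cells = {(x, y). x \<in> cells X \<and> y \<in> cells Y \<and> sdim X x = sdim Y y},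
                sdim = (\<lambda>(x, y). sdim X x),
                opr = (\<lambda>\<theta> (x, y). (opr X \<theta> x, opr Y \<theta> y))\<rparr>"

text \<open>The product with a discrete simplicial set.\<close>

definition sprod_disc :: "'a sset \<Rightarrow> 'b set \<Rightarrow> ('a \<times> 'b) sset" where
  "sprod_disc X W = \<lparr>cells = cells X \<times> W,
                     sdim = (\<lambda>(x, w). sdim X x),
                     opr = (\<lambda>\<theta> (x, w). (opr X \<theta> x, w))\<rparr>"

definition std_simplex :: "nat \<Rightarrow> nat list sset" where
  "std_simplex n = \<lparr>cells = (\<Union>m. ops m n),
                    sdim = (\<lambda>t. length t - 1),
                    opr = (\<lambda>\<theta> t. map ((!) t) \<theta>)\<rparr>"

text \<open>
  The circle is the 1-simplex modulo its boundary; the two constant simplices of each dimension are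
  identified, and the one with value \<open>0\<close> represents the base point.
\<close>

definition circle_base :: "nat \<Rightarrow> nat list" where
  "circle_base n = replicate (Suc n) 0"

definition circle :: "nat list sset" where
  "circle = \<lparr>cells = {t \<in> cells (std_simplex 1). 0 \<in> set t},
             sdim = (\<lambda>t. length t - 1),
             opr = (\<lambda>\<theta> t. let u = map ((!) t) \<theta> in if 0 \<in> set u then u else map (\<lambda>_. 0) u)\<rparr>"

definition homotopic :: "'a sset \<Rightarrow> 'b sset \<Rightarrow> ('a \<Rightarrow> 'b) \<Rightarrow> ('a \<Rightarrow> 'b) \<Rightarrow> bool" where
  "homotopic X Y f g \<longleftrightarrow> smap X Y f \<and> smap X Y g \<and>
     (\<exists>h. smap (sprod X (std_simplex 1)) Y h \<and>
        (\<forall>n. \<forall>x\<in>simp X n. h (x, replicate (Suc n) 0) = f x \<and> h (x, replicate (Suc n) 1) = g x))"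

text \<open>Homotopy is an equivalence relation if the target is a Kan complex, the only case used.\<close>

definition hclass :: "'a sset \<Rightarrow> 'b sset \<Rightarrow> ('a \<Rightarrow> 'b) \<Rightarrow> ('a \<Rightarrow> 'b) set" where
  "hclass X Y f = {g. homotopic X Y f g}"

definition homotopy_equiv :: "'a sset \<Rightarrow> 'b sset \<Rightarrow> ('a \<Rightarrow> 'b) \<Rightarrow> bool" where
  "homotopy_equiv X Y f \<longleftrightarrow> smap X Y f \<and>
     (\<exists>g. smap Y X g \<and> homotopic X X (g \<circ> f) id \<and> homotopic Y Y (f \<circ> g) id)"

text \<open>The injection \<open>[n] \<rightarrow> [n + 1]\<close> omitting \<open>i\<close>.\<close>

definition coface :: "nat \<Rightarrow> nat \<Rightarrow> nat list" where
  "coface n i = [0..<i] @ [Suc i..<Suc (Suc n)]"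

definition kan :: "'a sset \<Rightarrow> bool" where
  "kan X \<longleftrightarrow> is_sset X \<and>
     (\<forall>n k y. k \<le> Suc n \<and> (\<forall>i\<le>Suc n. i \<noteq> k \<longrightarrow> y i \<in> simp X n) \<and>
        (\<forall>i j. i < j \<and> j \<le> Suc n \<and> i \<noteq> k \<and> j \<noteq> k \<longrightarrow>
           opr X (coface (n - 1) i) (y j) = opr X (coface (n - 1) (j - 1)) (y i)) \<longrightarrow>
        (\<exists>x\<in>simp X (Suc n). \<forall>i\<le>Suc n. i \<noteq> k \<longrightarrow> opr X (coface n i) x = y i))"

text \<open>
  The simplicial mapping space of pointed maps from the circle to \<open>K\<close>, whose base point has the
  degeneracies \<open>b n\<close>. A \<open>k\<close>-simplex is \<open>k\<close> together with a map from the product of the circle and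
  the standard \<open>k\<close>-simplex to \<open>K\<close>.
\<close>

definition loops :: "'a sset \<Rightarrow> (nat \<Rightarrow> 'a) \<Rightarrow> (nat \<times> (nat list \<times> nat list \<Rightarrow> 'a)) sset" where
  "loops K b = \<lparr>cells = {(k, \<phi>). \<phi> \<in> extensional (cells (sprod circle (std_simplex k))) \<and>
                          smap (sprod circle (std_simplex k)) K \<phi> \<and>
                          (\<forall>j. \<forall>\<theta>\<in>ops j k. \<phi> (circle_base j, \<theta>) = b j)},
                sdim = fst,
                opr = (\<lambda>\<theta> (k, \<phi>). (length \<theta> - 1,
                        \<lambda>(t, \<psi>)\<in>cells (sprod circle (std_simplex (length \<theta> - 1))).
                          \<phi> (t, map ((!) \<theta>) \<psi>)))\<rparr>"


section \<open>Symmetric spectra\<close>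

text \<open>The block sum of permutations of \<open>{1..n}\<close> and \<open>{1..q}\<close>.\<close>

definition block_sum :: "nat \<Rightarrow> (nat \<Rightarrow> nat) \<Rightarrow> (nat \<Rightarrow> nat) \<Rightarrow> nat \<Rightarrow> nat" where
  "block_sum n \<alpha> \<beta> i = (if i \<le> n then \<alpha> i else n + \<beta> (i - n))"

text \<open>The left action on lists: entry \<open>i\<close> (counted from 1) is moved to position \<open>\<beta> i\<close>.\<close>

definition lperm :: "(nat \<Rightarrow> nat) \<Rightarrow> 'a list \<Rightarrow> 'a list" where
  "lperm \<beta> xs = map (\<lambda>i. xs ! (inv_into UNIV \<beta> (Suc i) - 1)) [0..<length xs]"

text \<open>
  Levels, base points (by level and dimension), symmetric group actions, and structure maps
  \<open>E\<^sub>n \<and> S\<^sup>1 \<rightarrow> E\<^sub>n\<^sub>+\<^sub>1\<close>.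
\<close>

record 'e symspec =
  lev :: "nat \<Rightarrow> 'e sset"
  bas :: "nat \<Rightarrow> nat \<Rightarrow> 'e"
  act :: "nat \<Rightarrow> (nat \<Rightarrow> nat) \<Rightarrow> 'e \<Rightarrow> 'e"
  sig :: "nat \<Rightarrow> 'e \<Rightarrow> nat list \<Rightarrow> 'e"

text \<open>The iterated structure map \<open>E\<^sub>n \<and> S\<^sup>q \<rightarrow> E\<^sub>n\<^sub>+\<^sub>q\<close>.\<close>

primrec sigs :: "'e symspec \<Rightarrow> nat \<Rightarrow> 'e \<Rightarrow> nat list list \<Rightarrow> 'e" where
  "sigs E n e [] = e"
| "sigs E n e (t # ts) = sigs E (Suc n) (sig E n e t) ts"

definition symmetric_spectrum :: "'e symspec \<Rightarrow> bool" where
  "symmetric_spectrum E \<longleftrightarrow>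
     (\<forall>n. is_sset (lev E n)) \<and>
     (\<forall>n k. bas E n k \<in> simp (lev E n) k) \<and>
     (\<forall>n l k. \<forall>\<theta>\<in>ops l k. opr (lev E n) \<theta> (bas E n k) = bas E n l) \<and>
     (\<forall>n. \<forall>\<alpha>\<in>carrier (sym_group n). smap (lev E n) (lev E n) (act E n \<alpha>) \<and>
        (\<forall>k. act E n \<alpha> (bas E n k) = bas E n k)) \<and>
     (\<forall>n. \<forall>e\<in>cells (lev E n). act E n id e = e \<and>
        (\<forall>\<alpha>\<in>carrier (sym_group n). \<forall>\<beta>\<in>carrier (sym_group n).
           act E n (\<alpha> \<circ> \<beta>) e = act E n \<alpha> (act E n \<beta> e))) \<and>
     (\<forall>n. smap (sprod (lev E n) circle) (lev E (Suc n)) (\<lambda>(e, t). sig E n e t)) \<and>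
     (\<forall>n k. \<forall>t\<in>simp circle k. sig E n (bas E n k) t = bas E (Suc n) k) \<and>
     (\<forall>n k. \<forall>e\<in>simp (lev E n) k. sig E n e (circle_base k) = bas E (Suc n) k) \<and>
     (\<forall>n q k. \<forall>e\<in>simp (lev E n) k. \<forall>ts. length ts = q \<and> set ts \<subseteq> simp circle k \<longrightarrow>
        (\<forall>\<alpha>\<in>carrier (sym_group n). \<forall>\<beta>\<in>carrier (sym_group q).
           sigs E n (act E n \<alpha> e) (lperm \<beta> ts) = act E (n + q) (block_sum n \<alpha> \<beta>) (sigs E n e ts)))"

definition loop_adjoint :: "'e symspec \<Rightarrow> nat \<Rightarrow> 'e \<Rightarrow> nat \<times> (nat list \<times> nat list \<Rightarrow> 'e)" where
  "loop_adjoint E n e =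
     (let k = sdim (lev E n) e in
      (k, \<lambda>(t, \<theta>)\<in>cells (sprod circle (std_simplex k)). sig E n (opr (lev E n) \<theta> e) t))"

text \<open>The stably fibrant objects; between Kan complexes weak equivalences are homotopy equivalences.\<close>

definition omega_spectrum :: "'e symspec \<Rightarrow> bool" where
  "omega_spectrum E \<longleftrightarrow> symmetric_spectrum E \<and> (\<forall>n. kan (lev E n)) \<and>
     (\<forall>n. homotopy_equiv (lev E n) (loops (lev E (Suc n)) (bas E (Suc n))) (loop_adjoint E n))"

text \<open>
  The latching object \<open>L\<^sub>n E\<close> is level \<open>n\<close> of the smash product, over the sphere spectrum \<open>S\<close>, of \<open>E\<close>
  with the truncation of \<open>S\<close> that has a point in level \<open>0\<close>. Its \<open>k\<close>-simplices are presented by tuples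
  \<open>(p, \<tau>, e, ts)\<close> with \<open>p < n\<close>, a permutation \<open>\<tau>\<close> of \<open>{1..n}\<close>, a simplex \<open>e\<close> of \<open>E\<^sub>p\<close>, and a simplex \<open>ts\<close>
  of \<open>S\<^sup>n\<^sup>-\<^sup>p\<close>, modulo \<open>latch_eq\<close>; the latching map to \<open>E\<^sub>n\<close> is \<open>latch_map\<close>.
\<close>

type_synonym 'e latch = "nat \<times> (nat \<Rightarrow> nat) \<times> 'e \<times> nat list list"

definition latch_pres :: "'e symspec \<Rightarrow> nat \<Rightarrow> nat \<Rightarrow> 'e latch set" where
  "latch_pres E n k =
     {(p, \<tau>, e, ts). p < n \<and> \<tau> \<in> carrier (sym_group n) \<and> e \<in> simp (lev E p) k \<and>
        length ts = n - p \<and> set ts \<subseteq> simp circle k}"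

definition latch_map :: "'e symspec \<Rightarrow> nat \<Rightarrow> 'e latch \<Rightarrow> 'e" where
  "latch_map E n = (\<lambda>(p, \<tau>, e, ts). act E n \<tau> (sigs E p e ts))"

definition latch_base :: "'e symspec \<Rightarrow> nat \<Rightarrow> 'e latch \<Rightarrow> bool" where
  "latch_base E k = (\<lambda>(p, \<tau>, e, ts). e = bas E p k \<or> circle_base k \<in> set ts)"

inductive latch_eq :: "'e symspec \<Rightarrow> nat \<Rightarrow> nat \<Rightarrow> 'e latch \<Rightarrow> 'e latch \<Rightarrow> bool" for E n k where
  refl: "x \<in> latch_pres E n k \<Longrightarrow> latch_eq E n k x x"
| sym: "latch_eq E n k x y \<Longrightarrow> latch_eq E n k y x"
| trans: "latch_eq E n k x y \<Longrightarrow> latch_eq E n k y z \<Longrightarrow> latch_eq E n k x z"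
| base: "x \<in> latch_pres E n k \<Longrightarrow> y \<in> latch_pres E n k \<Longrightarrow> latch_base E k x \<Longrightarrow> latch_base E k y
    \<Longrightarrow> latch_eq E n k x y"
| perm: "(p, \<tau>, e, ts) \<in> latch_pres E n k \<Longrightarrow> \<alpha> \<in> carrier (sym_group p) \<Longrightarrow>
    \<beta> \<in> carrier (sym_group (n - p)) \<Longrightarrow>
    latch_eq E n k (p, \<tau> \<circ> block_sum p \<alpha> \<beta>, e, ts) (p, \<tau>, act E p \<alpha> e, lperm \<beta> ts)"
| shift: "(p, \<tau>, e, t # ts) \<in> latch_pres E n k \<Longrightarrow> Suc p < n \<Longrightarrow>
    latch_eq E n k (p, \<tau>, e, t # ts) (Suc p, \<tau>, sig E p e t, ts)"

text \<open>
  Cofibrancy in the stable model structure: the latching maps are injective and the symmetric groups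
  act freely off their images.
\<close>

definition cofibrant :: "'e symspec \<Rightarrow> bool" where
  "cofibrant E \<longleftrightarrow>
     (\<forall>n k. \<forall>x\<in>latch_pres E n k. \<forall>y\<in>latch_pres E n k.
        latch_map E n x = latch_map E n y \<longrightarrow> latch_eq E n k x y) \<and>
     (\<forall>n k. \<forall>e\<in>simp (lev E n) k. e \<notin> latch_map E n ` latch_pres E n k \<longrightarrow>
        (\<forall>\<alpha>\<in>carrier (sym_group n). act E n \<alpha> e = e \<longrightarrow> \<alpha> = id))"


section \<open>Extended powers and \<open>H\<^sub>\<infinity>\<close> ring spectra\<close>

text \<open>The contractible space \<open>EG\<close> with free left translation action.\<close>

definition EG :: "('g, 'm) monoid_scheme \<Rightarrow> 'g list sset" where
  "EG G = \<lparr>cells = {gs. gs \<noteq> [] \<and> set gs \<subseteq> carrier G},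
           sdim = (\<lambda>gs. length gs - 1),
           opr = (\<lambda>\<theta> gs. map ((!) gs) \<theta>)\<rparr>"

definition ltrans :: "('g, 'm) monoid_scheme \<Rightarrow> 'g \<Rightarrow> 'g list \<Rightarrow> 'g list" where
  "ltrans G g gs = map (\<lambda>x. g \<otimes>\<^bsub>G\<^esub> x) gs"

abbreviation ES :: "nat \<Rightarrow> (nat \<Rightarrow> nat) list sset" where
  "ES j \<equiv> EG (sym_group j)"

text \<open>
  Permuting the factors of \<open>E\<^sub>p\<^sub>1 \<and> \<dots> \<and> E\<^sub>p\<^sub>j\<close> by \<open>\<gamma>\<close> permutes blocks of coordinates; \<open>block_perm\<close> sends a
  coordinate in the permuted arrangement to the same coordinate in the original one.
\<close>

definition block_perm :: "(nat \<Rightarrow> nat) \<Rightarrow> nat list \<Rightarrow> nat \<Rightarrow> nat" where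
  "block_perm \<gamma> ps x =
     (if x \<in> {1..sum_list ps}
      then THE y. \<exists>i\<in>{1..length ps}. \<exists>r\<in>{1..ps ! (i - 1)}.
             x = sum_list (take (\<gamma> i - 1) (lperm \<gamma> ps)) + r \<and> y = sum_list (take (i - 1) ps) + r
      else x)"

text \<open>The cycle moving the last coordinate \<open>N + 1\<close> to position \<open>o + 1\<close>.\<close>

definition insert_cycle :: "nat \<Rightarrow> nat \<Rightarrow> nat \<Rightarrow> nat" where
  "insert_cycle N o' x = (if x = Suc N then Suc o' else if o' < x \<and> x \<le> N then Suc x else x)"

text \<open>
  By the universal property of the smash product, a map of symmetric spectra
  \<open>P\<^sub>+ \<and> E \<and> \<dots> \<and> E \<rightarrow> E\<close> (with \<open>j\<close> smash factors \<open>E\<close>) is a family of maps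
  \<open>P\<^sub>+ \<and> E\<^sub>p\<^sub>1 \<and> \<dots> \<and> E\<^sub>p\<^sub>j \<rightarrow> E\<^sub>p\<^sub>1\<^sub>+\<^sub>\<dots>\<^sub>+\<^sub>p\<^sub>j\<close> which is equivariant and compatible with the structure maps in
  every variable. Its arguments are a simplex of \<open>P\<close>, the list of levels and the list of simplices.
\<close>

definition args :: "'e symspec \<Rightarrow> nat \<Rightarrow> nat \<Rightarrow> nat list \<Rightarrow> 'e list \<Rightarrow> bool" where
  "args E j k ps es \<longleftrightarrow>
     length ps = j \<and> length es = j \<and> (\<forall>i<j. es ! i \<in> simp (lev E (ps ! i)) k)"

definition multimap :: "'e symspec \<Rightarrow> 'p sset \<Rightarrow> nat \<Rightarrow> ('p \<Rightarrow> nat list \<Rightarrow> 'e list \<Rightarrow> 'e) \<Rightarrow> bool" where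
  "multimap E P j b \<longleftrightarrow>
     (\<forall>k. \<forall>w\<in>simp P k. \<forall>ps es. args E j k ps es \<longrightarrow>
        b w ps es \<in> simp (lev E (sum_list ps)) k \<and>
        (\<forall>l. \<forall>\<theta>\<in>ops l k. b (opr P \<theta> w) ps (map2 (\<lambda>p. opr (lev E p) \<theta>) ps es)
                        = opr (lev E (sum_list ps)) \<theta> (b w ps es)) \<and>
        (\<forall>i<j. let p = ps ! i; e = es ! i; q = sum_list (take i ps) in
           (e = bas E p k \<longrightarrow> b w ps es = bas E (sum_list ps) k) \<and>
           (\<forall>\<alpha>\<in>carrier (sym_group p). b w ps (es[i := act E p \<alpha> e])
              = act E (sum_list ps) (block_sum q id \<alpha>) (b w ps es)) \<and>
           (\<forall>t\<in>simp circle k. b w (ps[i := Suc p]) (es[i := sig E p e t])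
              = act E (Suc (sum_list ps)) (insert_cycle (sum_list ps) (q + p))
                  (sig E (sum_list ps) (b w ps es) t))))"

text \<open>
  The set \<open>S\<close> lists the elements of a group acting on \<open>P\<^sub>+ \<and> E \<and> \<dots> \<and> E\<close>, each by its action on \<open>P\<close> and
  the permutation of the factors it induces; a \<open>power_map\<close> is a map out of the quotient.
\<close>

definition power_map ::
    "'e symspec \<Rightarrow> 'p sset \<Rightarrow> (('p \<Rightarrow> 'p) \<times> (nat \<Rightarrow> nat)) set \<Rightarrow> nat \<Rightarrow>
     ('p \<Rightarrow> nat list \<Rightarrow> 'e list \<Rightarrow> 'e) \<Rightarrow> bool" where
  "power_map E P S j b \<longleftrightarrow> multimap E P j b \<and>
     (\<forall>(a, \<rho>)\<in>S. \<forall>k. \<forall>w\<in>simp P k. \<forall>ps es. args E j k ps es \<longrightarrow>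
        b w ps es = act E (sum_list ps) (block_perm \<rho> ps) (b (a w) (lperm \<rho> ps) (lperm \<rho> es)))"

definition power_homotopic ::
    "'e symspec \<Rightarrow> 'p sset \<Rightarrow> (('p \<Rightarrow> 'p) \<times> (nat \<Rightarrow> nat)) set \<Rightarrow> nat \<Rightarrow>
     ('p \<Rightarrow> nat list \<Rightarrow> 'e list \<Rightarrow> 'e) \<Rightarrow> ('p \<Rightarrow> nat list \<Rightarrow> 'e list \<Rightarrow> 'e) \<Rightarrow> bool" where
  "power_homotopic E P S j b c \<longleftrightarrow> power_map E P S j b \<and> power_map E P S j c \<and>
     (\<exists>h. power_map E (sprod P (std_simplex 1)) ((\<lambda>(a, \<rho>). (\<lambda>(w, t). (a w, t), \<rho>)) ` S) j h \<and>
        (\<forall>k. \<forall>w\<in>simp P k. \<forall>ps es. args E j k ps es \<longrightarrow>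
           h (w, replicate (Suc k) 0) ps es = b w ps es \<and>
           h (w, replicate (Suc k) 1) ps es = c w ps es))"

text \<open>The groups dividing out to \<open>D\<^sub>j E\<close>, to \<open>D\<^sub>j E \<and> D\<^sub>k E\<close>, and to \<open>D\<^sub>j D\<^sub>k E\<close>.\<close>

definition Dgrp :: "nat \<Rightarrow> (((nat \<Rightarrow> nat) list \<Rightarrow> (nat \<Rightarrow> nat) list) \<times> (nat \<Rightarrow> nat)) set" where
  "Dgrp j = {(ltrans (sym_group j) \<gamma>, \<gamma>) | \<gamma>. \<gamma> \<in> carrier (sym_group j)}"

definition DDgrp :: "nat \<Rightarrow> nat \<Rightarrow>
    (((nat \<Rightarrow> nat) list \<times> (nat \<Rightarrow> nat) list \<Rightarrow> (nat \<Rightarrow> nat) list \<times> (nat \<Rightarrow> nat) list) \<times> (nat \<Rightarrow> nat)) set"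
  where
  "DDgrp j k = {(\<lambda>(v, w). (ltrans (sym_group j) \<gamma> v, ltrans (sym_group k) \<delta> w), block_sum j \<gamma> \<delta>)
     | \<gamma> \<delta>. \<gamma> \<in> carrier (sym_group j) \<and> \<delta> \<in> carrier (sym_group k)}"

text \<open>The element of the wreath product sending the \<open>r\<close>-th entry of block \<open>i\<close> to entry \<open>\<sigma>\<^sub>i r\<close> of block \<open>\<gamma> i\<close>.\<close>

definition wreath :: "nat \<Rightarrow> nat \<Rightarrow> (nat \<Rightarrow> nat) \<Rightarrow> (nat \<Rightarrow> nat) list \<Rightarrow> nat \<Rightarrow> nat" where
  "wreath j k \<gamma> \<sigma>s x =
     (if x \<in> {1..j * k}
      then (\<gamma> ((x - 1) div k + 1) - 1) * k + (\<sigma>s ! ((x - 1) div k)) ((x - 1) mod k + 1)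
      else x)"

definition EDD :: "nat \<Rightarrow> nat \<Rightarrow> ((nat \<Rightarrow> nat) list \<times> (nat \<Rightarrow> nat) list list) sset" where
  "EDD j k = \<lparr>cells = {(v, ws). v \<in> cells (ES j) \<and> length ws = j \<and>
                               set ws \<subseteq> simp (ES k) (sdim (ES j) v)},
              sdim = (\<lambda>(v, ws). sdim (ES j) v),
              opr = (\<lambda>\<theta> (v, ws). (opr (ES j) \<theta> v, map (opr (ES k) \<theta>) ws))\<rparr>"

definition Wgrp :: "nat \<Rightarrow> nat \<Rightarrow>
    (((nat \<Rightarrow> nat) list \<times> (nat \<Rightarrow> nat) list list \<Rightarrow> (nat \<Rightarrow> nat) list \<times> (nat \<Rightarrow> nat) list list) \<times>
     (nat \<Rightarrow> nat)) set" where
  "Wgrp j k = {(\<lambda>(v, ws). (ltrans (sym_group j) \<gamma> v, lperm \<gamma> (map2 (ltrans (sym_group k)) \<sigma>s ws)),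
                wreath j k \<gamma> \<sigma>s)
     | \<gamma> \<sigma>s. \<gamma> \<in> carrier (sym_group j) \<and> length \<sigma>s = j \<and> set \<sigma>s \<subseteq> carrier (sym_group k)}"

text \<open>
  The equivariant map inducing \<open>\<beta>\<^sub>j\<^sub>,\<^sub>k : D\<^sub>j D\<^sub>k E \<rightarrow> D\<^sub>j\<^sub>k E\<close>. The inner permutations are reindexed because
  \<open>Wgrp\<close> acts on them by permuting the \<open>j\<close> factors, not by left multiplication in the wreath product.
\<close>

definition beta_map ::
    "nat \<Rightarrow> nat \<Rightarrow> (nat \<Rightarrow> nat) list \<times> (nat \<Rightarrow> nat) list list \<Rightarrow> (nat \<Rightarrow> nat) list" where
  "beta_map j k = (\<lambda>(v, ws). map (\<lambda>l. wreath j k (v ! l)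
                       (lperm (inv_into UNIV (v ! l)) (map (\<lambda>w. w ! l) ws))) [0..<length v])"

definition chunks :: "nat \<Rightarrow> nat \<Rightarrow> 'a list \<Rightarrow> 'a list list" where
  "chunks j k xs = map (\<lambda>i. take k (drop (i * k) xs)) [0..<j]"

text \<open>
  \<open>H\<^sub>\<infinity>\<close> ring spectra in the sense of Bruner, May, McClure and Steinberger: maps
  \<open>\<xi>\<^sub>j : D\<^sub>j E \<rightarrow> E\<close> in the stable homotopy category such that \<open>\<xi>\<^sub>1\<close> is the identity and the two diagrams
  involving \<open>\<alpha>\<^sub>j\<^sub>,\<^sub>k : D\<^sub>j E \<and> D\<^sub>k E \<rightarrow> D\<^sub>j\<^sub>+\<^sub>k E\<close> and \<open>\<beta>\<^sub>j\<^sub>,\<^sub>k\<close> commute. As \<open>E\<close> is cofibrant, so are these smash products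
  and extended powers, formed with the point-set smash product.
\<close>

type_synonym 'e power_ops = "nat \<Rightarrow> (nat \<Rightarrow> nat) list \<Rightarrow> nat list \<Rightarrow> 'e list \<Rightarrow> 'e"

definition H_infinity_ring_spectrum :: "'e symspec \<Rightarrow> 'e power_ops \<Rightarrow> bool" where
  "H_infinity_ring_spectrum E \<xi> \<longleftrightarrow>
     omega_spectrum E \<and> cofibrant E \<and>
     (\<forall>j. power_map E (ES j) (Dgrp j) j (\<xi> j)) \<and>
     power_homotopic E (ES 1) (Dgrp 1) 1 (\<xi> 1) (\<lambda>w ps es. hd es) \<and>
     (\<forall>j k. power_homotopic E (sprod (ES j) (ES k)) (DDgrp j k) (j + k)
        (\<lambda>(v, w) ps es. \<xi> (j + k) (map2 (block_sum j) v w) ps es)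
        (\<lambda>(v, w) ps es. \<xi> 2 (replicate (length v) id)
           [sum_list (take j ps), sum_list (drop j ps)]
           [\<xi> j v (take j ps) (take j es), \<xi> k w (drop j ps) (drop j es)])) \<and>
     (\<forall>j k. power_homotopic E (EDD j k) (Wgrp j k) (j * k)
        (\<lambda>w ps es. \<xi> (j * k) (beta_map j k w) ps es)
        (\<lambda>(v, ws) ps es. \<xi> j v (map sum_list (chunks j k ps))
           (map (\<lambda>i. \<xi> k (ws ! i) (chunks j k ps ! i) (chunks j k es ! i)) [0..<j])))"


section \<open>Transfers and the cohomology ring\<close>

definition fib :: "'y sset \<Rightarrow> ('y \<Rightarrow> 'x) \<Rightarrow> 'x \<Rightarrow> 'y set" where
  "fib Y p x = {y \<in> cells Y. p y = x}"

definition finite_cover :: "'y sset \<Rightarrow> 'x sset \<Rightarrow> ('y \<Rightarrow> 'x) \<Rightarrow> bool" where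
  "finite_cover Y X p \<longleftrightarrow> is_sset Y \<and> is_sset X \<and> smap Y X p \<and>
     (\<forall>x\<in>cells X. finite (fib Y p x)) \<and>
     (\<forall>m n. \<forall>\<theta>\<in>ops m n. \<forall>x\<in>simp X n. bij_betw (opr Y \<theta>) (fib Y p x) (fib Y p (opr X \<theta> x)))"

text \<open>
  For a finite cover \<open>p\<close> of \<open>X\<close> by \<open>Y\<close>, let \<open>Q\<close> be the spectrum of pairs \<open>(x, u)\<close>, where \<open>u\<close> assigns an
  element of \<open>E\<close> to each point of the fibre over \<open>x\<close>, with the pairs \<open>(x, base point)\<close> collapsed.
  The inclusion \<open>Y\<^sub>+ \<and> E \<rightarrow> Q\<close> (fibrewise, of the wedge into the product) is a stable equivalence, and a
  cofibration of sequential spectra if \<open>E\<close> is cofibrant. So if moreover \<open>E\<close> is an Omega-spectrum, the fold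
  map \<open>Y\<^sub>+ \<and> E \<rightarrow> E\<close> extends to a map \<open>s : Q \<rightarrow> E\<close> of sequential spectra, unique up to homotopy: summation
  along the fibres.
\<close>

definition fibre_sum ::
    "'e symspec \<Rightarrow> 'y sset \<Rightarrow> 'x sset \<Rightarrow> ('y \<Rightarrow> 'x) \<Rightarrow> (nat \<Rightarrow> 'x \<Rightarrow> ('y \<Rightarrow> 'e) \<Rightarrow> 'e) \<Rightarrow> bool" where
  "fibre_sum E Y X p s \<longleftrightarrow> finite_cover Y X p \<and>
     (\<forall>n k. \<forall>x\<in>simp X k. \<forall>u \<in> fib Y p x \<rightarrow>\<^sub>E simp (lev E n) k.
        s n x u \<in> simp (lev E n) k \<and>
        (\<forall>l. \<forall>\<theta>\<in>ops l k. \<forall>u' \<in> fib Y p (opr X \<theta> x) \<rightarrow>\<^sub>E simp (lev E n) l.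
           (\<forall>y\<in>fib Y p x. u' (opr Y \<theta> y) = opr (lev E n) \<theta> (u y)) \<longrightarrow>
           s n (opr X \<theta> x) u' = opr (lev E n) \<theta> (s n x u)) \<and>
        ((\<forall>y\<in>fib Y p x. u y = bas E n k) \<longrightarrow> s n x u = bas E n k) \<and>
        (\<forall>y\<in>fib Y p x. (\<forall>z\<in>fib Y p x - {y}. u z = bas E n k) \<longrightarrow> s n x u = u y) \<and>
        (\<forall>t\<in>simp circle k.
           s (Suc n) x (\<lambda>y\<in>fib Y p x. sig E n (u y) t) = sig E n (s n x u) t))"

text \<open>
  The transfer \<open>E\<^sup>0(Y) \<rightarrow> E\<^sup>0(X)\<close>. The union is over all choices of a representative and of a
  fibrewise summation, which all yield the same homotopy class.
\<close>

definition transfer ::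
    "'e symspec \<Rightarrow> 'y sset \<Rightarrow> 'x sset \<Rightarrow> ('y \<Rightarrow> 'x) \<Rightarrow> ('y \<Rightarrow> 'e) set \<Rightarrow> ('x \<Rightarrow> 'e) set" where
  "transfer E Y X p A =
     \<Union>{hclass X (lev E 0) (\<lambda>x. s 0 x (restrict f (fib Y p x))) | s f. fibre_sum E Y X p s \<and> f \<in> A}"

definition cohomology :: "'e symspec \<Rightarrow> 'x sset \<Rightarrow> ('x \<Rightarrow> 'e) set set" where
  "cohomology E X = {hclass X (lev E 0) f | f. smap X (lev E 0) f}"

text \<open>
  Multiplication comes from \<open>E \<and> E \<rightarrow> D\<^sub>2 E \<rightarrow> E\<close> and the unit from \<open>D\<^sub>0 E = S \<rightarrow> E\<close>. The sum is that of
  the additive category of spectra, given by inverting \<open>E \<or> E \<rightarrow> E \<times> E\<close> and folding; equivalently, it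
  is the transfer along the trivial double cover.
\<close>

definition cohomology_ring :: "'e symspec \<Rightarrow> 'e power_ops \<Rightarrow> 'x sset \<Rightarrow> ('x \<Rightarrow> 'e) set ring" where
  "cohomology_ring E \<xi> X =
     \<lparr>carrier = cohomology E X,
      mult = (\<lambda>A B. \<Union>f\<in>A. \<Union>g\<in>B. hclass X (lev E 0)
                (\<lambda>x. \<xi> 2 (replicate (Suc (sdim X x)) id) [0, 0] [f x, g x])),
      one = hclass X (lev E 0) (\<lambda>x. \<xi> 0 (replicate (Suc (sdim X x)) id) [] []),
      zero = hclass X (lev E 0) (\<lambda>x. bas E 0 (sdim X x)),
      add = (\<lambda>A B. transfer E (sprod_disc X (UNIV :: bool set)) X fst
                {h. (\<lambda>x. h (x, False)) \<in> A \<and> (\<lambda>x. h (x, True)) \<in> B})\<rparr>"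


section \<open>Classifying spaces and the two ideals\<close>

text \<open>The quotient of \<open>X\<close> by the action \<open>a\<close> of a group with underlying set \<open>L\<close>; simplices are orbits.\<close>

definition quot :: "'x sset \<Rightarrow> ('g \<Rightarrow> 'x \<Rightarrow> 'x) \<Rightarrow> 'g set \<Rightarrow> 'x set sset" where
  "quot X a L = \<lparr>cells = {(\<lambda>g. a g x) ` L | x. x \<in> cells X},
                 sdim = (\<lambda>O'. the_elem (sdim X ` O')),
                 opr = (\<lambda>\<theta> O'. opr X \<theta> ` O')\<rparr>"

definition BG :: "('g, 'm) monoid_scheme \<Rightarrow> 'g list set sset" where
  "BG G = quot (EG G) (ltrans G) (carrier G)"

text \<open>\<open>EG/L\<close>, the model of \<open>BL\<close>, for a subgroup \<open>L\<close> of \<open>G\<close>, that is a cover of \<open>BG\<close>.\<close>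

definition BG_sub :: "('g, 'm) monoid_scheme \<Rightarrow> 'g set \<Rightarrow> 'g list set sset" where
  "BG_sub G L = quot (EG G) (ltrans G) L"

definition homotopy_orbits ::
    "('g, 'm) monoid_scheme \<Rightarrow> 'w set \<Rightarrow> ('g \<Rightarrow> 'w \<Rightarrow> 'w) \<Rightarrow> ('g list \<times> 'w) set sset" where
  "homotopy_orbits G W a =
     quot (sprod_disc (EG G) W) (\<lambda>g (gs, w). (ltrans G g gs, a g w)) (carrier G)"

abbreviation BGS :: "('g, 'm) monoid_scheme \<Rightarrow> nat \<Rightarrow> ('g list set \<times> (nat \<Rightarrow> nat) list set) sset" where
  "BGS G m \<equiv> sprod (BG G) (BG (sym_group m))"

definition to_BGS :: "('g, 'm) monoid_scheme \<Rightarrow> nat \<Rightarrow> ('g \<times> (nat \<Rightarrow> nat)) list \<Rightarrow>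
    'g list set \<times> (nat \<Rightarrow> nat) list set" where
  "to_BGS G m ks =
     ((\<lambda>g. ltrans G g (map fst ks)) ` carrier G,
      (\<lambda>\<sigma>. ltrans (sym_group m) \<sigma> (map snd ks)) ` carrier (sym_group m))"

text \<open>\<open>G \<times> \<Sigma>\<^sub>i \<times> \<Sigma>\<^sub>m\<^sub>-\<^sub>i\<close> as a subgroup of \<open>G \<times> \<Sigma>\<^sub>m\<close>.\<close>

definition young :: "('g, 'm) monoid_scheme \<Rightarrow> nat \<Rightarrow> nat \<Rightarrow> ('g \<times> (nat \<Rightarrow> nat)) set" where
  "young G m i = carrier G \<times> {\<sigma> \<in> carrier (sym_group m). \<sigma> ` {1..i} = {1..i}}"

definition young_transfer :: "'e symspec \<Rightarrow> ('g, 'm) monoid_scheme \<Rightarrow> nat \<Rightarrow> nat \<Rightarrow>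
    (('g \<times> (nat \<Rightarrow> nat)) list set \<Rightarrow> 'e) set \<Rightarrow> ('g list set \<times> (nat \<Rightarrow> nat) list set \<Rightarrow> 'e) set" where
  "young_transfer E G m i =
     transfer E (BG_sub (G \<times>\<times> sym_group m) (young G m i)) (BGS G m)
       (\<lambda>O'. the_elem (to_BGS G m ` O'))"

definition I_Tr :: "'e symspec \<Rightarrow> 'e power_ops \<Rightarrow> ('g, 'm) monoid_scheme \<Rightarrow> nat \<Rightarrow>
    ('g list set \<times> (nat \<Rightarrow> nat) list set \<Rightarrow> 'e) set set" where
  "I_Tr E \<xi> G m =
     {finsum (cohomology_ring E \<xi> (BGS G m)) (\<lambda>i. young_transfer E G m i (a i)) {1..<m}
      | a. \<forall>i\<in>{1..<m}. a i \<in> cohomology E (BG_sub (G \<times>\<times> sym_group m) (young G m i))}"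

text \<open>The \<open>G \<times> \<Sigma>\<^sub>m\<close>-set \<open>(G/H)\<^sup>m\<close> and the complement of the diagonal orbit in it.\<close>

definition coset_tuples :: "('g, 'm) monoid_scheme \<Rightarrow> 'g set \<Rightarrow> nat \<Rightarrow> (nat \<Rightarrow> 'g set) set" where
  "coset_tuples G H m = {1..m} \<rightarrow>\<^sub>E {g <#\<^bsub>G\<^esub> H | g. g \<in> carrier G}"

definition tuple_action :: "('g, 'm) monoid_scheme \<Rightarrow> nat \<Rightarrow> 'g \<times> (nat \<Rightarrow> nat) \<Rightarrow>
    (nat \<Rightarrow> 'g set) \<Rightarrow> nat \<Rightarrow> 'g set" where
  "tuple_action G m = (\<lambda>(g, \<sigma>) x. \<lambda>i\<in>{1..m}. g <#\<^bsub>G\<^esub> x (inv_into UNIV \<sigma> i))"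

definition coset_diagonal :: "('g, 'm) monoid_scheme \<Rightarrow> 'g set \<Rightarrow> nat \<Rightarrow> (nat \<Rightarrow> 'g set) set" where
  "coset_diagonal G H m = {\<lambda>i\<in>{1..m}. g <#\<^bsub>G\<^esub> H | g. g \<in> carrier G}"

definition Z_space :: "('g, 'm) monoid_scheme \<Rightarrow> 'g set \<Rightarrow> nat \<Rightarrow>
    (('g \<times> (nat \<Rightarrow> nat)) list \<times> (nat \<Rightarrow> 'g set)) set sset" where
  "Z_space G H m = homotopy_orbits (G \<times>\<times> sym_group m)
     (coset_tuples G H m - coset_diagonal G H m) (tuple_action G m)"

definition Z_transfer :: "'e symspec \<Rightarrow> ('g, 'm) monoid_scheme \<Rightarrow> 'g set \<Rightarrow> nat \<Rightarrow>
    ((('g \<times> (nat \<Rightarrow> nat)) list \<times> (nat \<Rightarrow> 'g set)) set \<Rightarrow> 'e) set \<Rightarrow>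
    ('g list set \<times> (nat \<Rightarrow> nat) list set \<Rightarrow> 'e) set" where
  "Z_transfer E G H m =
     transfer E (Z_space G H m) (BGS G m) (\<lambda>O'. the_elem ((\<lambda>(ks, x). to_BGS G m ks) ` O'))"

definition J_ideal :: "'e symspec \<Rightarrow> 'e power_ops \<Rightarrow> ('g, 'm) monoid_scheme \<Rightarrow> 'g set \<Rightarrow> nat \<Rightarrow>
    ('g list set \<times> (nat \<Rightarrow> nat) list set \<Rightarrow> 'e) set set" where
  "J_ideal E \<xi> G H m =
     genideal (cohomology_ring E \<xi> (BGS G m))
       ((\<Union>i\<in>{1..<m}. young_transfer E G m i `
            cohomology E (BG_sub (G \<times>\<times> sym_group m) (young G m i))) \<union>
        Z_transfer E G H m ` cohomology E (Z_space G H m))"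

end

theory Submission imports Defs begin

text \<open>
 The stabiliser in \<open>G \<times> \<Sigma>\<^sub>m\<close> of a nondiagonal tuple \<open>w\<close> of cosets is not transitive on the indices, because
 \<open>m\<close> and \<open>|G/H|\<close> are coprime. So there is an equivariant choice of a nonempty proper set \<open>S(w)\<close> of
 indices. The part of \<open>Z\<close> with \<open>|S(w)| = i\<close> maps over \<open>BG \<times> B\<Sigma>\<^sub>m\<close> to \<open>B(G \<times> \<Sigma>\<^sub>i \<times> \<Sigma>\<^sub>m\<^sub>-\<^sub>i)\<close>, by looking
 at the tuples with \<open>S(w) = {1..i}\<close>, and its transfer factors through the transfer from there.

 This uses that transfers are functorial, additive, and satisfy the projection formula. These facts
 and the ring axioms rest on one statement: a map of sequential spectra defined on the tuples over the
 fibres of a finite cover exists, and is unique up to homotopy, once it is prescribed on the tuples with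
 at most one entry off the base point. Indeed a sum \<open>u + v\<close> of loops can be traversed as first \<open>u\<close>, then
 \<open>v\<close>, which forces its value in level \<open>n + 1\<close>; for an Omega-spectrum this lifts to level \<open>n\<close>, and
 the structure maps being injective off the base point, as \<open>E\<close> is cofibrant, the choices in different
 levels do not interfere.
\<close>

text \<open>The obstacle is a mismatch of strictness. The adjoint structure maps of an
  Omega-spectrum are invertible only up to homotopy, whereas a fibre summation must commute with the
  structure maps exactly. So maps that fit together up to homotopy are found in every level
  independently, and each level is then corrected to fit the preceding one exactly. A correction is
  a homotopy extension from the image of the structure map, and injectivity is what makes the
  prescribed homotopy well defined there.

  The only homotopical input is the filling of prisms relative to the bottom and the boundary;
  homotopy extension, calculus of homotopies and relative lifting along homotopy equivalences are
  derived from it. The recurring device is to exchange a loop coordinate with a homotopy coordinate.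

  Uniqueness is the existence statement applied to the cover \<open>Y \<times> I\<close> of
  \<open>X \<times> I\<close> with both ends prescribed. An identity between transfers then only
  asks for extensions of the same single-entry data on both sides. Sums of classes are themselves
  transfers, along the trivial double cover, so most of the ring axioms are instances of these
  identities.\<close>

declare upt_Suc [simp del] One_nat_def [simp del]

section \<open>The simplex category\<close>

abbreviation pull :: "'a list => nat list => 'a list" (infixl "\<odot>" 75) where
 "t \<odot> th \<equiv> map ((!) t) th"

abbreviation idl :: "nat => nat list" where
 "idl n \<equiv> [0..<Suc n]"

lemma ops_iff:
 "th \<in> ops m n \<longleftrightarrow> length th = Suc m \<and> (\<forall>i j. i \<le> j --> j \<le> m --> th ! i \<le> th ! j) \<and> (\<forall>i\<le>m. th ! i \<le> n)"
proof -
 have "sorted th \<longleftrightarrow> (\<forall>i j. i \<le> j --> j \<le> m --> th ! i \<le> th ! j)" if "length th = Suc m"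
  using that by (auto simp: sorted_iff_nth_mono less_Suc_eq_le)
 moreover have "set th \<subseteq> {..n} \<longleftrightarrow> (\<forall>i\<le>m. th ! i \<le> n)" if "length th = Suc m"
  using that by (fastforce simp: set_conv_nth less_Suc_eq_le)
 ultimately show ?thesis unfolding ops_def by blast
qed

lemma ops_length: "th \<in> ops m n ==> length th = Suc m"
 by (simp add: ops_iff)

lemma ops_nth_le: "th \<in> ops m n ==> i \<le> m ==> th ! i \<le> n"
 by (simp add: ops_iff)

lemma ops_mono: "th \<in> ops m n ==> i \<le> j ==> j \<le> m ==> th ! i \<le> th ! j"
 by (simp add: ops_iff)

lemma ops_in_set_le: "th \<in> ops m n ==> i \<in> set th ==> i \<le> n"
 by (auto simp: ops_def)

lemma pull_ops: "t \<in> ops m n ==> th \<in> ops l m ==> t \<odot> th \<in> ops l n"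
 unfolding ops_iff by (auto simp: less_Suc_eq_le)

lemma pull_assoc: "th \<in> ops l m ==> psi \<in> ops k l ==> (t \<odot> th) \<odot> psi = t \<odot> (th \<odot> psi)"
 by (rule nth_equalityI) (auto simp: ops_iff less_Suc_eq_le)

lemma pull_idl: "length t = Suc n ==> t \<odot> idl n = t"
 by (metis map_nth)

lemma idl_ops [simp]: "idl n \<in> ops n n"
 unfolding ops_iff by (auto simp del: upt_Suc)

lemma idl_pull: "th \<in> ops m n ==> idl n \<odot> th = th"
 by (rule nth_equalityI) (auto simp: ops_iff less_Suc_eq_le simp del: upt_Suc)

lemma length_pull_ops: "th \<in> ops m n ==> length (t \<odot> th) = Suc m"
 by (simp add: ops_iff)

lemma set_pull: "t \<in> ops m n ==> th \<in> ops l m ==> set (t \<odot> th) \<subseteq> set t"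
 by (auto simp: ops_iff) (metis in_set_conv_nth less_Suc_eq_le nth_mem)

text \<open>A section arises from one chosen preimage per value. That it can be made to pass through
  any given position \<open>j\<close> is what later shows that a simplex determines the surjective
  operator from which it arises.\<close>

lemma ops_section:
 assumes "th \<in> ops l d" "set th = {..d}" "j \<le> l"
 obtains \<delta> where "\<delta> \<in> ops d l" "th \<odot> \<delta> = idl d" "\<delta> ! (th ! j) = j"
proof -
 have "\<exists>p\<le>l. th ! p = i \<and> (i = th ! j --> p = j)" if "i \<le> d" for i
 proof (cases "i = th ! j")
  case False
  have "i \<in> set th" using assms that by auto
  thus ?thesis using False assms(1) by (auto simp: in_set_conv_nth ops_iff less_Suc_eq_le)
 qed (use assms in auto)
 then obtain p where p: "!!i. i \<le> d ==> p i \<le> l \<and> th ! p i = i \<and> (i = th ! j --> p i = j)" by metis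
 have "p i \<le> p i'" if "i \<le> i'" "i' \<le> d" for i i'
 proof (rule ccontr)
  assume "\<not> p i \<le> p i'"
  hence "th ! p i' \<le> th ! p i" using p[of i] that ops_mono[OF assms(1), of "p i'" "p i"] by auto
  hence "i' \<le> i" using p[of i] p[of i'] that by auto
  thus False using \<open>\<not> p i \<le> p i'\<close> that by auto
 qed
 hence "map p (idl d) \<in> ops d l" unfolding ops_iff using p by (auto simp: less_Suc_eq_le simp del: upt_Suc)
 moreover have "th \<odot> map p (idl d) = idl d"
  by (rule nth_equalityI) (use p in \<open>auto simp: less_Suc_eq_le simp del: upt_Suc\<close>)
 moreover have "map p (idl d) ! (th ! j) = j"
  using p[of "th ! j"] assms ops_nth_le[OF assms(1,3)] by (auto simp: less_Suc_eq_le simp del: upt_Suc)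
 ultimately show thesis using that by blast
qed

lemma surj_endo_idl:
 assumes "th \<in> ops d d" "set th = {..d}"
 shows "th = idl d"
proof (rule sorted_distinct_set_unique)
 show "distinct th" using assms by (intro card_distinct) (auto simp: ops_def)
 show "sorted th" using assms by (simp add: ops_def)
 show "sorted (idl d)" "distinct (idl d)" by (rule sorted_upt, rule distinct_upt)
 show "set th = set (idl d)" using assms by (simp add: atLeast0LessThan lessThan_Suc_atMost)
qed

lemma coface_nth: "j \<le> Suc n ==> p \<le> n ==> coface n j ! p = (if p < j then p else Suc p)"
 unfolding coface_def by (auto simp: nth_append simp del: upt_Suc)

lemma coface_length: "j \<le> Suc n ==> length (coface n j) = Suc n"
 by (simp add: coface_def)

lemma coface_ops: "j \<le> Suc n ==> coface n j \<in> ops n (Suc n)"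
 unfolding ops_iff by (auto simp: coface_nth coface_length)

text \<open>An operator that is not surjective factors through a face, so what it produces comes
  from a lower skeleton. The factor lowers every value above the omitted \<open>j\<close> by
  one.\<close>

lemma ops_factor_coface:
 assumes "th \<in> ops l (Suc n)" "j \<le> Suc n" "j \<notin> set th"
 obtains chi where "chi \<in> ops l n" "th = coface n j \<odot> chi"
proof -
 let ?c = "map (\<lambda>i. if i < j then i else i - 1) th"
 have ne: "th ! p \<noteq> j" if "p \<le> l" for p
  using assms that by (metis in_set_conv_nth less_Suc_eq_le ops_length)
 have "?c \<in> ops l n"
 proof -
  have "(if th ! p < j then th ! p else th ! p - 1) \<le> (if th ! q < j then th ! q else th ! q - 1)"
   if "p \<le> q" "q \<le> l" for p q using ops_mono[OF assms(1) that] by auto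
  moreover have "(if th ! p < j then th ! p else th ! p - 1) \<le> n" if "p \<le> l" for p
   using ops_nth_le[OF assms(1) that] ne[OF that] assms(2) by auto
  ultimately show ?thesis unfolding ops_iff using ops_length[OF assms(1)] by (auto simp: less_Suc_eq_le)
 qed
 moreover have "th = coface n j \<odot> ?c"
 proof (rule nth_equalityI)
  fix p assume "p < length th"
  hence "p \<le> l" using assms by (simp add: ops_iff)
  thus "th ! p = (coface n j \<odot> ?c) ! p"
   using ne[of p] ops_nth_le[OF assms(1), of p] ops_length[OF assms(1)] assms(2)
   by (auto simp: coface_nth)
 qed simp
 ultimately show thesis using that by blast
qed

section \<open>Simplicial sets and partial simplicial maps\<close>

lemma sset_opr:
 assumes "is_sset X" "x \<in> cells X" "th \<in> ops m (sdim X x)"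
 shows "opr X th x \<in> cells X" "sdim X (opr X th x) = m"
 using assms unfolding is_sset_def simp_def by blast+

lemma sset_id: "is_sset X ==> x \<in> cells X ==> opr X (idl (sdim X x)) x = x"
 unfolding is_sset_def simp_def by blast

lemma sset_comp:
 "is_sset X ==> x \<in> cells X ==> th \<in> ops m (sdim X x) ==> phi \<in> ops l m
  ==> opr X (th \<odot> phi) x = opr X phi (opr X th x)"
 unfolding is_sset_def simp_def by blast

lemma is_ssetI:
 assumes "!!m th x. x \<in> cells X ==> th \<in> ops m (sdim X x) ==> opr X th x \<in> cells X \<and> sdim X (opr X th x) = m"
  and "!!x. x \<in> cells X ==> opr X (idl (sdim X x)) x = x"
  and "!!l m th phi x. x \<in> cells X ==> th \<in> ops m (sdim X x) ==> phi \<in> ops l m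
   ==> opr X (th \<odot> phi) x = opr X phi (opr X th x)"
 shows "is_sset X"
 unfolding is_sset_def simp_def using assms by (auto simp del: upt_Suc)

text \<open>\<open>f\<close> remains a total function and only the simplices in \<open>C\<close>
  constrain it, so a partial map needs no simplicial set of its own. That \<open>C\<close> is closed
  under operators is not part of the notion; \<open>subc\<close> records it separately.\<close>

definition smap_on :: "'a set => 'a sset => 'b sset => ('a => 'b) => bool" where
 "smap_on C X Y f \<longleftrightarrow> (\<forall>x\<in>C. f x \<in> cells Y \<and> sdim Y (f x) = sdim X x \<and>
   (\<forall>m. \<forall>th\<in>ops m (sdim X x). f (opr X th x) = opr Y th (f x)))"

lemma smap_iff: "smap X Y f \<longleftrightarrow> smap_on (cells X) X Y f"
 unfolding smap_def smap_on_def simp_def by blast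

definition subc :: "'a sset => 'a set => bool" where
 "subc X C \<longleftrightarrow> C \<subseteq> cells X \<and> (\<forall>x\<in>C. \<forall>m. \<forall>th\<in>ops m (sdim X x). opr X th x \<in> C)"

lemma smap_onI:
 assumes "!!x. x \<in> C ==> f x \<in> cells Y \<and> sdim Y (f x) = sdim X x"
  and "!!x m th. x \<in> C ==> th \<in> ops m (sdim X x) ==> f (opr X th x) = opr Y th (f x)"
 shows "smap_on C X Y f"
 using assms unfolding smap_on_def by blast

lemma smap_onD:
 assumes "smap_on C X Y f" "x \<in> C"
 shows "f x \<in> cells Y" "sdim Y (f x) = sdim X x"
  "th \<in> ops m (sdim X x) ==> f (opr X th x) = opr Y th (f x)"
 using assms unfolding smap_on_def by blast+

lemma smapD:
 assumes "smap X Y f" "x \<in> cells X"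
 shows "f x \<in> cells Y" "sdim Y (f x) = sdim X x"
  "th \<in> ops m (sdim X x) ==> f (opr X th x) = opr Y th (f x)"
 using assms unfolding smap_iff by (auto dest: smap_onD)

lemma smapI:
 assumes "!!x. x \<in> cells X ==> f x \<in> cells Y \<and> sdim Y (f x) = sdim X x"
  and "!!x m th. x \<in> cells X ==> th \<in> ops m (sdim X x) ==> f (opr X th x) = opr Y th (f x)"
 shows "smap X Y f"
 using assms unfolding smap_iff by (intro smap_onI) auto

lemma smap_on_glue:
 assumes "smap_on C X Y f" "smap_on D X Y g" "subc X C" "subc X D"
  and "!!x. x \<in> C ==> x \<in> D ==> f x = g x"
 shows "smap_on (C \<union> D) X Y (\<lambda>x. if x \<in> C then f x else g x)"
proof -
 have C: "!!x m th. x \<in> C ==> th \<in> ops m (sdim X x) ==> opr X th x \<in> C"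
  and D: "!!x m th. x \<in> D ==> th \<in> ops m (sdim X x) ==> opr X th x \<in> D"
  using assms(3,4) unfolding subc_def by blast+
 show ?thesis
 proof (rule smap_onI)
  fix x m th assume x: "x \<in> C \<union> D" and th: "th \<in> ops m (sdim X x)"
  show "(if opr X th x \<in> C then f (opr X th x) else g (opr X th x)) = opr Y th (if x \<in> C then f x else g x)"
  proof (cases "x \<in> C")
   case True
   thus ?thesis using C th smap_onD[OF assms(1)] by auto
  next
   case False
   hence "x \<in> D" using x by auto
   thus ?thesis using D th smap_onD(3)[OF assms(2) _ th] assms(5) False by auto
  qed
 qed (use smap_onD[OF assms(1)] smap_onD[OF assms(2)] in auto)
qed

lemma smap_on_comp:
 assumes "smap_on C X Y f" "smap_on D Y Z g" "f ` C \<subseteq> D"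
 shows "smap_on C X Z (\<lambda>x. g (f x))"
 using assms unfolding smap_on_def image_subset_iff by (metis (no_types, lifting))

lemma smap_comp: "smap X Y f ==> smap Y Z g ==> smap X Z (\<lambda>x. g (f x))"
 unfolding smap_iff by (rule smap_on_comp) (auto dest: smap_onD)

lemma subc_cells: "is_sset X ==> subc X (cells X)"
 unfolding subc_def by (auto dest: sset_opr)

lemma subc_sub: "subc X C ==> x \<in> C ==> x \<in> cells X"
 unfolding subc_def by auto

lemma subc_opr: "subc X C ==> x \<in> C ==> th \<in> ops m (sdim X x) ==> opr X th x \<in> C"
 unfolding subc_def by auto

lemma subc_Un: "subc X C ==> subc X D ==> subc X (C \<union> D)"
 unfolding subc_def by blast

text \<open>
 A simplicial map, or any family \<open>s\<close> whose coherence is a relation \<open>R\<close> between the values at \<open>x\<close> and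
 at \<open>opr X th x\<close>, extends from a subcomplex if it extends from the boundary of every standard simplex
 of \<open>X\<close>: by Eilenberg-Zilber, a simplex outside the \<open>d\<close>-skeleton is uniquely a degeneracy.
\<close>

lemma extend_cells:
 fixes R :: "nat list => 'x => 'v => 'v => bool"
 assumes X: "is_sset X" and A: "subc X A"
  and s0: "!!x m th. x \<in> A ==> th \<in> ops m (sdim X x) ==> R th x (s0 x) (s0 (opr X th x))"
  and loc: "!!d x v. x \<in> cells X ==> sdim X x = d ==>
   (!!l th k psi. th \<in> ops l d ==> set th \<noteq> {..d} ==> psi \<in> ops k l ==> R psi (opr X th x) (v th) (v (th \<odot> psi))) ==>
   \<exists>v'. (\<forall>l. \<forall>th\<in>ops l d. set th \<noteq> {..d} --> v' th = v th) \<and>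
    (\<forall>l. \<forall>th\<in>ops l d. \<forall>k. \<forall>psi\<in>ops k l. R psi (opr X th x) (v' th) (v' (th \<odot> psi)))"
 shows "\<exists>s. (\<forall>x\<in>A. s x = s0 x) \<and> (\<forall>x\<in>cells X. \<forall>m. \<forall>th\<in>ops m (sdim X x). R th x (s x) (s (opr X th x)))"
proof -
 \<comment> \<open>\<open>S d\<close> is \<open>A\<close> together with the simplices generated in
   dimensions below \<open>d\<close>; the stages of the construction are the maps defined on
   \<open>S d\<close>.\<close>
 define S where "S d = A \<union> {opr X th y | y th m. y \<in> cells X \<and> sdim X y < d \<and> th \<in> ops m (sdim X y)}" for d
 define ok where "ok d s \<longleftrightarrow> (\<forall>x\<in>A. s x = s0 x) \<and>
  (\<forall>x\<in>S d. \<forall>m. \<forall>th\<in>ops m (sdim X x). R th x (s x) (s (opr X th x)))" for d s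
 have S_opr: "opr X th x \<in> S d" if "x \<in> S d" "th \<in> ops m (sdim X x)" for x th d m
 proof (cases "x \<in> A")
  case True thus ?thesis using that A unfolding S_def by (auto dest: subc_opr)
 next
  case False
  then obtain y phi k where y: "x = opr X phi y" "y \<in> cells X" "sdim X y < d" "phi \<in> ops k (sdim X y)"
   using \<open>x \<in> S d\<close> unfolding S_def by blast
  have k: "sdim X x = k" using sset_opr[OF X y(2,4)] y by simp
  have "opr X th x = opr X (phi \<odot> th) y" using sset_comp[OF X y(2,4)] that k y(1) by simp
  moreover have "phi \<odot> th \<in> ops m (sdim X y)" using pull_ops y that k by blast
  ultimately show ?thesis unfolding S_def using y by blast
 qed
 have S_low: "x \<in> S d" if "x \<in> cells X" "sdim X x < d" for x d
 proof -
  have "x = opr X (idl (sdim X x)) x" using sset_id[OF X that(1)] by simp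
  thus ?thesis unfolding S_def using that idl_ops by blast
 qed
 have S_sub: "S d \<subseteq> cells X" for d
  unfolding S_def using A sset_opr[OF X] by (auto simp: subc_def)
 have S_mono: "S d \<subseteq> S d'" if "d \<le> d'" for d d' unfolding S_def using that by force
 have nonsurj: "opr X th x \<in> S d" if "x \<in> cells X" "sdim X x = d" "th \<in> ops l d" "set th \<noteq> {..d}" for x d l th
 proof -
  have sub: "set th \<subseteq> {..d}" "th \<noteq> []" using that(3) by (auto simp: ops_def)
  hence ne: "set th \<noteq> {}" by simp
  obtain j where j: "j \<le> d" "j \<notin> set th" using sub \<open>set th \<noteq> {..d}\<close> by auto
  have "d \<noteq> 0"
  proof
   assume "d = 0"
   hence "set th = {0}" using sub(1) ne by (auto simp: subset_singleton_iff)
   thus False using j \<open>d = 0\<close> by simp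
  qed
  then obtain n where n: "d = Suc n" by (cases d) auto
  obtain chi where chi: "chi \<in> ops l n" "th = coface n j \<odot> chi" using ops_factor_coface \<open>th \<in> ops l d\<close> j n by blast
  have c: "coface n j \<in> ops n (sdim X x)" using coface_ops j n that by simp
  have "opr X th x = opr X chi (opr X (coface n j) x)" using sset_comp[OF X that(1) c] chi by simp
  moreover have "opr X (coface n j) x \<in> S d" using S_low sset_opr[OF X that(1) c] n by simp
  ultimately show ?thesis using S_opr chi sset_opr[OF X that(1) c] by metis
 qed
 have step: "\<exists>s'. ok (Suc d) s' \<and> (\<forall>x\<in>S d. s' x = s x)" if s: "ok d s" for d s
 proof -
  \<comment> \<open>These are the new generators in dimension \<open>d\<close>: a degenerate simplex
    of dimension \<open>d\<close> comes from a lower one and lies in \<open>S d\<close>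
    already.\<close>
  define N where "N = {x \<in> cells X. sdim X x = d \<and> x \<notin> S d}"
  have "\<exists>v'. (\<forall>l. \<forall>th\<in>ops l d. set th \<noteq> {..d} --> v' th = s (opr X th x)) \<and>
    (\<forall>l. \<forall>th\<in>ops l d. \<forall>k. \<forall>psi\<in>ops k l. R psi (opr X th x) (v' th) (v' (th \<odot> psi)))" if x: "x \<in> N" for x
  proof (rule loc)
   show "x \<in> cells X" "sdim X x = d" using x N_def by auto
   fix l th k psi assume a: "th \<in> ops l d" "set th \<noteq> {..d}" "psi \<in> ops k l"
   hence "opr X th x \<in> S d" using nonsurj x N_def by auto
   hence "R psi (opr X th x) (s (opr X th x)) (s (opr X psi (opr X th x)))"
    using s a sset_opr[OF X, of x th l] x unfolding ok_def N_def by blast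
   thus "R psi (opr X th x) (s (opr X th x)) (s (opr X (th \<odot> psi) x))"
    using sset_comp[OF X, of x th l psi k] a x unfolding N_def by simp
  qed
  then obtain V where V1: "!!x l th. x \<in> N ==> th \<in> ops l d ==> set th \<noteq> {..d} ==> V x th = s (opr X th x)"
   and V2: "!!x l th k psi. x \<in> N ==> th \<in> ops l d ==> psi \<in> ops k l ==> R psi (opr X th x) (V x th) (V x (th \<odot> psi))"
   by metis
  have surj: "set th = {..d}" if "x \<in> N" "th \<in> ops l d" "opr X th x \<notin> S d" for x th l
  proof (rule ccontr)
   assume "set th \<noteq> {..d}"
   hence "opr X th x \<in> S d" using nonsurj[of x d th l] that unfolding N_def by simp
   thus False using that by simp
  qed
  have inS: "x \<in> S d" if "x \<in> cells X" "sdim X x = d" "th \<in> ops l d" "set th = {..d}" "opr X th x \<in> S d" for x th l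
  proof -
   obtain \<delta> where \<delta>: "\<delta> \<in> ops d l" "th \<odot> \<delta> = idl d" using ops_section[OF \<open>th \<in> ops l d\<close> \<open>set th = {..d}\<close> le0] by blast
   have "opr X \<delta> (opr X th x) = x" using sset_comp[OF X that(1), of th l \<delta> d] sset_id[OF X that(1)] that \<delta> by simp
   thus ?thesis using S_opr[OF that(5), of \<delta>] \<delta> sset_opr[OF X that(1), of th l] that by simp
  qed
  \<comment> \<open>A section of \<open>th\<close> through position \<open>j\<close> exhibits
    \<open>x\<close> as \<open>th'\<close> followed by that section, applied to \<open>x'\<close>.
    This composite is surjective, as otherwise \<open>x\<close> would lie in \<open>S d\<close>, so
    it is the identity. Hence \<open>x = x'\<close>, and \<open>th'\<close> agrees with
    \<open>th\<close> at \<open>j\<close>; now \<open>j\<close> varies.\<close>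
  have uniq: "x = x' \<and> th = th'" if "x \<in> N" "x' \<in> N" "th \<in> ops l d" "th' \<in> ops l d" "opr X th x = opr X th' x'"
   "opr X th x \<notin> S d" for x x' th th' l
  proof -
   have x: "x \<in> cells X" "sdim X x = d" "x' \<in> cells X" "sdim X x' = d" using that N_def by auto
   have key: "x = x' \<and> th' ! j = th ! j" if "j \<le> l" for j
   proof -
    obtain \<delta> where \<delta>: "\<delta> \<in> ops d l" "th \<odot> \<delta> = idl d" "\<delta> ! (th ! j) = j"
     using ops_section[OF \<open>th \<in> ops l d\<close> surj[OF \<open>x \<in> N\<close> \<open>th \<in> ops l d\<close> \<open>opr X th x \<notin> S d\<close>] \<open>j \<le> l\<close>] by blast
    have e: "x = opr X (th' \<odot> \<delta>) x'"
     using sset_comp[OF X x(1), of th l \<delta> d] sset_comp[OF X x(3), of th' l \<delta> d] sset_id[OF X x(1)] x \<delta>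
      \<open>th \<in> ops l d\<close> \<open>th' \<in> ops l d\<close> \<open>opr X th x = opr X th' x'\<close> by simp
    have o: "th' \<odot> \<delta> \<in> ops d d" using pull_ops \<delta> \<open>th' \<in> ops l d\<close> by blast
    have "set (th' \<odot> \<delta>) = {..d}" using nonsurj[OF x(3,4) o] e \<open>x \<in> N\<close> N_def by auto
    hence i: "th' \<odot> \<delta> = idl d" using surj_endo_idl o by blast
    hence "x = x'" using e sset_id[OF X x(3)] x by simp
    moreover have "(th' \<odot> \<delta>) ! (th ! j) = idl d ! (th ! j)" using i by simp
    hence "th' ! j = th ! j" using \<delta> ops_nth_le[OF \<open>th \<in> ops l d\<close> \<open>j \<le> l\<close>] ops_length[OF \<delta>(1)]
     by (simp add: less_Suc_eq_le del: upt_Suc)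
    ultimately show ?thesis by simp
   qed
   have "th = th'"
    by (rule nth_equalityI) (use key ops_length[OF that(3)] ops_length[OF that(4)] in auto)
   thus ?thesis using key[of 0] by simp
  qed
  \<comment> \<open>By \<open>uniq\<close> the pair behind a simplex outside \<open>S d\<close> is
    determined, so the choice operator has no freedom.\<close>
  define s' where "s' z = (if z \<in> S d then s z else
   let (x, th) = (SOME (x, th). x \<in> N \<and> (\<exists>l. th \<in> ops l d) \<and> z = opr X th x) in V x th)" for z
  have s'new: "s' (opr X th x) = V x th" if "x \<in> N" "th \<in> ops l d" "opr X th x \<notin> S d" for x th l
  proof -
   have "(SOME (x', th'). x' \<in> N \<and> (\<exists>l. th' \<in> ops l d) \<and> opr X th x = opr X th' x') = (x, th)"
   proof (rule some_equality)
    show "case (x, th) of (x', th') => x' \<in> N \<and> (\<exists>l. th' \<in> ops l d) \<and> opr X th x = opr X th' x'"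
     using that by auto
    fix z assume z: "case z of (x', th') => x' \<in> N \<and> (\<exists>l. th' \<in> ops l d) \<and> opr X th x = opr X th' x'"
    obtain x' th' where zz: "z = (x', th')" by (cases z)
    then obtain k where k: "x' \<in> N" "th' \<in> ops k d" "opr X th x = opr X th' x'" using z by auto
    have "k = l" using sset_opr(2)[OF X, of x th l] sset_opr(2)[OF X, of x' th' k] k that N_def by auto
    thus "z = (x, th)" using uniq[OF that(1) k(1) that(2)] k that zz by auto
   qed
   thus ?thesis using that unfolding s'_def by simp
  qed
  have "R psi z (s' z) (s' (opr X psi z))" if z: "z \<in> S (Suc d)" "psi \<in> ops m (sdim X z)" for z psi m
  proof (cases "z \<in> S d")
   case True
   thus ?thesis using s S_opr[OF True z(2)] z(2) unfolding s'_def ok_def by auto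
  next
   case False
   then obtain x th l where x: "z = opr X th x" "x \<in> cells X" "sdim X x < Suc d" "th \<in> ops l (sdim X x)"
    using z unfolding S_def by blast
   have "\<not> sdim X x < d" using False x unfolding S_def by blast
   hence d: "sdim X x = d" using x by simp
   have xN: "x \<in> N" using S_opr[of x d th l] False x d unfolding N_def by auto
   have zl: "sdim X z = l" using sset_opr(2)[OF X x(2,4)] x(1) by simp
   have zp: "opr X psi z = opr X (th \<odot> psi) x" using sset_comp[OF X x(2)] x z zl by metis
   have thpsi: "th \<odot> psi \<in> ops m d" using pull_ops x z zl d by metis
   have "s' (opr X psi z) = V x (th \<odot> psi)"
   proof (cases "opr X psi z \<in> S d")
    case True
    have "set (th \<odot> psi) \<noteq> {..d}"
    proof
     assume "set (th \<odot> psi) = {..d}"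
     hence "x \<in> S d" using inS[OF x(2) d thpsi] True zp by simp
     thus False using xN N_def by auto
    qed
    thus ?thesis using V1[OF xN thpsi] True zp unfolding s'_def by simp
   next
    case F: False
    thus ?thesis using s'new[OF xN thpsi] zp by simp
   qed
   moreover have "s' z = V x th" using s'new[OF xN] x d False by simp
   ultimately show ?thesis using V2[OF xN, of th l psi m] x d z zl by simp
  qed
  moreover have "\<forall>x\<in>S d. s' x = s x" unfolding s'_def by simp
  moreover have "A \<subseteq> S d" unfolding S_def by auto
  ultimately have "ok (Suc d) s' \<and> (\<forall>x\<in>S d. s' x = s x)" using s unfolding ok_def by auto
  thus ?thesis by blast
 qed
 have "ok 0 s0" unfolding ok_def S_def using s0 by auto
 have "\<exists>F. \<forall>d. ok d (F d) \<and> (\<forall>x\<in>S d. F (Suc d) x = F d x)"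
  using dependent_nat_choice[where P = ok and Q = "\<lambda>d s s'. \<forall>x\<in>S d. s' x = s x"] \<open>ok 0 s0\<close> step by blast
 then obtain F where F: "!!d. ok d (F d)" "!!d x. x \<in> S d ==> F (Suc d) x = F d x" by blast
 have stable: "F d' x = F d x" if "x \<in> S d" "d \<le> d'" for x d d'
  using that(2)
 proof (induction rule: dec_induct)
  case (step n)
  thus ?case using F(2)[of x n] S_mono[of d n] that(1) by auto
 qed simp
 \<comment> \<open>The stages are stable, so any stage containing \<open>x\<close> gives the same
   value; the stage \<open>Suc (sdim X x)\<close> always contains it.\<close>
 define s where "s x = F (Suc (sdim X x)) x" for x
 have sF: "s x = F d x" if "x \<in> cells X" "x \<in> S d" for x d
 proof (cases "d \<le> Suc (sdim X x)")
  case True thus ?thesis using stable[OF that(2) True] unfolding s_def by simp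
 next
  case False
  thus ?thesis using stable[OF S_low[OF that(1), of "Suc (sdim X x)"], of d] unfolding s_def by simp
 qed
 have "R th x (s x) (s (opr X th x))" if x: "x \<in> cells X" "th \<in> ops m (sdim X x)" for x th m
 proof -
  let ?d = "Suc (sdim X x)"
  have "x \<in> S ?d" using S_low x by simp
  moreover have "opr X th x \<in> S ?d" using S_opr x calculation by blast
  ultimately show ?thesis using F(1)[of ?d] sF[of x ?d] sF[of "opr X th x" ?d] x sset_opr[OF X x] unfolding ok_def by simp
 qed
 moreover have "s x = s0 x" if "x \<in> A" for x
  using F(1)[of "Suc (sdim X x)"] that unfolding s_def ok_def by blast
 ultimately show ?thesis by blast
qed

declare map_map [simp del] replicate_Suc [simp del]

section \<open>Products, standard simplices and the interval\<close>

lemma cells_sprod: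
 "(x, y) \<in> cells (sprod X Y) \<longleftrightarrow> x \<in> cells X \<and> y \<in> cells Y \<and> sdim X x = sdim Y y"
 by (simp add: sprod_def)

lemma sdim_sprod [simp]: "sdim (sprod X Y) (x, y) = sdim X x"
 by (simp add: sprod_def)

lemma opr_sprod [simp]: "opr (sprod X Y) th (x, y) = (opr X th x, opr Y th y)"
 by (simp add: sprod_def)

lemma is_sset_sprod: "is_sset X ==> is_sset Y ==> is_sset (sprod X Y)"
 by (rule is_ssetI) (auto simp: cells_sprod sset_opr sset_comp split: prod.splits, metis sset_id, metis sset_id)

lemma cells_std_simplex: "t \<in> cells (std_simplex n) \<longleftrightarrow> (\<exists>m. t \<in> ops m n)"
 by (simp add: std_simplex_def)

lemma sdim_std_simplex [simp]: "sdim (std_simplex n) t = length t - 1"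
 by (simp add: std_simplex_def)

lemma opr_std_simplex [simp]: "opr (std_simplex n) th t = t \<odot> th"
 by (simp add: std_simplex_def)

lemma is_sset_std_simplex [simp]: "is_sset (std_simplex n)"
proof (rule is_ssetI)
 fix m th x assume "x \<in> cells (std_simplex n)" "th \<in> ops m (sdim (std_simplex n) x)"
 thus "opr (std_simplex n) th x \<in> cells (std_simplex n) \<and> sdim (std_simplex n) (opr (std_simplex n) th x) = m"
  unfolding cells_std_simplex opr_std_simplex sdim_std_simplex
  by (metis Suc_eq_plus1 add_diff_cancel_right' length_pull_ops ops_length pull_ops)
next
 fix x assume "x \<in> cells (std_simplex n)"
 thus "opr (std_simplex n) (idl (sdim (std_simplex n) x)) x = x"
  unfolding cells_std_simplex opr_std_simplex sdim_std_simplex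
  by (metis Suc_eq_plus1 add_diff_cancel_right' ops_length pull_idl)
next
 fix l m th phi x assume "th \<in> ops m (sdim (std_simplex n) x)" "phi \<in> ops l m"
 thus "opr (std_simplex n) (th \<odot> phi) x = opr (std_simplex n) phi (opr (std_simplex n) th x)"
  using pull_assoc[of th m "length x - 1" phi l x] by (simp del: map_map)
qed

abbreviation I1 :: "nat list sset" where "I1 \<equiv> std_simplex 1"

lemma cells_sprod_std [simp]:
 "is_sset X ==> (x, t) \<in> cells (sprod X (std_simplex n)) \<longleftrightarrow> x \<in> cells X \<and> t \<in> ops (sdim X x) n"
 unfolding cells_sprod cells_std_simplex sdim_std_simplex
 by (metis Suc_eq_plus1 add_diff_cancel_right' ops_length)

abbreviation cst :: "nat => nat => nat list" where
 "cst i n \<equiv> replicate (Suc n) i"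

lemma cst_ops [simp]: "i \<le> n ==> cst i m \<in> ops m n"
 unfolding ops_iff by (auto simp del: replicate_Suc)

lemma cst_pull: "th \<in> ops m n ==> cst i n \<odot> th = cst i m"
 by (rule nth_equalityI) (auto simp: ops_iff less_Suc_eq_le simp del: replicate_Suc)

lemma ops_I1_cases: "t \<in> ops m 1 ==> p \<le> m ==> t ! p = 0 \<or> t ! p = 1"
 using ops_nth_le[of t m 1 p] by auto

lemma ops_eq_cst: "t \<in> ops m n ==> (!!p. p \<le> m ==> t ! p = i) ==> t = cst i m"
 by (rule nth_equalityI) (auto simp: ops_iff less_Suc_eq_le simp del: replicate_Suc)

lemma cst0_iff: "t \<in> ops m 1 ==> 1 \<notin> set t \<longleftrightarrow> t = cst 0 m"
proof
 assume t: "t \<in> ops m 1" "1 \<notin> set t"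
 show "t = cst 0 m"
 proof (rule ops_eq_cst[OF t(1)])
  fix p assume "p \<le> m"
  hence "t ! p \<in> set t" using ops_length[OF t(1)] by simp
  thus "t ! p = 0" using ops_I1_cases[OF t(1) \<open>p \<le> m\<close>] t(2) by auto
 qed
qed simp

lemma cst1_iff: "t \<in> ops m 1 ==> 0 \<notin> set t \<longleftrightarrow> t = cst 1 m"
proof
 assume t: "t \<in> ops m 1" "0 \<notin> set t"
 show "t = cst 1 m"
 proof (rule ops_eq_cst[OF t(1)])
  fix p assume "p \<le> m"
  hence "t ! p \<in> set t" using ops_length[OF t(1)] by simp
  thus "t ! p = 1" using ops_I1_cases[OF t(1) \<open>p \<le> m\<close>] t(2) by metis
 qed
qed simp

section \<open>The homotopy extension property of Kan complexes\<close>

text \<open>The boundary of the simplex is \<open>set th \<noteq> {..d}\<close> and the bottom of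
  the prism is \<open>1 \<notin> set t\<close>. This property takes the place of the Kan condition
  in what follows, because it passes to loop spaces by a mere exchange of coordinates.\<close>

definition prism :: "'a sset => bool" where
 "prism K \<longleftrightarrow> is_sset K \<and> (\<forall>d g.
   smap_on {(th, t) \<in> cells (sprod (std_simplex d) I1). set th \<noteq> {..d} \<or> 1 \<notin> set t} (sprod (std_simplex d) I1) K g -->
   (\<exists>g'. smap (sprod (std_simplex d) I1) K g' \<and>
    (\<forall>(th, t) \<in> cells (sprod (std_simplex d) I1). set th \<noteq> {..d} \<or> 1 \<notin> set t --> g' (th, t) = g (th, t))))"

lemma coface_coface:
 assumes "i < j" "j \<le> Suc (Suc n)"
 shows "coface (Suc n) j \<odot> coface n i = coface (Suc n) i \<odot> coface n (j - 1)"
proof (rule nth_equalityI)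
 fix p assume "p < length (coface (Suc n) j \<odot> coface n i)"
 hence p: "p \<le> n" using assms by (simp add: coface_length)
 have l: "length (coface n i) = Suc n" "length (coface n (j - 1)) = Suc n" using assms by (auto simp: coface_length)
 have a: "coface n i ! p = (if p < i then p else Suc p)" "coface n (j - 1) ! p = (if p < j - 1 then p else Suc p)"
  using assms p by (auto simp: coface_nth)
 have b: "coface (Suc n) j ! q = (if q < j then q else Suc q)" "coface (Suc n) i ! q = (if q < i then q else Suc q)"
  if "q \<le> Suc n" for q using assms that by (auto simp: coface_nth)
 show "(coface (Suc n) j \<odot> coface n i) ! p = (coface (Suc n) i \<odot> coface n (j - 1)) ! p"
  using p l a b assms by auto
qed (use assms in \<open>simp add: coface_length\<close>)

text \<open>
 The prism is filled by attaching the shuffles \<open>(0,0) \<dots> (i,0) (i,1) \<dots> (d,1)\<close> for \<open>i = d, \<dots>, 0\<close>; of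
 the faces of the \<open>i\<close>-th one only that opposite to \<open>(i,0)\<close> is new.
\<close>

lemma kan_prism:
 assumes kan: "kan K"
 shows "prism K"
proof -
 have K: "is_sset K" using kan unfolding kan_def by blast
 have "\<exists>g'. smap (sprod (std_simplex d) I1) K g' \<and>
    (\<forall>(th, t) \<in> cells (sprod (std_simplex d) I1). set th \<noteq> {..d} \<or> 1 \<notin> set t --> g' (th, t) = g (th, t))"
  if g: "smap_on {(th, t) \<in> cells (sprod (std_simplex d) I1). set th \<noteq> {..d} \<or> 1 \<notin> set t} (sprod (std_simplex d) I1) K g" for d g
 proof -
  let ?P = "sprod (std_simplex d) I1"
  have cP: "(th, t) \<in> cells ?P \<longleftrightarrow> (\<exists>l. th \<in> ops l d \<and> t \<in> ops l 1)" for th t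
   by (auto simp: cells_sprod cells_std_simplex ops_length)
  define C where "C i = {(th, t) \<in> cells ?P. set th \<noteq> {..d} \<or> (\<forall>p<length t. t ! p = 1 --> i \<le> th ! p)}" for i
  have Csub: "C (Suc i) \<subseteq> C i" for i unfolding C_def by auto
  have "\<exists>g'. smap_on (C (Suc d - j)) ?P K g' \<and> (\<forall>z\<in>C (Suc d). g' z = g z)" if "j \<le> Suc d" for j
   using that
  proof (induction j)
   case 0
   have "C (Suc d) = {(th, t) \<in> cells ?P. set th \<noteq> {..d} \<or> 1 \<notin> set t}"
   proof -
    have "(\<forall>p<length t. t ! p = 1 --> Suc d \<le> th ! p) \<longleftrightarrow> 1 \<notin> set t" if "(th, t) \<in> cells ?P" for th t
    proof -
     obtain l where l: "th \<in> ops l d" "t \<in> ops l 1" using \<open>(th, t) \<in> cells ?P\<close> cP by blast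
     have "\<not> Suc d \<le> th ! p" if "p < length t" for p
      using ops_nth_le[OF l(1), of p] that ops_length[OF l(2)] by auto
     hence "(\<forall>p<length t. t ! p = 1 --> Suc d \<le> th ! p) \<longleftrightarrow> (\<forall>p<length t. t ! p \<noteq> 1)" by blast
     thus ?thesis unfolding in_set_conv_nth by blast
    qed
    thus ?thesis unfolding C_def by auto
   qed
   thus ?case using g by auto
  next
   case (Suc j)
   define i where "i = d - j"
   have i: "i \<le> d" "Suc d - j = Suc i" "Suc d - Suc j = i" using Suc.prems unfolding i_def by auto
   obtain h where h: "smap_on (C (Suc i)) ?P K h" "\<forall>z\<in>C (Suc d). h z = g z" using Suc i by auto
   \<comment> \<open>\<open>P1\<close> and \<open>P2\<close> are the two coordinates of the
     \<open>i\<close>-th shuffle, as operators out of the simplex of dimension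
     \<open>Suc d\<close>.\<close>
   define P1 where "P1 = map (\<lambda>p. if p \<le> i then p else p - 1) (idl (Suc d))"
   define P2 where "P2 = map (\<lambda>p. if p \<le> i then 0 else 1::nat) (idl (Suc d))"
   have nP: "P1 ! p = (if p \<le> i then p else p - 1)" "P2 ! p = (if p \<le> i then 0 else 1)" if "p \<le> Suc d" for p
    using that by (auto simp: P1_def P2_def less_Suc_eq_le nth_upt simp flip: less_Suc_eq_le)
   have P1: "P1 \<in> ops (Suc d) d" and P2: "P2 \<in> ops (Suc d) 1"
    unfolding ops_iff using nP i by (auto simp: P1_def P2_def)
   have Pc: "(P1 \<odot> psi, P2 \<odot> psi) \<in> cells ?P" if "psi \<in> ops l (Suc d)" for l psi
    using cP pull_ops[OF P1 that] pull_ops[OF P2 that] by blast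
   \<comment> \<open>Vertex \<open>Suc i\<close> of the shuffle is \<open>(i,1)\<close>, the only
     vertex violating the condition of \<open>C (Suc i)\<close>; omitting any other vertex except
     \<open>i\<close> loses a vertex of the base simplex. Omitting \<open>(i,0)\<close> alone keeps
     \<open>(i,1)\<close> and a surjective first coordinate. So the faces already filled form
     exactly the horn at \<open>i\<close>.\<close>
   have inC: "(P1 \<odot> psi, P2 \<odot> psi) \<in> C (Suc i) \<longleftrightarrow> (\<exists>j\<le>Suc d. j \<noteq> i \<and> j \<notin> set psi)" if psi: "psi \<in> ops l (Suc d)" for l psi
   proof
    assume L: "(P1 \<odot> psi, P2 \<odot> psi) \<in> C (Suc i)"
    show "\<exists>j\<le>Suc d. j \<noteq> i \<and> j \<notin> set psi"
    proof (rule ccontr)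
     assume "\<not> ?thesis"
     hence all: "!!j. j \<le> Suc d ==> j \<noteq> i ==> j \<in> set psi" by auto
     have "c \<in> set (P1 \<odot> psi)" if "c \<le> d" for c
     proof (cases "c < i")
      case True
      thus ?thesis using all[of c] nP(1)[of c] that by (force simp: image_iff)
     next
      case False
      hence "Suc c \<in> set psi" "P1 ! Suc c = c" using all[of "Suc c"] nP(1)[of "Suc c"] that by auto
      thus ?thesis by (force simp: image_iff)
     qed
     hence "set (P1 \<odot> psi) = {..d}"
      using ops_in_set_le[OF pull_ops[OF P1 psi]] by blast
     moreover obtain p where p: "p < length psi" "psi ! p = Suc i"
      using all[of "Suc i"] i by (metis in_set_conv_nth n_not_Suc_n not_less_eq_eq)
     ultimately show False using L nP[of "Suc i"] i unfolding C_def by (auto dest!: spec[of _ p])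
    qed
   next
    assume "\<exists>j\<le>Suc d. j \<noteq> i \<and> j \<notin> set psi"
    then obtain j where j: "j \<le> Suc d" "j \<noteq> i" "j \<notin> set psi" by blast
    show "(P1 \<odot> psi, P2 \<odot> psi) \<in> C (Suc i)"
    proof (cases "j = Suc i")
     case True
     have "Suc i \<le> P1 ! (psi ! p)" if "p < length psi" "P2 ! (psi ! p) = 1" for p
     proof -
      have "psi ! p \<in> set psi" using that by simp
      hence "psi ! p \<le> Suc d" "psi ! p \<noteq> Suc i" using ops_in_set_le[OF psi] j True by auto
      thus ?thesis using nP[of "psi ! p"] that by (auto split: if_splits)
     qed
     thus ?thesis using Pc[OF psi] unfolding C_def by auto
    next
     case False
     define c where "c = (if j < i then j else j - 1)"
     have "c \<le> d" using j False i unfolding c_def by auto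
     moreover have "c \<notin> set (P1 \<odot> psi)"
     proof
      assume "c \<in> set (P1 \<odot> psi)"
      then obtain q where q: "q \<in> set psi" "P1 ! q = c" by auto
      hence "q \<le> Suc d" "q \<noteq> j" using ops_in_set_le[OF psi] j by auto
      thus False using nP(1)[of q] q j False unfolding c_def by (auto split: if_splits)
     qed
     ultimately have "set (P1 \<odot> psi) \<noteq> {..d}" by blast
     thus ?thesis using Pc[OF psi] unfolding C_def by auto
    qed
   qed
   define y where "y j = h (P1 \<odot> coface d j, P2 \<odot> coface d j)" for j
   have cof: "(P1 \<odot> coface d j, P2 \<odot> coface d j) \<in> C (Suc i)" if "j \<le> Suc d" "j \<noteq> i" for j
    using inC[OF coface_ops[OF that(1)]] that by (auto simp: coface_def)
   have dimc: "sdim ?P (P1 \<odot> coface d j, P2 \<odot> coface d j) = d" if "j \<le> Suc d" for j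
    using that by (simp add: coface_length)
   have y: "y j \<in> simp K d" if "j \<le> Suc d" "j \<noteq> i" for j
    using smap_onD[OF h(1) cof[OF that]] dimc that unfolding simp_def y_def by simp
   have comp: "opr K (coface (d - 1) a) (y b) = opr K (coface (d - 1) (b - 1)) (y a)"
    if ab: "a < b" "b \<le> Suc d" "a \<noteq> i" "b \<noteq> i" for a b
   proof -
    have "d \<noteq> 0" using ab i by auto
    then obtain n where n: "d = Suc n" by (cases d) auto
    have ca: "coface n a \<in> ops n d" "coface n (b - 1) \<in> ops n d" using coface_ops ab n by auto
    have "opr K (coface n a) (y b) = h (opr ?P (coface n a) (P1 \<odot> coface d b, P2 \<odot> coface d b))"
     using smap_onD(3)[OF h(1) cof[OF ab(2,4)]] ca dimc[OF ab(2)] unfolding y_def by metis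
    also have "opr ?P (coface n a) (P1 \<odot> coface d b, P2 \<odot> coface d b)
      = opr ?P (coface n (b - 1)) (P1 \<odot> coface d a, P2 \<odot> coface d a)"
     using coface_coface[OF ab(1), of n] ab n ca pull_assoc[OF coface_ops, of b d "coface n a" n P1]
      pull_assoc[OF coface_ops, of a d "coface n (b - 1)" n P1] pull_assoc[OF coface_ops, of b d "coface n a" n P2]
      pull_assoc[OF coface_ops, of a d "coface n (b - 1)" n P2] by simp
    also have "h \<dots> = opr K (coface n (b - 1)) (y a)"
    proof -
     have "a \<le> Suc d" using ab by simp
     thus ?thesis
      using smap_onD(3)[OF h(1) cof[OF _ ab(3)]] ca dimc[of a] unfolding y_def by metis
    qed
    finally show ?thesis using n by simp
   qed
   have kan': "!!n k y. k \<le> Suc n ==> (\<forall>i\<le>Suc n. i \<noteq> k --> y i \<in> simp K n) ==>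
     (\<forall>i j. i < j \<and> j \<le> Suc n \<and> i \<noteq> k \<and> j \<noteq> k -->
       opr K (coface (n - 1) i) (y j) = opr K (coface (n - 1) (j - 1)) (y i)) ==>
     (\<exists>x\<in>simp K (Suc n). \<forall>i\<le>Suc n. i \<noteq> k --> opr K (coface n i) x = y i)"
    using kan unfolding kan_def by blast
   obtain k where k: "k \<in> simp K (Suc d)" "!!j. j \<le> Suc d ==> j \<noteq> i ==> opr K (coface d j) k = y j"
    using kan'[of i d y] y comp i by auto
   have kK: "k \<in> cells K" "sdim K k = Suc d" using k(1) unfolding simp_def by auto
   \<comment> \<open>The sum of the coordinates is the position in the shuffle: \<open>(a,0)\<close>
     with \<open>a \<le> i\<close> has position \<open>a\<close>, and \<open>(a,1)\<close> with
     \<open>a \<ge> i\<close> has position \<open>a + 1\<close>.\<close>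
   define psi where "psi = (\<lambda>(th, t). map2 (+) th t :: nat list)"
   have psio: "psi (th, t) \<in> ops l (Suc d)" if "th \<in> ops l d" "t \<in> ops l 1" for th t l
    unfolding ops_iff psi_def using ops_length[OF that(1)] ops_length[OF that(2)] ops_mono[OF that(1)] ops_mono[OF that(2)]
     ops_nth_le[OF that(1)] ops_nth_le[OF that(2)] by (auto intro!: add_mono) (metis add_mono add_Suc_right add.right_neutral One_nat_def)
   have psin: "psi (th \<odot> phi, t \<odot> phi) = psi (th, t) \<odot> phi" if "th \<in> ops l d" "t \<in> ops l 1" "phi \<in> ops m l" for th t l phi m
    unfolding psi_def using that by (intro nth_equalityI) (auto simp: ops_iff less_Suc_eq_le)
   \<comment> \<open>A simplex in \<open>C i\<close> but not in \<open>C (Suc i)\<close> passes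
     through \<open>(i,1)\<close>. By monotonicity its points at height 0 come earlier and have
     first coordinate at most \<open>i\<close>, so all of it runs along the shuffle.\<close>
   have Ppsi: "P1 \<odot> psi (th, t) = th \<and> P2 \<odot> psi (th, t) = t"
    if z: "(th, t) \<in> C i" "(th, t) \<notin> C (Suc i)" "th \<in> ops l d" "t \<in> ops l 1" for th t l
   proof -
    obtain p0 where p0: "p0 < length t" "t ! p0 = 1" "th ! p0 = i" and all: "\<forall>p<length t. t ! p = 1 --> i \<le> th ! p"
     using z unfolding C_def by (auto simp: not_less_eq_eq)
    have "P1 ! (th ! p + t ! p) = th ! p \<and> P2 ! (th ! p + t ! p) = t ! p" if p: "p \<le> l" for p
    proof (cases "t ! p = 1")
     case True
     hence "i \<le> th ! p" using all p ops_length[OF z(4)] by auto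
     thus ?thesis using True nP[of "th ! p + 1"] ops_nth_le[OF z(3) p] by auto
    next
     case False
     hence t0: "t ! p = 0" using ops_I1_cases[OF z(4) p] by auto
     have "p \<le> p0" using ops_mono[OF z(4), of p0 p] p t0 p0 by (cases "p \<le> p0") auto
     hence "th ! p \<le> i" using ops_mono[OF z(3), of p p0] p0 ops_length[OF z(4)] by auto
     thus ?thesis using t0 nP[of "th ! p"] i by auto
    qed
    thus ?thesis unfolding psi_def using ops_length[OF z(3)] ops_length[OF z(4)]
     by (auto intro!: nth_equalityI simp: less_Suc_eq_le)
   qed
   define h' where "h' z = (if z \<in> C (Suc i) then h z else opr K (psi z) k)" for z
   have "smap_on (C i) ?P K h'"
   proof (rule smap_onI)
    fix z assume z: "z \<in> C i"
    obtain th t where zz: "z = (th, t)" by (cases z)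
    then obtain l where l: "th \<in> ops l d" "t \<in> ops l 1" using z cP unfolding C_def by blast
    have "sdim ?P z = l" using l zz by (simp add: ops_length)
    thus "h' z \<in> cells K \<and> sdim K (h' z) = sdim ?P z"
     using smap_onD[OF h(1), of z] sset_opr[OF K kK(1), of "psi z" l] psio[OF l] kK zz unfolding h'_def by auto
   next
    fix z m phi assume z: "z \<in> C i" and phi: "phi \<in> ops m (sdim ?P z)"
    obtain th t where zz: "z = (th, t)" by (cases z)
    then obtain l where l: "th \<in> ops l d" "t \<in> ops l 1" using z cP unfolding C_def by blast
    have phil: "phi \<in> ops m l" using phi l zz by (simp add: ops_length)
    show "h' (opr ?P phi z) = opr K phi (h' z)"
    proof (cases "z \<in> C (Suc i)")
     case True
     have "opr ?P phi z \<in> C (Suc i)"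
     proof -
      have "(th \<odot> phi, t \<odot> phi) \<in> cells ?P" using cP pull_ops l phil by blast
      moreover have "set (th \<odot> phi) \<noteq> {..d} \<or> (\<forall>p<length phi. t ! (phi ! p) = 1 --> Suc i \<le> th ! (phi ! p))"
      proof (cases "set th = {..d}")
       case T: True
       hence "\<forall>p<length t. t ! p = 1 --> Suc i \<le> th ! p" using True zz unfolding C_def by auto
       thus ?thesis using ops_nth_le[OF phil] ops_length[OF phil] ops_length[OF l(2)]
        by (auto simp: less_Suc_eq_le)
      next
       case F: False
       then obtain c where "c \<le> d" "c \<notin> set th" using ops_in_set_le[OF l(1)] by auto
       hence "c \<notin> set (th \<odot> phi)" using set_pull[OF l(1) phil] by blast
       thus ?thesis using \<open>c \<le> d\<close> by auto
      qed
      ultimately show ?thesis using zz unfolding C_def by auto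
     qed
     thus ?thesis using True smap_onD(3)[OF h(1) True phi] unfolding h'_def by simp
    next
     case False
     have e: "h' z = opr K (psi z) k" using False unfolding h'_def by simp
     have PP: "P1 \<odot> psi z = th" "P2 \<odot> psi z = t" using Ppsi[of th t l] z False zz l by auto
     have psiz: "psi z \<in> ops l (Suc d)" using psio[OF l] zz by simp
     have n: "psi (opr ?P phi z) = psi z \<odot> phi" using psin[OF l phil] zz by simp
     have compphi: "opr K (psi z \<odot> phi) k = opr K phi (opr K (psi z) k)" using sset_comp[OF K kK(1)] psiz kK phil by metis
     show ?thesis
     proof (cases "opr ?P phi z \<in> C (Suc i)")
      case True
      have oe: "opr ?P phi z = (P1 \<odot> (psi z \<odot> phi), P2 \<odot> (psi z \<odot> phi))"
       using PP pull_assoc[OF psiz phil, of P1] pull_assoc[OF psiz phil, of P2] zz by simp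
      have o: "psi z \<odot> phi \<in> ops m (Suc d)" using pull_ops psiz phil by blast
      obtain j where j: "j \<le> Suc d" "j \<noteq> i" "j \<notin> set (psi z \<odot> phi)" using inC[OF o] True oe by auto
      obtain chi where chi: "chi \<in> ops m d" "psi z \<odot> phi = coface d j \<odot> chi" using ops_factor_coface[OF o j(1,3)] .
      have "opr K (psi z \<odot> phi) k = opr K chi (y j)"
       using sset_comp[OF K kK(1), of "coface d j" d chi m] coface_ops[OF j(1)] kK chi k(2)[OF j(1,2)] by simp
      also have "\<dots> = h (opr ?P chi (P1 \<odot> coface d j, P2 \<odot> coface d j))"
       using smap_onD(3)[OF h(1) cof[OF j(1,2)]] chi(1) dimc[OF j(1)] unfolding y_def by metis
      also have "opr ?P chi (P1 \<odot> coface d j, P2 \<odot> coface d j) = opr ?P phi z"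
       using oe chi pull_assoc[OF coface_ops[OF j(1)] chi(1), of P1]
        pull_assoc[OF coface_ops[OF j(1)] chi(1), of P2] by simp
      finally show ?thesis using True e compphi unfolding h'_def by simp
     next
      case F: False
      hence "h' (opr ?P phi z) = opr K (psi z \<odot> phi) k" using n unfolding h'_def by simp
      thus ?thesis using e compphi by simp
     qed
    qed
   qed
   moreover have "\<forall>z\<in>C (Suc d). h' z = g z"
   proof
    fix z assume "z \<in> C (Suc d)"
    moreover have "C (Suc d) \<subseteq> C (Suc i)" unfolding C_def using i by force
    ultimately show "h' z = g z" using h(2) unfolding h'_def by auto
   qed
   ultimately show ?case using i by auto
  qed
  from this[of "Suc d"] obtain g' where g': "smap_on (C 0) ?P K g'" "\<forall>z\<in>C (Suc d). g' z = g z" by auto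
  have "C 0 = cells ?P" unfolding C_def by auto
  moreover have "(th, t) \<in> C (Suc d)" if "(th, t) \<in> cells ?P" "set th \<noteq> {..d} \<or> 1 \<notin> set t" for th t
   using that unfolding C_def by (auto simp: in_set_conv_nth)
  ultimately show ?thesis using g' unfolding smap_iff by (intro exI[of _ g']) fastforce
 qed
 thus ?thesis unfolding prism_def using K by blast
qed

text \<open>The homotopy is built with \<open>extend_cells\<close>, the datum at a simplex being the
  function of \<open>t\<close> over it; extending over one simplex of \<open>B\<close> is filling
  one prism.\<close>

theorem hep:
 fixes B :: "'b sset" and K :: "'a sset"
 assumes K: "prism K" and B: "is_sset B" and A: "subc B A"
  and h: "smap_on {(b, t) \<in> cells (sprod B I1). b \<in> A \<or> 1 \<notin> set t} (sprod B I1) K h"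
 obtains h' where "smap (sprod B I1) K h'"
  "!!b t. (b, t) \<in> cells (sprod B I1) ==> b \<in> A \<or> 1 \<notin> set t ==> h' (b, t) = h (b, t)"
proof -
 let ?C = "{(b, t) \<in> cells (sprod B I1). b \<in> A \<or> 1 \<notin> set t}"
 have KS: "is_sset K" using K unfolding prism_def by blast
 \<comment> \<open>The relation expresses naturality in \<open>t\<close> and in the simplex at once;
   the last clause pins the bottom of the cylinder to \<open>h\<close> also outside
   \<open>A\<close>.\<close>
 define R :: "nat list => 'b => (nat list => 'a) => (nat list => 'a) => bool" where
  "R psi x v v' \<longleftrightarrow> (\<forall>t\<in>ops (sdim B x) 1. v t \<in> cells K \<and> sdim K (v t) = sdim B x \<and> v' (t \<odot> psi) = opr K psi (v t)) \<and>
    v (cst 0 (sdim B x)) = h (x, cst 0 (sdim B x))" for psi x v v'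
 have "\<exists>s. (\<forall>x\<in>A. s x = (\<lambda>t. h (x, t))) \<and> (\<forall>x\<in>cells B. \<forall>m. \<forall>th\<in>ops m (sdim B x). R th x (s x) (s (opr B th x)))"
 proof (rule extend_cells[OF B A])
  fix x m th assume x: "x \<in> A" "th \<in> ops m (sdim B x)"
  have "(x, t) \<in> ?C" if "t \<in> ops (sdim B x) 1" for t using x A B that by (auto dest: subc_sub)
  thus "R th x (\<lambda>t. h (x, t)) (\<lambda>t. h (opr B th x, t))"
   using smap_onD(1,2)[OF h] smap_onD(3)[OF h, of "(x, _)" th m] x unfolding R_def by auto
 next
  fix d x and v :: "nat list => nat list => 'a"
  assume x: "x \<in> cells B" "sdim B x = d"
   and v: "!!l th k psi. th \<in> ops l d ==> set th \<noteq> {..d} ==> psi \<in> ops k l ==> R psi (opr B th x) (v th) (v (th \<odot> psi))"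
  let ?P = "sprod (std_simplex d) I1"
  have cP: "(th, t) \<in> cells ?P \<longleftrightarrow> (\<exists>l. th \<in> ops l d \<and> t \<in> ops l 1)" for th t
   by (auto simp: cells_sprod cells_std_simplex ops_length)
  have dx: "opr B th x \<in> cells B" "sdim B (opr B th x) = l" if "th \<in> ops l d" for th l
   using sset_opr[OF B x(1)] that x by auto
  define g where "g = (\<lambda>(th, t). if set th \<noteq> {..d} then v th t else h (opr B th x, t))"
  have zc: "(opr B th x, cst 0 l) \<in> ?C" if "th \<in> ops l d" for th l
   using dx[OF that] B by auto
  have ns: "set (th \<odot> psi) \<noteq> {..d}" if "th \<in> ops l d" "psi \<in> ops k l" "set th \<noteq> {..d}" for th psi l k
   using set_pull[OF that(1,2)] that(3) ops_in_set_le[OF that(1)] by blast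
  have g: "smap_on {(th, t) \<in> cells ?P. set th \<noteq> {..d} \<or> 1 \<notin> set t} ?P K g"
  proof (rule smap_onI)
   fix z assume z: "z \<in> {(th, t) \<in> cells ?P. set th \<noteq> {..d} \<or> 1 \<notin> set t}"
   then obtain th t l where zz: "z = (th, t)" "th \<in> ops l d" "t \<in> ops l 1" using cP by blast
   show "g z \<in> cells K \<and> sdim K (g z) = sdim ?P z"
   proof (cases "set th = {..d}")
    case False
    thus ?thesis using v[OF zz(2) False idl_ops] zz dx[OF zz(2)] ops_length[OF zz(2)] unfolding R_def g_def by auto
   next
    case True
    hence "t = cst 0 l" using z zz cst0_iff by auto
    thus ?thesis using True zz smap_onD[OF h zc[OF zz(2)]] dx[OF zz(2)] ops_length[OF zz(2)] unfolding g_def by simp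
   qed
  next
   fix z m phi assume z: "z \<in> {(th, t) \<in> cells ?P. set th \<noteq> {..d} \<or> 1 \<notin> set t}" and phi: "phi \<in> ops m (sdim ?P z)"
   then obtain th t l where zz: "z = (th, t)" "th \<in> ops l d" "t \<in> ops l 1" using cP by blast
   have phil: "phi \<in> ops m l" using phi zz by (simp add: ops_length)
   show "g (opr ?P phi z) = opr K phi (g z)"
   proof (cases "set th = {..d}")
    case False
    thus ?thesis using v[OF zz(2) False phil] zz dx[OF zz(2)] ns[OF zz(2) phil False] unfolding R_def g_def by auto
   next
    case True
    hence t: "t = cst 0 l" using z zz cst0_iff by auto
    have e: "opr K phi (g z) = h (opr B (th \<odot> phi) x, cst 0 m)"
     using True zz t smap_onD(3)[OF h zc[OF zz(2)], of phi m] dx[OF zz(2)] phil cst_pull[OF phil] sset_comp[OF B x(1)] x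
     unfolding g_def by simp
    show ?thesis
    proof (cases "set (th \<odot> phi) = {..d}")
     case T: True
     thus ?thesis using e zz t cst_pull[OF phil] unfolding g_def by simp
    next
     case F: False
     have o: "th \<odot> phi \<in> ops m d" using pull_ops zz phil by blast
     hence "v (th \<odot> phi) (cst 0 m) = h (opr B (th \<odot> phi) x, cst 0 m)"
      using v[OF o F idl_ops] dx[OF o] unfolding R_def by simp
     thus ?thesis using e zz t cst_pull[OF phil] F unfolding g_def by simp
    qed
   qed
  qed
  obtain g' where g': "smap ?P K g'"
    "!!th t. (th, t) \<in> cells ?P ==> set th \<noteq> {..d} \<or> 1 \<notin> set t ==> g' (th, t) = g (th, t)"
   using K g unfolding prism_def by blast
  define v' where "v' th = (if set th \<noteq> {..d} then v th else (\<lambda>t. g' (th, t)))" for th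
  have v'g: "v' th t = g' (th, t)" if "th \<in> ops l d" "t \<in> ops l 1" for th l t
  proof (cases "set th = {..d}")
   case False
   have "(th, t) \<in> cells ?P" using that cP by blast
   thus ?thesis using g'(2)[of th t] False unfolding v'_def g_def by simp
  qed (simp add: v'_def)
  have "R psi (opr B th x) (v' th) (v' (th \<odot> psi))" if o: "th \<in> ops l d" "psi \<in> ops k l" for th l psi k
  proof -
   have "v' th t \<in> cells K \<and> sdim K (v' th t) = l \<and> v' (th \<odot> psi) (t \<odot> psi) = opr K psi (v' th t)" if t: "t \<in> ops l 1" for t
   proof -
    have c: "(th, t) \<in> cells ?P" "sdim ?P (th, t) = l" using cP o t by (auto simp: ops_length)
    have "v' (th \<odot> psi) (t \<odot> psi) = g' (opr ?P psi (th, t))" using v'g[OF pull_ops[OF o] pull_ops[OF t o(2)]] by simp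
    thus ?thesis using smapD[OF g'(1) c(1)] v'g[OF o(1) t] c(2) o(2) by simp
   qed
   moreover have "v' th (cst 0 l) = h (opr B th x, cst 0 l)"
   proof (cases "set th = {..d}")
    case True
    have c: "(th, cst 0 l) \<in> cells ?P" using cP o by auto
    thus ?thesis using g'(2)[OF c] True unfolding v'_def g_def by simp
   next
    case False
    thus ?thesis using v[OF o(1) False idl_ops] dx[OF o(1)] unfolding R_def v'_def by simp
   qed
   ultimately show ?thesis using dx[OF o(1)] unfolding R_def by simp
  qed
  moreover have "\<forall>l. \<forall>th\<in>ops l d. set th \<noteq> {..d} --> v' th = v th" unfolding v'_def by simp
  ultimately show "\<exists>v'. (\<forall>l. \<forall>th\<in>ops l d. set th \<noteq> {..d} --> v' th = v th) \<and>
    (\<forall>l. \<forall>th\<in>ops l d. \<forall>k. \<forall>psi\<in>ops k l. R psi (opr B th x) (v' th) (v' (th \<odot> psi)))" by blast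
 qed
 then obtain s where s: "\<forall>x\<in>A. s x = (\<lambda>t. h (x, t))"
   "!!x m th. x \<in> cells B ==> th \<in> ops m (sdim B x) ==> R th x (s x) (s (opr B th x))" by blast
 show thesis
 proof (rule that[of "\<lambda>(x, t). s x t"])
  show "smap (sprod B I1) K (\<lambda>(x, t). s x t)"
  proof (rule smapI)
   fix z assume "z \<in> cells (sprod B I1)"
   thus "(case z of (x, t) => s x t) \<in> cells K \<and> sdim K (case z of (x, t) => s x t) = sdim (sprod B I1) z"
    using s(2)[OF _ idl_ops] B unfolding R_def by (cases z) auto
  next
   fix z m th assume "z \<in> cells (sprod B I1)" "th \<in> ops m (sdim (sprod B I1) z)"
   thus "(case opr (sprod B I1) th z of (x, t) => s x t) = opr K th (case z of (x, t) => s x t)"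
    using s(2)[of "fst z" th m] B unfolding R_def by (cases z) auto
  qed
  fix b t assume b: "(b, t) \<in> cells (sprod B I1)" "b \<in> A \<or> 1 \<notin> set t"
  show "(case (b, t) of (x, t) => s x t) = h (b, t)"
  proof (cases "b \<in> A")
   case True thus ?thesis using s(1) by simp
  next
   case False
   hence "t = cst 0 (sdim B b)" using b B cst0_iff by auto
   thus ?thesis using s(2)[OF _ idl_ops, of b] b B unfolding R_def by auto
  qed
 qed
qed

section \<open>Homotopies relative to a subcomplex\<close>

lemma smap_cyl:
 assumes "smap (sprod B I1) K h" "is_sset B" "b \<in> cells B" "t \<in> ops (sdim B b) 1"
 shows "h (b, t) \<in> cells K" "sdim K (h (b, t)) = sdim B b"
  "th \<in> ops m (sdim B b) ==> h (opr B th b, t \<odot> th) = opr K th (h (b, t))"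
proof -
 have c: "(b, t) \<in> cells (sprod B I1)" using assms by simp
 show "h (b, t) \<in> cells K" "sdim K (h (b, t)) = sdim B b"
  "th \<in> ops m (sdim B b) ==> h (opr B th b, t \<odot> th) = opr K th (h (b, t))"
  using smapD[OF assms(1) c] by simp_all
qed

lemma smap_cylI:
 assumes "is_sset B"
  and "!!b t. b \<in> cells B ==> t \<in> ops (sdim B b) 1 ==> h (b, t) \<in> cells K \<and> sdim K (h (b, t)) = sdim B b"
  and "!!b t m th. b \<in> cells B ==> t \<in> ops (sdim B b) 1 ==> th \<in> ops m (sdim B b) ==>
   h (opr B th b, t \<odot> th) = opr K th (h (b, t))"
 shows "smap (sprod B I1) K h"
proof (rule smapI)
 fix z assume "z \<in> cells (sprod B I1)"
 thus "h z \<in> cells K \<and> sdim K (h z) = sdim (sprod B I1) z" using assms by (cases z) auto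
next
 fix z m th assume "z \<in> cells (sprod B I1)" "th \<in> ops m (sdim (sprod B I1) z)"
 thus "h (opr (sprod B I1) th z) = opr K th (h z)" using assms by (cases z) auto
qed

lemma smap_on_cylI:
 assumes "is_sset B" "subc B A"
  and "!!b t. b \<in> A ==> b \<in> cells B ==> t \<in> ops (sdim B b) 1 ==> h (b, t) \<in> cells K \<and> sdim K (h (b, t)) = sdim B b"
  and "!!b t m th. b \<in> A ==> b \<in> cells B ==> t \<in> ops (sdim B b) 1 ==> th \<in> ops m (sdim B b) ==>
   h (opr B th b, t \<odot> th) = opr K th (h (b, t))"
 shows "smap_on {(b, t) \<in> cells (sprod B I1). b \<in> A} (sprod B I1) K h"
 using assms by (intro smap_onI) auto

lemma is_sset_cyl [simp]: "is_sset B ==> is_sset (sprod B I1)"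
 by (simp add: is_sset_sprod)

lemma subc_cyl: "is_sset B ==> subc B A ==> subc (sprod B I1) {(b, t) \<in> cells (sprod B I1). b \<in> A}"
 unfolding subc_def using sset_opr[of "sprod B I1"] by (auto simp: pull_ops subset_iff sset_opr)

lemma subc_zero: "is_sset B ==> subc (sprod B I1) {(b, t) \<in> cells (sprod B I1). 1 \<notin> set t}"
 unfolding subc_def using set_pull by (fastforce simp: pull_ops sset_opr)

text \<open>The boundary of the cylinder over the pair \<open>(B, A)\<close>. Statements about
  homotopies between homotopies, and about loops in families, are relative to it.\<close>

definition rim :: "'b sset => 'b set => ('b \<times> nat list) set" where
 "rim B A = {(b, t) \<in> cells (sprod B I1). b \<in> A \<or> t = cst 0 (sdim B b) \<or> t = cst 1 (sdim B b)}"

lemma subc_rim: "is_sset B ==> subc B A ==> subc (sprod B I1) (rim B A)"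
 unfolding subc_def rim_def by (auto simp: pull_ops sset_opr cst_pull)

lemma cst_01 [simp]: "cst 0 n \<noteq> cst 1 m" "cst 1 n \<noteq> cst 0 m"
 by (simp_all add: replicate_Suc)

lemma hep_pair:
 assumes K: "prism K" and B: "is_sset B" and A: "subc B A" and f: "smap B K f"
  and a: "smap_on {(b, t) \<in> cells (sprod B I1). b \<in> A} (sprod B I1) K a"
  and fa: "!!b. b \<in> A ==> a (b, cst 0 (sdim B b)) = f b"
 obtains H where "smap (sprod B I1) K H"
  "!!b. b \<in> cells B ==> H (b, cst 0 (sdim B b)) = f b"
  "!!b t. b \<in> A ==> t \<in> ops (sdim B b) 1 ==> H (b, t) = a (b, t)"
proof -
 let ?C = "{(b, t) \<in> cells (sprod B I1). b \<in> A}" and ?D = "{(b, t) \<in> cells (sprod B I1). 1 \<notin> set t}"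
 define h where "h z = (if z \<in> ?C then a z else f (fst z))" for z
 have "smap_on ?D (sprod B I1) K (\<lambda>z. f (fst z))"
  using B smapD[OF f] by (intro smap_onI) auto
 hence "smap_on (?C \<union> ?D) (sprod B I1) K h"
  unfolding h_def
  by (rule smap_on_glue[OF a _ subc_cyl[OF B A] subc_zero[OF B]]) (use fa B cst0_iff in auto)
 moreover have "?C \<union> ?D = {(b, t) \<in> cells (sprod B I1). b \<in> A \<or> 1 \<notin> set t}" by auto
 ultimately obtain H where H: "smap (sprod B I1) K H"
  "!!b t. (b, t) \<in> cells (sprod B I1) ==> b \<in> A \<or> 1 \<notin> set t ==> H (b, t) = h (b, t)"
  using hep[OF K B A, of h] by auto
 have AB: "b \<in> cells B" if "b \<in> A" for b using that A by (rule subc_sub[rotated])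
 show thesis
 proof (rule that[OF H(1)])
  fix b assume "b \<in> cells B"
  thus "H (b, cst 0 (sdim B b)) = f b" using H(2)[of b "cst 0 (sdim B b)"] B fa unfolding h_def by auto
 next
  fix b t assume "b \<in> A" "t \<in> ops (sdim B b) 1"
  thus "H (b, t) = a (b, t)" using H(2)[of b t] AB B unfolding h_def by auto
 qed
qed

text \<open>Homotopy extension for the cylinder of \<open>B\<close> relative to its rim: the bottom
  edge \<open>f\<close>, the sides \<open>l\<close> and \<open>r\<close> and the whole square
  \<open>a\<close> over \<open>A\<close> are given, and the top edge of \<open>H\<close> is the
  homotopy that is gained.\<close>

lemma box:
 assumes K: "prism K" and B: "is_sset B" and A: "subc B A"
  and f: "smap (sprod B I1) K f" and l: "smap (sprod B I1) K l" and r: "smap (sprod B I1) K r"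
  and a: "!!b x y. b \<in> A ==> x \<in> ops (sdim B b) 1 ==> y \<in> ops (sdim B b) 1 ==>
    a b x y \<in> cells K \<and> sdim K (a b x y) = sdim B b"
  "!!b x y th m. b \<in> A ==> x \<in> ops (sdim B b) 1 ==> y \<in> ops (sdim B b) 1 ==> th \<in> ops m (sdim B b) ==>
    a (opr B th b) (x \<odot> th) (y \<odot> th) = opr K th (a b x y)"
  and fl: "!!b. b \<in> cells B ==> f (b, cst 0 (sdim B b)) = l (b, cst 0 (sdim B b))"
  and fr: "!!b. b \<in> cells B ==> f (b, cst 1 (sdim B b)) = r (b, cst 0 (sdim B b))"
  and fa: "!!b x. b \<in> A ==> x \<in> ops (sdim B b) 1 ==> a b x (cst 0 (sdim B b)) = f (b, x)"
  and la: "!!b y. b \<in> A ==> y \<in> ops (sdim B b) 1 ==> a b (cst 0 (sdim B b)) y = l (b, y)"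
  and ra: "!!b y. b \<in> A ==> y \<in> ops (sdim B b) 1 ==> a b (cst 1 (sdim B b)) y = r (b, y)"
 obtains H where "smap (sprod (sprod B I1) I1) K H"
  "!!b x. b \<in> cells B ==> x \<in> ops (sdim B b) 1 ==> H ((b, x), cst 0 (sdim B b)) = f (b, x)"
  "!!b y. b \<in> cells B ==> y \<in> ops (sdim B b) 1 ==> H ((b, cst 0 (sdim B b)), y) = l (b, y)"
  "!!b y. b \<in> cells B ==> y \<in> ops (sdim B b) 1 ==> H ((b, cst 1 (sdim B b)), y) = r (b, y)"
  "!!b x y. b \<in> A ==> x \<in> ops (sdim B b) 1 ==> y \<in> ops (sdim B b) 1 ==> H ((b, x), y) = a b x y"
proof -
 define k where "k = (\<lambda>((b, x), y). if b \<in> A then a b x y else if x = cst 0 (sdim B b) then l (b, y) else r (b, y))"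
 have AB: "b \<in> cells B" if "b \<in> A" for b using that A by (rule subc_sub[rotated])
 have k0: "k ((b, cst 0 (sdim B b)), y) = l (b, y)" if "b \<in> cells B" "y \<in> ops (sdim B b) 1" for b y
  using that la unfolding k_def by auto
 have k1: "k ((b, cst 1 (sdim B b)), y) = r (b, y)" if "b \<in> cells B" "y \<in> ops (sdim B b) 1" for b y
  using that ra unfolding k_def by auto
 have cells2: "(b, x) \<in> rim B A ==> b \<in> cells B \<and> x \<in> ops (sdim B b) 1" for b x using B unfolding rim_def by auto
 have nat: "k ((b, x), y) \<in> cells K \<and> sdim K (k ((b, x), y)) = sdim B b \<and>
   (\<forall>m. \<forall>th\<in>ops m (sdim B b). k ((opr B th b, x \<odot> th), y \<odot> th) = opr K th (k ((b, x), y)))"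
  if bx: "(b, x) \<in> rim B A" and y: "y \<in> ops (sdim B b) 1" for b x y
 proof -
  have b: "b \<in> cells B" "x \<in> ops (sdim B b) 1" using cells2 bx by auto
  consider "b \<in> A" | "b \<notin> A" "x = cst 0 (sdim B b)" | "b \<notin> A" "x = cst 1 (sdim B b)"
   using bx unfolding rim_def by auto
  thus ?thesis
  proof cases
   case 1
   thus ?thesis using a[of b x y] b y A unfolding k_def by (auto dest: subc_opr)
  next
   case 2
   have "k ((opr B th b, x \<odot> th), y \<odot> th) = opr K th (k ((b, x), y))" if "th \<in> ops m (sdim B b)" for m th
    using 2 k0[of "opr B th b" "y \<odot> th"] k0[OF b(1) y] smap_cyl(3)[OF l B b(1) y that] sset_opr[OF B b(1) that]
     pull_ops[OF y that] cst_pull[OF that] by simp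
   thus ?thesis using 2 k0[OF b(1) y] smap_cyl[OF l B b(1) y] by simp
  next
   case 3
   have "k ((opr B th b, x \<odot> th), y \<odot> th) = opr K th (k ((b, x), y))" if "th \<in> ops m (sdim B b)" for m th
    using 3 k1[of "opr B th b" "y \<odot> th"] k1[OF b(1) y] smap_cyl(3)[OF r B b(1) y that] sset_opr[OF B b(1) that]
     pull_ops[OF y that] cst_pull[OF that] by simp
   thus ?thesis using 3 k1[OF b(1) y] smap_cyl[OF r B b(1) y] by simp
  qed
 qed
 have kk: "smap_on {(z, y) \<in> cells (sprod (sprod B I1) I1). z \<in> rim B A} (sprod (sprod B I1) I1) K k"
 proof (rule smap_on_cylI[OF is_sset_cyl[OF B] subc_rim[OF B A]])
  fix z y assume "z \<in> rim B A" "y \<in> ops (sdim (sprod B I1) z) 1"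
  thus "k (z, y) \<in> cells K \<and> sdim K (k (z, y)) = sdim (sprod B I1) z" using nat by (cases z) auto
 next
  fix z y m th assume "z \<in> rim B A" "y \<in> ops (sdim (sprod B I1) z) 1" "th \<in> ops m (sdim (sprod B I1) z)"
  thus "k (opr (sprod B I1) th z, y \<odot> th) = opr K th (k (z, y))" using nat by (cases z) auto
 qed
 have kf: "k (z, cst 0 (sdim (sprod B I1) z)) = f z" if "z \<in> rim B A" for z
 proof -
  obtain b x where z: "z = (b, x)" by (cases z)
  have b: "b \<in> cells B" "x \<in> ops (sdim B b) 1" using cells2 that z by auto
  show ?thesis
  proof (cases "b \<in> A")
   case True thus ?thesis using fa b z unfolding k_def by simp
  next
   case False
   hence "x = cst 0 (sdim B b) \<or> x = cst 1 (sdim B b)" using that z unfolding rim_def by auto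
   thus ?thesis using fl[OF b(1)] fr[OF b(1)] False z unfolding k_def by auto
  qed
 qed
 obtain H where H: "smap (sprod (sprod B I1) I1) K H"
  "!!z. z \<in> cells (sprod B I1) ==> H (z, cst 0 (sdim (sprod B I1) z)) = f z"
  "!!z t. z \<in> rim B A ==> t \<in> ops (sdim (sprod B I1) z) 1 ==> H (z, t) = k (z, t)"
  using hep_pair[OF K is_sset_cyl[OF B] subc_rim[OF B A] f kk kf] by blast
 show thesis
 proof (rule that[OF H(1)])
  fix b x assume "b \<in> cells B" "x \<in> ops (sdim B b) 1"
  thus "H ((b, x), cst 0 (sdim B b)) = f (b, x)" using H(2)[of "(b, x)"] B by simp
 next
  fix b y assume b: "b \<in> cells B" "y \<in> ops (sdim B b) 1"
  thus "H ((b, cst 0 (sdim B b)), y) = l (b, y)" "H ((b, cst 1 (sdim B b)), y) = r (b, y)"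
   using H(3)[of "(b, cst 0 (sdim B b))" y] H(3)[of "(b, cst 1 (sdim B b))" y] B k0[OF b] k1[OF b]
   unfolding rim_def by auto
 next
  fix b x y assume b: "b \<in> A" "x \<in> ops (sdim B b) 1" "y \<in> ops (sdim B b) 1"
  thus "H ((b, x), y) = a b x y" using H(3)[of "(b, x)" y] B AB unfolding rim_def k_def by auto
 qed
qed

definition hrel :: "'b sset => 'b set => 'a sset => ('b => 'a) => ('b => 'a) => bool" where
 "hrel B A K f g \<longleftrightarrow> (\<exists>h. smap (sprod B I1) K h \<and>
   (\<forall>b\<in>cells B. h (b, cst 0 (sdim B b)) = f b \<and> h (b, cst 1 (sdim B b)) = g b) \<and>
   (\<forall>b\<in>A. \<forall>t\<in>ops (sdim B b) 1. h (b, t) = f b))"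

lemma smap_end:
 assumes "smap (sprod B I1) K h" "is_sset B" "i \<le> 1"
 shows "smap B K (\<lambda>b. h (b, cst i (sdim B b)))"
proof (rule smapI)
 fix x m th assume "x \<in> cells B" "th \<in> ops m (sdim B x)"
 thus "h (opr B th x, cst i (sdim B (opr B th x))) = opr K th (h (x, cst i (sdim B x)))"
  using smap_cyl(3)[OF assms(1,2), of x "cst i (sdim B x)" th m] assms sset_opr[of B x th m] by (simp add: cst_pull)
qed (use assms smap_cyl[OF assms(1,2)] in auto)

lemma smap_cong:
 assumes "smap B K f" "is_sset B" "!!b. b \<in> cells B ==> f b = g b"
 shows "smap B K g"
proof (rule smapI)
 fix x assume "x \<in> cells B"
 thus "g x \<in> cells K \<and> sdim K (g x) = sdim B x" using smapD[OF assms(1)] assms(3) by metis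
next
 fix x m th assume x: "x \<in> cells B" "th \<in> ops m (sdim B x)"
 thus "g (opr B th x) = opr K th (g x)"
  using smapD(3)[OF assms(1) x] assms(3)[OF x(1)] assms(3)[OF sset_opr(1)[OF assms(2) x]] by simp
qed

lemma hrelD:
 assumes "hrel B A K f g" "is_sset B" "subc B A"
 shows "smap B K f" "smap B K g" "b \<in> A ==> f b = g b"
proof -
 obtain h where h: "smap (sprod B I1) K h"
   "\<forall>b\<in>cells B. h (b, cst 0 (sdim B b)) = f b \<and> h (b, cst 1 (sdim B b)) = g b"
   "\<forall>b\<in>A. \<forall>t\<in>ops (sdim B b) 1. h (b, t) = f b" using assms(1) unfolding hrel_def by blast
 show "smap B K f" by (rule smap_cong[OF smap_end[OF h(1) assms(2), of 0] assms(2)]) (use h in auto)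
 show "smap B K g" by (rule smap_cong[OF smap_end[OF h(1) assms(2), of 1] assms(2)]) (use h in auto)
 show "f b = g b" if "b \<in> A" using h(2,3) that subc_sub[OF assms(3) that] by (metis cst_ops order_refl)
qed

text \<open>Take a box with constant bottom and sides \<open>h\<close> and \<open>h'\<close>; its
  top edge joins the two ends. The homotopies may move on \<open>A\<close> as long as they move
  there in the same way, and then the result is stationary on \<open>A\<close>.\<close>

lemma hrel_end:
 assumes K: "prism K" and B: "is_sset B" and A: "subc B A"
  and h: "smap (sprod B I1) K h" and h': "smap (sprod B I1) K h'"
  and eA: "!!b t. b \<in> A ==> t \<in> ops (sdim B b) 1 ==> h (b, t) = h' (b, t)"
  and e0: "!!b. b \<in> cells B ==> h (b, cst 0 (sdim B b)) = h' (b, cst 0 (sdim B b))"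
 shows "hrel B A K (\<lambda>b. h (b, cst 1 (sdim B b))) (\<lambda>b. h' (b, cst 1 (sdim B b)))"
proof -
 note hh = smap_cyl[OF h B]
 have AB: "b \<in> cells B" if "b \<in> A" for b using that A by (rule subc_sub[rotated])
 have f: "smap (sprod B I1) K (\<lambda>(b, x). h (b, cst 0 (sdim B b)))"
  using smapD[OF smap_end[OF h B, of 0]] by (intro smap_cylI[OF B]) auto
 obtain H where H: "smap (sprod (sprod B I1) I1) K H"
  "!!b x. b \<in> cells B ==> x \<in> ops (sdim B b) 1 ==> H ((b, x), cst 0 (sdim B b)) = h (b, cst 0 (sdim B b))"
  "!!b y. b \<in> cells B ==> y \<in> ops (sdim B b) 1 ==> H ((b, cst 0 (sdim B b)), y) = h (b, y)"
  "!!b y. b \<in> cells B ==> y \<in> ops (sdim B b) 1 ==> H ((b, cst 1 (sdim B b)), y) = h' (b, y)"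
  "!!b x y. b \<in> A ==> x \<in> ops (sdim B b) 1 ==> y \<in> ops (sdim B b) 1 ==> H ((b, x), y) = h (b, y)"
  by (rule box[OF K B A f h h', of "\<lambda>b x y. h (b, y)"]) (use hh smap_cyl[OF h' B] AB eA e0 in auto)
 have "smap (sprod B I1) K (\<lambda>z. H (z, cst 1 (sdim (sprod B I1) z)))"
  using smap_end[OF H(1) is_sset_cyl[OF B], of 1] by simp
 thus ?thesis unfolding hrel_def
  by (intro exI[of _ "\<lambda>z. H (z, cst 1 (sdim (sprod B I1) z))"]) (use H in auto)
qed

lemma hrel_refl: "smap B K f ==> is_sset B ==> hrel B A K f f"
 unfolding hrel_def
 by (intro exI[of _ "\<lambda>(b, t). f b"] conjI smap_cylI) (auto dest: smapD)

lemma hrel_cong: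
 assumes "hrel B A K f g" "A \<subseteq> cells B" "!!b. b \<in> cells B ==> f b = f' b" "!!b. b \<in> cells B ==> g b = g' b"
 shows "hrel B A K f' g'"
proof -
 obtain h where h: "smap (sprod B I1) K h"
   "\<forall>b\<in>cells B. h (b, cst 0 (sdim B b)) = f b \<and> h (b, cst 1 (sdim B b)) = g b"
   "\<forall>b\<in>A. \<forall>t\<in>ops (sdim B b) 1. h (b, t) = f b" using assms(1) unfolding hrel_def by blast
 show ?thesis unfolding hrel_def using h assms(2-4) by (intro exI[of _ h]) (auto simp: subset_iff)
qed

lemma hrel_common:
 assumes K: "prism K" and B: "is_sset B" and A: "subc B A" and "hrel B A K f g" "hrel B A K f g'"
 shows "hrel B A K g g'"
proof -
 have AB: "b \<in> cells B" if "b \<in> A" for b using that A by (rule subc_sub[rotated])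
 obtain h where h: "smap (sprod B I1) K h"
   "\<forall>b\<in>cells B. h (b, cst 0 (sdim B b)) = f b \<and> h (b, cst 1 (sdim B b)) = g b"
   "\<forall>b\<in>A. \<forall>t\<in>ops (sdim B b) 1. h (b, t) = f b" using assms(4) unfolding hrel_def by blast
 obtain h' where h': "smap (sprod B I1) K h'"
   "\<forall>b\<in>cells B. h' (b, cst 0 (sdim B b)) = f b \<and> h' (b, cst 1 (sdim B b)) = g' b"
   "\<forall>b\<in>A. \<forall>t\<in>ops (sdim B b) 1. h' (b, t) = f b" using assms(5) unfolding hrel_def by blast
 have "hrel B A K (\<lambda>b. h (b, cst 1 (sdim B b))) (\<lambda>b. h' (b, cst 1 (sdim B b)))"
  using hrel_end[OF K B A h(1) h'(1)] h h' by simp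
 thus ?thesis by (rule hrel_cong) (use AB h h' in auto)
qed

lemma hrel_sym:
 assumes "prism K" "is_sset B" "subc B A" "hrel B A K f g"
 shows "hrel B A K g f"
 using hrel_common[OF assms hrel_refl[OF hrelD(1)[OF assms(4,2,3)] assms(2)]] .

lemma hrel_trans:
 assumes "prism K" "is_sset B" "subc B A" "hrel B A K f g" "hrel B A K g h"
 shows "hrel B A K f h"
 using hrel_common[OF assms(1-3) hrel_sym[OF assms(1-4)] assms(5)] .

lemma hrel_pre:
 assumes "hrel B A K f g" "smap C B u" "is_sset B" "is_sset C" "A' \<subseteq> cells C" "u ` A' \<subseteq> A"
 shows "hrel C A' K (\<lambda>c. f (u c)) (\<lambda>c. g (u c))"
proof -
 obtain h where h: "smap (sprod B I1) K h"
   "\<forall>b\<in>cells B. h (b, cst 0 (sdim B b)) = f b \<and> h (b, cst 1 (sdim B b)) = g b"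
   "\<forall>b\<in>A. \<forall>t\<in>ops (sdim B b) 1. h (b, t) = f b" using assms(1) unfolding hrel_def by blast
 have "smap (sprod C I1) K (\<lambda>(c, t). h (u c, t))"
  using smapD[OF assms(2)] smap_cyl[OF h(1) assms(3)] by (intro smap_cylI[OF assms(4)]) auto
 moreover have "h (u c, cst 0 (sdim C c)) = f (u c) \<and> h (u c, cst 1 (sdim C c)) = g (u c)" if "c \<in> cells C" for c
  using h(2) smapD(1,2)[OF assms(2) that] by metis
 ultimately show ?thesis unfolding hrel_def using h(3) smapD(2)[OF assms(2)] assms(5,6)
  by (intro exI[of _ "\<lambda>(c, t). h (u c, t)"]) (auto simp: subset_iff image_subset_iff)
qed

lemma is_sset_sub: "is_sset B ==> subc B A ==> is_sset (B\<lparr>cells := A\<rparr>)"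
 by (rule is_ssetI) (auto dest: subc_opr subc_sub simp: sset_opr sset_id sset_comp)

text \<open>
 Reversing the homotopies, compatibly on \<open>A\<close>, reduces homotopies with a common end to homotopies
 with a common start.
\<close>

lemma hrel_start:
 assumes K: "prism K" and B: "is_sset B" and A: "subc B A"
  and h: "smap (sprod B I1) K h" and h': "smap (sprod B I1) K h'"
  and eA: "!!b t. b \<in> A ==> t \<in> ops (sdim B b) 1 ==> h (b, t) = h' (b, t)"
  and e1: "!!b. b \<in> cells B ==> h (b, cst 1 (sdim B b)) = h' (b, cst 1 (sdim B b))"
 shows "hrel B A K (\<lambda>b. h (b, cst 0 (sdim B b))) (\<lambda>b. h' (b, cst 0 (sdim B b)))"
proof -
 have AB: "b \<in> cells B" if "b \<in> A" for b using that A by (rule subc_sub[rotated])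
 let ?S = "B\<lparr>cells := A\<rparr>"
 have S: "is_sset ?S" by (rule is_sset_sub[OF B A])
 have hS: "smap (sprod ?S I1) K h"
  using smap_cyl[OF h B] AB by (intro smap_cylI[OF S]) auto
 have cS: "smap (sprod ?S I1) K (\<lambda>(b, x). h (b, cst 0 (sdim B b)))"
  using smapD[OF smap_end[OF h B, of 0]] AB by (intro smap_cylI[OF S]) auto
 \<comment> \<open>A reversal is not unique, so one is fixed over \<open>A\<close> beforehand: the
   top edge of \<open>D\<close> is the reverse of \<open>h\<close> there. Both \<open>h\<close> and
   \<open>h'\<close> are then reversed over \<open>B\<close> extending this same
   \<open>D\<close>.\<close>
 obtain D where D: "smap (sprod (sprod ?S I1) I1) K D"
  "!!b x. b \<in> A ==> x \<in> ops (sdim B b) 1 ==> D ((b, x), cst 0 (sdim B b)) = h (b, cst 0 (sdim B b))"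
  "!!b y. b \<in> A ==> y \<in> ops (sdim B b) 1 ==> D ((b, cst 0 (sdim B b)), y) = h (b, y)"
  "!!b y. b \<in> A ==> y \<in> ops (sdim B b) 1 ==> D ((b, cst 1 (sdim B b)), y) = h (b, cst 0 (sdim B b))"
  by (rule box[OF K S _ cS hS cS, of "{}" undefined]) (auto simp: subc_def)
 have Dc: "D ((b, x), y) \<in> cells K \<and> sdim K (D ((b, x), y)) = sdim B b"
  "th \<in> ops m (sdim B b) ==> D ((opr B th b, x \<odot> th), y \<odot> th) = opr K th (D ((b, x), y))"
  if "b \<in> A" "x \<in> ops (sdim B b) 1" "y \<in> ops (sdim B b) 1" for b x y m th
  using smap_cyl[OF D(1) is_sset_cyl[OF S], of "(b, x)" y] that S by auto
 have rev: "\<exists>H. smap (sprod B I1) K H \<and> (\<forall>b\<in>cells B. H (b, cst 0 (sdim B b)) = k (b, cst 1 (sdim B b)) \<and>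
    H (b, cst 1 (sdim B b)) = k (b, cst 0 (sdim B b))) \<and> (\<forall>b\<in>A. \<forall>x\<in>ops (sdim B b) 1. H (b, x) = D ((b, x), cst 1 (sdim B b)))"
  if k: "smap (sprod B I1) K k" and kA: "!!b t. b \<in> A ==> t \<in> ops (sdim B b) 1 ==> k (b, t) = h (b, t)" for k
 proof -
  have c: "smap (sprod B I1) K (\<lambda>(b, x). k (b, cst 0 (sdim B b)))"
   using smapD[OF smap_end[OF k B, of 0]] by (intro smap_cylI[OF B]) auto
  obtain H where H: "smap (sprod (sprod B I1) I1) K H"
   "!!b x. b \<in> cells B ==> x \<in> ops (sdim B b) 1 ==> H ((b, x), cst 0 (sdim B b)) = k (b, cst 0 (sdim B b))"
   "!!b y. b \<in> cells B ==> y \<in> ops (sdim B b) 1 ==> H ((b, cst 0 (sdim B b)), y) = k (b, y)"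
   "!!b y. b \<in> cells B ==> y \<in> ops (sdim B b) 1 ==> H ((b, cst 1 (sdim B b)), y) = k (b, cst 0 (sdim B b))"
   "!!b x y. b \<in> A ==> x \<in> ops (sdim B b) 1 ==> y \<in> ops (sdim B b) 1 ==> H ((b, x), y) = D ((b, x), y)"
   by (rule box[OF K B A c k c, of "\<lambda>b x y. D ((b, x), y)"]) (use Dc D kA in auto)
  have "smap (sprod B I1) K (\<lambda>z. H (z, cst 1 (sdim (sprod B I1) z)))"
   using smap_end[OF H(1) is_sset_cyl[OF B], of 1] by simp
  thus ?thesis
   by (intro exI[of _ "\<lambda>z. H (z, cst 1 (sdim (sprod B I1) z))"]) (use H in auto)
 qed
 obtain H where H: "smap (sprod B I1) K H" "!!b. b \<in> cells B ==> H (b, cst 0 (sdim B b)) = h (b, cst 1 (sdim B b))"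
   "!!b. b \<in> cells B ==> H (b, cst 1 (sdim B b)) = h (b, cst 0 (sdim B b))"
   "!!b x. b \<in> A ==> x \<in> ops (sdim B b) 1 ==> H (b, x) = D ((b, x), cst 1 (sdim B b))"
  using rev[OF h] by blast
 obtain H' where H': "smap (sprod B I1) K H'" "!!b. b \<in> cells B ==> H' (b, cst 0 (sdim B b)) = h' (b, cst 1 (sdim B b))"
   "!!b. b \<in> cells B ==> H' (b, cst 1 (sdim B b)) = h' (b, cst 0 (sdim B b))"
   "!!b x. b \<in> A ==> x \<in> ops (sdim B b) 1 ==> H' (b, x) = D ((b, x), cst 1 (sdim B b))"
  using rev[OF h'] eA by metis
 have "hrel B A K (\<lambda>b. H (b, cst 1 (sdim B b))) (\<lambda>b. H' (b, cst 1 (sdim B b)))"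
  by (rule hrel_end[OF K B A H(1) H'(1)]) (use H H' e1 in auto)
 thus ?thesis by (rule hrel_cong) (use AB H H' in auto)
qed

lemma homotopic_iff:
 assumes "is_sset X"
 shows "homotopic X Y f g \<longleftrightarrow> hrel X {} Y f g"
proof -
 have "subc X {}" by (simp add: subc_def)
 thus ?thesis
  unfolding homotopic_def using hrelD(1,2)[of X "{}" Y f g] assms unfolding hrel_def simp_def by auto
qed

section \<open>Relative lifting along homotopy equivalences\<close>

text \<open>A homotopy \<open>alpha\<close> from \<open>e\<close> to the identity gives a path from
  \<open>g b\<close> to \<open>phi b\<close> for \<open>b\<close> in \<open>A\<close>. Extending it
  to a homotopy starting at \<open>g\<close> and taking its end gives \<open>s\<close>. Now
  \<open>e (s b)\<close> and \<open>g b\<close> are both joined to \<open>s b\<close> by homotopies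
  that agree on \<open>A\<close>, so \<open>hrel_start\<close> applies.\<close>

lemma lift_homotopic_id:
 assumes K: "prism K" and e: "homotopic K K e id"
  and B: "is_sset B" and A: "subc B A" and g: "smap B K g" and phi: "smap_on A B K phi"
  and eg: "!!b. b \<in> A ==> e (phi b) = g b"
 obtains s where "smap B K s" "!!b. b \<in> A ==> s b = phi b" "hrel B A K (\<lambda>b. e (s b)) g"
proof -
 have KS: "is_sset K" using K unfolding prism_def by blast
 have AB: "b \<in> cells B" if "b \<in> A" for b using that A by (rule subc_sub[rotated])
 obtain alpha where alpha: "smap (sprod K I1) K alpha" "!!k n. k \<in> cells K ==> sdim K k = n ==> alpha (k, cst 0 n) = e k"
  "!!k n. k \<in> cells K ==> sdim K k = n ==> alpha (k, cst 1 n) = k"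
  using e unfolding homotopic_iff[OF KS] hrel_def by auto
 have a: "smap_on {(b, t) \<in> cells (sprod B I1). b \<in> A} (sprod B I1) K (\<lambda>(b, t). alpha (phi b, t))"
  using smap_cyl[OF alpha(1) KS] smap_onD[OF phi] by (intro smap_on_cylI[OF B A]) auto
 obtain S where S: "smap (sprod B I1) K S" "!!b. b \<in> cells B ==> S (b, cst 0 (sdim B b)) = g b"
  "!!b t. b \<in> A ==> t \<in> ops (sdim B b) 1 ==> S (b, t) = alpha (phi b, t)"
  by (rule hep_pair[OF K B A g a]) (use alpha(2) smap_onD[OF phi] eg in auto)
 define s where "s b = S (b, cst 1 (sdim B b))" for b
 have s: "smap B K s" unfolding s_def using smap_end[OF S(1) B, of 1] by simp
 have sA: "s b = phi b" if "b \<in> A" for b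
  using S(3)[OF that, of "cst 1 (sdim B b)"] alpha(3)[of "phi b" "sdim B b"] smap_onD[OF phi that] unfolding s_def by simp
 have alphas: "smap (sprod B I1) K (\<lambda>(b, t). alpha (s b, t))"
  using smap_cyl[OF alpha(1) KS] smapD[OF s] by (intro smap_cylI[OF B]) auto
 have "hrel B A K (\<lambda>b. (\<lambda>(b, t). alpha (s b, t)) (b, cst 0 (sdim B b))) (\<lambda>b. S (b, cst 0 (sdim B b)))"
  by (rule hrel_start[OF K B A alphas S(1)]) (use sA S(3) alpha(3) smapD[OF s] s_def in auto)
 hence "hrel B A K (\<lambda>b. e (s b)) g"
  by (rule hrel_cong) (use AB S(2) alpha(2) smapD[OF s] in auto)
 thus thesis using that[OF s sA] by blast
qed

text \<open>With \<open>r\<close> a homotopy inverse, lifting along \<open>r \<circ> w\<close>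
  yields \<open>s\<close> with \<open>w (s b)\<close> and \<open>g b\<close> homotopic after
  applying \<open>r\<close>. To remove \<open>r\<close>, that homotopy is itself lifted along
  \<open>w \<circ> r\<close>, over the cylinder and relative to its rim.\<close>

lemma lift_homotopy_equiv:
 assumes K: "prism K" and L: "prism L" and w: "homotopy_equiv K L w"
  and B: "is_sset B" and A: "subc B A" and g: "smap B L g" and phi: "smap_on A B K phi"
  and wg: "!!b. b \<in> A ==> w (phi b) = g b"
 obtains s where "smap B K s" "!!b. b \<in> A ==> s b = phi b" "hrel B A L (\<lambda>b. w (s b)) g"
proof -
 have AB: "b \<in> cells B" if "b \<in> A" for b using that A by (rule subc_sub[rotated])
 obtain r where ws: "smap K L w" and r: "smap L K r" "homotopic K K (r \<circ> w) id" "homotopic L L (w \<circ> r) id"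
  using w unfolding homotopy_equiv_def by blast
 obtain s where s: "smap B K s" "!!b. b \<in> A ==> s b = phi b" "hrel B A K (\<lambda>b. (r \<circ> w) (s b)) (\<lambda>b. r (g b))"
  by (rule lift_homotopic_id[OF K r(2) B A smap_comp[OF g r(1)] phi]) (use wg in auto)
 obtain k where k: "smap (sprod B I1) K k"
  "!!b. b \<in> cells B ==> k (b, cst 0 (sdim B b)) = r (w (s b)) \<and> k (b, cst 1 (sdim B b)) = r (g b)"
  "!!b t. b \<in> A ==> t \<in> ops (sdim B b) 1 ==> k (b, t) = r (w (s b))"
  using s(3) unfolding hrel_def comp_def by blast
 \<comment> \<open>The prescribed boundary of the homotopy sought: \<open>g\<close> at the final
   end, \<open>w (s b)\<close> on the rest of the rim. Over \<open>A\<close> the two agree.\<close>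
 define psi where "psi = (\<lambda>(b, t). if t = cst 1 (sdim B b) then g b else w (s b))"
 have psiA: "psi (b, t) = g b" "g b = w (s b)" if "b \<in> A" for b t
  using that wg s(2) unfolding psi_def by auto
 have wss: "smap B L (\<lambda>b. w (s b))" by (rule smap_comp[OF s(1) ws])
 have "smap_on (rim B A) (sprod B I1) L psi"
 proof (rule smap_onI)
  fix z assume "z \<in> rim B A"
  thus "psi z \<in> cells L \<and> sdim L (psi z) = sdim (sprod B I1) z"
   using smapD[OF g] smapD[OF wss] B unfolding rim_def psi_def by auto
 next
  fix z m th assume z: "z \<in> rim B A" and th: "th \<in> ops m (sdim (sprod B I1) z)"
  obtain b t where zz: "z = (b, t)" by (cases z)
  have b: "b \<in> cells B" "t \<in> ops (sdim B b) 1" and th': "th \<in> ops m (sdim B b)" using z zz B th unfolding rim_def by auto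
  consider "b \<in> A" | "t = cst 0 (sdim B b)" | "t = cst 1 (sdim B b)" using z zz unfolding rim_def by auto
  thus "psi (opr (sprod B I1) th z) = opr L th (psi z)"
  proof cases
   case 1
   thus ?thesis using psiA[of b] psiA[of "opr B th b"] zz subc_opr[OF A 1 th'] smapD(3)[OF g b(1) th'] by simp
  next
   case 2
   thus ?thesis using zz smapD(3)[OF wss b(1) th'] sset_opr[OF B b(1) th'] unfolding psi_def by (simp add: cst_pull[OF th'])
  next
   case 3
   thus ?thesis using zz smapD(3)[OF g b(1) th'] sset_opr[OF B b(1) th'] unfolding psi_def by (simp add: cst_pull[OF th'])
  qed
 qed
 moreover have "(w \<circ> r) (psi z) = w (k z)" if "z \<in> rim B A" for z
  using that k(2,3) psiA B AB unfolding rim_def by (auto simp: psi_def)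
 ultimately obtain s' where s': "smap (sprod B I1) L s'" "!!z. z \<in> rim B A ==> s' z = psi z"
  using lift_homotopic_id[OF L r(3) is_sset_cyl[OF B] subc_rim[OF B A] smap_comp[OF k(1) ws], of psi] by metis
 have "hrel B A L (\<lambda>b. w (s b)) g" unfolding hrel_def
  using s' AB B psiA by (intro exI[of _ s']) (auto simp: rim_def psi_def)
 thus thesis using that[OF s(1,2)] by blast
qed

section \<open>Loops and cylinders\<close>

text \<open>The quotient map from the 1-simplex to the circle.\<close>

definition cl :: "nat list => nat list" where
 "cl c = (if 0 \<in> set c then c else map (\<lambda>_. 0) c)"

lemma cl_id: "0 \<in> set c ==> cl c = c"
 by (simp add: cl_def)

lemma cl_cst [simp]: "cl (cst i n) = cst 0 n"
 by (auto simp: cl_def map_replicate_const)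

lemma cl_ops: "c \<in> ops m 1 ==> cl c \<in> ops m 1"
 using cst1_iff[of c m] by (cases "0 \<in> set c") (auto simp: cl_id)

lemma zero_in_cl: "c \<in> ops m 1 ==> 0 \<in> set (cl c)"
 using cst1_iff[of c m] by (cases "0 \<in> set c") (auto simp: cl_id)

lemma cl_pull: "c \<in> ops m 1 ==> th \<in> ops l m ==> cl (cl c \<odot> th) = cl (c \<odot> th)"
 using cst1_iff[of c m] by (cases "0 \<in> set c") (auto simp: cl_id cst_pull)

lemma cl_cases: "c \<in> ops m 1 ==> cl c = c \<or> c = cst 1 m"
 using cst1_iff[of c m] by (auto simp: cl_id)

lemma cells_circle: "c \<in> cells circle \<longleftrightarrow> (\<exists>m. c \<in> ops m 1) \<and> 0 \<in> set c"
 by (simp add: circle_def cells_std_simplex)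

lemma sdim_circle [simp]: "sdim circle c = length c - 1"
 by (simp add: circle_def)

lemma opr_circle [simp]: "opr circle th c = cl (c \<odot> th)"
 by (simp add: circle_def cl_def Let_def)

lemma length_ops: "c \<in> ops m n ==> length c - 1 = m"
 by (simp add: ops_length)

lemma simp_circle: "c \<in> simp circle m \<longleftrightarrow> c \<in> ops m 1 \<and> 0 \<in> set c"
 unfolding simp_def by (auto simp: cells_circle length_ops)

lemma cells_sprod_circle:
 "(c, psi) \<in> cells (sprod circle (std_simplex k)) \<longleftrightarrow> (\<exists>m. c \<in> ops m 1 \<and> 0 \<in> set c \<and> psi \<in> ops m k)"
 unfolding cells_sprod cells_circle cells_std_simplex sdim_circle sdim_std_simplex by (metis length_ops)

lemma circle_base_cst [simp]: "circle_base n = cst 0 n"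
 by (simp add: circle_base_def)

definition basepoint :: "'a sset => (nat => 'a) => bool" where
 "basepoint K beta \<longleftrightarrow> (\<forall>k. beta k \<in> cells K \<and> sdim K (beta k) = k) \<and> (\<forall>l k. \<forall>th\<in>ops l k. opr K th (beta k) = beta l)"

lemma basepointD:
 assumes "basepoint K beta"
 shows "beta k \<in> cells K" "sdim K (beta k) = k" "th \<in> ops l k ==> opr K th (beta k) = beta l"
 using assms unfolding basepoint_def by auto

lemma cells_loops:
 "(k, phi) \<in> cells (loops K beta) \<longleftrightarrow> phi \<in> extensional (cells (sprod circle (std_simplex k))) \<and>
   (\<forall>m. \<forall>c\<in>ops m 1. 0 \<in> set c --> (\<forall>psi\<in>ops m k. phi (c, psi) \<in> cells K \<and> sdim K (phi (c, psi)) = m \<and>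
    (\<forall>l. \<forall>th\<in>ops l m. phi (cl (c \<odot> th), psi \<odot> th) = opr K th (phi (c, psi))))) \<and>
   (\<forall>j. \<forall>th\<in>ops j k. phi (cst 0 j, th) = beta j)"
proof -
 have "smap (sprod circle (std_simplex k)) K phi \<longleftrightarrow>
   (\<forall>m. \<forall>c\<in>ops m 1. 0 \<in> set c --> (\<forall>psi\<in>ops m k. phi (c, psi) \<in> cells K \<and> sdim K (phi (c, psi)) = m \<and>
    (\<forall>l. \<forall>th\<in>ops l m. phi (cl (c \<odot> th), psi \<odot> th) = opr K th (phi (c, psi)))))" (is "?L \<longleftrightarrow> ?R")
 proof
  assume L: ?L
  show ?R
  proof (intro allI ballI impI)
   fix m c psi assume "c \<in> ops m 1" "0 \<in> set c" "psi \<in> ops m k"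
   hence "(c, psi) \<in> cells (sprod circle (std_simplex k))" "length c - 1 = m"
    using cells_sprod_circle length_ops by blast+
   thus "phi (c, psi) \<in> cells K \<and> sdim K (phi (c, psi)) = m \<and>
    (\<forall>l. \<forall>th\<in>ops l m. phi (cl (c \<odot> th), psi \<odot> th) = opr K th (phi (c, psi)))"
    using smapD[OF L, of "(c, psi)"] by auto
  qed
 next
  assume R: ?R
  show ?L
  proof (rule smapI)
   fix x assume "x \<in> cells (sprod circle (std_simplex k))"
   thus "phi x \<in> cells K \<and> sdim K (phi x) = sdim (sprod circle (std_simplex k)) x"
    using R by (cases x) (auto simp: cells_sprod_circle length_ops)
  next
   fix x m th assume "x \<in> cells (sprod circle (std_simplex k))" "th \<in> ops m (sdim (sprod circle (std_simplex k)) x)"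
   thus "phi (opr (sprod circle (std_simplex k)) th x) = opr K th (phi x)"
    using R by (cases x) (auto simp: cells_sprod_circle length_ops)
  qed
 qed
 thus ?thesis by (simp add: loops_def)
qed

lemma sdim_loops [simp]: "sdim (loops K beta) = fst"
 by (simp add: loops_def)

lemma opr_loops:
 "opr (loops K beta) th (k, phi) = (length th - 1,
   \<lambda>z\<in>cells (sprod circle (std_simplex (length th - 1))). phi (fst z, th \<odot> snd z))"
 by (simp add: loops_def case_prod_beta')

lemma is_sset_loops: "is_sset (loops K beta)"
proof (rule is_ssetI)
 fix m th x assume x: "x \<in> cells (loops K beta)" and th: "th \<in> ops m (sdim (loops K beta) x)"
 obtain k phi where xx: "x = (k, phi)" by (cases x)
 have thk: "th \<in> ops m k" using th xx by simp
 have P: "psi \<in> ops j m ==> th \<odot> psi \<in> ops j k" for j psi using pull_ops[OF thk] .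
 have mem: "(c, psi) \<in> cells (sprod circle (std_simplex m))" if "c \<in> ops j 1" "0 \<in> set c" "psi \<in> ops j m" for c j psi
  using that cells_sprod_circle by blast
 have c0: "(cl (c \<odot> chi), psi \<odot> chi) \<in> cells (sprod circle (std_simplex m))"
  if "c \<in> ops j 1" "0 \<in> set c" "psi \<in> ops j m" "chi \<in> ops l j" for c j psi l chi
  using that mem cl_ops zero_in_cl pull_ops by metis
 have "opr (loops K beta) th x = (m, \<lambda>z\<in>cells (sprod circle (std_simplex m)). phi (fst z, th \<odot> snd z))"
  by (simp add: xx opr_loops length_ops[OF thk])
 moreover have "(m, \<lambda>z\<in>cells (sprod circle (std_simplex m)). phi (fst z, th \<odot> snd z)) \<in> cells (loops K beta)"
  unfolding cells_loops
 proof (intro conjI allI ballI impI)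
  note L = x[unfolded xx cells_loops]
  fix j c psi assume a: "c \<in> ops j 1" "0 \<in> set c" "psi \<in> ops j m"
  let ?phi = "\<lambda>z\<in>cells (sprod circle (std_simplex m)). phi (fst z, th \<odot> snd z)"
  have v: "?phi (c, psi) = phi (c, th \<odot> psi)" using mem[OF a] by simp
  show "?phi (c, psi) \<in> cells K" "sdim K (?phi (c, psi)) = j" using L a P[OF a(3)] v by auto
  fix l chi assume chi: "chi \<in> ops l j"
  have "?phi (cl (c \<odot> chi), psi \<odot> chi) = phi (cl (c \<odot> chi), th \<odot> psi \<odot> chi)"
   using c0[OF a chi] pull_assoc[OF a(3) chi, of th] by simp
  thus "?phi (cl (c \<odot> chi), psi \<odot> chi) = opr K chi (?phi (c, psi))" using L a P[OF a(3)] v chi by simp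
 next
  fix j psi assume a: "psi \<in> ops j m"
  have "(cst 0 j, psi) \<in> cells (sprod circle (std_simplex m))" using mem[OF cst_ops _ a] by simp
  thus "(\<lambda>z\<in>cells (sprod circle (std_simplex m)). phi (fst z, th \<odot> snd z)) (cst 0 j, psi) = beta j"
   using x[unfolded xx cells_loops] P[OF a] by simp
 qed simp
 ultimately show "opr (loops K beta) th x \<in> cells (loops K beta) \<and> sdim (loops K beta) (opr (loops K beta) th x) = m"
  by simp
next
 fix x assume x: "x \<in> cells (loops K beta)"
 obtain k phi where xx: "x = (k, phi)" by (cases x)
 have "(\<lambda>z\<in>cells (sprod circle (std_simplex k)). phi (fst z, idl k \<odot> snd z)) = phi"
 proof (rule extensionalityI[OF restrict_extensional])
  show "phi \<in> extensional (cells (sprod circle (std_simplex k)))" using x xx cells_loops by blast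
  fix z assume "z \<in> cells (sprod circle (std_simplex k))"
  thus "(\<lambda>z\<in>cells (sprod circle (std_simplex k)). phi (fst z, idl k \<odot> snd z)) z = phi z"
   by (cases z) (auto simp: cells_sprod_circle idl_pull)
 qed
 thus "opr (loops K beta) (idl (sdim (loops K beta) x)) x = x" by (simp add: xx opr_loops)
next
 fix l m th phi' x assume x: "x \<in> cells (loops K beta)" and th: "th \<in> ops m (sdim (loops K beta) x)" and phi': "phi' \<in> ops l m"
 obtain k phi where xx: "x = (k, phi)" by (cases x)
 have thk: "th \<in> ops m k" using th xx by simp
 have *: "length th - 1 = m" "length (th \<odot> phi') - 1 = l" "length phi' - 1 = l" using length_ops thk phi' by auto
 have "(fst z, phi' \<odot> snd z) \<in> cells (sprod circle (std_simplex m)) \<and> th \<odot> phi' \<odot> snd z = th \<odot> (phi' \<odot> snd z)"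
  if "z \<in> cells (sprod circle (std_simplex l))" for z
  using that phi' pull_ops pull_assoc by (cases z) (fastforce simp: cells_sprod_circle)
 thus "opr (loops K beta) (th \<odot> phi') x = opr (loops K beta) phi' (opr (loops K beta) th x)"
  unfolding xx opr_loops * by (auto intro!: restrict_ext)
qed

text \<open>Currying: a map on the cylinder that is the base point on both ends becomes a map to the
  loop space. The simplex coordinate of the loop at \<open>b\<close> is absorbed into the operator
  applied to \<open>b\<close>.\<close>

definition lam :: "'b sset => ('b \<times> nat list => 'a) => 'b => nat \<times> (nat list \<times> nat list => 'a)" where
 "lam B G b = (sdim B b, \<lambda>z\<in>cells (sprod circle (std_simplex (sdim B b))). G (opr B (snd z) b, fst z))"

text \<open>The inverse of \<open>lam\<close>: evaluation at the identity operator recovers the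
  simplex \<open>b\<close> itself, and \<open>cl\<close> collapses the end 1 of the interval to the
  base point of the circle.\<close>

definition unlam :: "'b sset => ('b => nat \<times> (nat list \<times> nat list => 'a)) => 'b \<times> nat list => 'a" where
 "unlam B g = (\<lambda>(b, c). snd (g b) (cl c, idl (sdim B b)))"

lemma smap_lam:
 assumes B: "is_sset B" and beta: "basepoint K beta" and G: "smap (sprod B I1) K G"
  and ends: "!!b i. b \<in> cells B ==> i \<le> 1 ==> G (b, cst i (sdim B b)) = beta (sdim B b)"
 shows "smap B (loops K beta) (lam B G)"
proof (rule smapI)
 fix b assume b: "b \<in> cells B"
 let ?k = "sdim B b"
 have mem: "(c, psi) \<in> cells (sprod circle (std_simplex ?k))" if "c \<in> ops j 1" "0 \<in> set c" "psi \<in> ops j ?k" for c j psi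
  using that cells_sprod_circle by blast
 have Gcl: "G (opr B psi b, cl c) = G (opr B psi b, c)" if "c \<in> ops m 1" "psi \<in> ops m ?k" for c psi m
  using cl_cases[OF that(1)] ends[of "opr B psi b" 0] ends[of "opr B psi b" 1] sset_opr[OF B b that(2)] by auto
 have c0: "(cl (c \<odot> chi), psi \<odot> chi) \<in> cells (sprod circle (std_simplex ?k))"
  if "c \<in> ops j 1" "0 \<in> set c" "psi \<in> ops j ?k" "chi \<in> ops l j" for c j psi l chi
  using that mem cl_ops zero_in_cl pull_ops by metis
 have v1: "G (opr B psi b, c) \<in> cells K \<and> sdim K (G (opr B psi b, c)) = m"
  if "c \<in> ops m 1" "psi \<in> ops m ?k" for c m psi
  using that smap_cyl[OF G B, of "opr B psi b" c] sset_opr[OF B b that(2)] by auto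
 have v2: "G (opr B (psi \<odot> th) b, cl (c \<odot> th)) = opr K th (G (opr B psi b, c))"
  if "c \<in> ops m 1" "psi \<in> ops m ?k" "th \<in> ops l m" for c m psi th l
  using that smap_cyl(3)[OF G B, of "opr B psi b" c th l] sset_opr[OF B b that(2)]
   Gcl[OF pull_ops[OF that(1,3)] pull_ops[OF that(2,3)]] sset_comp[OF B b that(2,3)] by simp
 note v = v1 v2
 have base: "(cst 0 j, psi) \<in> cells (sprod circle (std_simplex ?k)) \<and> G (opr B psi b, cst 0 j) = beta j"
  if "psi \<in> ops j ?k" for j psi
  using mem[OF cst_ops _ that] ends[of "opr B psi b" 0] sset_opr[OF B b that] by simp
 show "lam B G b \<in> cells (loops K beta) \<and> sdim (loops K beta) (lam B G b) = sdim B b"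
  unfolding lam_def cells_loops using mem c0 v ends[of "opr B _ b" 0] sset_opr[OF B b] base
  by (auto simp: zero_in_cl)
next
 fix b m th assume b: "b \<in> cells B" and th: "th \<in> ops m (sdim B b)"
 have "G (opr B (snd z) (opr B th b), fst z) = G (opr B (th \<odot> snd z) b, fst z) \<and>
   (fst z, th \<odot> snd z) \<in> cells (sprod circle (std_simplex (sdim B b)))"
  if "z \<in> cells (sprod circle (std_simplex m))" for z
  using that pull_ops[OF th] sset_comp[OF B b th] by (cases z) (auto simp: cells_sprod_circle)
 thus "lam B G (opr B th b) = opr (loops K beta) th (lam B G b)"
  unfolding lam_def opr_loops length_ops[OF th] sset_opr(2)[OF B b th] by (auto intro!: restrict_ext)
qed

text \<open>The partial form is what transposes a prism problem in a loop space, whose data live on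
  a subcomplex only.\<close>

lemma unlam_on:
 assumes B: "is_sset B" and C: "subc B C" and g: "smap_on C B (loops K beta) g" and b: "b \<in> C" and c: "c \<in> ops (sdim B b) 1"
 shows "unlam B g (b, c) \<in> cells K" "sdim K (unlam B g (b, c)) = sdim B b"
  "th \<in> ops m (sdim B b) ==> unlam B g (opr B th b, c \<odot> th) = opr K th (unlam B g (b, c))"
  "unlam B g (b, cst i (sdim B b)) = beta (sdim B b)"
  "lam B (unlam B g) b = g b"
proof -
 let ?k = "sdim B b"
 obtain phi where phi: "g b = (?k, phi)" using smap_onD(2)[OF g b] by (cases "g b") auto
 note L = smap_onD(1)[OF g b, unfolded phi cells_loops]
 have *: "cl c \<in> ops ?k 1" "0 \<in> set (cl c)" using c by (auto simp: cl_ops zero_in_cl)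
 thus "unlam B g (b, c) \<in> cells K" "sdim K (unlam B g (b, c)) = sdim B b"
  using L idl_ops[of ?k] unfolding unlam_def by (auto simp: phi)
 have gop: "snd (g (opr B th b)) (c', idl m) = phi (c', th)"
  if th: "th \<in> ops m ?k" and c': "c' \<in> ops m 1" "0 \<in> set c'" for th m c'
 proof -
  have "(c', idl m) \<in> cells (sprod circle (std_simplex m))" using c' idl_ops cells_sprod_circle by blast
  thus ?thesis using smap_onD(3)[OF g b th] pull_idl[OF ops_length[OF th]] by (simp add: phi opr_loops length_ops[OF th])
 qed
 show "unlam B g (opr B th b, c \<odot> th) = opr K th (unlam B g (b, c))" if th: "th \<in> ops m ?k" for th m
 proof -
  have o: "c \<odot> th \<in> ops m 1" using pull_ops c th by blast
  have "unlam B g (opr B th b, c \<odot> th) = phi (cl (c \<odot> th), th)"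
   unfolding unlam_def using gop[OF th, of "cl (c \<odot> th)"] sset_opr[OF B subc_sub[OF C b] th] cl_ops[OF o] zero_in_cl[OF o] by simp
  also have "\<dots> = opr K th (phi (cl c, idl ?k))"
   using L * th idl_ops[of ?k] idl_pull[OF th] cl_pull[OF c th] by metis
  finally show ?thesis by (simp add: unlam_def phi)
 qed
 show "unlam B g (b, cst i (sdim B b)) = beta (sdim B b)"
  using L idl_ops[of ?k] by (simp add: unlam_def phi)
 show "lam B (unlam B g) b = g b"
 proof -
  have "(\<lambda>z\<in>cells (sprod circle (std_simplex ?k)). unlam B g (opr B (snd z) b, fst z)) = phi"
  proof (rule extensionalityI[OF restrict_extensional])
   show "phi \<in> extensional (cells (sprod circle (std_simplex ?k)))" using L by blast
   fix z assume z: "z \<in> cells (sprod circle (std_simplex ?k))"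
   obtain c' psi where zz: "z = (c', psi)" by (cases z)
   obtain m where m: "c' \<in> ops m 1" "0 \<in> set c'" "psi \<in> ops m ?k" using z zz cells_sprod_circle by blast
   thus "(\<lambda>z\<in>cells (sprod circle (std_simplex ?k)). unlam B g (opr B (snd z) b, fst z)) z = phi z"
    using z zz gop[OF m(3,1,2)] sset_opr[OF B subc_sub[OF C b] m(3)] by (simp add: unlam_def cl_id)
  qed
  thus ?thesis by (simp add: lam_def phi)
 qed
qed

lemma lam_cong:
 assumes "is_sset B" "b \<in> cells B"
  and "!!m psi c. psi \<in> ops m (sdim B b) ==> c \<in> ops m 1 ==> G (opr B psi b, c) = G' (opr B psi b, c)"
 shows "lam B G b = lam B G' b"
 unfolding lam_def using assms by (auto intro!: restrict_ext simp: cells_sprod_circle)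

text \<open>By adjunction, filling a prism in the loop space is homotopy extension in
  \<open>K\<close> for the cylinder of the simplex, with the loop coordinate as cylinder coordinate
  and relative to its rim. On the ends of the loop coordinate the filling is forced to be the base
  point.\<close>

lemma prism_loops:
 assumes K: "prism K" and beta: "basepoint K beta"
 shows "prism (loops K beta)"
proof -
 have "\<exists>g'. smap (sprod (std_simplex d) I1) (loops K beta) g' \<and>
    (\<forall>(th, t) \<in> cells (sprod (std_simplex d) I1). set th \<noteq> {..d} \<or> 1 \<notin> set t --> g' (th, t) = g (th, t))"
  if g: "smap_on {(th, t) \<in> cells (sprod (std_simplex d) I1). set th \<noteq> {..d} \<or> 1 \<notin> set t} (sprod (std_simplex d) I1) (loops K beta) g"
  for d g
 proof -
  let ?P = "sprod (std_simplex d) I1"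
  let ?C = "{(th, t) \<in> cells ?P. set th \<noteq> {..d} \<or> 1 \<notin> set t}"
  define A where "A = {th \<in> cells (std_simplex d). set th \<noteq> {..d}}"
  have cP: "(th, t) \<in> cells ?P \<longleftrightarrow> (\<exists>l. th \<in> ops l d \<and> t \<in> ops l 1)" for th t
   by (auto simp: cells_sprod cells_std_simplex ops_length)
  have A: "subc (std_simplex d) A" unfolding subc_def A_def
  proof (intro conjI ballI allI)
   fix x m th assume x: "x \<in> {th \<in> cells (std_simplex d). set th \<noteq> {..d}}" "th \<in> ops m (sdim (std_simplex d) x)"
   then obtain l where l: "x \<in> ops l d" by (auto simp: cells_std_simplex)
   have th: "th \<in> ops m l" using x length_ops[OF l] by simp
   have "set (x \<odot> th) \<noteq> {..d}" using set_pull[OF l th] ops_in_set_le[OF l] x by blast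
   thus "opr (std_simplex d) th x \<in> {th \<in> cells (std_simplex d). set th \<noteq> {..d}}"
    using pull_ops[OF l th] by (auto simp: cells_std_simplex)
  qed auto
  have P: "is_sset ?P" by simp
  have "?C = {(th, t) \<in> cells ?P. th \<in> A} \<union> {(th, t) \<in> cells ?P. 1 \<notin> set t}"
   unfolding A_def by (auto simp: cP cells_std_simplex)
  hence C: "subc ?P ?C" using subc_Un[OF subc_cyl[OF _ A] subc_zero] by simp
  note U = unlam_on[OF P C g]
  have Cc: "(th, t) \<in> ?C" if "((th, c), t) \<in> cells (sprod ?P I1)" "(th, c) \<in> rim (std_simplex d) A \<or> 1 \<notin> set t"
   "c \<noteq> cst 0 (length th - 1)" "c \<noteq> cst 1 (length th - 1)" for th c t
   using that unfolding rim_def A_def by auto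
  \<comment> \<open>The loop coordinate \<open>c\<close> moves inside, next to \<open>th\<close>,
    and the prism coordinate \<open>t\<close> becomes the direction of extension. The case
    distinction extends the transposed data by base points on the ends of \<open>c\<close>.\<close>
  define h where "h = (\<lambda>((th, c), t). if c = cst 0 (length th - 1) \<or> c = cst 1 (length th - 1) then beta (length th - 1)
    else unlam ?P g ((th, t), c))"
  have hC: "h ((th, c), t) = unlam ?P g ((th, t), c)" if "(th, t) \<in> ?C" "c \<in> ops (length th - 1) 1" for th c t
   using U(4)[OF that(1), of c 0] U(4)[OF that(1), of c 1] that unfolding h_def by auto
  have hb: "h ((th, cst i (length th - 1)), t) = beta (length th - 1)" if "i \<le> 1" for th t i
   using that unfolding h_def by (cases "i = 0") auto
  have "smap_on {(z, t) \<in> cells (sprod ?P I1). z \<in> rim (std_simplex d) A \<or> 1 \<notin> set t} (sprod ?P I1) K h"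
  proof (rule smap_onI)
   fix z assume z: "z \<in> {(z, t) \<in> cells (sprod ?P I1). z \<in> rim (std_simplex d) A \<or> 1 \<notin> set t}"
   obtain th c t where zz: "z = ((th, c), t)" by (cases z) auto
   obtain l where l: "th \<in> ops l d" "c \<in> ops l 1" "t \<in> ops l 1" using z zz by (auto simp: cells_std_simplex length_ops)
   show "h z \<in> cells K \<and> sdim K (h z) = sdim (sprod ?P I1) z"
   proof (cases "c = cst 0 l \<or> c = cst 1 l")
    case True
    hence "h z = beta l" using hb[of 0 th] hb[of 1 th] zz length_ops[OF l(1)] by auto
    thus ?thesis using basepointD[OF beta] zz length_ops[OF l(1)] by simp
   next
    case False
    hence m: "(th, t) \<in> ?C" using Cc[of th c t] z zz length_ops[OF l(1)] by auto
    thus ?thesis using hC[OF m] U(1,2)[OF m, of c] l zz length_ops[OF l(1)] by simp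
   qed
  next
   fix z m chi assume z: "z \<in> {(z, t) \<in> cells (sprod ?P I1). z \<in> rim (std_simplex d) A \<or> 1 \<notin> set t}"
    and chi: "chi \<in> ops m (sdim (sprod ?P I1) z)"
   obtain th c t where zz: "z = ((th, c), t)" by (cases z) auto
   obtain l where l: "th \<in> ops l d" "c \<in> ops l 1" "t \<in> ops l 1" using z zz by (auto simp: cells_std_simplex length_ops)
   have chil: "chi \<in> ops m l" using chi zz length_ops[OF l(1)] by simp
   have len: "length th - 1 = l" "length (th \<odot> chi) - 1 = m" using length_ops l chil by auto
   show "h (opr (sprod ?P I1) chi z) = opr K chi (h z)"
   proof (cases "c = cst 0 l \<or> c = cst 1 l")
    case True
    hence "h z = beta l" "h (opr (sprod ?P I1) chi z) = beta m"
     using hb[of 0 th t] hb[of 1 th t] hb[of 0 "th \<odot> chi" "t \<odot> chi"] hb[of 1 "th \<odot> chi" "t \<odot> chi"] zz len cst_pull[OF chil] by auto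
    thus ?thesis using basepointD[OF beta] chil by simp
   next
    case False
    hence mC: "(th, t) \<in> ?C" using Cc[of th c t] z zz len by auto
    have m': "(th \<odot> chi, t \<odot> chi) \<in> ?C" using subc_opr[OF C mC, of chi m] chil len by simp
    show ?thesis using hC[OF mC] hC[OF m', of "c \<odot> chi"] U(3)[OF mC, of c chi m] l chil zz len pull_ops[OF l(2) chil] by simp
   qed
  qed
  then obtain H where H: "smap (sprod ?P I1) K H"
   "!!z t. (z, t) \<in> cells (sprod ?P I1) ==> z \<in> rim (std_simplex d) A \<or> 1 \<notin> set t ==> H (z, t) = h (z, t)"
   using hep[OF K P subc_rim[OF _ A], of h] by auto
  define G where "G = (\<lambda>((th, t), c). H ((th, c), t))"
  have "smap (sprod ?P I1) K G"
  proof (rule smap_cylI[OF P])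
   fix b c assume b: "b \<in> cells ?P" "c \<in> ops (sdim ?P b) 1"
   thus "G (b, c) \<in> cells K \<and> sdim K (G (b, c)) = sdim ?P b"
    using smap_cyl[OF H(1) P, of "(fst b, c)" "snd b"] by (cases b) (auto simp: G_def)
   fix m chi assume "chi \<in> ops m (sdim ?P b)"
   thus "G (opr ?P chi b, c \<odot> chi) = opr K chi (G (b, c))"
    using b smap_cyl[OF H(1) P, of "(fst b, c)" "snd b"] by (cases b) (auto simp: G_def)
  qed
  moreover have "G (b, cst i (sdim ?P b)) = beta (sdim ?P b)" if b: "b \<in> cells ?P" "i \<le> 1" for b i
  proof -
   obtain th t where bb: "b = (th, t)" by (cases b)
   have "i = 0 \<or> i = 1" using that by auto
   hence "(th, cst i (length th - 1)) \<in> rim (std_simplex d) A" using b bb unfolding rim_def by auto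
   thus ?thesis using H(2)[of "(th, cst i (length th - 1))" t] hb[OF b(2)] b bb by (simp add: G_def)
  qed
  ultimately have "smap ?P (loops K beta) (lam ?P G)" by (rule smap_lam[OF P beta])
  moreover have "lam ?P G (th, t) = g (th, t)" if "(th, t) \<in> cells ?P" "set th \<noteq> {..d} \<or> 1 \<notin> set t" for th t
  proof -
   have m: "(th, t) \<in> ?C" using that by auto
   have "lam ?P G (th, t) = lam ?P (unlam ?P g) (th, t)"
   proof (rule lam_cong[OF P that(1)])
    fix k psi c assume psi: "psi \<in> ops k (sdim ?P (th, t))" and c: "c \<in> ops k 1"
    have m': "(th \<odot> psi, t \<odot> psi) \<in> ?C" using subc_opr[OF C m psi] by simp
    have l: "length (th \<odot> psi) - 1 = k" using length_ops[OF psi] by simp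
    have "(th \<odot> psi, c) \<in> rim (std_simplex d) A \<or> 1 \<notin> set (t \<odot> psi)"
    proof (cases "1 \<in> set (t \<odot> psi)")
     case True
     hence "th \<odot> psi \<in> A" "th \<odot> psi \<in> cells (std_simplex d)" using m' unfolding A_def by auto
     thus ?thesis using c l unfolding rim_def by simp
    qed simp
    moreover have "((th \<odot> psi, c), t \<odot> psi) \<in> cells (sprod ?P I1)" using m' c l by auto
    ultimately show "G (opr ?P psi (th, t), c) = unlam ?P g (opr ?P psi (th, t), c)"
     using H(2) hC[OF m', of c] c l by (simp add: G_def)
   qed
   thus ?thesis using U(5)[OF m cst_ops, of 0] by simp
  qed
  ultimately show ?thesis by (intro exI[of _ "lam ?P G"]) fastforce
 qed
 thus ?thesis unfolding prism_def using is_sset_loops by blast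
qed

section \<open>Lifting along the adjoint structure maps\<close>

text \<open>The structure map with its circle coordinate pulled back to the interval, so that
  suspensions become maps on cylinders; both ends of the interval go to the base point.\<close>

definition sg :: "'e symspec => nat => 'e => nat list => 'e" where
 "sg E n e t = sig E n e (cl t)"

locale omega =
 fixes E :: "'e symspec"
 assumes om: "omega_spectrum E"
begin

lemma spec: "symmetric_spectrum E"
 using om unfolding omega_spectrum_def by blast

lemma prism_lev: "prism (lev E n)"
 using om kan_prism unfolding omega_spectrum_def by blast

lemma sset_lev [simp]: "is_sset (lev E n)"
 by (rule spec[unfolded symmetric_spectrum_def, THEN conjunct1, rule_format])

lemma basepoint_lev: "basepoint (lev E n) (bas E n)"
 using spec[unfolded symmetric_spectrum_def, THEN conjunct2, THEN conjunct1]
  spec[unfolded symmetric_spectrum_def, THEN conjunct2, THEN conjunct2, THEN conjunct1]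
 unfolding basepoint_def simp_def by simp

lemmas basD = basepointD[OF basepoint_lev]

lemma sig_smap: "smap (sprod (lev E n) circle) (lev E (Suc n)) (\<lambda>(e, t). sig E n e t)"
 by (rule spec[unfolded symmetric_spectrum_def, THEN conjunct2, THEN conjunct2, THEN conjunct2, THEN conjunct2,
  THEN conjunct2, THEN conjunct1, rule_format])

lemma sig_bas: "t \<in> ops k 1 ==> 0 \<in> set t ==> sig E n (bas E n k) t = bas E (Suc n) k"
 using spec[unfolded symmetric_spectrum_def, THEN conjunct2, THEN conjunct2, THEN conjunct2, THEN conjunct2,
  THEN conjunct2, THEN conjunct2, THEN conjunct1] simp_circle by blast

lemma sig_base: "e \<in> cells (lev E n) ==> sig E n e (cst 0 (sdim (lev E n) e)) = bas E (Suc n) (sdim (lev E n) e)"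
 using spec[unfolded symmetric_spectrum_def, THEN conjunct2, THEN conjunct2, THEN conjunct2, THEN conjunct2,
  THEN conjunct2, THEN conjunct2, THEN conjunct2, THEN conjunct1] unfolding simp_def circle_base_cst by blast

lemma sg_bas: "t \<in> ops k 1 ==> sg E n (bas E n k) t = bas E (Suc n) k"
 unfolding sg_def by (auto intro!: sig_bas cl_ops zero_in_cl)

lemma sg_base: "e \<in> cells (lev E n) ==> sdim (lev E n) e = k ==> sg E n e (cst i k) = bas E (Suc n) k"
 unfolding sg_def by (auto simp: sig_base)

lemma sgD:
 assumes "e \<in> cells (lev E n)" "t \<in> ops (sdim (lev E n) e) 1"
 shows "sg E n e t \<in> cells (lev E (Suc n))" "sdim (lev E (Suc n)) (sg E n e t) = sdim (lev E n) e"
  "th \<in> ops m (sdim (lev E n) e) ==> sg E n (opr (lev E n) th e) (t \<odot> th) = opr (lev E (Suc n)) th (sg E n e t)"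
proof -
 have "(e, cl t) \<in> cells (sprod (lev E n) circle)"
  using assms cl_ops[OF assms(2)] zero_in_cl[OF assms(2)] by (auto simp: cells_sprod cells_circle length_ops)
 note * = smapD[OF sig_smap this]
 show "sg E n e t \<in> cells (lev E (Suc n))" "sdim (lev E (Suc n)) (sg E n e t) = sdim (lev E n) e"
  using *(1,2) by (auto simp: sg_def)
 show "sg E n (opr (lev E n) th e) (t \<odot> th) = opr (lev E (Suc n)) th (sg E n e t)" if "th \<in> ops m (sdim (lev E n) e)"
  using *(3)[of th m] that cl_pull[OF assms(2), of th m] by (simp add: sg_def)
qed

lemma loop_adjoint_lam:
 assumes "e \<in> cells (lev E n)"
 shows "loop_adjoint E n e = lam (lev E n) (\<lambda>(e, t). sg E n e t) e"
 unfolding loop_adjoint_def lam_def Let_def case_prod_beta'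
 by (auto intro!: restrict_ext simp: cells_sprod_circle sg_def cl_id)

text \<open>A family of loops in level \<open>n + 1\<close> is, up to homotopy, the suspension of a
  map to level \<open>n\<close>, and a desuspension \<open>phi\<close> given over \<open>A\<close>
  can be kept. This is \<open>lift_homotopy_equiv\<close> for the adjoint structure map,
  transposed.\<close>

lemma lift_sg:
 assumes B: "is_sset B" and A: "subc B A" and g: "smap (sprod B I1) (lev E (Suc n)) g"
  and ends: "!!b i. b \<in> cells B ==> i \<le> 1 ==> g (b, cst i (sdim B b)) = bas E (Suc n) (sdim B b)"
  and phi: "smap_on A B (lev E n) phi"
  and gphi: "!!b t. b \<in> A ==> t \<in> ops (sdim B b) 1 ==> g (b, t) = sg E n (phi b) t"
 obtains s where "smap B (lev E n) s" "!!b. b \<in> A ==> s b = phi b"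
  "hrel (sprod B I1) (rim B A) (lev E (Suc n)) (\<lambda>(b, t). sg E n (s b) t) g"
proof -
 let ?K = "lev E (Suc n)" and ?beta = "bas E (Suc n)" and ?P = "sprod B I1"
 let ?L = "loops ?K ?beta"
 have L: "prism ?L" by (rule prism_loops[OF prism_lev basepoint_lev])
 have AB: "b \<in> cells B" if "b \<in> A" for b using that A by (rule subc_sub[rotated])
 have w: "homotopy_equiv (lev E n) ?L (loop_adjoint E n)" using om unfolding omega_spectrum_def by blast
 have gs: "smap B ?L (lam B g)" by (rule smap_lam[OF B basepoint_lev g ends])
 have lamsg: "loop_adjoint E n (s b) = lam B (\<lambda>(b, t). sg E n (s b) t) b"
  if s: "smap_on C B (lev E n) s" and C: "subc B C" and b: "b \<in> C" for s b C
 proof -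
  have "s (opr B psi b) = opr (lev E n) psi (s b)" if "psi \<in> ops m (sdim B b)" for psi m
   using smap_onD(3)[OF s b that] .
  thus ?thesis unfolding loop_adjoint_lam[OF smap_onD(1)[OF s b]] lam_def smap_onD(2)[OF s b]
   by (auto intro!: restrict_ext simp: cells_sprod_circle)
 qed
 have "loop_adjoint E n (phi b) = lam B g b" if b: "b \<in> A" for b
  unfolding lamsg[OF phi A b]
 proof (rule lam_cong[OF B AB[OF b]])
  fix m psi c assume psi: "psi \<in> ops m (sdim B b)" "c \<in> ops m 1"
  thus "(case (opr B psi b, c) of (b, t) => sg E n (phi b) t) = g (opr B psi b, c)"
   using gphi[OF subc_opr[OF A b psi(1)]] sset_opr[OF B AB[OF b] psi(1)] by simp
 qed
 then obtain s where s: "smap B (lev E n) s" "!!b. b \<in> A ==> s b = phi b"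
  "hrel B A ?L (\<lambda>b. loop_adjoint E n (s b)) (lam B g)"
  using lift_homotopy_equiv[OF prism_lev L w B A gs phi] by blast
 obtain k where k: "smap ?P ?L k" "!!b. b \<in> cells B ==> k (b, cst 0 (sdim B b)) = loop_adjoint E n (s b)"
  "!!b. b \<in> cells B ==> k (b, cst 1 (sdim B b)) = lam B g b"
  "!!b t. b \<in> A ==> t \<in> ops (sdim B b) 1 ==> k (b, t) = loop_adjoint E n (s b)"
  using s(3) unfolding hrel_def by blast
 have P: "is_sset ?P" using B by simp
 note U = unlam_on[OF P subc_cells[OF P] k(1)[unfolded smap_iff]]
 \<comment> \<open>The lifting homotopy takes values in loops; exchanging its time with the loop
   coordinate turns it into a homotopy on the cylinder. Being based on the ends of the loops, it is
   fixed on the whole rim.\<close>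
 define H where "H = (\<lambda>((b, c), t). unlam ?P k ((b, t), c))"
 have "smap (sprod ?P I1) ?K H"
 proof (rule smap_cylI[OF P])
  fix z t assume z: "z \<in> cells ?P" "t \<in> ops (sdim ?P z) 1"
  thus "H (z, t) \<in> cells ?K \<and> sdim ?K (H (z, t)) = sdim ?P z"
   using U(1,2)[of "(fst z, t)" "snd z"] B by (cases z) (auto simp: H_def)
  fix m th assume "th \<in> ops m (sdim ?P z)"
  thus "H (opr ?P th z, t \<odot> th) = opr ?K th (H (z, t))"
   using z U(3)[of "(fst z, t)" "snd z"] B by (cases z) (auto simp: H_def)
 qed
 moreover have v: "unlam ?P k ((b, t), c) = sg E n (s b) c"
  if "b \<in> cells B" "c \<in> ops (sdim B b) 1" "k (b, t) = loop_adjoint E n (s b)" for b c t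
 proof -
  have "(cl c, idl (sdim B b)) \<in> cells (sprod circle (std_simplex (sdim B b)))"
   using that cells_sprod_circle cl_ops zero_in_cl idl_ops by blast
  moreover have "opr (lev E n) (idl (sdim B b)) (s b) = s b"
   using sset_id[OF sset_lev smapD(1)[OF s(1) that(1)]] smapD(2)[OF s(1) that(1)] by simp
  ultimately show ?thesis using that smapD[OF s(1) that(1)]
   by (simp add: unlam_def loop_adjoint_lam lam_def) (simp add: sg_def zero_in_cl cl_id)
 qed
 moreover have "unlam ?P k ((b, cst 1 (sdim B b)), c) = g (b, c)" if "b \<in> cells B" "c \<in> ops (sdim B b) 1" for b c
 proof -
  have "(cl c, idl (sdim B b)) \<in> cells (sprod circle (std_simplex (sdim B b)))"
   using that cells_sprod_circle cl_ops zero_in_cl idl_ops by blast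
  moreover have "g (b, cl c) = g (b, c)" using cl_cases[OF that(2)] ends[OF that(1), of 0] ends[OF that(1), of 1] by auto
  ultimately show ?thesis using that sset_id[OF B that(1)] by (simp add: unlam_def lam_def k(3))
 qed
 moreover have "H (z, t) = sg E n (s (fst z)) (snd z)" if z: "z \<in> rim B A" "t \<in> ops (sdim ?P z) 1" for z t
 proof -
  obtain b c where zz: "z = (b, c)" by (cases z)
  have b: "b \<in> cells B" "c \<in> ops (sdim B b) 1" using z zz B unfolding rim_def by auto
  have t: "t \<in> ops (sdim B b) 1" using z zz by simp
  show ?thesis
  proof (cases "b \<in> A")
   case True thus ?thesis using v[OF b] k(4)[OF True t] zz by (simp add: H_def)
  next
   case False
   then obtain i where i: "c = cst i (sdim B b)" using z zz unfolding rim_def by auto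
   have "unlam ?P k ((b, t), cst i (sdim B b)) = ?beta (sdim B b)"
    using U(4)[of "(b, t)" c i] b t B by simp
   thus ?thesis using i zz sg_base[OF smapD(1,2)[OF s(1) b(1)]] by (simp add: H_def)
  qed
 qed
 ultimately have "hrel ?P (rim B A) ?K (\<lambda>(b, t). sg E n (s b) t) g"
  unfolding hrel_def using B k(2) by (intro exI[of _ H]) (auto simp: H_def case_prod_beta')
 thus thesis using that s(1,2) by blast
qed

end

section \<open>Extending maps of spectra\<close>

context omega
begin

text \<open>On the ends of the loop coordinate every suspension is the base point, so the suspended
  homotopy is stationary on the rim and not only over \<open>A\<close>.\<close>

lemma hrel_sg:
 assumes B: "is_sset B" and A: "A \<subseteq> cells B" and f: "hrel B A (lev E n) f g"
 shows "hrel (sprod B I1) (rim B A) (lev E (Suc n)) (\<lambda>(b, t). sg E n (f b) t) (\<lambda>(b, t). sg E n (g b) t)"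
proof -
 obtain k where k: "smap (sprod B I1) (lev E n) k" "!!b. b \<in> cells B ==> k (b, cst 0 (sdim B b)) = f b"
  "!!b. b \<in> cells B ==> k (b, cst 1 (sdim B b)) = g b"
  "!!b t. b \<in> A ==> t \<in> ops (sdim B b) 1 ==> k (b, t) = f b"
  using f unfolding hrel_def by blast
 note kk = smap_cyl[OF k(1) B]
 have fb: "f b \<in> cells (lev E n)" "sdim (lev E n) (f b) = sdim B b" if "b \<in> cells B" for b
  using smap_cyl[OF k(1) B that, of "cst 0 (sdim B b)"] k(2)[OF that] by auto
 have "smap (sprod (sprod B I1) I1) (lev E (Suc n)) (\<lambda>((b, c), y). sg E n (k (b, y)) c)"
  using kk sgD by (intro smap_cylI[OF is_sset_cyl[OF B]]) (auto simp: B)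
 moreover have "(case (z, y) of ((b, c), y) => sg E n (k (b, y)) c) = (case z of (b, t) => sg E n (f b) t)"
  if z: "z \<in> rim B A" "y \<in> ops (sdim (sprod B I1) z) 1" for z y
 proof -
  obtain b c where zz: "z = (b, c)" by (cases z)
  have b: "b \<in> cells B" "c \<in> ops (sdim B b) 1" "y \<in> ops (sdim B b) 1" using z zz B unfolding rim_def by auto
  show ?thesis
  proof (cases "b \<in> A")
   case True thus ?thesis using k(4) b zz by simp
  next
   case False
   then obtain i where "c = cst i (sdim B b)" using z zz unfolding rim_def by auto
   thus ?thesis using sg_base kk[OF b(1,3)] fb[OF b(1)] zz by simp
  qed
 qed
 ultimately show ?thesis unfolding hrel_def
  using k B by (intro exI[of _ "\<lambda>((b, c), y). sg E n (k (b, y)) c"]) auto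
qed

text \<open>
 The structure maps \<open>sb\<close> of \<open>B\<close> become, through the squares \<open>kappa\<close>, composites of loops coming from the
 subspectrum \<open>A\<close>. So for every extension \<open>s\<close> to level \<open>n + 1\<close> the map \<open>s \<circ> sb\<close> is the top edge of a
 square whose other three edges are prescribed, hence determined up to homotopy.
\<close>

lemma spectrum_extend:
 fixes B :: "nat => 'b sset" and A :: "nat => 'b set"
 assumes B: "!!n. is_sset (B n)" and A: "!!n. subc (B n) (A n)"
  and phi: "!!n. smap_on (A n) (B n) (lev E n) (phi n)"
  and sb: "!!n. smap (sprod (B n) I1) (B (Suc n)) (\<lambda>(b, t). sb n b t)"
  and sb_end: "!!n b i. b \<in> cells (B n) ==> i \<le> 1 ==> sb n b (cst i (sdim (B n) b)) \<in> A (Suc n) \<and>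
    phi (Suc n) (sb n b (cst i (sdim (B n) b))) = bas E (Suc n) (sdim (B n) b)"
  and sb_A: "!!n b t. b \<in> A n ==> t \<in> ops (sdim (B n) b) 1 ==>
    sb n b t \<in> A (Suc n) \<and> phi (Suc n) (sb n b t) = sg E n (phi n b) t"
  and sb_inj: "!!n b t b' t'. b \<in> cells (B n) ==> b' \<in> cells (B n) ==> t \<in> ops (sdim (B n) b) 1 ==>
    t' \<in> ops (sdim (B n) b') 1 ==> sb n b t = sb n b' t' ==> sb n b t \<notin> A (Suc n) ==> b = b' \<and> t = t'"
  and sb_notA: "!!n b t. b \<in> cells (B n) ==> t \<in> ops (sdim (B n) b) 1 ==> sb n b t \<in> A (Suc n) ==> (b, t) \<in> rim (B n) (A n)"
  and kappa: "!!n. smap (sprod (sprod (B n) I1) I1) (B (Suc n)) (\<lambda>((b, x), y). kappa n b x y)"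
  and kappa1: "!!n b x. b \<in> cells (B n) ==> x \<in> ops (sdim (B n) b) 1 ==> kappa n b x (cst 1 (sdim (B n) b)) = sb n b x"
  and kappa0: "!!n b x. b \<in> cells (B n) ==> x \<in> ops (sdim (B n) b) 1 ==> kappa n b x (cst 0 (sdim (B n) b)) \<in> A (Suc n)"
  and kappaA: "!!n b x y. (b, x) \<in> rim (B n) (A n) ==> y \<in> ops (sdim (B n) b) 1 ==> kappa n b x y \<in> A (Suc n)"
 obtains s where "!!n. smap (B n) (lev E n) (s n)" "!!n b. b \<in> A n ==> s n b = phi n b"
  "!!n b t. b \<in> cells (B n) ==> t \<in> ops (sdim (B n) b) 1 ==> s (Suc n) (sb n b t) = sg E n (s n b) t"
proof -
 let ?P = "\<lambda>n. sprod (B n) I1"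
 have P: "is_sset (?P n)" for n using B by simp
 have R: "subc (?P n) (rim (B n) (A n))" for n by (rule subc_rim[OF B A])
 have Rc: "b \<in> cells (B n) \<and> x \<in> ops (sdim (B n) b) 1" if "(b, x) \<in> rim (B n) (A n)" for n b x
  using that B unfolding rim_def by auto
 have AB: "b \<in> cells (B n)" if "b \<in> A n" for b n using that A by (rule subc_sub[rotated])
 have kappaD: "kappa n b x y \<in> cells (B (Suc n))" "sdim (B (Suc n)) (kappa n b x y) = sdim (B n) b"
  "th \<in> ops m (sdim (B n) b) ==> kappa n (opr (B n) th b) (x \<odot> th) (y \<odot> th) = opr (B (Suc n)) th (kappa n b x y)"
  if "b \<in> cells (B n)" "x \<in> ops (sdim (B n) b) 1" "y \<in> ops (sdim (B n) b) 1" for n b x y th m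
  using smap_cyl[OF kappa P, of "(b, x)" n y] that B by auto
 have sbD: "sb n b t \<in> cells (B (Suc n))" "sdim (B (Suc n)) (sb n b t) = sdim (B n) b"
  "th \<in> ops m (sdim (B n) b) ==> sb n (opr (B n) th b) (t \<odot> th) = opr (B (Suc n)) th (sb n b t)"
  if "b \<in> cells (B n)" "t \<in> ops (sdim (B n) b) 1" for n b t th m
  using smap_cyl[OF sb B that] by auto
 \<comment> \<open>The image in \<open>E\<close> of the squares \<open>kappa\<close>:
   \<open>phi\<close> prescribes it on three edges and over \<open>A n\<close>, and homotopy
   extension completes it. Its fourth edge \<open>g n\<close> is what \<open>s (Suc n)\<close> has
   to be on suspensions, up to homotopy.\<close>
 have "\<exists>c. smap (sprod (?P n) I1) (lev E (Suc n)) c \<and>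
   (\<forall>z\<in>cells (?P n). c (z, cst 0 (sdim (?P n) z)) = phi (Suc n) (kappa n (fst z) (snd z) (cst 0 (sdim (?P n) z)))) \<and>
   (\<forall>z\<in>rim (B n) (A n). \<forall>y\<in>ops (sdim (?P n) z) 1. c (z, y) = phi (Suc n) (kappa n (fst z) (snd z) y))" for n
 proof -
  have f: "smap (?P n) (lev E (Suc n)) (\<lambda>z. phi (Suc n) (kappa n (fst z) (snd z) (cst 0 (sdim (?P n) z))))"
  proof (rule smap_cylI[OF B])
   fix b x assume b: "b \<in> cells (B n)" "x \<in> ops (sdim (B n) b) 1"
   note D = smap_onD[OF phi kappa0[OF b]]
   show "phi (Suc n) (kappa n (fst (b, x)) (snd (b, x)) (cst 0 (sdim (?P n) (b, x)))) \<in> cells (lev E (Suc n)) \<and>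
    sdim (lev E (Suc n)) (phi (Suc n) (kappa n (fst (b, x)) (snd (b, x)) (cst 0 (sdim (?P n) (b, x))))) = sdim (B n) b"
    using D(1,2) kappaD[OF b, of "cst 0 (sdim (B n) b)"] by simp
   fix m th assume th: "th \<in> ops m (sdim (B n) b)"
   show "phi (Suc n) (kappa n (fst (opr (B n) th b, x \<odot> th)) (snd (opr (B n) th b, x \<odot> th)) (cst 0 (sdim (?P n) (opr (B n) th b, x \<odot> th))))
    = opr (lev E (Suc n)) th (phi (Suc n) (kappa n (fst (b, x)) (snd (b, x)) (cst 0 (sdim (?P n) (b, x)))))"
    using D(3)[of th m] kappaD[OF b, of "cst 0 (sdim (B n) b)"] kappaD(3)[OF b cst_ops th, of 0] th cst_pull[OF th]
     sset_opr[OF B b(1) th] by simp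
  qed
  have a: "smap_on {(z, y) \<in> cells (sprod (?P n) I1). z \<in> rim (B n) (A n)} (sprod (?P n) I1) (lev E (Suc n))
    (\<lambda>(z, y). phi (Suc n) (kappa n (fst z) (snd z) y))"
  proof (rule smap_on_cylI[OF P R])
   fix z y assume z: "z \<in> rim (B n) (A n)" "y \<in> ops (sdim (?P n) z) 1"
   obtain b x where zz: "z = (b, x)" by (cases z)
   have b: "b \<in> cells (B n)" "x \<in> ops (sdim (B n) b) 1" "y \<in> ops (sdim (B n) b) 1" using Rc z zz by auto
   note D = smap_onD[OF phi kappaA[OF z(1)[unfolded zz] b(3)]]
   show "(case (z, y) of (z, y) => phi (Suc n) (kappa n (fst z) (snd z) y)) \<in> cells (lev E (Suc n)) \<and>
    sdim (lev E (Suc n)) (case (z, y) of (z, y) => phi (Suc n) (kappa n (fst z) (snd z) y)) = sdim (?P n) z"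
    using D(1,2) kappaD[OF b] zz by simp
   fix m th assume "th \<in> ops m (sdim (?P n) z)"
   thus "(case (opr (?P n) th z, y \<odot> th) of (z, y) => phi (Suc n) (kappa n (fst z) (snd z) y)) =
    opr (lev E (Suc n)) th (case (z, y) of (z, y) => phi (Suc n) (kappa n (fst z) (snd z) y))"
    using D(3)[of th m] kappaD[OF b] zz by simp
  qed
  obtain c where "smap (sprod (?P n) I1) (lev E (Suc n)) c"
   "!!z. z \<in> cells (?P n) ==> c (z, cst 0 (sdim (?P n) z)) = phi (Suc n) (kappa n (fst z) (snd z) (cst 0 (sdim (?P n) z)))"
   "!!z y. z \<in> rim (B n) (A n) ==> y \<in> ops (sdim (?P n) z) 1 ==> c (z, y) = (case (z, y) of (z, y) => phi (Suc n) (kappa n (fst z) (snd z) y))"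
   using hep_pair[OF prism_lev P R f a] by auto
  thus ?thesis by (intro exI[of _ c]) auto
 qed
 then obtain c where c: "!!n. smap (sprod (?P n) I1) (lev E (Suc n)) (c n)"
   "!!n z. z \<in> cells (?P n) ==> c n (z, cst 0 (sdim (?P n) z)) = phi (Suc n) (kappa n (fst z) (snd z) (cst 0 (sdim (?P n) z)))"
   "!!n z y. z \<in> rim (B n) (A n) ==> y \<in> ops (sdim (?P n) z) 1 ==> c n (z, y) = phi (Suc n) (kappa n (fst z) (snd z) y)"
  by metis
 define g where "g n z = c n (z, cst 1 (sdim (?P n) z))" for n z
 have gs: "smap (?P n) (lev E (Suc n)) (g n)" for n
  unfolding g_def using smap_end[OF c(1) P, of 1 n] by simp
 \<comment> \<open>Desuspending \<open>g n\<close> gives a candidate in each level separately. The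
   candidates are compatible with the structure maps only up to homotopy.\<close>
 have "\<exists>s. smap (B n) (lev E n) s \<and> (\<forall>b\<in>A n. s b = phi n b) \<and>
   hrel (?P n) (rim (B n) (A n)) (lev E (Suc n)) (\<lambda>(b, t). sg E n (s b) t) (g n)" for n
 proof -
  have e: "g n (b, cst i (sdim (B n) b)) = bas E (Suc n) (sdim (B n) b)" if b: "b \<in> cells (B n)" "i \<le> 1" for b i
  proof -
   have "i = 0 \<or> i = 1" using b by auto
   hence "(b, cst i (sdim (B n) b)) \<in> rim (B n) (A n)" using b B unfolding rim_def by auto
   thus ?thesis using c(3)[of "(b, cst i (sdim (B n) b))" n "cst 1 (sdim (B n) b)"] sb_end[OF b] kappa1[OF b(1) cst_ops[OF b(2)]]
    by (simp add: g_def)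
  qed
  have a: "g n (b, t) = sg E n (phi n b) t" if b: "b \<in> A n" "t \<in> ops (sdim (B n) b) 1" for b t
  proof -
   have "(b, t) \<in> rim (B n) (A n)" using b AB B unfolding rim_def by auto
   thus ?thesis using c(3)[of "(b, t)" n "cst 1 (sdim (B n) b)"] sb_A[OF b] kappa1[OF AB[OF b(1)] b(2)] by (simp add: g_def)
  qed
  show ?thesis by (rule lift_sg[OF B A gs e phi a]) blast+
 qed
 then obtain s where s: "!!n. smap (B n) (lev E n) (s n)" "!!n b. b \<in> A n ==> s n b = phi n b"
   "!!n. hrel (?P n) (rim (B n) (A n)) (lev E (Suc n)) (\<lambda>(b, t). sg E n (s n b) t) (g n)" by metis
 \<comment> \<open>Composing the candidate of level \<open>n + 1\<close> with \<open>kappa\<close>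
   and the square \<open>c n\<close> agree at the start and on the rim, hence have homotopic
   ends.\<close>
 have sq: "hrel (?P n) (rim (B n) (A n)) (lev E (Suc n)) (\<lambda>(b, t). s (Suc n) (sb n b t)) (g n)" for n
 proof -
  have h: "smap (sprod (?P n) I1) (lev E (Suc n)) (\<lambda>z. s (Suc n) ((\<lambda>((b, x), y). kappa n b x y) z))"
   using smap_comp[OF kappa[of n] s(1)[of "Suc n"]] .
  have "hrel (?P n) (rim (B n) (A n)) (lev E (Suc n))
    (\<lambda>z. s (Suc n) ((\<lambda>((b, x), y). kappa n b x y) (z, cst 1 (sdim (?P n) z)))) (\<lambda>z. c n (z, cst 1 (sdim (?P n) z)))"
  proof (rule hrel_end[OF prism_lev P R h c(1)])
   fix z t assume z: "z \<in> rim (B n) (A n)" "t \<in> ops (sdim (?P n) z) 1"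
   thus "s (Suc n) ((\<lambda>((b, x), y). kappa n b x y) (z, t)) = c n (z, t)"
    using c(3)[OF z] s(2) kappaA[of "fst z" "snd z" n t] by (cases z) simp
  next
   fix z assume z: "z \<in> cells (?P n)"
   thus "s (Suc n) ((\<lambda>((b, x), y). kappa n b x y) (z, cst 0 (sdim (?P n) z))) = c n (z, cst 0 (sdim (?P n) z))"
    using c(2)[OF z] s(2) kappa0[of "fst z" n "snd z"] B by (cases z) simp
  qed
  thus ?thesis
   by (rule hrel_cong) (use kappa1 B subc_sub[OF R] in \<open>auto simp: g_def\<close>)
 qed
 \<comment> \<open>A corrected map stays homotopic, relative to \<open>A n\<close>, to the original
   candidate, so the comparison with \<open>g n\<close> remains available for correcting the next
   level.\<close>
 define ok where "ok n t \<longleftrightarrow> smap (B n) (lev E n) t \<and> (\<forall>b\<in>A n. t b = phi n b) \<and> hrel (B n) (A n) (lev E n) t (s n)" for n t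
 have step: "\<exists>t'. ok (Suc n) t' \<and> (\<forall>b\<in>cells (B n). \<forall>x\<in>ops (sdim (B n) b) 1. t' (sb n b x) = sg E n (t b) x)"
  if t: "ok n t" for n t
 proof -
  have tD: "smap (B n) (lev E n) t" "!!b. b \<in> A n ==> t b = phi n b" "hrel (B n) (A n) (lev E n) t (s n)"
   using t unfolding ok_def by auto
  have "hrel (?P n) (rim (B n) (A n)) (lev E (Suc n)) (\<lambda>(b, x). sg E n (t b) x) (g n)"
   using hrel_trans[OF prism_lev P R hrel_sg[OF B _ tD(3)] s(3)] AB by blast
  hence "hrel (?P n) (rim (B n) (A n)) (lev E (Suc n)) (\<lambda>(b, x). s (Suc n) (sb n b x)) (\<lambda>(b, x). sg E n (t b) x)"
   using hrel_trans[OF prism_lev P R sq] hrel_sym[OF prism_lev P R] by blast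
  then obtain h where h: "smap (sprod (?P n) I1) (lev E (Suc n)) h"
   "!!z. z \<in> cells (?P n) ==> h (z, cst 0 (sdim (?P n) z)) = s (Suc n) (sb n (fst z) (snd z))"
   "!!z. z \<in> cells (?P n) ==> h (z, cst 1 (sdim (?P n) z)) = sg E n (t (fst z)) (snd z)"
   "!!z y. z \<in> rim (B n) (A n) ==> y \<in> ops (sdim (?P n) z) 1 ==> h (z, y) = s (Suc n) (sb n (fst z) (snd z))"
   unfolding hrel_def by (auto simp: case_prod_beta')
  \<comment> \<open>The map of level \<open>n + 1\<close> is to be changed only where its value is
    now forced: on suspensions from level \<open>n\<close>. On \<open>A (Suc n)\<close> it is
    kept.\<close>
  define D where "D = A (Suc n) \<union> (\<lambda>z. sb n (fst z) (snd z)) ` cells (?P n)"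
  have D: "subc (B (Suc n)) D" unfolding subc_def
  proof (intro conjI ballI allI)
   show "D \<subseteq> cells (B (Suc n))" unfolding D_def using AB sbD(1) B by auto
   fix z m th assume z: "z \<in> D" "th \<in> ops m (sdim (B (Suc n)) z)"
   show "opr (B (Suc n)) th z \<in> D"
   proof (cases "z \<in> A (Suc n)")
    case True thus ?thesis using subc_opr[OF A] z unfolding D_def by auto
   next
    case False
    then obtain b x where b: "z = sb n b x" "b \<in> cells (B n)" "x \<in> ops (sdim (B n) b) 1" using z B unfolding D_def by auto
    have th: "th \<in> ops m (sdim (B n) b)" using z sbD[OF b(2,3)] b by simp
    have "opr (B (Suc n)) th z = sb n (opr (B n) th b) (x \<odot> th)" using sbD(3)[OF b(2,3) th] b by simp
    moreover have "(opr (B n) th b, x \<odot> th) \<in> cells (?P n)" using sset_opr[OF B b(2) th] pull_ops[OF b(3) th] B by simp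
    ultimately show ?thesis unfolding D_def by force
   qed
  qed
  \<comment> \<open>The homotopy \<open>h\<close> on the cylinder descends to its image in level
    \<open>n + 1\<close>. Off \<open>A (Suc n)\<close> the preimage is unique by
    \<open>sb_inj\<close>; a suspension inside \<open>A (Suc n)\<close> comes from the rim by
    \<open>sb_notA\<close>, where \<open>h\<close> is stationary with value
    \<open>phi\<close>.\<close>
  define a where "a = (\<lambda>(z, y). if z \<in> A (Suc n) then phi (Suc n) z
    else h (SOME w. w \<in> cells (?P n) \<and> z = sb n (fst w) (snd w), y))"
  have aA: "a (z, y) = phi (Suc n) z" if "z \<in> A (Suc n)" for z y using that by (simp add: a_def)
  have asb: "a (sb n b x, y) = h ((b, x), y)" if b: "b \<in> cells (B n)" "x \<in> ops (sdim (B n) b) 1" "y \<in> ops (sdim (B n) b) 1" for b x y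
  proof (cases "sb n b x \<in> A (Suc n)")
   case True
   hence "(b, x) \<in> rim (B n) (A n)" using sb_notA b by blast
   thus ?thesis using aA[OF True] h(4)[of "(b, x)" y] s(2)[OF True] b by simp
  next
   case False
   have "(SOME w. w \<in> cells (?P n) \<and> sb n b x = sb n (fst w) (snd w)) = (b, x)"
   proof (rule some_equality)
    show "(b, x) \<in> cells (?P n) \<and> sb n b x = sb n (fst (b, x)) (snd (b, x))" using b B by simp
    fix w assume w: "w \<in> cells (?P n) \<and> sb n b x = sb n (fst w) (snd w)"
    obtain b' x' where ww: "w = (b', x')" by (cases w)
    hence "b' \<in> cells (B n)" "x' \<in> ops (sdim (B n) b') 1" "sb n b x = sb n b' x'" using w B by auto
    thus "w = (b, x)" using sb_inj[OF b(1) _ b(2) _ _ False, of b' x'] ww by simp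
   qed
   thus ?thesis using False by (simp add: a_def)
  qed
  have as: "smap_on {(z, y) \<in> cells (sprod (B (Suc n)) I1). z \<in> D} (sprod (B (Suc n)) I1) (lev E (Suc n)) a"
  proof (rule smap_on_cylI[OF B D])
   fix z y assume z: "z \<in> D" "z \<in> cells (B (Suc n))" "y \<in> ops (sdim (B (Suc n)) z) 1"
   consider "z \<in> A (Suc n)" | b x where "z = sb n b x" "b \<in> cells (B n)" "x \<in> ops (sdim (B n) b) 1"
    using z B unfolding D_def by auto
   note cs = this
   show "a (z, y) \<in> cells (lev E (Suc n)) \<and> sdim (lev E (Suc n)) (a (z, y)) = sdim (B (Suc n)) z"
    using cs
   proof cases
    case 1 thus ?thesis using aA smap_onD(1,2)[OF phi] by simp
   next
    case 2
    thus ?thesis using asb[OF 2(2,3)] smap_cyl(1,2)[OF h(1) P, of "(b, x)" y] sbD[OF 2(2,3)] z B by simp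
   qed
   fix m th assume th: "th \<in> ops m (sdim (B (Suc n)) z)"
   show "a (opr (B (Suc n)) th z, y \<odot> th) = opr (lev E (Suc n)) th (a (z, y))"
    using cs
   proof cases
    case 1 thus ?thesis using aA smap_onD(3)[OF phi 1 th] subc_opr[OF A 1 th] by simp
   next
    case 2
    have th': "th \<in> ops m (sdim (B n) b)" and y: "y \<in> ops (sdim (B n) b) 1" using th z 2 sbD[OF 2(2,3)] by auto
    have "opr (B (Suc n)) th z = sb n (opr (B n) th b) (x \<odot> th)" using sbD(3)[OF 2(2,3) th'] 2 by simp
    thus ?thesis using 2 asb[OF 2(2,3) y] asb[of "opr (B n) th b" "x \<odot> th" "y \<odot> th"] sset_opr[OF B 2(2) th']
     pull_ops[OF 2(3) th'] pull_ops[OF y th'] smap_cyl(3)[OF h(1) P, of "(b, x)" y th m] th' y B by simp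
   qed
  qed
  have a0: "a (z, cst 0 (sdim (B (Suc n)) z)) = s (Suc n) z" if z: "z \<in> D" for z
  proof (cases "z \<in> A (Suc n)")
   case True thus ?thesis using aA s(2) by simp
  next
   case False
   then obtain b x where b: "z = sb n b x" "b \<in> cells (B n)" "x \<in> ops (sdim (B n) b) 1" using z B unfolding D_def by auto
   thus ?thesis using asb[OF b(2,3), of "cst 0 (sdim (B n) b)"] sbD[OF b(2,3)] h(2)[of "(b, x)"] B by simp
  qed
  obtain H where H: "smap (sprod (B (Suc n)) I1) (lev E (Suc n)) H"
   "!!z. z \<in> cells (B (Suc n)) ==> H (z, cst 0 (sdim (B (Suc n)) z)) = s (Suc n) z"
   "!!z y. z \<in> D ==> y \<in> ops (sdim (B (Suc n)) z) 1 ==> H (z, y) = a (z, y)"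
   using hep_pair[OF prism_lev B D s(1) as a0] by auto
  define t' where "t' z = H (z, cst 1 (sdim (B (Suc n)) z))" for z
  have t': "smap (B (Suc n)) (lev E (Suc n)) t'" unfolding t'_def using smap_end[OF H(1) B, of 1] by simp
  have AD: "A (Suc n) \<subseteq> D" unfolding D_def by auto
  have t'A: "t' z = phi (Suc n) z" if "z \<in> A (Suc n)" for z using H(3)[of z] aA that AD unfolding t'_def by auto
  have "hrel (B (Suc n)) (A (Suc n)) (lev E (Suc n)) (s (Suc n)) t'"
   unfolding hrel_def using H AD aA s(2) by (intro exI[of _ H]) (auto simp: t'_def)
  hence "ok (Suc n) t'" unfolding ok_def using t' t'A hrel_sym[OF prism_lev B A] by blast
  moreover have "t' (sb n b x) = sg E n (t b) x" if b: "b \<in> cells (B n)" "x \<in> ops (sdim (B n) b) 1" for b x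
  proof -
   have "(b, x) \<in> cells (?P n)" using b B by simp
   hence "sb n b x \<in> D" unfolding D_def by force
   thus ?thesis unfolding t'_def
    using H(3)[of "sb n b x" "cst 1 (sdim (B n) b)"] asb[OF b, of "cst 1 (sdim (B n) b)"] h(3)[of "(b, x)"] b B sbD[OF b] by simp
  qed
  ultimately show ?thesis by blast
 qed
 have ok0: "ok 0 (s 0)" unfolding ok_def using s hrel_refl[OF s(1) B] by blast
 have "\<exists>F. \<forall>n. ok n (F n) \<and> (\<forall>b\<in>cells (B n). \<forall>x\<in>ops (sdim (B n) b) 1. F (Suc n) (sb n b x) = sg E n (F n b) x)"
  using dependent_nat_choice[where P = ok and Q = "\<lambda>n t t'. \<forall>b\<in>cells (B n). \<forall>x\<in>ops (sdim (B n) b) 1. t' (sb n b x) = sg E n (t b) x"]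
   ok0 step by blast
 then obtain F where F: "!!n. ok n (F n)" "!!n b x. b \<in> cells (B n) ==> x \<in> ops (sdim (B n) b) 1 ==> F (Suc n) (sb n b x) = sg E n (F n b) x"
  by blast
 show thesis by (rule that[of F]) (use F in \<open>auto simp: ok_def\<close>)
qed

end

section \<open>Structure maps of cofibrant spectra\<close>

declare split_paired_All [simp del] split_paired_Ex [simp del]

abbreviation pinv :: "('a => 'a) => 'a => 'a" where
 "pinv f \<equiv> inv_into UNIV f"

section \<open>Block sums of permutations and their action on lists\<close>

lemma block_sum_id_right: "alpha permutes {1..n} ==> block_sum n alpha id = alpha"
 by (rule ext) (auto simp: block_sum_def permutes_not_in)

lemma block_sum_id [simp]: "block_sum n id id = id"
 by (rule ext) (auto simp: block_sum_def)

lemma block_sum_comp: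
 assumes "alpha' permutes {1..n}" "beta' permutes {1..m}"
 shows "block_sum n alpha beta \<circ> block_sum n alpha' beta' = block_sum n (alpha \<circ> alpha') (beta \<circ> beta')"
proof
 fix i
 have "alpha' i \<le> n" if "i \<le> n"
  using that permutes_in_image[OF assms(1), of i] permutes_not_in[OF assms(1), of i] by (cases "i \<in> {1..n}") auto
 moreover have "beta' j \<noteq> 0" if "j \<noteq> 0" for j
  using that permutes_in_image[OF assms(2), of j] permutes_not_in[OF assms(2), of j] by (cases "j \<in> {1..m}") auto
 hence "beta' (i - n) \<noteq> 0" if "\<not> i \<le> n" using that by simp
 ultimately show "(block_sum n alpha beta \<circ> block_sum n alpha' beta') i = block_sum n (alpha \<circ> alpha') (beta \<circ> beta') i"
  unfolding block_sum_def by auto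
qed

lemma block_sum_permutes:
 assumes "alpha permutes {1..n}" "beta permutes {1..m}"
 shows "block_sum n alpha beta permutes {1..n + m}"
proof -
 have "block_sum n alpha beta \<circ> block_sum n (pinv alpha) (pinv beta) = id" "block_sum n (pinv alpha) (pinv beta) \<circ> block_sum n alpha beta = id"
  using block_sum_comp[OF permutes_inv[OF assms(1)] permutes_inv[OF assms(2)], of alpha beta]
   block_sum_comp[OF assms, of "pinv alpha" "pinv beta"] permutes_inv_o[OF assms(1)] permutes_inv_o[OF assms(2)]
  by (auto simp: block_sum_def fun_eq_iff)
 hence "bij (block_sum n alpha beta)" using o_bij by blast
 moreover have "block_sum n alpha beta i = i" if "i \<notin> {1..n + m}" for i
 proof (cases "i \<le> n")
  case True
  thus ?thesis using that permutes_not_in[OF assms(1), of i] by (simp add: block_sum_def)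
 next
  case False
  hence "i - n \<notin> {1..m}" using that by auto
  thus ?thesis using False permutes_not_in[OF assms(2), of "i - n"] by (simp add: block_sum_def)
 qed
 ultimately show ?thesis unfolding permutes_def bij_iff by metis
qed

lemma inv_block_sum:
 assumes "alpha permutes {1..n}" "beta permutes {1..m}"
 shows "pinv (block_sum n alpha beta) = block_sum n (pinv alpha) (pinv beta)"
proof (rule inv_unique_comp)
 show "block_sum n alpha beta \<circ> block_sum n (pinv alpha) (pinv beta) = id" "block_sum n (pinv alpha) (pinv beta) \<circ> block_sum n alpha beta = id"
  using block_sum_comp[OF permutes_inv[OF assms(1)] permutes_inv[OF assms(2)], of alpha beta]
   block_sum_comp[OF assms, of "pinv alpha" "pinv beta"] permutes_inv_o[OF assms(1)] permutes_inv_o[OF assms(2)]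
  by (auto simp: block_sum_def fun_eq_iff)
qed

lemma lperm_length [simp]: "length (lperm beta xs) = length xs"
 by (simp add: lperm_def)

lemma lperm_nth: "i < length xs ==> lperm beta xs ! i = xs ! (pinv beta (Suc i) - 1)"
 by (simp add: lperm_def)

lemma lperm_id [simp]: "lperm id xs = xs"
 by (rule nth_equalityI) (auto simp: lperm_nth)

lemma lperm_set:
 assumes "beta permutes {1..length xs}"
 shows "set (lperm beta xs) = set xs"
proof -
 have "pinv beta permutes {1..length xs}" by (rule permutes_inv[OF assms])
 hence im: "pinv beta ` {1..length xs} = {1..length xs}" by (rule permutes_image)
 have "set (lperm beta xs) = (\<lambda>i. xs ! (pinv beta (Suc i) - 1)) ` {..<length xs}" by (auto simp: lperm_def)
 also have "\<dots> = (\<lambda>j. xs ! (j - 1)) ` pinv beta ` Suc ` {..<length xs}" by (auto simp: image_image)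
 also have S: "Suc ` {..<length xs} = {1..length xs}"
  by (rule image_Suc_lessThan)
 also have "(\<lambda>j. xs ! (j - 1)) ` pinv beta ` {1..length xs} = (\<lambda>j. xs ! (j - 1)) ` {1..length xs}"
  by (simp only: im)
 also have "\<dots> = set xs"
  unfolding S[symmetric] image_image by (auto simp: set_conv_nth)
 finally show ?thesis .
qed

lemma lperm_comp:
 assumes "beta permutes {1..length xs}" "beta' permutes {1..length xs}"
 shows "lperm beta (lperm beta' xs) = lperm (beta \<circ> beta') xs"
proof (rule nth_equalityI)
 fix i assume i: "i < length (lperm beta (lperm beta' xs))"
 have "pinv beta (Suc i) \<in> {1..length xs}" using i permutes_in_image[OF permutes_inv[OF assms(1)], of "Suc i"] by auto
 hence "pinv beta (Suc i) - 1 < length xs" "Suc (pinv beta (Suc i) - 1) = pinv beta (Suc i)" by auto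
 moreover have "pinv (beta \<circ> beta') = pinv beta' \<circ> pinv beta" using o_inv_distrib permutes_bij assms by blast
 ultimately show "lperm beta (lperm beta' xs) ! i = lperm (beta \<circ> beta') xs ! i" using i by (simp add: lperm_nth)
qed simp

lemma lperm_block:
 assumes "alpha permutes {1..length us}" "beta permutes {1..length xs}"
 shows "lperm (block_sum (length us) alpha beta) (us @ xs) = lperm alpha us @ lperm beta xs"
proof (rule nth_equalityI)
 fix i assume i: "i < length (lperm (block_sum (length us) alpha beta) (us @ xs))"
 show "lperm (block_sum (length us) alpha beta) (us @ xs) ! i = (lperm alpha us @ lperm beta xs) ! i"
 proof (cases "i < length us")
  case True
  hence "pinv alpha (Suc i) \<in> {1..length us}" using permutes_in_image[OF permutes_inv[OF assms(1)], of "Suc i"] by auto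
  thus ?thesis using True i unfolding lperm_nth[OF i[unfolded lperm_length]] inv_block_sum[OF assms]
   by (auto simp: block_sum_def nth_append lperm_nth)
 next
  case False
  hence "pinv beta (Suc i - length us) \<in> {1..length xs}"
   using i permutes_in_image[OF permutes_inv[OF assms(2)], of "Suc i - length us"] by auto
  thus ?thesis using False i unfolding lperm_nth[OF i[unfolded lperm_length]] inv_block_sum[OF assms]
   by (auto simp: block_sum_def nth_append lperm_nth Suc_diff_le)
 qed
qed simp

lemma in_sym_group: "alpha \<in> carrier (sym_group n) \<longleftrightarrow> alpha permutes {1..n}"
 by (simp add: sym_group_def)

section \<open>Equivariance and base points of the iterated structure maps\<close>

context omega
begin

lemma
 assumes "alpha permutes {1..n}"
 shows act_smap: "smap (lev E n) (lev E n) (act E n alpha)"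
  and act_bas: "act E n alpha (bas E n k) = bas E n k"
 using spec[unfolded symmetric_spectrum_def, THEN conjunct2, THEN conjunct2, THEN conjunct2, THEN conjunct1] assms
 unfolding in_sym_group[symmetric] by auto

lemma
 assumes "e \<in> cells (lev E n)"
 shows act_id: "act E n id e = e"
  and act_comp: "alpha permutes {1..n} ==> beta permutes {1..n} ==> act E n (alpha \<circ> beta) e = act E n alpha (act E n beta e)"
 using spec[unfolded symmetric_spectrum_def, THEN conjunct2, THEN conjunct2, THEN conjunct2, THEN conjunct2, THEN conjunct1] assms
 unfolding in_sym_group[symmetric] by auto

lemma act_simp: "alpha permutes {1..n} ==> e \<in> simp (lev E n) k ==> act E n alpha e \<in> simp (lev E n) k"
 using smapD[OF act_smap] unfolding simp_def by auto

lemma act_inv: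
 assumes "alpha permutes {1..n}" "e \<in> simp (lev E n) k"
 shows "act E n (pinv alpha) (act E n alpha e) = e"
proof -
 have e: "e \<in> cells (lev E n)" using assms(2) by (simp add: simp_def)
 show ?thesis using act_comp[OF e permutes_inv[OF assms(1)] assms(1)] permutes_inv_o(2)[OF assms(1)] act_id[OF e] by simp
qed

lemma act_eq_bas: "alpha permutes {1..n} ==> e \<in> simp (lev E n) k ==> act E n alpha e = bas E n k \<longleftrightarrow> e = bas E n k"
 using act_inv[of alpha n e k] act_bas[of alpha n k] act_bas[OF permutes_inv, of alpha n k] by auto

lemma sig_simp: "e \<in> simp (lev E n) k ==> t \<in> simp circle k ==> sig E n e t \<in> simp (lev E (Suc n)) k"
 using smapD(1,2)[OF sig_smap, of "(e, t)" n] unfolding simp_def by (auto simp: cells_sprod)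

lemma sigs_append: "sigs E n e (ts @ us) = sigs E (n + length ts) (sigs E n e ts) us"
 by (induction ts arbitrary: n e) auto

lemma sigs_simp: "e \<in> simp (lev E n) k ==> set ts \<subseteq> simp circle k ==> sigs E n e ts \<in> simp (lev E (n + length ts)) k"
proof (induction ts arbitrary: n e)
 case (Cons t ts)
 thus ?case using Cons.IH[of "sig E n e t" "Suc n"] sig_simp by auto
qed simp

lemma sig_bas': "t \<in> simp circle k ==> sig E n (bas E n k) t = bas E (Suc n) k"
 using sig_bas simp_circle by auto

lemma sig_base': "e \<in> simp (lev E n) k ==> sig E n e (circle_base k) = bas E (Suc n) k"
 using sig_base[of e n] by (auto simp: simp_def)

lemma sigs_bas: "set ts \<subseteq> simp circle k ==> sigs E n (bas E n k) ts = bas E (n + length ts) k"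
 by (induction ts arbitrary: n) (auto simp: sig_bas')

lemma sigs_base: "e \<in> simp (lev E n) k ==> set ts \<subseteq> simp circle k ==> circle_base k \<in> set ts ==>
  sigs E n e ts = bas E (n + length ts) k"
proof (induction ts arbitrary: n e)
 case (Cons t ts)
 show ?case
 proof (cases "t = circle_base k")
  case True
  thus ?thesis using Cons.prems sig_base'[of e n k] sigs_bas[of ts k "Suc n"] by simp
 next
  case False
  thus ?thesis using Cons.IH[of "sig E n e t" "Suc n"] Cons.prems sig_simp by auto
 qed
qed simp

lemma sigs_act:
 assumes "e \<in> simp (lev E n) k" "set ts \<subseteq> simp circle k" "alpha permutes {1..n}" "beta permutes {1..length ts}"
 shows "sigs E n (act E n alpha e) (lperm beta ts) = act E (n + length ts) (block_sum n alpha beta) (sigs E n e ts)"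
 by (rule spec[unfolded symmetric_spectrum_def, THEN conjunct2, THEN conjunct2, THEN conjunct2, THEN conjunct2,
  THEN conjunct2, THEN conjunct2, THEN conjunct2, THEN conjunct2, rule_format])
  (use assms in \<open>auto simp: in_sym_group\<close>)

lemma sigs_act_left:
 assumes "e \<in> simp (lev E n) k" "set ts \<subseteq> simp circle k" "alpha permutes {1..n}"
 shows "sigs E n (act E n alpha e) ts = act E (n + length ts) alpha (sigs E n e ts)"
 using sigs_act[OF assms permutes_id] block_sum_id_right[OF assms(3)] by simp

end

text \<open>
 A nonbasepoint simplex is \<open>tau(g; ts)\<close> with \<open>g\<close> outside the latching image and no base point among
 \<open>ts\<close>, uniquely up to block permutations.
\<close>

definition normal_form :: "'e symspec => nat => nat => 'e => 'e latch => bool" where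
 "normal_form E k N x = (\<lambda>(q, tau, g, ts). q \<le> N \<and> tau permutes {1..N} \<and> g \<in> simp (lev E q) k \<and> g \<noteq> bas E q k \<and>
   g \<notin> latch_map E q ` latch_pres E q k \<and> length ts = N - q \<and> set ts \<subseteq> simp circle k \<and> circle_base k \<notin> set ts \<and>
   x = act E N tau (sigs E q g ts))"

definition nf_eq :: "'e symspec => nat => 'e latch => 'e latch => bool" where
 "nf_eq E N = (\<lambda>(q, tau, g, ts) (q', tau', g', ts'). q = q' \<and> (\<exists>alpha beta. alpha permutes {1..q} \<and> beta permutes {1..N - q} \<and>
   tau = tau' \<circ> block_sum q alpha beta \<and> g' = act E q alpha g \<and> ts' = lperm beta ts))"

text \<open>Applied to a normal form of \<open>e\<close>, this is the normal form of
  \<open>act E n tau (sigs E p e ts)\<close>: new sphere coordinates are appended after those that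
  are already there.\<close>

definition compose_nf :: "(nat => nat) => nat list list => 'e latch => 'e latch" where
 "compose_nf tau ts = (\<lambda>(q, tau', g, ts'). (q, tau \<circ> tau', g, ts' @ ts))"

locale cof_omega = omega E for E :: "'e symspec" +
 assumes cof: "cofibrant E"
begin

lemma latch_eqI:
 "x \<in> latch_pres E n k ==> y \<in> latch_pres E n k ==> latch_map E n x = latch_map E n y ==> latch_eq E n k x y"
 using cof[unfolded cofibrant_def, THEN conjunct1] by blast

lemma latch_pres_iff: "(p, tau, e, ts) \<in> latch_pres E n k \<longleftrightarrow> p < n \<and> tau permutes {1..n} \<and> e \<in> simp (lev E p) k \<and>
    length ts = n - p \<and> set ts \<subseteq> simp circle k"
 unfolding latch_pres_def in_sym_group by simp

lemma perm_up: "alpha permutes {1..p} ==> p \<le> n ==> alpha permutes {1..n::nat}"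
 by (rule permutes_subset) auto

lemma normal_form_compose:
 assumes nf: "normal_form E k p e w" and p: "p \<le> n" "tau permutes {1..n}"
  and ts: "length ts = n - p" "set ts \<subseteq> simp circle k" "circle_base k \<notin> set ts"
 shows "normal_form E k n (act E n tau (sigs E p e ts)) (compose_nf tau ts w)"
proof -
 obtain q tau' g us where w: "w = (q, tau', g, us)" by (cases w) auto
 have a: "q \<le> p" "tau' permutes {1..p}" "g \<in> simp (lev E q) k" "length us = p - q" "set us \<subseteq> simp circle k"
  "e = act E p tau' (sigs E q g us)" using nf unfolding normal_form_def w by auto
 have s: "sigs E q g us \<in> simp (lev E p) k" using sigs_simp[OF a(3,5)] a by simp
 have "sigs E p e ts = act E n tau' (sigs E p (sigs E q g us) ts)"
  using sigs_act_left[OF s ts(2) a(2)] a(6) ts p by simp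
 also have "sigs E p (sigs E q g us) ts = sigs E q g (us @ ts)" using a by (simp add: sigs_append)
 finally have "act E n tau (sigs E p e ts) = act E n (tau \<circ> tau') (sigs E q g (us @ ts))"
  using act_comp[OF _ p(2) perm_up[OF a(2) p(1)], of "sigs E q g (us @ ts)"] sigs_simp[OF a(3), of "us @ ts"] a ts p
  by (simp add: simp_def)
 thus ?thesis using nf ts p a permutes_compose[OF perm_up[OF a(2) p(1)] p(2)]
  unfolding normal_form_def w compose_nf_def by auto
qed

text \<open>Induction on the level. A simplex in the latching image is a permuted suspension of some
  \<open>e\<close> from a lower level; as the simplex is not the base point, neither is
  \<open>e\<close> nor any of the sphere coordinates, and a normal form of \<open>e\<close> can be
  composed.\<close>

lemma normal_form_ex:
 assumes "x \<in> simp (lev E N) k" "x \<noteq> bas E N k"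
 shows "\<exists>w. normal_form E k N x w"
 using assms
proof (induction N arbitrary: x rule: less_induct)
 case (less N)
 show ?case
 proof (cases "x \<in> latch_map E N ` latch_pres E N k")
  case False
  hence "normal_form E k N x (N, id, x, [])" using less.prems act_id[of x N]
   unfolding normal_form_def by (auto simp: permutes_id simp_def)
  thus ?thesis by blast
 next
  case True
  then obtain p tau e ts where z: "(p, tau, e, ts) \<in> latch_pres E N k" "x = act E N tau (sigs E p e ts)"
   unfolding latch_map_def by auto
  hence p: "p < N" "tau permutes {1..N}" "e \<in> simp (lev E p) k" "length ts = N - p" "set ts \<subseteq> simp circle k"
   by (auto simp: latch_pres_iff)
  have "e \<noteq> bas E p k" using less.prems(2) z(2) sigs_bas[OF p(5), of p] p act_bas by auto
  then obtain w where "normal_form E k p e w" using less.IH p by blast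
  moreover have "circle_base k \<notin> set ts" using less.prems(2) z(2) sigs_base[OF p(3,5)] p act_bas by auto
  ultimately have "normal_form E k N x (compose_nf tau ts w)" using normal_form_compose[of k p e w N tau ts] p z(2) by simp
  thus ?thesis by blast
 qed
qed

lemma nf_eq_sym:
 assumes "nf_eq E N w w'" "normal_form E k N x w"
 shows "nf_eq E N w' w"
proof -
 obtain q tau g us where w: "w = (q, tau, g, us)" by (cases w) auto
 obtain q' tau' g' us' where w': "w' = (q', tau', g', us')" by (cases w') auto
 obtain alpha beta where a: "q = q'" "alpha permutes {1..q}" "beta permutes {1..N - q}" "tau = tau' \<circ> block_sum q alpha beta"
  "g' = act E q alpha g" "us' = lperm beta us" using assms(1) unfolding nf_eq_def w w' by auto
 have b: "g \<in> simp (lev E q) k" "length us = N - q" using assms(2) unfolding normal_form_def w by auto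
 have "block_sum q alpha beta \<circ> block_sum q (pinv alpha) (pinv beta) = id"
  using block_sum_comp[OF permutes_inv[OF a(2)] permutes_inv[OF a(3)], of alpha beta]
  by (simp add: permutes_inv_o(1)[OF a(2)] permutes_inv_o(1)[OF a(3)])
 hence "tau' = tau \<circ> block_sum q (pinv alpha) (pinv beta)" using a(4) by (simp add: comp_assoc)
 moreover have "us = lperm (pinv beta) us'"
  using lperm_comp[of "pinv beta" us beta] permutes_inv[OF a(3)] a(3,6) b permutes_inv_o(2)[OF a(3)] by simp
 moreover have "g = act E q (pinv alpha) g'" using act_inv[OF a(2) b(1)] a(5) by simp
 ultimately show ?thesis unfolding nf_eq_def w w' using a permutes_inv by auto
qed

lemma nf_eq_trans:
 assumes "nf_eq E N w w'" "nf_eq E N w' w''" "normal_form E k N x w"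
 shows "nf_eq E N w w''"
proof -
 obtain q tau g us where w: "w = (q, tau, g, us)" by (cases w) auto
 obtain q' tau' g' us' where w': "w' = (q', tau', g', us')" by (cases w') auto
 obtain q2 tau2 g2 us2 where w2: "w'' = (q2, tau2, g2, us2)" by (cases w'') auto
 obtain alpha beta where a: "q = q'" "alpha permutes {1..q}" "beta permutes {1..N - q}" "tau = tau' \<circ> block_sum q alpha beta"
  "g' = act E q alpha g" "us' = lperm beta us" using assms(1) unfolding nf_eq_def w w' by auto
 obtain alpha' beta' where a': "q' = q2" "alpha' permutes {1..q}" "beta' permutes {1..N - q}" "tau' = tau2 \<circ> block_sum q alpha' beta'"
  "g2 = act E q alpha' g'" "us2 = lperm beta' us'" using assms(2) a(1) unfolding nf_eq_def w2 w' by auto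
 have b: "g \<in> cells (lev E q)" "length us = N - q" using assms(3) unfolding normal_form_def w simp_def by auto
 have "tau = tau2 \<circ> block_sum q (alpha' \<circ> alpha) (beta' \<circ> beta)"
  using block_sum_comp[OF a(2,3), of alpha' beta'] a(4) a'(4) by (simp add: comp_assoc)
 moreover have "us2 = lperm (beta' \<circ> beta) us" using lperm_comp[of beta' us beta] a a' b by simp
 moreover have "g2 = act E q (alpha' \<circ> alpha) g" using act_comp[OF b(1) a'(2) a(2)] a a' by simp
 moreover have "alpha' \<circ> alpha permutes {1..q}" "beta' \<circ> beta permutes {1..N - q}"
  using permutes_compose[OF a(2) a'(2)] permutes_compose[OF a(3) a'(3)] by auto
 ultimately show ?thesis unfolding nf_eq_def w w2 prod.case using a(1) a'(1) by blast
qed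

lemma nf_eq_compose:
 assumes "nf_eq E p w w'" "normal_form E k p e w" "p \<le> n" "length ts = n - p"
 shows "nf_eq E n (compose_nf tau ts w) (compose_nf tau ts w')"
proof -
 obtain q tau1 g us where w: "w = (q, tau1, g, us)" by (cases w) auto
 obtain q' tau' g' us' where w': "w' = (q', tau', g', us')" by (cases w') auto
 obtain alpha beta where a: "q = q'" "alpha permutes {1..q}" "beta permutes {1..p - q}" "tau1 = tau' \<circ> block_sum q alpha beta"
  "g' = act E q alpha g" "us' = lperm beta us" using assms(1) unfolding nf_eq_def w w' by auto
 have b: "q \<le> p" "length us = p - q" using assms(2) unfolding normal_form_def w by auto
 have "lperm beta (us @ ts) = us' @ ts"
  using lperm_block[of beta us id ts] a b block_sum_id_right[OF a(3)] by (simp add: permutes_id)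
 moreover have "beta permutes {1..n - q}" using perm_up[OF a(3), of "n - q"] assms(3) by simp
 moreover have "tau \<circ> tau1 = tau \<circ> tau' \<circ> block_sum q alpha beta" using a(4) by (simp only: comp_assoc)
 ultimately show ?thesis unfolding nf_eq_def w w' compose_nf_def prod.case using a(1,2,5)
  by (intro conjI exI[of _ alpha] exI[of _ beta]) auto
qed

lemma latch_eq_pres:
 assumes "latch_eq E n k x y"
 shows "x \<in> latch_pres E n k \<and> y \<in> latch_pres E n k"
 using assms
proof induction
 case (perm p tau e ts alpha beta)
 hence p: "p < n" "tau permutes {1..n}" "e \<in> simp (lev E p) k" "length ts = n - p" "set ts \<subseteq> simp circle k"
  "alpha permutes {1..p}" "beta permutes {1..n - p}" by (auto simp: latch_pres_iff in_sym_group)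
 have "block_sum p alpha beta permutes {1..n}" using block_sum_permutes[OF p(6,7)] p(1) by simp
 thus ?case using p act_simp lperm_set[of beta ts] permutes_compose[of "block_sum p alpha beta" "{1..n}" tau]
  unfolding latch_pres_iff by simp
next
 case (shift p tau e t ts)
 thus ?case using sig_simp unfolding latch_pres_iff by auto
qed auto

text \<open>Being a base point and the composed normal form are invariants of each generating
  relation. The two assumptions concern lower levels only: \<open>U\<close> makes the normal form of
  an entry well defined, and \<open>sb\<close> is needed for the shift relation, which might
  otherwise turn a nonbase tuple into a base one.\<close>

lemma latch_invariant:
 assumes U: "!!p x w w'. p < n ==> normal_form E k p x w ==> normal_form E k p x w' ==> nf_eq E p w w'"
  and sb: "!!p e t. Suc p < n ==> e \<in> simp (lev E p) k ==> t \<in> simp circle k ==> sig E p e t = bas E (Suc p) k ==>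
    e = bas E p k \<or> t = circle_base k"
  and "latch_eq E n k x y"
 shows "(latch_base E k x \<longleftrightarrow> latch_base E k y) \<and> (\<not> latch_base E k x -->
   (case (x, y) of ((p, tau, e, ts), (p', tau', e', ts')) => \<forall>w w'. normal_form E k p e w --> normal_form E k p' e' w' -->
    nf_eq E n (compose_nf tau ts w) (compose_nf tau' ts' w')))"
 using assms(3)
proof induction
 case (refl x)
 obtain p tau e ts where x: "x = (p, tau, e, ts)" by (cases x) auto
 hence p: "p < n" "length ts = n - p" using refl by (auto simp: latch_pres_iff)
 show ?case unfolding x using nf_eq_compose[OF U[OF p(1)], of _ _ _ k] p by auto
next
 case (sym x y)
 obtain p tau e ts where x: "x = (p, tau, e, ts)" by (cases x) auto
 obtain p' tau' e' ts' where y: "y = (p', tau', e', ts')" by (cases y) auto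
 have xp: "p < n" "tau permutes {1..n}" "length ts = n - p" "set ts \<subseteq> simp circle k"
  using latch_eq_pres[OF sym.hyps] x by (auto simp: latch_pres_iff)
 have "nf_eq E n (compose_nf tau' ts' w') (compose_nf tau ts w)"
  if a: "\<not> latch_base E k y" "normal_form E k p' e' w'" "normal_form E k p e w" for w w'
 proof -
  have "nf_eq E n (compose_nf tau ts w) (compose_nf tau' ts' w')" using sym.IH a x y by auto
  moreover have "circle_base k \<notin> set ts" using sym.IH a x by (auto simp: latch_base_def)
  ultimately show ?thesis using nf_eq_sym normal_form_compose[OF a(3), of n tau ts] xp by auto
 qed
 thus ?case using sym.IH x y by auto
next
 case (trans x y z)
 obtain p tau e ts where x: "x = (p, tau, e, ts)" by (cases x) auto
 obtain p' tau' e' ts' where y: "y = (p', tau', e', ts')" by (cases y) auto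
 obtain p2 tau2 e2 ts2 where z: "z = (p2, tau2, e2, ts2)" by (cases z) auto
 have xp: "p < n" "tau permutes {1..n}" "length ts = n - p" "set ts \<subseteq> simp circle k"
  using latch_eq_pres[OF trans.hyps(1)] x by (auto simp: latch_pres_iff)
 have yp: "e' \<in> simp (lev E p') k" using latch_eq_pres[OF trans.hyps(1)] y by (auto simp: latch_pres_iff)
 have "nf_eq E n (compose_nf tau ts w) (compose_nf tau2 ts2 w2)"
  if a: "\<not> latch_base E k x" "normal_form E k p e w" "normal_form E k p2 e2 w2" for w w2
 proof -
  \<comment> \<open>Base tuples correspond to base tuples, so the intermediate tuple is not one; its
    entry has a normal form, through which the two outer ones are compared.\<close>
  have nb: "\<not> latch_base E k y" using trans.IH a by auto
  then obtain w' where w': "normal_form E k p' e' w'" using normal_form_ex[OF yp] y by (auto simp: latch_base_def)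
  have "nf_eq E n (compose_nf tau ts w) (compose_nf tau' ts' w')" "nf_eq E n (compose_nf tau' ts' w') (compose_nf tau2 ts2 w2)"
   using trans.IH a nb w' x y z by auto
  moreover have "circle_base k \<notin> set ts" using a x by (auto simp: latch_base_def)
  ultimately show ?thesis using nf_eq_trans normal_form_compose[OF a(2), of n tau ts] xp by auto
 qed
 thus ?case using trans.IH x z by auto
next
 case (base x y)
 thus ?case by auto
next
 case (perm p tau e ts alpha beta)
 hence p: "p < n" "tau permutes {1..n}" "e \<in> simp (lev E p) k" "length ts = n - p" "set ts \<subseteq> simp circle k"
  "alpha permutes {1..p}" "beta permutes {1..n - p}" by (auto simp: latch_pres_iff in_sym_group)
 have b: "latch_base E k (p, tau \<circ> block_sum p alpha beta, e, ts) \<longleftrightarrow> latch_base E k (p, tau, act E p alpha e, lperm beta ts)"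
  using act_eq_bas[OF p(6,3)] lperm_set[of beta ts] p unfolding latch_base_def by simp
 have "nf_eq E n (compose_nf (tau \<circ> block_sum p alpha beta) ts w) (compose_nf tau (lperm beta ts) w')"
  if nb: "circle_base k \<notin> set ts" and w: "normal_form E k p e w" "normal_form E k p (act E p alpha e) w'" for w w'
 proof -
  obtain q tau1 g us where ww: "w = (q, tau1, g, us)" by (cases w) auto
  have q: "q \<le> p" "tau1 permutes {1..p}" "g \<in> simp (lev E q) k" "length us = p - q" "set us \<subseteq> simp circle k"
   "e = act E p tau1 (sigs E q g us)" using w(1) unfolding normal_form_def ww by auto
  let ?w = "(q, alpha \<circ> tau1, g, us)"
  have "act E p alpha e = act E p (alpha \<circ> tau1) (sigs E q g us)"
   using act_comp[OF _ p(6) q(2), of "sigs E q g us"] sigs_simp[OF q(3,5)] q by (simp add: simp_def)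
  hence nw: "normal_form E k p (act E p alpha e) ?w"
   using w(1) permutes_compose[OF q(2) p(6)] unfolding normal_form_def ww by auto
  have e2: "nf_eq E n (compose_nf tau (lperm beta ts) ?w) (compose_nf tau (lperm beta ts) w')"
   using nf_eq_compose[OF U[OF p(1) nw w(2)] nw, of n "lperm beta ts" tau] p by simp
  \<comment> \<open>In the composed form the last \<open>p - q\<close> coordinates of level
    \<open>p\<close> have become sphere coordinates too, so \<open>beta\<close> now acts after an
    identity block of that length.\<close>
  have bq: "block_sum (p - q) id beta permutes {1..n - q}"
   using block_sum_permutes[OF permutes_id p(7), of "p - q"] p(1) q(1) by simp
  have "block_sum p alpha beta \<circ> tau1 = block_sum p alpha beta \<circ> block_sum p tau1 id" using block_sum_id_right[OF q(2)] by simp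
  also have "\<dots> = block_sum p (alpha \<circ> tau1) beta" using block_sum_comp[OF q(2) permutes_id] by simp
  also have "\<dots> = block_sum p (alpha \<circ> tau1) id \<circ> block_sum p id beta" using block_sum_comp[OF permutes_id p(7), of p "alpha \<circ> tau1" id] by simp
  also have "\<dots> = alpha \<circ> tau1 \<circ> block_sum p id beta" using block_sum_id_right[OF permutes_compose[OF q(2) p(6)]] by simp
  also have "block_sum p id beta = block_sum q id (block_sum (p - q) id beta)"
   using q(1) by (auto simp: block_sum_def fun_eq_iff)
  finally have "tau \<circ> (block_sum p alpha beta \<circ> tau1) = tau \<circ> (alpha \<circ> tau1 \<circ> block_sum q id (block_sum (p - q) id beta))"
   by (simp only:)
  hence "tau \<circ> block_sum p alpha beta \<circ> tau1 = tau \<circ> (alpha \<circ> tau1) \<circ> block_sum q id (block_sum (p - q) id beta)"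
   by (simp only: comp_assoc)
  moreover have "us @ lperm beta ts = lperm (block_sum (p - q) id beta) (us @ ts)"
   using lperm_block[of id us beta ts] p q by (simp add: permutes_id)
  moreover have "g = act E q id g" using act_id q by (simp add: simp_def)
  ultimately have e1: "nf_eq E n (compose_nf (tau \<circ> block_sum p alpha beta) ts w) (compose_nf tau (lperm beta ts) ?w)"
   unfolding nf_eq_def ww compose_nf_def prod.case using bq permutes_id
   by (intro conjI exI[of _ id] exI[of _ "block_sum (p - q) id beta"]) auto
  have "block_sum p alpha beta permutes {1..n}" using block_sum_permutes[OF p(6,7)] p(1) by simp
  hence "tau \<circ> block_sum p alpha beta permutes {1..n}" using permutes_compose p(2) by blast
  thus ?thesis using nf_eq_trans[OF e1 e2 normal_form_compose[OF w(1)]] p nb by simp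
 qed
 thus ?case using b by (auto simp: latch_base_def)
next
 case (shift p tau e t ts)
 hence p: "Suc p < n" "tau permutes {1..n}" "e \<in> simp (lev E p) k" "length (t # ts) = n - p" "t \<in> simp circle k"
  "set ts \<subseteq> simp circle k" by (auto simp: latch_pres_iff)
 have b: "latch_base E k (p, tau, e, t # ts) \<longleftrightarrow> latch_base E k (Suc p, tau, sig E p e t, ts)"
  using sb[OF p(1,3,5)] sig_bas'[OF p(5)] sig_base'[OF p(3)] unfolding latch_base_def by auto
 have *: "nf_eq E n (compose_nf tau (t # ts) w) (compose_nf tau ts w')"
  if nb: "circle_base k \<noteq> t" and w: "normal_form E k p e w" "normal_form E k (Suc p) (sig E p e t) w'" for w w'
 proof -
  have "sig E p e t \<in> cells (lev E (Suc p))" using sig_simp[OF p(3,5)] by (simp add: simp_def)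
  hence nw: "normal_form E k (Suc p) (sig E p e t) (compose_nf id [t] w)"
   using normal_form_compose[OF w(1), of "Suc p" id "[t]"] p nb permutes_id act_id by simp
  have "compose_nf tau (t # ts) w = compose_nf tau ts (compose_nf id [t] w)"
   by (cases w) (auto simp: compose_nf_def)
  thus ?thesis using nf_eq_compose[OF U[OF p(1) nw w(2)] nw, of n ts tau] p by simp
 qed
 show ?case
 proof (intro conjI impI b)
  assume "\<not> latch_base E k (p, tau, e, t # ts)"
  hence "circle_base k \<noteq> t" by (auto simp: latch_base_def)
  thus "case ((p, tau, e, t # ts), (Suc p, tau, sig E p e t, ts)) of ((p, tau, e, ts), (p', tau', e', ts')) =>
    \<forall>w w'. normal_form E k p e w --> normal_form E k p' e' w' -->
    nf_eq E n (compose_nf tau ts w) (compose_nf tau' ts' w')"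
   using * unfolding prod.case by blast
 qed
qed

text \<open>Both claims are proved by one induction, because \<open>latch_invariant\<close> in level
  \<open>N\<close> uses both in lower levels. Cofibrancy enters through \<open>latch_eqI\<close>:
  tuples with the same value under the latching map are related by the generating relations.\<close>

lemma nf_unique_and_sig:
 "(\<forall>x w w'. normal_form E k N x w --> normal_form E k N x w' --> nf_eq E N w w') \<and>
  (\<forall>p e t. Suc p = N --> e \<in> simp (lev E p) k --> t \<in> simp circle k --> sig E p e t = bas E (Suc p) k -->
    e = bas E p k \<or> t = circle_base k)"
proof (induction N rule: less_induct)
 case (less N)
 have inv: "(latch_base E k x \<longleftrightarrow> latch_base E k y) \<and> (\<not> latch_base E k x -->
   (case (x, y) of ((p, tau, e, ts), (p', tau', e', ts')) => \<forall>w w'. normal_form E k p e w --> normal_form E k p' e' w' -->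
    nf_eq E N (compose_nf tau ts w) (compose_nf tau' ts' w')))" if "latch_eq E N k x y" for x y
  by (rule latch_invariant[OF _ _ that]) (use less.IH in blast)+
 show ?case
 proof (intro conjI allI impI)
  fix x w w' assume nf: "normal_form E k N x w" "normal_form E k N x w'"
  obtain q tau g ts where w: "w = (q, tau, g, ts)" by (cases w) auto
  obtain q' tau' g' ts' where w': "w' = (q', tau', g', ts')" by (cases w') auto
  have a: "q \<le> N" "tau permutes {1..N}" "g \<in> simp (lev E q) k" "g \<noteq> bas E q k" "g \<notin> latch_map E q ` latch_pres E q k"
   "length ts = N - q" "set ts \<subseteq> simp circle k" "circle_base k \<notin> set ts" "x = act E N tau (sigs E q g ts)"
   using nf(1) unfolding normal_form_def w by auto
  have a': "q' \<le> N" "tau' permutes {1..N}" "g' \<in> simp (lev E q') k" "g' \<noteq> bas E q' k" "g' \<notin> latch_map E q' ` latch_pres E q' k"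
   "length ts' = N - q'" "set ts' \<subseteq> simp circle k" "circle_base k \<notin> set ts'" "x = act E N tau' (sigs E q' g' ts')"
   using nf(2) unfolding normal_form_def w' by auto
  \<comment> \<open>A normal form whose first entry lives in level \<open>N\<close> itself excludes
    one from a lower level, which would put that entry into the latching image. So the two forms
    either both live in level \<open>N\<close> or are both latching tuples.\<close>
  have top: "r = N" if "normal_form E k N x (N, \<sigma>, h, [])" "normal_form E k N x (r, \<sigma>', h', us)" for r \<sigma> h \<sigma>' h' us
  proof (rule ccontr)
   assume "r \<noteq> N"
   hence z: "(r, pinv \<sigma> \<circ> \<sigma>', h', us) \<in> latch_pres E N k"
    using that permutes_compose[of \<sigma>' "{1..N}" "pinv \<sigma>"] permutes_inv[of \<sigma> "{1..N}"]
    unfolding normal_form_def latch_pres_iff by auto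
   have c: "sigs E r h' us \<in> cells (lev E N)"
    using that(2) sigs_simp[of h' r k us] unfolding normal_form_def simp_def by auto
   have "h = act E N (pinv \<sigma>) x" using that(1) act_inv unfolding normal_form_def by auto
   also have "\<dots> = latch_map E N (r, pinv \<sigma> \<circ> \<sigma>', h', us)"
    using that act_comp[OF c permutes_inv, of \<sigma> \<sigma>'] unfolding normal_form_def latch_map_def by auto
   finally show False using that(1) z unfolding normal_form_def by blast
  qed
  show "nf_eq E N w w'"
  proof (cases "q = N")
   case True
   hence t: "ts = []" using a by simp
   hence q': "q' = N" using top[of tau g q' tau' g' ts'] nf True w w' by simp
   hence t': "ts' = []" using a' by simp
   have g: "g \<in> cells (lev E N)" using a(3) True by (simp add: simp_def)
   have "act E N tau' g' = act E N tau g" using a(9) a'(9) True q' t t' by simp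
   hence "g' = act E N (pinv tau' \<circ> tau) g"
    using act_inv[OF a'(2), of g' k] a'(3) q' act_comp[OF g permutes_inv[OF a'(2)] a(2)] by simp
   moreover have "tau = tau' \<circ> block_sum N (pinv tau' \<circ> tau) id"
    using block_sum_id_right[OF permutes_compose[OF a(2) permutes_inv[OF a'(2)]]] permutes_inv_o(1)[OF a'(2)]
    by (simp add: comp_assoc[symmetric])
   ultimately show ?thesis unfolding nf_eq_def w w'
    unfolding prod.case using True q' t t' permutes_compose[OF a(2) permutes_inv[OF a'(2)]] permutes_id
    by (intro conjI exI[of _ "pinv tau' \<circ> tau"] exI[of _ id]) simp_all
  next
   case False
   have q': "q' \<noteq> N"
   proof
    assume "q' = N"
    thus False using top[of tau' g' q tau g ts] nf w w' a'(6) False by simp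
   qed
   have l: "w \<in> latch_pres E N k" "w' \<in> latch_pres E N k" using a a' False q' unfolding w w' latch_pres_iff by auto
   have "latch_map E N w = latch_map E N w'" using a(9) a'(9) unfolding w w' latch_map_def by simp
   hence le: "latch_eq E N k w w'" by (rule latch_eqI[OF l])
   have nb: "\<not> latch_base E k w" using a unfolding w latch_base_def by simp
   have "normal_form E k q g (q, id, g, [])" "normal_form E k q' g' (q', id, g', [])"
    using a a' act_id permutes_id unfolding normal_form_def simp_def by auto
   hence "nf_eq E N (compose_nf tau ts (q, id, g, [])) (compose_nf tau' ts' (q', id, g', []))"
    using inv[OF le] nb unfolding w w' by auto
   thus ?thesis unfolding w w' compose_nf_def by simp
  qed
 next
  fix p e t assume p: "Suc p = N" "e \<in> simp (lev E p) k" "t \<in> simp circle k" "sig E p e t = bas E (Suc p) k"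
  have bs: "bas E p k \<in> simp (lev E p) k" using basD by (simp add: simp_def)
  \<comment> \<open>Compare with the tuple having the base point in place of \<open>e\<close>: it
    has the same value, and it is a base tuple, so \<open>(p, id, e, [t])\<close> is one
    too.\<close>
  have l: "(p, id, e, [t]) \<in> latch_pres E N k" "(p, id, bas E p k, [t]) \<in> latch_pres E N k"
   using p bs permutes_id unfolding latch_pres_iff by auto
  have "latch_map E N (p, id, e, [t]) = latch_map E N (p, id, bas E p k, [t])"
   using p sig_bas'[OF p(3), of p] unfolding latch_map_def by simp
  hence "latch_base E k (p, id, e, [t])"
   using inv[OF latch_eqI[OF l]] unfolding latch_base_def by auto
  thus "e = bas E p k \<or> t = circle_base k" unfolding latch_base_def by auto
 qed
qed

lemma sig_eq_bas:
 assumes "e \<in> simp (lev E n) k" "t \<in> simp circle k" "sig E n e t = bas E (Suc n) k"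
 shows "e = bas E n k \<or> t = circle_base k"
 using nf_unique_and_sig[of k "Suc n"] assms by blast

text \<open>Appending \<open>t\<close> and \<open>t'\<close> to normal forms of \<open>e\<close> and
  \<open>e'\<close> gives two normal forms of the same simplex, hence a block permutation between
  them. It turns out to fix the appended coordinate.\<close>

lemma sig_inj:
 assumes e: "e \<in> simp (lev E n) k" "e' \<in> simp (lev E n) k" and t: "t \<in> simp circle k" "t' \<in> simp circle k"
  and eq: "sig E n e t = sig E n e' t'" and nb: "sig E n e t \<noteq> bas E (Suc n) k"
 shows "e = e' \<and> t = t'"
proof -
 let ?x = "(n, id, e, [t])" and ?y = "(n, id, e', [t'])"
 have nbx: "e \<noteq> bas E n k" "t \<noteq> circle_base k" "e' \<noteq> bas E n k" "t' \<noteq> circle_base k"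
  using nb eq sig_bas' sig_base' e t by auto
 obtain w w' where nf: "normal_form E k n e w" "normal_form E k n e' w'" using normal_form_ex e nbx by metis
 have l: "?x \<in> latch_pres E (Suc n) k" "?y \<in> latch_pres E (Suc n) k"
  using e t permutes_id unfolding latch_pres_iff by auto
 have le: "latch_eq E (Suc n) k ?x ?y" by (rule latch_eqI[OF l]) (use eq in \<open>simp add: latch_map_def\<close>)
 have "(latch_base E k ?x \<longleftrightarrow> latch_base E k ?y) \<and> (\<not> latch_base E k ?x -->
   (case (?x, ?y) of ((p, tau, e, ts), (p', tau', e', ts')) => \<forall>w w'. normal_form E k p e w --> normal_form E k p' e' w' -->
    nf_eq E (Suc n) (compose_nf tau ts w) (compose_nf tau' ts' w')))"
  by (rule latch_invariant[OF _ _ le]) (use nf_unique_and_sig in blast)+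
 hence nq: "nf_eq E (Suc n) (compose_nf id [t] w) (compose_nf id [t'] w')"
  using nbx nf unfolding latch_base_def by auto
 obtain q tau g ts where w: "w = (q, tau, g, ts)" by (cases w) auto
 obtain q' tau' g' ts' where w': "w' = (q', tau', g', ts')" by (cases w') auto
 have a: "q \<le> n" "tau permutes {1..n}" "g \<in> simp (lev E q) k" "length ts = n - q" "set ts \<subseteq> simp circle k"
  "e = act E n tau (sigs E q g ts)" using nf(1) unfolding normal_form_def w by auto
 have a': "tau' permutes {1..n}" "length ts' = n - q'" "e' = act E n tau' (sigs E q' g' ts')"
  using nf(2) unfolding normal_form_def w' by auto
 obtain alpha beta where b: "q = q'" "alpha permutes {1..q}" "beta permutes {1..Suc n - q}" "tau = tau' \<circ> block_sum q alpha beta"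
  "g' = act E q alpha g" "ts' @ [t'] = lperm beta (ts @ [t])"
  using nq unfolding nf_eq_def compose_nf_def w w' by auto
 \<comment> \<open>\<open>tau\<close> and \<open>tau'\<close> are permutations of the first
   \<open>n\<close> letters only, so the block permutation relating them fixes \<open>Suc n\<close>.
   Hence \<open>beta\<close> fixes its last letter, and the relation restricts to the forms of
   \<open>e\<close> and \<open>e'\<close>.\<close>
 have "tau' (block_sum q alpha beta (Suc n)) = Suc n" using b(4) permutes_not_in[OF a(2), of "Suc n"] by (simp add: fun_eq_iff)
 hence "block_sum q alpha beta (Suc n) = Suc n"
  using permutes_not_in[OF a'(1), of "Suc n"] permutes_inj[OF a'(1)] by (metis atLeastAtMost_iff injD not_less_eq_eq order_refl)
 hence betan: "beta (Suc n - q) = Suc n - q" using a(1) by (auto simp: block_sum_def split: if_splits)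
 have beta: "beta permutes {1..n - q}"
 proof (rule permutes_superset[OF b(3)])
  fix x assume "x \<in> {1..Suc n - q} - {1..n - q}"
  hence "x = Suc n - q" using a(1) by auto
  thus "beta x = x" using betan by simp
 qed
 have "ts' @ [t'] = lperm beta ts @ [t]"
  using b(6) lperm_block[of beta ts id "[t]"] a(4) beta block_sum_id_right[OF beta] permutes_id by simp
 hence tt: "ts' = lperm beta ts" "t' = t" by auto
 have c: "sigs E q g ts \<in> cells (lev E n)" using sigs_simp[OF a(3,5)] a by (simp add: simp_def)
 have bp: "block_sum q alpha beta permutes {1..n}" using block_sum_permutes[OF b(2) beta] a(1) by simp
 have "e = act E n tau' (act E n (block_sum q alpha beta) (sigs E q g ts))"
  using a(6) b(4) act_comp[OF c a'(1) bp] by simp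
 also have "act E n (block_sum q alpha beta) (sigs E q g ts) = sigs E q g' ts'"
  using sigs_act[OF a(3,5) b(2), of beta] beta a(1,4) b(5) tt by simp
 finally show ?thesis using a'(3) b(1) tt by simp
qed

end

section \<open>Summation along the fibres of a finite cover\<close>

lemma fibD:
 assumes "finite_cover Y X p" "y \<in> fib Y p x"
 shows "y \<in> cells Y" "p y = x" "sdim Y y = sdim X x"
 using assms smapD(2)[of Y X p y] unfolding fib_def finite_cover_def by auto

lemma fib_opr:
 assumes "finite_cover Y X p" "x \<in> cells X" "th \<in> ops m (sdim X x)"
 shows "bij_betw (opr Y th) (fib Y p x) (fib Y p (opr X th x))"
 using assms unfolding finite_cover_def simp_def by blast

lemma finite_fib: "finite_cover Y X p ==> x \<in> cells X ==> finite (fib Y p x)"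
 unfolding finite_cover_def by blast

text \<open>Maps of sequential spectra from \<open>Y\<^sub>+ \<and> E\<close> to \<open>E\<close>, and their extensions over the subcomplex \<open>A\<close> of \<open>X\<close>.\<close>

definition pmap :: "'e symspec => 'y sset => (nat => 'y => 'e => 'e) => bool" where
 "pmap E Y phi \<longleftrightarrow> (\<forall>n. \<forall>y\<in>cells Y. \<forall>e\<in>simp (lev E n) (sdim Y y). phi n y e \<in> simp (lev E n) (sdim Y y) \<and>
   (\<forall>l. \<forall>th\<in>ops l (sdim Y y). phi n (opr Y th y) (opr (lev E n) th e) = opr (lev E n) th (phi n y e)) \<and>
   phi n y (bas E n (sdim Y y)) = bas E n (sdim Y y) \<and>
   (\<forall>t\<in>simp circle (sdim Y y). phi (Suc n) y (sig E n e t) = sig E n (phi n y e) t))"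

text \<open>The conditions at one simplex \<open>x\<close> and one operator \<open>th\<close>, for a
  value \<open>v\<close> at \<open>x\<close> and a value \<open>v'\<close> at the simplex obtained
  by \<open>th\<close>. In this shape they can serve as the relation in \<open>extend_cells\<close>;
  \<open>length th - 1\<close> is the dimension of the new simplex.\<close>

definition qcell :: "'e symspec => 'y sset => 'x sset => ('y => 'x) => (nat => 'y => 'e => 'e) =>
  nat list => 'x => (nat => ('y => 'e) => 'e) => (nat => ('y => 'e) => 'e) => bool" where
 "qcell E Y X p phi th x v v' \<longleftrightarrow> (\<forall>n. \<forall>u \<in> fib Y p x \<rightarrow>\<^sub>E simp (lev E n) (sdim X x).
   v n u \<in> simp (lev E n) (sdim X x) \<and>
   (\<forall>u' \<in> fib Y p (opr X th x) \<rightarrow>\<^sub>E simp (lev E n) (length th - 1).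
    (\<forall>y\<in>fib Y p x. u' (opr Y th y) = opr (lev E n) th (u y)) --> v' n u' = opr (lev E n) th (v n u)) \<and>
   ((\<forall>y\<in>fib Y p x. u y = bas E n (sdim X x)) --> v n u = bas E n (sdim X x)) \<and>
   (\<forall>y\<in>fib Y p x. (\<forall>z\<in>fib Y p x - {y}. u z = bas E n (sdim X x)) --> v n u = phi n y (u y)) \<and>
   (\<forall>t\<in>simp circle (sdim X x). v (Suc n) (\<lambda>y\<in>fib Y p x. sig E n (u y) t) = sig E n (v n u) t))"

definition qmap :: "'e symspec => 'y sset => 'x sset => ('y => 'x) => 'x set => (nat => 'y => 'e => 'e) =>
  (nat => 'x => ('y => 'e) => 'e) => bool" where
 "qmap E Y X p A phi s \<longleftrightarrow> (\<forall>x\<in>A. \<forall>l. \<forall>th\<in>ops l (sdim X x).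
   qcell E Y X p phi th x (\<lambda>n. s n x) (\<lambda>n. s n (opr X th x)))"

lemma fibre_sum_iff:
 "fibre_sum E Y X p s \<longleftrightarrow> finite_cover Y X p \<and> qmap E Y X p (cells X) (\<lambda>n y e. e) s" (is "?L \<longleftrightarrow> ?C \<and> ?R")
proof
 assume L: ?L
 hence "qmap E Y X p (cells X) (\<lambda>n y e. e) s"
  unfolding fibre_sum_def qmap_def qcell_def simp_def by (auto simp: ops_length)
 thus "?C \<and> ?R" using L unfolding fibre_sum_def by blast
next
 assume R: "?C \<and> ?R"
 show ?L unfolding fibre_sum_def
 proof (intro conjI allI ballI)
  fix n k x u assume x: "x \<in> simp X k" and u: "u \<in> fib Y p x \<rightarrow>\<^sub>E simp (lev E n) k"
  have x': "x \<in> cells X" "sdim X x = k" using x by (auto simp: simp_def)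
  have q: "qcell E Y X p (\<lambda>n y e. e) th x (\<lambda>n. s n x) (\<lambda>n. s n (opr X th x))" if "th \<in> ops l k" for l th
   using R x' that unfolding qmap_def by blast
  note q0 = q[OF idl_ops, unfolded qcell_def, rule_format, of u n]
  show "s n x u \<in> simp (lev E n) k" using q0 u x' by blast
  show "(\<forall>y\<in>fib Y p x. u y = bas E n k) --> s n x u = bas E n k" using q0 u x' by blast
  show "(\<forall>z\<in>fib Y p x - {y}. u z = bas E n k) --> s n x u = u y" if "y \<in> fib Y p x" for y using q0 u x' that by blast
  show "s (Suc n) x (\<lambda>y\<in>fib Y p x. sig E n (u y) t) = sig E n (s n x u) t" if "t \<in> simp circle k" for t
   using q0 u x' that by blast
  show "(\<forall>y\<in>fib Y p x. u' (opr Y th y) = opr (lev E n) th (u y)) --> s n (opr X th x) u' = opr (lev E n) th (s n x u)"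
   if th: "th \<in> ops l k" and u': "u' \<in> fib Y p (opr X th x) \<rightarrow>\<^sub>E simp (lev E n) l" for l th u'
   using q[OF th, unfolded qcell_def, rule_format, of u n] u u' x' length_ops[OF th] by simp
 qed (use R in blast)
qed

section \<open>Tuples over a standard simplex, filtered by their support\<close>

context cof_omega
begin

lemma bas_simp [simp]: "bas E n k \<in> simp (lev E n) k"
 using basD by (simp add: simp_def)

lemma sg_simp: "e \<in> simp (lev E n) k ==> t \<in> ops k 1 ==> sg E n e t \<in> simp (lev E (Suc n)) k"
 using sgD[of e n t] by (auto simp: simp_def)

lemma cl_circle: "t \<in> ops k 1 ==> cl t \<in> simp circle k"
 by (simp add: simp_circle cl_ops zero_in_cl)

lemma sg_cst: "e \<in> simp (lev E n) k ==> sg E n e (cst i k) = bas E (Suc n) k"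
 using sg_base by (auto simp: simp_def)

lemma sg_eq_bas: "e \<in> simp (lev E n) k ==> t \<in> ops k 1 ==> t \<noteq> cst 0 k ==> t \<noteq> cst 1 k ==>
  sg E n e t = bas E (Suc n) k \<longleftrightarrow> e = bas E n k"
 using sig_eq_bas[OF _ cl_circle, of e n k t] cl_cases[of t k] sg_bas[of t k n] by (auto simp: sg_def)

lemma sg_inj:
 assumes e: "e \<in> simp (lev E n) k" "e' \<in> simp (lev E n) k" and t: "t \<in> ops k 1" "t' \<in> ops k 1"
  and eq: "sg E n e t = sg E n e' t'" and nb: "sg E n e t \<noteq> bas E (Suc n) k"
 shows "e = e' \<and> t = t'"
proof -
 have "t \<noteq> cst 1 k" "t' \<noteq> cst 1 k" using nb eq sg_cst e by auto
 hence "cl t = t" "cl t' = t'" using cl_cases t by blast+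
 thus ?thesis using sig_inj[OF e cl_circle[OF t(1)] cl_circle[OF t(2)]] eq nb by (simp add: sg_def)
qed

lemma map2_min_ops: "x \<in> ops m 1 ==> y \<in> ops m 1 ==> map2 min x y \<in> ops m 1"
 unfolding ops_iff by (auto simp: min_le_iff_disj)

lemma map2_min_pull: "x \<in> ops m 1 ==> y \<in> ops m 1 ==> th \<in> ops l m ==> map2 min (x \<odot> th) (y \<odot> th) = map2 min x y \<odot> th"
 by (rule nth_equalityI) (auto simp: ops_iff less_Suc_eq_le)

lemma map2_min_cst1: "x \<in> ops m 1 ==> map2 min x (cst 1 m) = x"
 by (rule nth_equalityI) (auto simp: ops_iff less_Suc_eq_le min_def)

lemma map2_min_cst0: "x \<in> ops m 1 ==> map2 min x (cst 0 m) = cst 0 m"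
 by (rule nth_equalityI) (auto simp: ops_iff less_Suc_eq_le)

text \<open>The product of the standard \<open>d\<close>-simplex with the \<open>F\<close>-fold
  power of level \<open>n\<close>. Over a single simplex of the base a cover is trivial with fibre
  \<open>F\<close>, and this is where a fibrewise map is defined.\<close>

definition loc :: "'f set => nat => nat => (nat list \<times> ('f => 'e)) sset" where
 "loc F d n = \<lparr>cells = {(th, u). \<exists>l. th \<in> ops l d \<and> u \<in> F \<rightarrow>\<^sub>E simp (lev E n) l}, sdim = (\<lambda>(th, u). length th - 1),
   opr = (\<lambda>psi (th, u). (th \<odot> psi, \<lambda>y\<in>F. opr (lev E n) psi (u y)))\<rparr>"

lemma cells_loc: "(th, u) \<in> cells (loc F d n) \<longleftrightarrow> (\<exists>l. th \<in> ops l d \<and> u \<in> F \<rightarrow>\<^sub>E simp (lev E n) l)"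
 by (simp add: loc_def)

lemma sdim_loc [simp]: "sdim (loc F d n) (th, u) = length th - 1"
 by (simp add: loc_def)

lemma opr_loc [simp]: "opr (loc F d n) psi (th, u) = (th \<odot> psi, \<lambda>y\<in>F. opr (lev E n) psi (u y))"
 by (simp add: loc_def)

lemma opr_simp: "e \<in> simp (lev E n) k ==> th \<in> ops l k ==> opr (lev E n) th e \<in> simp (lev E n) l"
 using sset_opr[OF sset_lev, of e n th l] by (auto simp: simp_def)

lemma is_sset_loc: "is_sset (loc F d n)"
proof (rule is_ssetI)
 fix m psi z assume z: "z \<in> cells (loc F d n)" and psi: "psi \<in> ops m (sdim (loc F d n) z)"
 obtain th u l where zz: "z = (th, u)" "th \<in> ops l d" "u \<in> F \<rightarrow>\<^sub>E simp (lev E n) l" using z by (cases z) (auto simp: cells_loc)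
 have psil: "psi \<in> ops m l" using psi zz length_ops[OF zz(2)] by simp
 show "opr (loc F d n) psi z \<in> cells (loc F d n) \<and> sdim (loc F d n) (opr (loc F d n) psi z) = m"
  using pull_ops[OF zz(2) psil] opr_simp[OF PiE_mem[OF zz(3)] psil] zz length_ops[OF psil] by (auto simp: cells_loc)
next
 fix z assume z: "z \<in> cells (loc F d n)"
 obtain th u l where zz: "z = (th, u)" "th \<in> ops l d" "u \<in> F \<rightarrow>\<^sub>E simp (lev E n) l" using z by (cases z) (auto simp: cells_loc)
 have "opr (lev E n) (idl l) (u y) = u y" if "y \<in> F" for y
  using PiE_mem[OF zz(3) that] sset_id[OF sset_lev, of "u y" n] by (auto simp: simp_def)
 hence "(\<lambda>y\<in>F. opr (lev E n) (idl l) (u y)) = u" using zz(3)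
  by (intro extensionalityI[where A = F]) (auto simp: PiE_def)
 thus "opr (loc F d n) (idl (sdim (loc F d n) z)) z = z"
  using zz length_ops[OF zz(2)] pull_idl[OF ops_length[OF zz(2)]] by simp
next
 fix k m psi chi z assume z: "z \<in> cells (loc F d n)" and psi: "psi \<in> ops m (sdim (loc F d n) z)" and chi: "chi \<in> ops k m"
 obtain th u l where zz: "z = (th, u)" "th \<in> ops l d" "u \<in> F \<rightarrow>\<^sub>E simp (lev E n) l" using z by (cases z) (auto simp: cells_loc)
 have psil: "psi \<in> ops m l" using psi zz length_ops[OF zz(2)] by simp
 have "opr (lev E n) (psi \<odot> chi) (u y) = opr (lev E n) chi (opr (lev E n) psi (u y))" if "y \<in> F" for y
  using PiE_mem[OF zz(3) that] sset_comp[OF sset_lev, of "u y" n psi m chi k] psil chi by (auto simp: simp_def)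
 thus "opr (loc F d n) (psi \<odot> chi) z = opr (loc F d n) chi (opr (loc F d n) psi z)"
  using zz pull_assoc[OF psil chi, of th] by (auto intro!: restrict_ext)
qed

text \<open>For empty \<open>F'\<close> this is where the sum is prescribed: over the boundary of
  the simplex and on tuples with at most one entry off the base point. Enlarging \<open>F'\<close>
  admits tuples with larger support, up to all of \<open>loc\<close>.\<close>

definition filt :: "'f set => nat => nat => 'f set => (nat list \<times> ('f => 'e)) set" where
 "filt F d n F' = {(th, u) \<in> cells (loc F d n). set th \<noteq> {..d} \<or> (\<forall>y\<in>F - F'. u y = bas E n (length th - 1)) \<or>
   (\<exists>y\<in>F. \<forall>z\<in>F - {y}. u z = bas E n (length th - 1))}"

lemma filtE:
 assumes "z \<in> filt F d n F'"
 obtains th u l where "z = (th, u)" "th \<in> ops l d" "u \<in> F \<rightarrow>\<^sub>E simp (lev E n) l" "length th - 1 = l"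
  "set th \<noteq> {..d} \<or> (\<forall>y\<in>F - F'. u y = bas E n l) \<or> (\<exists>y\<in>F. \<forall>z\<in>F - {y}. u z = bas E n l)"
proof -
 obtain th u where z: "z = (th, u)" by (cases z)
 then obtain l where l: "th \<in> ops l d" "u \<in> F \<rightarrow>\<^sub>E simp (lev E n) l"
  using assms unfolding filt_def by (auto simp: cells_loc)
 show thesis by (rule that[OF z l length_ops[OF l(1)]]) (use assms z length_ops[OF l(1)] in \<open>simp add: filt_def\<close>)
qed

lemma filtI:
 assumes "th \<in> ops l d" "u \<in> F \<rightarrow>\<^sub>E simp (lev E n) l"
  "set th \<noteq> {..d} \<or> (\<forall>y\<in>F - F'. u y = bas E n l) \<or> (\<exists>y\<in>F. \<forall>z\<in>F - {y}. u z = bas E n l)"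
 shows "(th, u) \<in> filt F d n F'"
 using assms length_ops[OF assms(1)] unfolding filt_def by (auto simp: cells_loc)

text \<open>The filtration sees only the operator and the support, so it is preserved whenever base
  entries stay base entries. This covers the simplicial operators as well as suspension.\<close>

lemma filt_map:
 assumes z: "(th, u) \<in> filt F d n F'" and th: "th \<in> ops l d" and psi: "psi \<in> ops m l"
  and w: "w \<in> F \<rightarrow>\<^sub>E simp (lev E n') m" and sup: "!!y. y \<in> F ==> u y = bas E n l ==> w y = bas E n' m"
 shows "(th \<odot> psi, w) \<in> filt F d n' F'"
proof (rule filtI[OF pull_ops[OF th psi] w])
 have ns: "set (th \<odot> psi) \<noteq> {..d}" if "set th \<noteq> {..d}"
  using set_pull[OF th psi] ops_in_set_le[OF th] that by blast
 show "set (th \<odot> psi) \<noteq> {..d} \<or> (\<forall>y\<in>F - F'. w y = bas E n' m) \<or> (\<exists>y\<in>F. \<forall>z\<in>F - {y}. w z = bas E n' m)"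
 proof -
  have "set th \<noteq> {..d} \<or> (\<forall>y\<in>F - F'. u y = bas E n l) \<or> (\<exists>y\<in>F. \<forall>z\<in>F - {y}. u z = bas E n l)"
   using z length_ops[OF th] unfolding filt_def by simp
  thus ?thesis
  proof (elim disjE bexE)
   fix y assume "y \<in> F" "\<forall>z\<in>F - {y}. u z = bas E n l"
   hence "\<exists>y\<in>F. \<forall>z\<in>F - {y}. w z = bas E n' m" using sup by (intro bexI[of _ y]) auto
   thus ?thesis by blast
  qed (use ns sup in auto)
 qed
qed

lemma filt_map_id:
 assumes z: "(th, u) \<in> filt F d n F'" and th: "th \<in> ops l d"
  and w: "w \<in> F \<rightarrow>\<^sub>E simp (lev E n') l" and sup: "!!y. y \<in> F ==> u y = bas E n l ==> w y = bas E n' l"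
 shows "(th, w) \<in> filt F d n' F'"
 using filt_map[OF z th idl_ops w sup] pull_idl[OF ops_length[OF th]] by simp

lemma subc_filt: "subc (loc F d n) (filt F d n F')"
 unfolding subc_def
proof (intro conjI ballI allI)
 fix z m psi assume z: "z \<in> filt F d n F'" and psi: "psi \<in> ops m (sdim (loc F d n) z)"
 obtain th u l where zz: "z = (th, u)" "th \<in> ops l d" "u \<in> F \<rightarrow>\<^sub>E simp (lev E n) l" "length th - 1 = l" using z by (rule filtE)
 have psil: "psi \<in> ops m l" using psi zz by simp
 show "opr (loc F d n) psi z \<in> filt F d n F'"
  unfolding zz(1) opr_loc
  by (rule filt_map[OF z[unfolded zz(1)] zz(2) psil]) (use opr_simp[OF PiE_mem[OF zz(3)] psil] basD(3)[OF psil] in auto)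
qed (auto simp: filt_def)

definition sgu :: "'f set => nat => ('f => 'e) => nat list => 'f => 'e" where
 "sgu F n u t = (\<lambda>y\<in>F. sg E n (u y) t)"

lemma sgu_PiE: "u \<in> F \<rightarrow>\<^sub>E simp (lev E n) l ==> t \<in> ops l 1 ==> sgu F n u t \<in> F \<rightarrow>\<^sub>E simp (lev E (Suc n)) l"
 unfolding sgu_def by (auto intro!: sg_simp dest: PiE_mem)

lemma filt_all:
 assumes "F' = F" shows "filt F d n F' = cells (loc F d n)"
 unfolding filt_def using assms by auto

text \<open>
 Sums over the fibre \<open>F\<close> are extended over the \<open>d\<close>-simplex one point of \<open>F\<close> at a time; the new point
 is the one whose loop is traversed second.
\<close>

lemma fibre_extend:
 assumes F: "finite F"
  and phi: "!!n. smap_on (filt F d n {}) (loc F d n) (lev E n) (phi n)"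
  and phis: "!!n th u l t. (th, u) \<in> filt F d n {} ==> th \<in> ops l d ==> t \<in> ops l 1 ==> phi (Suc n) (th, sgu F n u t) = sg E n (phi n (th, u)) t"
  and phib: "!!n th l. th \<in> ops l d ==> phi n (th, \<lambda>y\<in>F. bas E n l) = bas E n l"
 obtains s where "!!n. smap (loc F d n) (lev E n) (s n)" "!!n z. z \<in> filt F d n {} ==> s n z = phi n z"
  "!!n th u l t. (th, u) \<in> cells (loc F d n) ==> th \<in> ops l d ==> t \<in> ops l 1 ==> s (Suc n) (th, sgu F n u t) = sg E n (s n (th, u)) t"
proof -
 have "finite F' ==> F' \<subseteq> F ==> \<exists>s. (\<forall>n. smap_on (filt F d n F') (loc F d n) (lev E n) (s n)) \<and> (\<forall>n. \<forall>z\<in>filt F d n {}. s n z = phi n z) \<and>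
   (\<forall>n th u l t. (th, u) \<in> filt F d n F' --> th \<in> ops l d --> t \<in> ops l 1 --> s (Suc n) (th, sgu F n u t) = sg E n (s n (th, u)) t)" for F'
 proof (induction F' rule: finite_induct)
  case empty
  show ?case using phi phis by blast
 next
  case (insert a F')
  then obtain s where s: "!!n. smap_on (filt F d n F') (loc F d n) (lev E n) (s n)" "!!n z. z \<in> filt F d n {} ==> s n z = phi n z"
   "!!n th u l t. (th, u) \<in> filt F d n F' ==> th \<in> ops l d ==> t \<in> ops l 1 ==> s (Suc n) (th, sgu F n u t) = sg E n (s n (th, u)) t"
   by blast
  have aF: "a \<in> F" using insert by auto
  define B where "B n = (loc F d n)\<lparr>cells := filt F d n (insert a F')\<rparr>" for n
  have cB: "cells (B n) = filt F d n (insert a F')" and sB: "sdim (B n) = sdim (loc F d n)" and oB: "opr (B n) = opr (loc F d n)" for n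
   by (auto simp: B_def)
  have B: "is_sset (B n)" for n unfolding B_def by (rule is_sset_sub[OF is_sset_loc subc_filt])
  have sub: "filt F d n F' \<subseteq> filt F d n (insert a F')" for n F' unfolding filt_def by auto
  have A: "subc (B n) (filt F d n F')" for n
   using subc_filt sub unfolding subc_def cB sB oB by blast
  have As: "smap_on (filt F d n F') (B n) (lev E n) (s n)" for n
   using s(1)[of n] unfolding smap_on_def sB oB .
  define sb where "sb n = (\<lambda>(th, u) t. (th :: nat list, sgu F n u t))" for n
  \<comment> \<open>All loops run with parameter \<open>x\<close>, except that the loop at
    \<open>a\<close> is held back to the minimum of \<open>x\<close> and \<open>y\<close>. At
    \<open>y = 1\<close> this is the suspended tuple; at \<open>y = 0\<close> the entry at
    \<open>a\<close> vanishes; at \<open>x = 1\<close> only the loop at \<open>a\<close> remains,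
    run by \<open>y\<close>. So the diagonal edge is the loop of the other points followed by that
    of \<open>a\<close>.\<close>
  define kappa where "kappa n = (\<lambda>(th, u) x y. (th :: nat list, \<lambda>z\<in>F. sg E n (u z) (if z = a then map2 min x y else x)))" for n
  have allbas: "(th, \<lambda>y\<in>F. bas E n l) \<in> filt F d n F''" if "th \<in> ops l d" for n th l F''
   by (rule filtI[OF that]) auto
  have sgu_end: "sgu F n u (cst i l) = (\<lambda>y\<in>F. bas E (Suc n) l)" if "u \<in> F \<rightarrow>\<^sub>E simp (lev E n) l" for n u l i
   unfolding sgu_def using sg_cst[OF PiE_mem[OF that]] by (auto intro!: restrict_ext)
  have sbA: "sb n (th, u) t \<in> filt F d (Suc n) F''" if "(th, u) \<in> filt F d n F''" "th \<in> ops l d" "u \<in> F \<rightarrow>\<^sub>E simp (lev E n) l" "t \<in> ops l 1" for n th u l t F''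
   unfolding sb_def prod.case
   by (rule filt_map_id[OF that(1,2) sgu_PiE[OF that(3,4)]]) (use sg_bas[OF that(4)] in \<open>auto simp: sgu_def\<close>)
  have kappaP: "(\<lambda>z\<in>F. sg E n (u z) (if z = a then map2 min x y else x)) \<in> F \<rightarrow>\<^sub>E simp (lev E (Suc n)) l"
   if "u \<in> F \<rightarrow>\<^sub>E simp (lev E n) l" "x \<in> ops l 1" "y \<in> ops l 1" for n u l x y
   using sg_simp[OF PiE_mem[OF that(1)]] that(2) map2_min_ops[OF that(2,3)] by auto
  have kappain: "kappa n (th, u) x y \<in> filt F d (Suc n) F''" if "(th, u) \<in> filt F d n F''" "th \<in> ops l d" "u \<in> F \<rightarrow>\<^sub>E simp (lev E n) l"
   "x \<in> ops l 1" "y \<in> ops l 1" for n th u l x y F''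
   unfolding kappa_def prod.case
   by (rule filt_map_id[OF that(1,2) kappaP[OF that(3-5)]]) (use sg_bas[OF that(4)] sg_bas[OF map2_min_ops[OF that(4,5)]] in auto)
  obtain s' where s': "!!n. smap (B n) (lev E n) (s' n)" "!!n b. b \<in> filt F d n F' ==> s' n b = s n b"
   "!!n b t. b \<in> cells (B n) ==> t \<in> ops (sdim (B n) b) 1 ==> s' (Suc n) (sb n b t) = sg E n (s' n b) t"
  proof (rule spectrum_extend[OF B A As, of sb kappa])
   fix n
   show "smap (sprod (B n) I1) (B (Suc n)) (\<lambda>(b, t). sb n b t)"
   proof (rule smap_cylI[OF B])
    fix b t assume b: "b \<in> cells (B n)" and t: "t \<in> ops (sdim (B n) b) 1"
    obtain th u l where bb: "b = (th, u)" "th \<in> ops l d" "u \<in> F \<rightarrow>\<^sub>E simp (lev E n) l" "length th - 1 = l" using b unfolding cB by (rule filtE)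
    have tl: "t \<in> ops l 1" using t bb by (simp add: sB)
    show "(case (b, t) of (b, t) => sb n b t) \<in> cells (B (Suc n)) \<and> sdim (B (Suc n)) (case (b, t) of (b, t) => sb n b t) = sdim (B n) b"
     using sbA[OF _ bb(2,3) tl] b bb unfolding cB sB by (simp add: sb_def)
    fix m psi assume psi: "psi \<in> ops m (sdim (B n) b)"
    hence psil: "psi \<in> ops m l" using bb by (simp add: sB)
    have "sg E n (opr (lev E n) psi (u y)) (t \<odot> psi) = opr (lev E (Suc n)) psi (sg E n (u y) t)" if "y \<in> F" for y
     using sgD(3)[of "u y" n t psi m] PiE_mem[OF bb(3) that] tl psil by (auto simp: simp_def)
    thus "(case (opr (B n) psi b, t \<odot> psi) of (b, t) => sb n b t) = opr (B (Suc n)) psi (case (b, t) of (b, t) => sb n b t)"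
     using bb unfolding oB by (auto simp: sb_def sgu_def intro!: restrict_ext)
   qed
   show "smap (sprod (sprod (B n) I1) I1) (B (Suc n)) (\<lambda>((b, x), y). kappa n b x y)"
   proof (rule smap_cylI[OF is_sset_cyl[OF B]])
    fix z y assume z: "z \<in> cells (sprod (B n) I1)" and y: "y \<in> ops (sdim (sprod (B n) I1) z) 1"
    obtain b x where zz: "z = (b, x)" by (cases z)
    have b: "b \<in> cells (B n)" and x: "x \<in> ops (sdim (B n) b) 1" using z zz B by auto
    obtain th u l where bb: "b = (th, u)" "th \<in> ops l d" "u \<in> F \<rightarrow>\<^sub>E simp (lev E n) l" "length th - 1 = l" using b unfolding cB by (rule filtE)
    have xl: "x \<in> ops l 1" and yl: "y \<in> ops l 1" using x y bb zz by (simp_all add: sB)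
    show "((\<lambda>((b, x), y). kappa n b x y) (z, y)) \<in> cells (B (Suc n)) \<and> sdim (B (Suc n)) ((\<lambda>((b, x), y). kappa n b x y) (z, y)) = sdim (sprod (B n) I1) z"
     using kappain[OF _ bb(2,3) xl yl] b bb zz unfolding cB sB by (simp add: kappa_def sB)
    fix m psi assume psi: "psi \<in> ops m (sdim (sprod (B n) I1) z)"
    hence psil: "psi \<in> ops m l" using bb zz by (simp add: sB)
    have "sg E n (opr (lev E n) psi (u v)) (if v = a then map2 min (x \<odot> psi) (y \<odot> psi) else x \<odot> psi)
      = opr (lev E (Suc n)) psi (sg E n (u v) (if v = a then map2 min x y else x))" if "v \<in> F" for v
     unfolding map2_min_pull[OF xl yl psil]
     using sgD(3)[of "u v" n "if v = a then map2 min x y else x" psi m] PiE_mem[OF bb(3) that] xl map2_min_ops[OF xl yl] psil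
     by (auto simp: simp_def)
    thus "(\<lambda>((b, x), y). kappa n b x y) (opr (sprod (B n) I1) psi z, y \<odot> psi) = opr (B (Suc n)) psi ((\<lambda>((b, x), y). kappa n b x y) (z, y))"
     using bb zz by (auto simp: kappa_def oB intro!: restrict_ext)
   qed
  next
   fix n b i assume b: "b \<in> cells (B n)" and i: "i \<le> (1::nat)"
   obtain th u l where bb: "b = (th, u)" "th \<in> ops l d" "u \<in> F \<rightarrow>\<^sub>E simp (lev E n) l" "length th - 1 = l" using b unfolding cB by (rule filtE)
   have e: "sb n b (cst i (sdim (B n) b)) = (th, \<lambda>y\<in>F. bas E (Suc n) l)" using sgu_end[OF bb(3)] bb by (simp add: sb_def sB)
   show "sb n b (cst i (sdim (B n) b)) \<in> filt F d (Suc n) F' \<and> s (Suc n) (sb n b (cst i (sdim (B n) b))) = bas E (Suc n) (sdim (B n) b)"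
    unfolding e using allbas[OF bb(2)] s(2)[OF allbas[OF bb(2)]] phib[OF bb(2)] bb by (simp add: sB)
  next
   fix n b t assume b: "b \<in> filt F d n F'" and t: "t \<in> ops (sdim (B n) b) 1"
   obtain th u l where bb: "b = (th, u)" "th \<in> ops l d" "u \<in> F \<rightarrow>\<^sub>E simp (lev E n) l" "length th - 1 = l" using b by (rule filtE)
   have tl: "t \<in> ops l 1" using t bb by (simp add: sB)
   show "sb n b t \<in> filt F d (Suc n) F' \<and> s (Suc n) (sb n b t) = sg E n (s n b) t"
    using sbA[OF b[unfolded bb(1)] bb(2,3) tl] s(3)[OF b[unfolded bb(1)] bb(2) tl] bb by (simp add: sb_def)
  next
   fix n b t b' t'
   assume b: "b \<in> cells (B n)" "b' \<in> cells (B n)" and t: "t \<in> ops (sdim (B n) b) 1" "t' \<in> ops (sdim (B n) b') 1"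
    and eq: "sb n b t = sb n b' t'" and nA: "sb n b t \<notin> filt F d (Suc n) F'"
   obtain th u l where bb: "b = (th, u)" "th \<in> ops l d" "u \<in> F \<rightarrow>\<^sub>E simp (lev E n) l" "length th - 1 = l" using b(1) unfolding cB by (rule filtE)
   obtain th' u' l' where bb': "b' = (th', u')" "th' \<in> ops l' d" "u' \<in> F \<rightarrow>\<^sub>E simp (lev E n) l'" "length th' - 1 = l'" using b(2) unfolding cB by (rule filtE)
   have th': "th' = th" "l' = l" using eq bb bb' by (auto simp: sb_def)
   have tl: "t \<in> ops l 1" "t' \<in> ops l 1" using t bb bb' th' by (auto simp: sB)
   have sge: "sg E n (u y) t = sg E n (u' y) t'" if "y \<in> F" for y
   proof -
    have "sgu F n u t y = sgu F n u' t' y" using eq bb bb' by (simp add: sb_def)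
    thus ?thesis using that by (simp add: sgu_def)
   qed
   \<comment> \<open>An entry off the base point determines \<open>t\<close>, which then is not an
     end of the interval. For such \<open>t\<close> suspension detects the base point, so the
     remaining entries agree as well.\<close>
   obtain y where y: "y \<in> F" "sg E n (u y) t \<noteq> bas E (Suc n) l"
   proof -
    have "\<exists>y\<in>F. sg E n (u y) t \<noteq> bas E (Suc n) l"
    proof (rule ccontr)
     assume "\<not> ?thesis"
     hence "sgu F n u t = (\<lambda>y\<in>F. bas E (Suc n) l)" unfolding sgu_def by (auto intro!: restrict_ext)
     thus False using nA allbas[OF bb(2)] bb by (simp add: sb_def)
    qed
    thus thesis using that by blast
   qed
   have um: "u y \<in> simp (lev E n) l" "u' y \<in> simp (lev E n) l" if "y \<in> F" for y
    using PiE_mem[OF bb(3) that] PiE_mem[OF bb'(3) that] th' by auto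
   have tt: "t = t'" using sg_inj[OF um[OF y(1)] tl sge[OF y(1)] y(2)] by simp
   have tc: "t \<noteq> cst 0 l" "t \<noteq> cst 1 l" using y sg_cst[OF um(1)[OF y(1)]] by auto
   have "u z = u' z" if z: "z \<in> F" for z
   proof (cases "sg E n (u z) t = bas E (Suc n) l")
    case True
    hence "u z = bas E n l" using sg_eq_bas[OF um(1)[OF z] tl(1) tc] by blast
    moreover have "sg E n (u' z) t = bas E (Suc n) l" using True sge[OF z] unfolding tt by simp
    hence "u' z = bas E n l" using sg_eq_bas[OF um(2)[OF z] tl(1) tc] by blast
    ultimately show ?thesis by simp
   next
    case False
    thus ?thesis using sg_inj[OF um[OF z] tl sge[OF z]] by simp
   qed
   hence "u = u'" using PiE_ext[OF bb(3), of u'] bb'(3) th' by blast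
   thus "b = b' \<and> t = t'" using tt bb bb' th' by simp
  next
   fix n b t assume b: "b \<in> cells (B n)" and t: "t \<in> ops (sdim (B n) b) 1" and iA: "sb n b t \<in> filt F d (Suc n) F'"
   obtain th u l where bb: "b = (th, u)" "th \<in> ops l d" "u \<in> F \<rightarrow>\<^sub>E simp (lev E n) l" "length th - 1 = l" using b unfolding cB by (rule filtE)
   have tl: "t \<in> ops l 1" using t bb by (simp add: sB)
   show "(b, t) \<in> rim (B n) (filt F d n F')"
   proof (cases "t = cst 0 l \<or> t = cst 1 l")
    case True
    thus ?thesis using b t bb B unfolding rim_def by (auto simp: sB)
   next
    case False
    have e: "sgu F n u t y = bas E (Suc n) l \<longleftrightarrow> u y = bas E n l" if "y \<in> F" for y
     using sg_eq_bas[OF PiE_mem[OF bb(3) that] tl] False that by (simp add: sgu_def)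
    have "(th, u) \<in> filt F d n F'"
    proof (rule filt_map_id[OF _ bb(2,3)])
     show "(th, sgu F n u t) \<in> filt F d (Suc n) F'" using iA bb by (simp add: sb_def)
    qed (use e in simp)
    thus ?thesis using b t bb B unfolding rim_def by simp
   qed
  next
   fix n b x assume b: "b \<in> cells (B n)" and x: "x \<in> ops (sdim (B n) b) 1"
   obtain th u l where bb: "b = (th, u)" "th \<in> ops l d" "u \<in> F \<rightarrow>\<^sub>E simp (lev E n) l" "length th - 1 = l"
    "set th \<noteq> {..d} \<or> (\<forall>y\<in>F - insert a F'. u y = bas E n l) \<or> (\<exists>y\<in>F. \<forall>z\<in>F - {y}. u z = bas E n l)" using b unfolding cB by (rule filtE)
   have xl: "x \<in> ops l 1" using x bb by (simp add: sB)
   show "kappa n b x (cst 1 (sdim (B n) b)) = sb n b x"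
    using bb(1,4) map2_min_cst1[OF xl] by (simp add: kappa_def sb_def sgu_def sB cong: if_cong)
   \<comment> \<open>With the entry at \<open>a\<close> gone, a tuple supported on
     \<open>insert a F'\<close> is supported on \<open>F'\<close>, where the map is known
     already.\<close>
   have "(th, \<lambda>z\<in>F. sg E n (u z) (if z = a then cst 0 l else x)) \<in> filt F d (Suc n) F'"
   proof (rule filtI[OF bb(2)])
    let ?w = "\<lambda>z\<in>F. sg E n (u z) (if z = a then cst 0 l else x)"
    show "?w \<in> F \<rightarrow>\<^sub>E simp (lev E (Suc n)) l" using sg_simp[OF PiE_mem[OF bb(3)]] xl by auto
    have wa: "?w a = bas E (Suc n) l" using sg_cst[OF PiE_mem[OF bb(3) aF]] aF by simp
    have wb: "?w z = bas E (Suc n) l" if "z \<in> F" "u z = bas E n l" for z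
     using that sg_bas[OF xl] sg_cst[OF bas_simp] by simp
    show "set th \<noteq> {..d} \<or> (\<forall>y\<in>F - F'. ?w y = bas E (Suc n) l) \<or> (\<exists>y\<in>F. \<forall>z\<in>F - {y}. ?w z = bas E (Suc n) l)"
     using bb(5)
    proof (elim disjE bexE)
     assume "\<forall>y\<in>F - insert a F'. u y = bas E n l"
     hence "\<forall>y\<in>F - F'. ?w y = bas E (Suc n) l" using wa wb by (metis DiffE DiffI insert_iff)
     thus ?thesis by blast
    next
     fix y assume y: "y \<in> F" "\<forall>z\<in>F - {y}. u z = bas E n l"
     have "\<exists>y\<in>F. \<forall>z\<in>F - {y}. ?w z = bas E (Suc n) l" by (rule bexI[OF _ y(1)]) (use wb y in blast)
     thus ?thesis by blast
    qed blast
   qed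
   thus "kappa n b x (cst 0 (sdim (B n) b)) \<in> filt F d (Suc n) F'"
    using bb(1,4) map2_min_cst0[OF xl] by (simp add: kappa_def sB cong: if_cong)
  next
   fix n b x y assume bx: "(b, x) \<in> rim (B n) (filt F d n F')" and y: "y \<in> ops (sdim (B n) b) 1"
   have b: "b \<in> cells (B n)" and x: "x \<in> ops (sdim (B n) b) 1" using bx B unfolding rim_def by auto
   obtain th u l where bb: "b = (th, u)" "th \<in> ops l d" "u \<in> F \<rightarrow>\<^sub>E simp (lev E n) l" "length th - 1 = l" using b unfolding cB by (rule filtE)
   have xl: "x \<in> ops l 1" and yl: "y \<in> ops l 1" using x y bb by (simp_all add: sB)
   consider "b \<in> filt F d n F'" | "x = cst 0 l" | "x = cst 1 l" using bx bb unfolding rim_def by (auto simp: sB)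
   thus "kappa n b x y \<in> filt F d (Suc n) F'"
   proof cases
    case 1
    thus ?thesis using kappain[OF _ bb(2,3) xl yl] bb by simp
   next
    case 2
    have "map2 min x y = cst 0 l" unfolding 2
     by (rule nth_equalityI) (use ops_length[OF yl] in auto)
    hence "(\<lambda>z\<in>F. sg E n (u z) (if z = a then map2 min x y else x)) = (\<lambda>z\<in>F. bas E (Suc n) l)"
     using 2 sg_cst[OF PiE_mem[OF bb(3)]] by (auto intro!: restrict_ext)
    thus ?thesis using allbas[OF bb(2)] bb by (simp add: kappa_def)
   next
    case 3
    have "(th, \<lambda>z\<in>F. sg E n (u z) (if z = a then map2 min x y else x)) \<in> filt F d (Suc n) F'"
     by (rule filtI[OF bb(2) kappaP[OF bb(3) xl yl]]) (use 3 sg_cst[OF PiE_mem[OF bb(3)]] aF in auto)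
    thus ?thesis using bb by (simp add: kappa_def)
   qed
  qed blast
  have "smap_on (filt F d n (insert a F')) (loc F d n) (lev E n) (s' n)" for n
   using s'(1)[of n] unfolding smap_iff smap_on_def cB sB oB .
  moreover have "s' n z = phi n z" if "z \<in> filt F d n {}" for n z
  proof -
   have "z \<in> filt F d n F'" using that unfolding filt_def by auto
   thus ?thesis using s'(2) s(2)[OF that] by simp
  qed
  moreover have "s' (Suc n) (th, sgu F n u t) = sg E n (s' n (th, u)) t"
   if "(th, u) \<in> filt F d n (insert a F')" "th \<in> ops l d" "t \<in> ops l 1" for n th u l t
   using s'(3)[of "(th, u)" n t] that length_ops[OF that(2)] by (simp add: cB sB sb_def)
  ultimately show ?case by blast
 qed
 from this[OF F order_refl] obtain s where s: "\<forall>n. smap_on (filt F d n F) (loc F d n) (lev E n) (s n)" "\<forall>n. \<forall>z\<in>filt F d n {}. s n z = phi n z"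
   "\<forall>n th u l t. (th, u) \<in> filt F d n F --> th \<in> ops l d --> t \<in> ops l 1 --> s (Suc n) (th, sgu F n u t) = sg E n (s n (th, u)) t"
  by blast
 show thesis by (rule that[of s]) (use s in \<open>auto simp: filt_all smap_iff\<close>)
qed

end

section \<open>Extension over all simplices of the base\<close>

lemma pmapD:
 assumes "pmap E Y phi" "y \<in> cells Y" "e \<in> simp (lev E n) (sdim Y y)"
 shows "phi n y e \<in> simp (lev E n) (sdim Y y)"
  "th \<in> ops l (sdim Y y) ==> phi n (opr Y th y) (opr (lev E n) th e) = opr (lev E n) th (phi n y e)"
  "phi n y (bas E n (sdim Y y)) = bas E n (sdim Y y)"
  "t \<in> simp circle (sdim Y y) ==> phi (Suc n) y (sig E n e t) = sig E n (phi n y e) t"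
 using assms unfolding pmap_def by blast+

lemma qcellD:
 assumes "qcell E Y X p phi th x v v'" "u \<in> fib Y p x \<rightarrow>\<^sub>E simp (lev E n) (sdim X x)"
 shows "v n u \<in> simp (lev E n) (sdim X x)"
  "th \<in> ops l (sdim X x) ==> u' \<in> fib Y p (opr X th x) \<rightarrow>\<^sub>E simp (lev E n) l ==>
    (!!y. y \<in> fib Y p x ==> u' (opr Y th y) = opr (lev E n) th (u y)) ==> v' n u' = opr (lev E n) th (v n u)"
  "(!!y. y \<in> fib Y p x ==> u y = bas E n (sdim X x)) ==> v n u = bas E n (sdim X x)"
  "y \<in> fib Y p x ==> (!!z. z \<in> fib Y p x ==> z \<noteq> y ==> u z = bas E n (sdim X x)) ==> v n u = phi n y (u y)"
  "t \<in> simp circle (sdim X x) ==> v (Suc n) (\<lambda>y\<in>fib Y p x. sig E n (u y) t) = sig E n (v n u) t"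
proof -
 note Q = assms(1)[unfolded qcell_def, rule_format, OF assms(2)]
 show "v n u \<in> simp (lev E n) (sdim X x)" using Q by blast
 show "(!!y. y \<in> fib Y p x ==> u y = bas E n (sdim X x)) ==> v n u = bas E n (sdim X x)" using Q by blast
 show "y \<in> fib Y p x ==> (!!z. z \<in> fib Y p x ==> z \<noteq> y ==> u z = bas E n (sdim X x)) ==> v n u = phi n y (u y)" using Q by blast
 show "t \<in> simp circle (sdim X x) ==> v (Suc n) (\<lambda>y\<in>fib Y p x. sig E n (u y) t) = sig E n (v n u) t" using Q by blast
 show "th \<in> ops l (sdim X x) ==> u' \<in> fib Y p (opr X th x) \<rightarrow>\<^sub>E simp (lev E n) l ==>
    (!!y. y \<in> fib Y p x ==> u' (opr Y th y) = opr (lev E n) th (u y)) ==> v' n u' = opr (lev E n) th (v n u)"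
  using Q length_ops by blast
qed

lemma qcellI:
 assumes "th \<in> ops l (sdim X x)"
  and "!!n u. u \<in> fib Y p x \<rightarrow>\<^sub>E simp (lev E n) (sdim X x) ==> v n u \<in> simp (lev E n) (sdim X x)"
  and "!!n u u'. u \<in> fib Y p x \<rightarrow>\<^sub>E simp (lev E n) (sdim X x) ==> u' \<in> fib Y p (opr X th x) \<rightarrow>\<^sub>E simp (lev E n) l ==>
    (!!y. y \<in> fib Y p x ==> u' (opr Y th y) = opr (lev E n) th (u y)) ==> v' n u' = opr (lev E n) th (v n u)"
  and "!!n u. u \<in> fib Y p x \<rightarrow>\<^sub>E simp (lev E n) (sdim X x) ==>
    (!!y. y \<in> fib Y p x ==> u y = bas E n (sdim X x)) ==> v n u = bas E n (sdim X x)"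
  and "!!n u y. u \<in> fib Y p x \<rightarrow>\<^sub>E simp (lev E n) (sdim X x) ==> y \<in> fib Y p x ==>
    (!!z. z \<in> fib Y p x ==> z \<noteq> y ==> u z = bas E n (sdim X x)) ==> v n u = phi n y (u y)"
  and "!!n u t. u \<in> fib Y p x \<rightarrow>\<^sub>E simp (lev E n) (sdim X x) ==>
    t \<in> simp circle (sdim X x) ==> v (Suc n) (\<lambda>y\<in>fib Y p x. sig E n (u y) t) = sig E n (v n u) t"
 shows "qcell E Y X p phi th x v v'"
 unfolding qcell_def using assms length_ops[OF assms(1)] by simp

context cof_omega
begin

text \<open>By \<open>extend_cells\<close> it is enough to extend over one simplex \<open>x\<close>.
  The covering property identifies the fibres over all its faces with the fibre \<open>F\<close>
  over \<open>x\<close>, which turns the problem into \<open>fibre_extend\<close>.\<close>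

lemma qmap_extend:
 assumes c: "finite_cover Y X p" and A: "subc X A" and phi: "pmap E Y phi" and s0: "qmap E Y X p A phi s0"
 obtains s where "qmap E Y X p (cells X) phi s" "!!n x u. x \<in> A ==> s n x u = s0 n x u"
proof -
 have X: "is_sset X" and Y: "is_sset Y" using c unfolding finite_cover_def by blast+
 have "\<exists>s. (\<forall>x\<in>A. s x = (\<lambda>n. s0 n x)) \<and> (\<forall>x\<in>cells X. \<forall>m. \<forall>th\<in>ops m (sdim X x). qcell E Y X p phi th x (s x) (s (opr X th x)))"
 proof (rule extend_cells[OF X A])
  show "qcell E Y X p phi th x (\<lambda>n. s0 n x) (\<lambda>n. s0 n (opr X th x))" if "x \<in> A" "th \<in> ops m (sdim X x)" for x m th
   using s0 that unfolding qmap_def by blast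
 next
  fix d x and v :: "nat list => nat => ('a => 'e) => 'e"
  assume x: "x \<in> cells X" "sdim X x = d"
   and v: "!!l th k psi. th \<in> ops l d ==> set th \<noteq> {..d} ==> psi \<in> ops k l ==> qcell E Y X p phi psi (opr X th x) (v th) (v (th \<odot> psi))"
  define F where "F = fib Y p x"
  have F: "finite F" unfolding F_def by (rule finite_fib[OF c x(1)])
  have FY: "y \<in> cells Y" "sdim Y y = d" if "y \<in> F" for y using fibD[OF c] that x unfolding F_def by auto
  have xo: "opr X th x \<in> cells X" "sdim X (opr X th x) = l" if "th \<in> ops l d" for th l using sset_opr[OF X x(1)] that x by auto
  have bij: "bij_betw (opr Y th) F (fib Y p (opr X th x))" if "th \<in> ops l d" for th l
   using fib_opr[OF c x(1)] that x unfolding F_def by auto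
  have FO: "opr Y th y \<in> fib Y p (opr X th x)" if "y \<in> F" "th \<in> ops l d" for y th l
   using bij_betwE[OF bij[OF that(2)]] that(1) by blast
  have FOD: "opr Y th y \<in> cells Y" "sdim Y (opr Y th y) = l" if "y \<in> F" "th \<in> ops l d" for y th l
   using sset_opr[OF Y FY(1)[OF that(1)]] FY(2)[OF that(1)] that(2) by auto
  have FOc: "opr Y (th \<odot> psi) y = opr Y psi (opr Y th y)" if "y \<in> F" "th \<in> ops l d" "psi \<in> ops m l" for y th psi l m
   using sset_comp[OF Y FY(1)[OF that(1)]] FY(2)[OF that(1)] that(2,3) by auto
  have Fex: "\<exists>y\<in>F. z = opr Y th y" if "z \<in> fib Y p (opr X th x)" "th \<in> ops l d" for z th l
   using bij_betw_imp_surj_on[OF bij[OF that(2)]] that(1) by auto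
  \<comment> \<open>\<open>tr\<close> carries a tuple on \<open>F\<close> to the fibre over the
    simplex obtained by \<open>th\<close>; \<open>pl\<close> carries it back.\<close>
  define tr where "tr th u = (\<lambda>z\<in>fib Y p (opr X th x). u (inv_into F (opr Y th) z))" for th and u :: "'a => 'e"
  define pl where "pl th w = (\<lambda>y\<in>F. w (opr Y th y))" for th and w :: "'a => 'e"
  have tr1: "tr th u (opr Y th y) = u y" if "th \<in> ops l d" "y \<in> F" for th l u y
   using FO[OF that(2,1)] bij_betw_inv_into_left[OF bij[OF that(1)] that(2)] by (simp add: tr_def)
  have tr2: "tr th u \<in> fib Y p (opr X th x) \<rightarrow>\<^sub>E S" if o: "th \<in> ops l d" and u: "u \<in> F \<rightarrow>\<^sub>E S" for th l u S
  proof (rule PiE_I)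
   fix z assume "z \<in> fib Y p (opr X th x)"
   then obtain y where "y \<in> F" "z = opr Y th y" using Fex[OF _ o] by blast
   thus "tr th u z \<in> S" using tr1[OF o] PiE_mem[OF u] by simp
  qed (simp add: tr_def)
  have pl1: "pl th w \<in> F \<rightarrow>\<^sub>E S" if "th \<in> ops l d" "w \<in> fib Y p (opr X th x) \<rightarrow>\<^sub>E S" for th l w S
   using FO[OF _ that(1)] PiE_mem[OF that(2)] by (auto simp: pl_def)
  have trpl: "tr th (pl th w) = w" if o: "th \<in> ops l d" and w: "w \<in> fib Y p (opr X th x) \<rightarrow>\<^sub>E S" for th l w S
  proof (rule PiE_ext[OF tr2[OF o pl1[OF o w]] w])
   fix z assume "z \<in> fib Y p (opr X th x)"
   then obtain y where "y \<in> F" "z = opr Y th y" using Fex[OF _ o] by blast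
   thus "tr th (pl th w) z = w z" using tr1[OF o] by (simp add: pl_def)
  qed
  \<comment> \<open>The prescribed part: \<open>v\<close> over the boundary, and \<open>phi\<close>
    on tuples with at most one entry off the base point. The choice of the entry is ambiguous only
    if all are base points, and then the value is the base point anyway. The last case occurs on the
    filtration stage only for empty \<open>F\<close>.\<close>
  define phi0 where "phi0 n = (\<lambda>(th, u). if set th \<noteq> {..d} then v th n (tr th u)
    else if \<exists>y\<in>F. \<forall>z\<in>F - {y}. u z = bas E n (length th - 1)
    then let y = (SOME y. y \<in> F \<and> (\<forall>z\<in>F - {y}. u z = bas E n (length th - 1))) in phi n (opr Y th y) (u y)
    else bas E n (length th - 1))" for n
  have phi0v: "phi0 n (th, u) = v th n (tr th u)" if "set th \<noteq> {..d}" for n th u using that by (simp add: phi0_def)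
  have trD: "tr th u \<in> fib Y p (opr X th x) \<rightarrow>\<^sub>E simp (lev E n) (sdim X (opr X th x))" if "th \<in> ops l d" "u \<in> F \<rightarrow>\<^sub>E simp (lev E n) l" for th l u n
   using tr2[OF that] xo[OF that(1)] by simp
  have W: "phi0 n (th, u) = phi n (opr Y th y) (u y)" if o: "th \<in> ops l d" and u: "u \<in> F \<rightarrow>\<^sub>E simp (lev E n) l"
   and y: "y \<in> F" "!!z. z \<in> F ==> z \<noteq> y ==> u z = bas E n l" for n th u l y
  proof (cases "set th = {..d}")
   case False
   have "v th n (tr th u) = phi n (opr Y th y) (tr th u (opr Y th y))"
   proof (rule qcellD(4)[OF v[OF o False idl_ops] trD[OF o u] FO[OF y(1) o]])
    fix z assume z: "z \<in> fib Y p (opr X th x)" "z \<noteq> opr Y th y"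
    then obtain y' where "y' \<in> F" "z = opr Y th y'" using Fex[OF _ o] by blast
    thus "tr th u z = bas E n (sdim X (opr X th x))" using tr1[OF o] y(2) xo[OF o] z by auto
   qed
   thus ?thesis using phi0v[OF False] tr1[OF o y(1)] by simp
  next
   case True
   have l: "length th - 1 = l" by (rule length_ops[OF o])
   define y' where "y' = (SOME y. y \<in> F \<and> (\<forall>z\<in>F - {y}. u z = bas E n l))"
   have y': "y' \<in> F \<and> (\<forall>z\<in>F - {y'}. u z = bas E n l)" unfolding y'_def by (rule someI[of _ y]) (use y in auto)
   have "\<exists>y\<in>F. \<forall>z\<in>F - {y}. u z = bas E n l" using y by blast
   hence e: "phi0 n (th, u) = phi n (opr Y th y') (u y')"
    using True l by (simp add: phi0_def y'_def Let_def)
   show ?thesis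
   proof (cases "y' = y")
    case False
    hence "u y' = bas E n l" "u y = bas E n l" using y y' by auto
    moreover have "phi n (opr Y th z) (bas E n l) = bas E n l" if "z \<in> F" for z
     using pmapD(3)[OF phi FOD(1)[OF that o]] FOD(2)[OF that o] by (metis bas_simp)
    ultimately show ?thesis using e y y' by simp
   qed (use e in simp)
  qed
  have Wb: "phi0 n (th, u) = bas E n l" if o: "th \<in> ops l d" and u: "u \<in> F \<rightarrow>\<^sub>E simp (lev E n) l"
   and y: "!!z. z \<in> F ==> u z = bas E n l" for n th u l
  proof (cases "F = {}")
   case True
   show ?thesis
   proof (cases "set th = {..d}")
    case F: False
    have "fib Y p (opr X th x) = {}" using Fex[OF _ o] True by blast
    hence "v th n (tr th u) = bas E n (sdim X (opr X th x))"
     by (intro qcellD(3)[OF v[OF o F idl_ops] trD[OF o u]]) simp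
    thus ?thesis using phi0v[OF F] xo[OF o] by simp
   next
    case T: True
    thus ?thesis using True length_ops[OF o] by (simp add: phi0_def)
   qed
  next
   case False
   then obtain a where a: "a \<in> F" by auto
   have "phi n (opr Y th a) (bas E n l) = bas E n l"
    using pmapD(3)[OF phi FOD(1)[OF a o], of "bas E n l" n] FOD(2)[OF a o] by simp
   thus ?thesis using W[OF o u a] y a by simp
  qed
  have nscomp: "set (th \<odot> psi) \<noteq> {..d}" if "th \<in> ops l d" "psi \<in> ops k l" "set th \<noteq> {..d}" for th psi l k
   using set_pull[OF that(1,2)] that(3) ops_in_set_le[OF that(1)] by blast
  have opPiE: "(\<lambda>y\<in>F. opr (lev E n) psi (u y)) \<in> F \<rightarrow>\<^sub>E simp (lev E n) m" if "u \<in> F \<rightarrow>\<^sub>E simp (lev E n) l" "psi \<in> ops m l" for u n l psi m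
   using opr_simp[OF PiE_mem[OF that(1)] that(2)] by auto
  have phi0s: "smap_on (filt F d n {}) (loc F d n) (lev E n) (phi0 n)" for n
  proof (rule smap_onI)
   fix z assume "z \<in> filt F d n {}"
   then obtain th u l where zz: "z = (th, u)" "th \<in> ops l d" "u \<in> F \<rightarrow>\<^sub>E simp (lev E n) l" "length th - 1 = l"
    "set th \<noteq> {..d} \<or> (\<forall>y\<in>F - {}. u y = bas E n l) \<or> (\<exists>y\<in>F. \<forall>z\<in>F - {y}. u z = bas E n l)" by (rule filtE)
   have "phi0 n z \<in> simp (lev E n) l"
    using zz(5)
   proof (elim disjE bexE)
    assume ns: "set th \<noteq> {..d}"
    show ?thesis using qcellD(1)[OF v[OF zz(2) ns idl_ops] trD[OF zz(2,3)]] xo[OF zz(2)] phi0v[OF ns] zz(1) by simp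
   next
    assume "\<forall>y\<in>F - {}. u y = bas E n l"
    thus ?thesis using Wb[OF zz(2,3)] zz(1) by simp
   next
    fix y assume y: "y \<in> F" "\<forall>z\<in>F - {y}. u z = bas E n l"
    thus ?thesis using W[OF zz(2,3) y(1)] zz(1) pmapD(1)[OF phi FOD(1)[OF y(1) zz(2)], of "u y" n] FOD(2)[OF y(1) zz(2)]
     PiE_mem[OF zz(3) y(1)] by auto
   qed
   thus "phi0 n z \<in> cells (lev E n) \<and> sdim (lev E n) (phi0 n z) = sdim (loc F d n) z"
    using zz by (simp add: simp_def)
  next
   fix z m psi assume "z \<in> filt F d n {}" and psi: "psi \<in> ops m (sdim (loc F d n) z)"
   then obtain th u l where zz: "z = (th, u)" "th \<in> ops l d" "u \<in> F \<rightarrow>\<^sub>E simp (lev E n) l" "length th - 1 = l"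
    "set th \<noteq> {..d} \<or> (\<forall>y\<in>F - {}. u y = bas E n l) \<or> (\<exists>y\<in>F. \<forall>z\<in>F - {y}. u z = bas E n l)" by (elim filtE)
   have psil: "psi \<in> ops m l" using psi zz by simp
   note o2 = pull_ops[OF zz(2) psil] and w = opPiE[OF zz(3) psil]
   have "phi0 n (th \<odot> psi, \<lambda>y\<in>F. opr (lev E n) psi (u y)) = opr (lev E n) psi (phi0 n (th, u))"
    using zz(5)
   proof (elim disjE bexE)
    assume ns: "set th \<noteq> {..d}"
    have xx: "opr X (th \<odot> psi) x = opr X psi (opr X th x)" using sset_comp[OF X x(1)] zz(2) psil x by auto
    have "v (th \<odot> psi) n (tr (th \<odot> psi) (\<lambda>y\<in>F. opr (lev E n) psi (u y))) = opr (lev E n) psi (v th n (tr th u))"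
    proof (rule qcellD(2)[OF v[OF zz(2) ns psil] trD[OF zz(2,3)]])
     show "psi \<in> ops m (sdim X (opr X th x))" using xo[OF zz(2)] psil by simp
     show "tr (th \<odot> psi) (\<lambda>y\<in>F. opr (lev E n) psi (u y)) \<in> fib Y p (opr X psi (opr X th x)) \<rightarrow>\<^sub>E simp (lev E n) m"
      using tr2[OF o2 w] xx by simp
     fix y assume "y \<in> fib Y p (opr X th x)"
     then obtain a where a: "a \<in> F" "y = opr Y th a" using Fex[OF _ zz(2)] by blast
     show "tr (th \<odot> psi) (\<lambda>y\<in>F. opr (lev E n) psi (u y)) (opr Y psi y) = opr (lev E n) psi (tr th u y)"
      using tr1[OF o2 a(1)] tr1[OF zz(2) a(1)] FOc[OF a(1) zz(2) psil] a by simp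
    qed
    thus ?thesis using phi0v[OF ns] phi0v[OF nscomp[OF zz(2) psil ns]] by simp
   next
    assume "\<forall>y\<in>F - {}. u y = bas E n l"
    thus ?thesis using Wb[OF zz(2,3)] Wb[OF o2 w] basD(3)[OF psil] by simp
   next
    fix y assume y: "y \<in> F" "\<forall>z\<in>F - {y}. u z = bas E n l"
    have "phi0 n (th \<odot> psi, \<lambda>y\<in>F. opr (lev E n) psi (u y)) = phi n (opr Y (th \<odot> psi) y) (opr (lev E n) psi (u y))"
     using W[OF o2 w y(1)] y basD(3)[OF psil] by simp
    also have "\<dots> = opr (lev E n) psi (phi n (opr Y th y) (u y))"
     using pmapD(2)[OF phi FOD(1)[OF y(1) zz(2)], of "u y" n psi m] FOD(2)[OF y(1) zz(2)] PiE_mem[OF zz(3) y(1)] psil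
      FOc[OF y(1) zz(2) psil] by simp
    finally show ?thesis using W[OF zz(2,3) y(1)] y by simp
   qed
   thus "phi0 n (opr (loc F d n) psi z) = opr (lev E n) psi (phi0 n z)" using zz(1) by simp
  qed
  have phi0sg: "phi0 (Suc n) (th, sgu F n u t) = sg E n (phi0 n (th, u)) t"
   if z: "(th, u) \<in> filt F d n {}" and o: "th \<in> ops l d" and t: "t \<in> ops l 1" for n th u l t
  proof -
   have ul: "u \<in> F \<rightarrow>\<^sub>E simp (lev E n) l"
    "set th \<noteq> {..d} \<or> (\<forall>y\<in>F. u y = bas E n l) \<or> (\<exists>y\<in>F. \<forall>z\<in>F - {y}. u z = bas E n l)"
    using filtE[OF z] o length_ops[OF o] by auto
   note w = sgu_PiE[OF ul(1) t]
   show ?thesis using ul(2)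
   proof (elim disjE bexE)
    assume ns: "set th \<noteq> {..d}"
    have "tr th (sgu F n u t) = (\<lambda>z\<in>fib Y p (opr X th x). sig E n (tr th u z) (cl t))"
    proof (rule extensionalityI[of _ "fib Y p (opr X th x)"])
     fix z assume z: "z \<in> fib Y p (opr X th x)"
     then obtain a where a: "a \<in> F" "z = opr Y th a" using Fex[OF _ o] by blast
     show "tr th (sgu F n u t) z = (\<lambda>z\<in>fib Y p (opr X th x). sig E n (tr th u z) (cl t)) z"
      using tr1[OF o a(1)] a z by (simp add: sgu_def sg_def)
    qed (auto simp: tr_def)
    thus ?thesis using qcellD(5)[OF v[OF o ns idl_ops] trD[OF o ul(1)], of "cl t"] cl_circle[OF t] xo[OF o] phi0v[OF ns]
     by (simp add: sg_def)
   next
    assume "\<forall>y\<in>F. u y = bas E n l"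
    thus ?thesis using Wb[OF o ul(1)] Wb[OF o w] sg_bas[OF t] by (simp add: sgu_def)
   next
    fix y assume y: "y \<in> F" "\<forall>z\<in>F - {y}. u z = bas E n l"
    have "phi0 (Suc n) (th, sgu F n u t) = phi (Suc n) (opr Y th y) (sg E n (u y) t)"
     using W[OF o w y(1)] y sg_bas[OF t] by (simp add: sgu_def)
    thus ?thesis using W[OF o ul(1) y(1)] y pmapD(4)[OF phi FOD(1)[OF y(1) o], of "u y" n "cl t"] FOD(2)[OF y(1) o]
     PiE_mem[OF ul(1) y(1)] cl_circle[OF t] by (simp add: sg_def)
   qed
  qed
  have phi0b: "phi0 n (th, \<lambda>y\<in>F. bas E n l) = bas E n l" if "th \<in> ops l d" for n th l
   by (rule Wb[OF that]) auto
  obtain s where s: "!!n. smap (loc F d n) (lev E n) (s n)" "!!n z. z \<in> filt F d n {} ==> s n z = phi0 n z"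
   "!!n th u l t. (th, u) \<in> cells (loc F d n) ==> th \<in> ops l d ==> t \<in> ops l 1 ==> s (Suc n) (th, sgu F n u t) = sg E n (s n (th, u)) t"
   by (rule fibre_extend[OF F phi0s]) (erule (2) phi0sg, erule phi0b, blast)
  define v' where "v' th = (if set th \<noteq> {..d} then v th else (\<lambda>n w. s n (th, pl th w)))" for th
  have v's: "v' th n w = s n (th, pl th w)" if o: "th \<in> ops l d" and w: "w \<in> fib Y p (opr X th x) \<rightarrow>\<^sub>E simp (lev E n) l" for th n w l
  proof (cases "set th = {..d}")
   case False
   have "(th, pl th w) \<in> filt F d n {}" by (rule filtI[OF o pl1[OF o w]]) (use False in blast)
   thus ?thesis using s(2) phi0v[OF False] trpl[OF o w] False by (simp add: v'_def)
  qed (simp add: v'_def)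
  have "qcell E Y X p phi psi (opr X th x) (v' th) (v' (th \<odot> psi))" if o: "th \<in> ops l d" and psi: "psi \<in> ops k l" for th l psi k
  proof (rule qcellI)
   note xo' = xo[OF o]
   have xx: "opr X (th \<odot> psi) x = opr X psi (opr X th x)" using sset_comp[OF X x(1)] o psi x by auto
   show "psi \<in> ops k (sdim X (opr X th x))" using psi xo' by simp
   fix n w assume "w \<in> fib Y p (opr X th x) \<rightarrow>\<^sub>E simp (lev E n) (sdim X (opr X th x))"
   hence w: "w \<in> fib Y p (opr X th x) \<rightarrow>\<^sub>E simp (lev E n) l" using xo' by simp
   note u = pl1[OF o w]
   have uc: "(th, pl th w) \<in> cells (loc F d n)" using u o cells_loc by blast
   note vw = v's[OF o w]
   show "v' th n w \<in> simp (lev E n) (sdim X (opr X th x))"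
    using smapD(1,2)[OF s(1) uc] vw xo' length_ops[OF o] by (simp add: simp_def)
   show "v' th n w = bas E n (sdim X (opr X th x))" if b: "!!y. y \<in> fib Y p (opr X th x) ==> w y = bas E n (sdim X (opr X th x))"
   proof -
    have e: "pl th w y = bas E n l" if "y \<in> F" for y using b[OF FO[OF that o]] xo' that by (simp add: pl_def)
    have "(th, pl th w) \<in> filt F d n {}" by (rule filtI[OF o u]) (use e in auto)
    thus ?thesis using s(2) Wb[OF o u e] vw xo' by simp
   qed
   show "v' th n w = phi n z (w z)" if z: "z \<in> fib Y p (opr X th x)"
    and b: "!!y. y \<in> fib Y p (opr X th x) ==> y \<noteq> z ==> w y = bas E n (sdim X (opr X th x))" for z
   proof -
    obtain a where a: "a \<in> F" "z = opr Y th a" using Fex[OF z o] by blast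
    have e: "pl th w y = bas E n l" if y: "y \<in> F" "y \<noteq> a" for y
    proof -
     have "opr Y th y \<noteq> z" using bij_betw_imp_inj_on[OF bij[OF o]] a y by (auto dest: inj_onD)
     thus ?thesis using b[OF FO[OF y(1) o]] xo' y by (simp add: pl_def)
    qed
    have "(th, pl th w) \<in> filt F d n {}" by (rule filtI[OF o u]) (use e a in auto)
    hence "v' th n w = phi n (opr Y th a) (pl th w a)" using s(2) W[OF o u a(1) e] vw by simp
    thus ?thesis using a by (simp add: pl_def)
   qed
   show "v' th (Suc n) (\<lambda>y\<in>fib Y p (opr X th x). sig E n (w y) t) = sig E n (v' th n w) t"
    if t: "t \<in> simp circle (sdim X (opr X th x))" for t
   proof -
    have tl: "t \<in> ops l 1" "cl t = t" using t xo' by (auto simp: simp_circle cl_id)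
    let ?w = "\<lambda>y\<in>fib Y p (opr X th x). sig E n (w y) t"
    have "?w \<in> fib Y p (opr X th x) \<rightarrow>\<^sub>E simp (lev E (Suc n)) l"
     using sig_simp[OF PiE_mem[OF w]] t xo' by auto
    moreover have "pl th ?w = sgu F n (pl th w) t"
     using FO[OF _ o] tl by (auto simp: pl_def sgu_def sg_def intro!: restrict_ext)
    ultimately show ?thesis using v's[OF o, of ?w "Suc n"] s(3)[OF uc o tl(1)] vw tl by (simp add: sg_def)
   qed
   fix w' assume w': "w' \<in> fib Y p (opr X psi (opr X th x)) \<rightarrow>\<^sub>E simp (lev E n) k"
    and m: "!!y. y \<in> fib Y p (opr X th x) ==> w' (opr Y psi y) = opr (lev E n) psi (w y)"
   have "pl (th \<odot> psi) w' = (\<lambda>y\<in>F. opr (lev E n) psi (pl th w y))"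
    using FOc[OF _ o psi] m[OF FO[OF _ o]] by (auto simp: pl_def intro!: restrict_ext)
   hence "s n (th \<odot> psi, pl (th \<odot> psi) w') = opr (lev E n) psi (s n (th, pl th w))"
    using smapD(3)[OF s(1) uc, of psi k] psi length_ops[OF o] by simp
   thus "v' (th \<odot> psi) n w' = opr (lev E n) psi (v' th n w)"
    using vw v's[OF pull_ops[OF o psi], of w' n] w' xx by simp
  qed
  moreover have "\<forall>l. \<forall>th\<in>ops l d. set th \<noteq> {..d} --> v' th = v th" by (simp add: v'_def)
  ultimately show "\<exists>v'. (\<forall>l. \<forall>th\<in>ops l d. set th \<noteq> {..d} --> v' th = v th) \<and>
    (\<forall>l. \<forall>th\<in>ops l d. \<forall>k. \<forall>psi\<in>ops k l. qcell E Y X p phi psi (opr X th x) (v' th) (v' (th \<odot> psi)))" by blast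
 qed
 then obtain s where s: "\<forall>x\<in>A. s x = (\<lambda>n. s0 n x)"
  "\<forall>x\<in>cells X. \<forall>m. \<forall>th\<in>ops m (sdim X x). qcell E Y X p phi th x (s x) (s (opr X th x))" by blast
 show thesis by (rule that[of "\<lambda>n x. s x n"]) (use s in \<open>auto simp: qmap_def\<close>)
qed

lemma pmap_id: "pmap E Y (\<lambda>n y e. e)"
 unfolding pmap_def by auto

lemma fibre_sum_ex:
 assumes "finite_cover Y X p"
 obtains s where "fibre_sum E Y X p s"
proof -
 obtain s where "qmap E Y X p (cells X) (\<lambda>n y e. e) s"
  by (rule qmap_extend[OF assms _ pmap_id, of "{}"]) (auto simp: subc_def qmap_def)
 thus thesis using that assms by (auto simp: fibre_sum_iff)
qed

end

section \<open>Transfers\<close>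

definition along :: "'y sset => ('y => 'x) => (nat => 'x => ('y => 'e) => 'e) => nat => ('y => 'e) => 'x => 'e" where
 "along Y p s n f x = s n x (restrict f (fib Y p x))"

lemma finite_coverD:
 assumes "finite_cover Y X p"
 shows "is_sset Y" "is_sset X" "smap Y X p"
 using assms unfolding finite_cover_def by blast+

lemma finite_coverI:
 assumes "is_sset Y" "is_sset X" "smap Y X p" "!!x. x \<in> cells X ==> finite (fib Y p x)"
  and "!!x m th y y'. x \<in> cells X ==> th \<in> ops m (sdim X x) ==> y \<in> fib Y p x ==> y' \<in> fib Y p x ==>
    opr Y th y = opr Y th y' ==> y = y'"
  and "!!x m th z. x \<in> cells X ==> th \<in> ops m (sdim X x) ==> z \<in> fib Y p (opr X th x) ==> \<exists>y\<in>fib Y p x. z = opr Y th y"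
 shows "finite_cover Y X p"
 unfolding finite_cover_def
proof (intro conjI allI ballI)
 fix m n th x assume th: "th \<in> ops m n" and "x \<in> simp X n"
 hence x: "x \<in> cells X" "th \<in> ops m (sdim X x)" by (auto simp: simp_def)
 have "opr Y th y \<in> fib Y p (opr X th x)" if "y \<in> fib Y p x" for y
 proof -
  have y: "y \<in> cells Y" "p y = x" using that by (auto simp: fib_def)
  hence thy: "th \<in> ops m (sdim Y y)" using x smapD(2)[OF assms(3) y(1)] by simp
  show ?thesis using sset_opr(1)[OF assms(1) y(1) thy] smapD(3)[OF assms(3) y(1) thy] y by (simp add: fib_def)
 qed
 thus "bij_betw (opr Y th) (fib Y p x) (fib Y p (opr X th x))"
 proof (intro bij_betw_imageI inj_onI equalityI subsetI)
  show "y = y'" if "y \<in> fib Y p x" "y' \<in> fib Y p x" "opr Y th y = opr Y th y'" for y y'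
   by (rule assms(5)[OF x that])
  show "z \<in> opr Y th ` fib Y p x" if "z \<in> fib Y p (opr X th x)" for z
   using assms(6)[OF x that] by blast
 qed blast
qed (use assms in auto)

lemma fib_opr_mem: "finite_cover Y X p ==> x \<in> cells X ==> th \<in> ops m (sdim X x) ==> y \<in> fib Y p x ==> opr Y th y \<in> fib Y p (opr X th x)"
 by (rule bij_betwE[OF fib_opr, rule_format])

lemma fib_opr_inj:
 assumes "finite_cover Y X p" "x \<in> cells X" "th \<in> ops m (sdim X x)" "y \<in> fib Y p x" "y' \<in> fib Y p x"
  "opr Y th y = opr Y th y'"
 shows "y = y'"
 by (rule inj_onD[OF bij_betw_imp_inj_on[OF fib_opr[OF assms(1-3)]] assms(6,4,5)])

lemma fib_opr_ex:
 assumes "finite_cover Y X p" "x \<in> cells X" "th \<in> ops m (sdim X x)" "z \<in> fib Y p (opr X th x)"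
 shows "\<exists>y\<in>fib Y p x. z = opr Y th y"
 using bij_betw_imp_surj_on[OF fib_opr[OF assms(1-3)]] assms(4) by auto

lemma fib_cyl:
 assumes "finite_cover Y X p" "x \<in> cells X" "t \<in> ops (sdim X x) 1"
 shows "fib (sprod Y I1) (\<lambda>z. (p (fst z), snd z)) (x, t) = (\<lambda>y. (y, t)) ` fib Y p x"
 using assms finite_coverD(1)[OF assms(1)] fibD(3)[OF assms(1)] unfolding fib_def by (auto simp: image_iff)

lemma finite_cover_cyl:
 assumes c: "finite_cover Y X p"
 shows "finite_cover (sprod Y I1) (sprod X I1) (\<lambda>z. (p (fst z), snd z))"
proof (rule finite_coverI)
 note D = finite_coverD[OF c]
 show "is_sset (sprod Y I1)" "is_sset (sprod X I1)" using D by auto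
 show "smap (sprod Y I1) (sprod X I1) (\<lambda>z. (p (fst z), snd z))"
  by (rule smap_cylI[OF D(1)]) (use D smapD[OF D(3)] in auto)
 fix x assume x: "x \<in> cells (sprod X I1)"
 obtain a t where a: "x = (a, t)" "a \<in> cells X" "t \<in> ops (sdim X a) 1" using x D(2) by (cases x) auto
 show "finite (fib (sprod Y I1) (\<lambda>z. (p (fst z), snd z)) x)" unfolding a(1) fib_cyl[OF c a(2,3)] using finite_fib[OF c a(2)] by simp
 fix m th assume "th \<in> ops m (sdim (sprod X I1) x)"
 hence th: "th \<in> ops m (sdim X a)" using a by simp
 show "y = y'" if "y \<in> fib (sprod Y I1) (\<lambda>z. (p (fst z), snd z)) x" "y' \<in> fib (sprod Y I1) (\<lambda>z. (p (fst z), snd z)) x"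
  "opr (sprod Y I1) th y = opr (sprod Y I1) th y'" for y y'
  using that fib_opr_inj[OF c a(2) th] unfolding a(1) fib_cyl[OF c a(2,3)] by auto
 show "\<exists>y\<in>fib (sprod Y I1) (\<lambda>z. (p (fst z), snd z)) x. z = opr (sprod Y I1) th y"
  if "z \<in> fib (sprod Y I1) (\<lambda>z. (p (fst z), snd z)) (opr (sprod X I1) th x)" for z
  using that fib_opr_ex[OF c a(2) th] sset_opr[OF D(2) a(2) th] pull_ops[OF a(3) th]
  unfolding a(1) fib_cyl[OF c a(2,3)] opr_sprod opr_std_simplex by (auto simp: fib_cyl[OF c])
qed

lemma qmapD: "qmap E Y X p A phi s ==> x \<in> A ==> th \<in> ops l (sdim X x) ==> qcell E Y X p phi th x (\<lambda>n. s n x) (\<lambda>n. s n (opr X th x))"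
 unfolding qmap_def by blast

lemma restrict_fib_PiE:
 assumes "finite_cover Y X p" "smap Y K f"
 shows "restrict f (fib Y p x) \<in> fib Y p x \<rightarrow>\<^sub>E simp K (sdim X x)"
 using smapD(1,2)[OF assms(2)] fibD[OF assms(1)] by (auto simp: simp_def)

lemma smap_along:
 assumes c: "finite_cover Y X p" and s: "qmap E Y X p (cells X) phi s" and f: "smap Y (lev E n) f"
 shows "smap X (lev E n) (along Y p s n f)"
proof (rule smapI)
 fix x assume x: "x \<in> cells X"
 show "along Y p s n f x \<in> cells (lev E n) \<and> sdim (lev E n) (along Y p s n f x) = sdim X x"
  using qcellD(1)[OF qmapD[OF s x idl_ops] restrict_fib_PiE[OF c f]] by (simp add: along_def simp_def)
 fix m th assume th: "th \<in> ops m (sdim X x)"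
 have x': "sdim X (opr X th x) = m" using sset_opr[OF finite_coverD(2)[OF c] x th] by simp
 have "s n (opr X th x) (restrict f (fib Y p (opr X th x))) = opr (lev E n) th (s n x (restrict f (fib Y p x)))"
 proof (rule qcellD(2)[OF qmapD[OF s x th] restrict_fib_PiE[OF c f] th])
  show "restrict f (fib Y p (opr X th x)) \<in> fib Y p (opr X th x) \<rightarrow>\<^sub>E simp (lev E n) m"
   using restrict_fib_PiE[OF c f, of "opr X th x"] x' by simp
  fix y assume y: "y \<in> fib Y p x"
  thus "restrict f (fib Y p (opr X th x)) (opr Y th y) = opr (lev E n) th (restrict f (fib Y p x) y)"
   using fib_opr_mem[OF c x th y] smapD(3)[OF f, of y th m] fibD[OF c y] th by simp
 qed
 thus "along Y p s n f (opr X th x) = opr (lev E n) th (along Y p s n f x)" by (simp add: along_def)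
qed

context cof_omega
begin

text \<open>Apply \<open>qmap_extend\<close> to the cover of the cylinder, with the two maps
  prescribed over the ends. Pushing forward a homotopy from \<open>f\<close> to \<open>f'\<close>
  along the resulting extension gives the homotopy sought.\<close>

lemma qmap_unique:
 assumes c: "finite_cover Y X p" and phi: "pmap E Y phi"
  and s: "qmap E Y X p (cells X) phi s" "qmap E Y X p (cells X) phi s'"
  and f: "hrel Y {} (lev E n) f f'"
 shows "hrel X {} (lev E n) (along Y p s n f) (along Y p s' n f')"
proof -
 let ?Y = "sprod Y I1" and ?X = "sprod X I1" and ?p = "\<lambda>z. (p (fst z), snd z)"
 note D = finite_coverD[OF c]
 note c' = finite_cover_cyl[OF c]
 have R: "subc ?X (rim X {})" by (rule subc_rim[OF D(2)]) (simp add: subc_def)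
 obtain k where k: "smap ?Y (lev E n) k" "!!b. b \<in> cells Y ==> k (b, cst 0 (sdim Y b)) = f b"
  "!!b. b \<in> cells Y ==> k (b, cst 1 (sdim Y b)) = f' b" using f unfolding hrel_def by blast
 define phi' where "phi' n z = phi n (fst z)" for n and z :: "'a \<times> nat list"
 have phi': "pmap E ?Y phi'" using phi D(1) unfolding pmap_def phi'_def by auto
 \<comment> \<open>For empty \<open>A\<close> the rim consists of the two ends only:
   \<open>s\<close> is placed over the end 0 and \<open>s'\<close> over the end 1.\<close>
 define s0 where "s0 n z u = (if snd z = cst 0 (sdim X (fst z)) then s n (fst z) (\<lambda>y\<in>fib Y p (fst z). u (y, snd z))
   else s' n (fst z) (\<lambda>y\<in>fib Y p (fst z). u (y, snd z)))" for n z u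
 have "qmap E ?Y ?X ?p (rim X {}) phi' s0"
  unfolding qmap_def
 proof (intro ballI allI)
  fix z l th assume z: "z \<in> rim X {}" and "th \<in> ops l (sdim ?X z)"
  obtain x t where zz: "z = (x, t)" by (cases z)
  have th: "th \<in> ops l (sdim X x)" using \<open>th \<in> ops l (sdim ?X z)\<close> zz by simp
  have x: "x \<in> cells X" "t \<in> ops (sdim X x) 1" and t: "t = cst 0 (sdim X x) \<or> t = cst 1 (sdim X x)"
   using z zz D(2) unfolding rim_def by auto
  have x2: "opr X th x \<in> cells X" "sdim X (opr X th x) = l" using sset_opr[OF D(2) x(1) th] by auto
  have t2: "t \<odot> th \<in> ops l 1" using pull_ops[OF x(2) th] .
  obtain r where r: "qmap E Y X p (cells X) phi r" "!!n u. s0 n (x, t) u = r n x (\<lambda>y\<in>fib Y p x. u (y, t))"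
   "!!n u. s0 n (opr X th x, t \<odot> th) u = r n (opr X th x) (\<lambda>y\<in>fib Y p (opr X th x). u (y, t \<odot> th))"
  proof (cases "t = cst 0 (sdim X x)")
   case True
   hence "t \<odot> th = cst 0 l" using cst_pull[OF th] by simp
   thus thesis using that[of s] s True x2 by (simp add: s0_def)
  next
   case False
   hence "t \<odot> th = cst 1 l" using cst_pull[OF th] t by simp
   thus thesis using that[of s'] s False x2 by (simp add: s0_def)
  qed
  note fc = fib_cyl[OF c x] and fc2 = fib_cyl[OF c x2(1)]
  have U: "(\<lambda>y\<in>fib Y p x. u (y, t)) \<in> fib Y p x \<rightarrow>\<^sub>E simp (lev E n) (sdim X x)"
   if "u \<in> fib ?Y ?p z \<rightarrow>\<^sub>E simp (lev E n) (sdim ?X z)" for n u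
   using PiE_mem[OF that] unfolding zz fc by auto
  have q: "qcell E Y X p phi th x (\<lambda>n. r n x) (\<lambda>n. r n (opr X th x))" by (rule qmapD[OF r(1) x(1) th])
  show "qcell E ?Y ?X ?p phi' th z (\<lambda>n. s0 n z) (\<lambda>n. s0 n (opr ?X th z))"
  proof (rule qcellI)
   show "th \<in> ops l (sdim ?X z)" by fact
   fix n u assume u: "u \<in> fib ?Y ?p z \<rightarrow>\<^sub>E simp (lev E n) (sdim ?X z)"
   note Q = qcellD[OF q U[OF u]]
   show "s0 n z u \<in> simp (lev E n) (sdim ?X z)" using Q(1) zz r(2) by simp
   show "s0 n z u = bas E n (sdim ?X z)" if "!!y. y \<in> fib ?Y ?p z ==> u y = bas E n (sdim ?X z)"
    using Q(3) that unfolding zz fc by (simp add: r(2))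
   show "s0 n z u = phi' n y (u y)" if y: "y \<in> fib ?Y ?p z" and b: "!!w. w \<in> fib ?Y ?p z ==> w \<noteq> y ==> u w = bas E n (sdim ?X z)" for y
   proof -
    obtain y0 where y0: "y = (y0, t)" "y0 \<in> fib Y p x" using y unfolding zz fc by auto
    have "r n x (\<lambda>y\<in>fib Y p x. u (y, t)) = phi n y0 ((\<lambda>y\<in>fib Y p x. u (y, t)) y0)"
     by (rule Q(4)[OF y0(2)]) (use b y0 in \<open>auto simp: zz fc\<close>)
    thus ?thesis using y0 by (simp add: zz r(2) phi'_def)
   qed
   show "s0 (Suc n) z (\<lambda>y\<in>fib ?Y ?p z. sig E n (u y) t') = sig E n (s0 n z u) t'" if t': "t' \<in> simp circle (sdim ?X z)" for t'
   proof -
    have "(\<lambda>y\<in>fib Y p x. (\<lambda>y\<in>fib ?Y ?p z. sig E n (u y) t') (y, t)) = (\<lambda>y\<in>fib Y p x. sig E n ((\<lambda>y\<in>fib Y p x. u (y, t)) y) t')"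
     unfolding zz fc by (auto intro!: restrict_ext)
    thus ?thesis using Q(5)[of t'] t' by (simp add: zz r(2))
   qed
   fix u' assume u': "u' \<in> fib ?Y ?p (opr ?X th z) \<rightarrow>\<^sub>E simp (lev E n) l"
    and m: "!!y. y \<in> fib ?Y ?p z ==> u' (opr ?Y th y) = opr (lev E n) th (u y)"
   have "r n (opr X th x) (\<lambda>y\<in>fib Y p (opr X th x). u' (y, t \<odot> th)) = opr (lev E n) th (r n x (\<lambda>y\<in>fib Y p x. u (y, t)))"
   proof (rule Q(2)[OF th])
    show "(\<lambda>y\<in>fib Y p (opr X th x). u' (y, t \<odot> th)) \<in> fib Y p (opr X th x) \<rightarrow>\<^sub>E simp (lev E n) l"
     using PiE_mem[OF u'] fc2[of "t \<odot> th"] t2 x2 zz by auto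
    fix y assume y: "y \<in> fib Y p x"
    have "(y, t) \<in> fib ?Y ?p z" using y unfolding zz fc by simp
    thus "(\<lambda>y\<in>fib Y p (opr X th x). u' (y, t \<odot> th)) (opr Y th y) = opr (lev E n) th ((\<lambda>y\<in>fib Y p x. u (y, t)) y)"
     using m[of "(y, t)"] fib_opr_mem[OF c x(1) th y] y by simp
   qed
   thus "s0 n (opr ?X th z) u' = opr (lev E n) th (s0 n z u)" by (simp add: zz r(2,3))
  qed
 qed
 then obtain H where H: "qmap E ?Y ?X ?p (cells ?X) phi' H" "!!n x u. x \<in> rim X {} ==> H n x u = s0 n x u"
  using qmap_extend[OF c' R phi'] by blast
 have "smap ?X (lev E n) (along ?Y ?p H n k)" by (rule smap_along[OF c' H(1) k(1)])
 moreover have "along ?Y ?p H n k (x, cst i (sdim X x)) = r n x (restrict g (fib Y p x))"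
  if x: "x \<in> cells X" and i: "i = 0 \<and> r = s \<and> g = f \<or> i = 1 \<and> r = s' \<and> g = f'" for x i r g
 proof -
  have o: "cst i (sdim X x) \<in> ops (sdim X x) 1" using i by auto
  have "(x, cst i (sdim X x)) \<in> rim X {}" using x i D(2) unfolding rim_def by auto
  hence "along ?Y ?p H n k (x, cst i (sdim X x)) = s0 n (x, cst i (sdim X x)) (restrict k (fib ?Y ?p (x, cst i (sdim X x))))"
   by (simp add: along_def H(2))
  also have "\<dots> = r n x (\<lambda>y\<in>fib Y p x. restrict k (fib ?Y ?p (x, cst i (sdim X x))) (y, cst i (sdim X x)))"
   using i by (auto simp: s0_def)
  also have "(\<lambda>y\<in>fib Y p x. restrict k (fib ?Y ?p (x, cst i (sdim X x))) (y, cst i (sdim X x))) = restrict g (fib Y p x)"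
  proof (rule restrict_ext)
   fix y assume y: "y \<in> fib Y p x"
   hence "k (y, cst i (sdim X x)) = g y" using k(2,3)[of y] fibD[OF c y] i by auto
   thus "restrict k (fib ?Y ?p (x, cst i (sdim X x))) (y, cst i (sdim X x)) = g y"
    unfolding fib_cyl[OF c x o] using y by simp
  qed
  finally show ?thesis .
 qed
 ultimately show ?thesis unfolding hrel_def by (intro exI[of _ "along ?Y ?p H n k"]) (auto simp: along_def)
qed

abbreviation cls :: "'x sset => ('x => 'e) => ('x => 'e) set" where
 "cls X \<equiv> hclass X (lev E 0)"

abbreviation hm :: "'x sset => ('x => 'e) => ('x => 'e) => bool" where
 "hm X \<equiv> hrel X {} (lev E 0)"

lemma subc_empty [simp]: "subc X {}"
 by (simp add: subc_def)

lemma hm_sym: "is_sset X ==> hm X f g ==> hm X g f"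
 by (rule hrel_sym[OF prism_lev _ subc_empty])

lemma hm_trans: "is_sset X ==> hm X f g ==> hm X g h ==> hm X f h"
 by (rule hrel_trans[OF prism_lev _ subc_empty])

lemma in_hclass: "is_sset X ==> g \<in> cls X f \<longleftrightarrow> hm X f g"
 by (simp add: hclass_def homotopic_iff)

lemma hclass_eqI:
 assumes "is_sset X" "hm X f g"
 shows "cls X f = cls X g"
 using in_hclass[OF assms(1)] hm_sym[OF assms] hm_trans[OF assms(1)] assms(2) by blast

lemma hclass_self: "is_sset X ==> smap X (lev E 0) f ==> f \<in> cls X f"
 by (simp add: in_hclass hrel_refl)

lemma cohomologyE:
 assumes "A \<in> cohomology E X"
 obtains f where "smap X (lev E 0) f" "A = cls X f"
 using assms unfolding cohomology_def by blast

lemma cohomologyI: "smap X (lev E 0) f ==> cls X f \<in> cohomology E X"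
 unfolding cohomology_def by blast

text \<open>All summations and representatives in the union that defines \<open>transfer\<close>
  give homotopic maps, by \<open>qmap_unique\<close>; so the union is a single class, which may be
  computed with any of them.\<close>

lemma transfer_eq:
 assumes s: "fibre_sum E Y X p s" and f: "smap Y (lev E 0) f"
 shows "transfer E Y X p (cls Y f) = cls X (along Y p s 0 f)"
proof -
 have c: "finite_cover Y X p" and q: "qmap E Y X p (cells X) (\<lambda>n y e. e) s" using s by (auto simp: fibre_sum_iff)
 note D = finite_coverD[OF c]
 have "cls X (\<lambda>x. s' 0 x (restrict f' (fib Y p x))) = cls X (along Y p s 0 f)"
  if s': "fibre_sum E Y X p s'" and f': "f' \<in> cls Y f" for s' f'
 proof -
  have "hm X (along Y p s 0 f) (along Y p s' 0 f')"
   by (rule qmap_unique[OF c pmap_id q]) (use s' f' in_hclass[OF D(1)] in \<open>auto simp: fibre_sum_iff\<close>)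
  thus ?thesis using hclass_eqI[OF D(2)] by (simp add: along_def[abs_def])
 qed
 thus ?thesis unfolding transfer_def using s hclass_self[OF D(1) f] by blast
qed

lemma transfer_closed:
 assumes c: "finite_cover Y X p" and A: "A \<in> cohomology E Y"
 shows "transfer E Y X p A \<in> cohomology E X"
proof -
 obtain f where f: "smap Y (lev E 0) f" "A = cls Y f" using A by (rule cohomologyE)
 obtain s where s: "fibre_sum E Y X p s" using fibre_sum_ex[OF c] .
 hence "qmap E Y X p (cells X) (\<lambda>n y e. e) s" by (simp add: fibre_sum_iff)
 thus ?thesis unfolding f(2) transfer_eq[OF s f(1)] by (rule cohomologyI[OF smap_along[OF c _ f(1)]])
qed

end

section \<open>Summations for composites, base change and multiplication maps\<close>

lemma fibre_sumD:
 assumes s: "fibre_sum E Y X p s" and x: "x \<in> cells X" and u: "u \<in> fib Y p x \<rightarrow>\<^sub>E simp (lev E n) (sdim X x)"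
 shows "s n x u \<in> simp (lev E n) (sdim X x)"
  "th \<in> ops l (sdim X x) ==> u' \<in> fib Y p (opr X th x) \<rightarrow>\<^sub>E simp (lev E n) l ==>
    (!!y. y \<in> fib Y p x ==> u' (opr Y th y) = opr (lev E n) th (u y)) ==> s n (opr X th x) u' = opr (lev E n) th (s n x u)"
  "(!!y. y \<in> fib Y p x ==> u y = bas E n (sdim X x)) ==> s n x u = bas E n (sdim X x)"
  "y \<in> fib Y p x ==> (!!z. z \<in> fib Y p x ==> z \<noteq> y ==> u z = bas E n (sdim X x)) ==> s n x u = u y"
  "t \<in> simp circle (sdim X x) ==> s (Suc n) x (\<lambda>y\<in>fib Y p x. sig E n (u y) t) = sig E n (s n x u) t"
proof -
 have q: "qmap E Y X p (cells X) (\<lambda>n y e. e) s" using s by (simp add: fibre_sum_iff)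
 show "th \<in> ops l (sdim X x) ==> u' \<in> fib Y p (opr X th x) \<rightarrow>\<^sub>E simp (lev E n) l ==>
    (!!y. y \<in> fib Y p x ==> u' (opr Y th y) = opr (lev E n) th (u y)) ==> s n (opr X th x) u' = opr (lev E n) th (s n x u)"
  using qcellD(2)[OF qmapD[OF q x] u] by blast
 note Q = qcellD[OF qmapD[OF q x idl_ops] u]
 show "s n x u \<in> simp (lev E n) (sdim X x)" by (rule Q(1))
 show "(!!y. y \<in> fib Y p x ==> u y = bas E n (sdim X x)) ==> s n x u = bas E n (sdim X x)" by (rule Q(3))
 show "y \<in> fib Y p x ==> (!!z. z \<in> fib Y p x ==> z \<noteq> y ==> u z = bas E n (sdim X x)) ==> s n x u = u y" by (rule Q(4))
 show "t \<in> simp circle (sdim X x) ==> s (Suc n) x (\<lambda>y\<in>fib Y p x. sig E n (u y) t) = sig E n (s n x u) t" by (rule Q(5))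
qed

lemma fibre_sumI:
 assumes c: "finite_cover Y X p"
  and "!!n x u. x \<in> cells X ==> u \<in> fib Y p x \<rightarrow>\<^sub>E simp (lev E n) (sdim X x) ==> s n x u \<in> simp (lev E n) (sdim X x)"
  and "!!n x u th l u'. x \<in> cells X ==> u \<in> fib Y p x \<rightarrow>\<^sub>E simp (lev E n) (sdim X x) ==>
    th \<in> ops l (sdim X x) ==> u' \<in> fib Y p (opr X th x) \<rightarrow>\<^sub>E simp (lev E n) l ==>
    (!!y. y \<in> fib Y p x ==> u' (opr Y th y) = opr (lev E n) th (u y)) ==> s n (opr X th x) u' = opr (lev E n) th (s n x u)"
  and "!!n x u. x \<in> cells X ==> u \<in> fib Y p x \<rightarrow>\<^sub>E simp (lev E n) (sdim X x) ==>
    (!!y. y \<in> fib Y p x ==> u y = bas E n (sdim X x)) ==> s n x u = bas E n (sdim X x)"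
  and "!!n x u y. x \<in> cells X ==> u \<in> fib Y p x \<rightarrow>\<^sub>E simp (lev E n) (sdim X x) ==>
    y \<in> fib Y p x ==> (!!z. z \<in> fib Y p x ==> z \<noteq> y ==> u z = bas E n (sdim X x)) ==> s n x u = u y"
  and "!!n x u t. x \<in> cells X ==> u \<in> fib Y p x \<rightarrow>\<^sub>E simp (lev E n) (sdim X x) ==>
    t \<in> simp circle (sdim X x) ==> s (Suc n) x (\<lambda>y\<in>fib Y p x. sig E n (u y) t) = sig E n (s n x u) t"
 shows "fibre_sum E Y X p s"
 unfolding fibre_sum_iff qmap_def
proof (intro conjI c ballI allI)
 fix x l th assume x: "x \<in> cells X" and th: "th \<in> ops l (sdim X x)"
 show "qcell E Y X p (\<lambda>n y e. e) th x (\<lambda>n. s n x) (\<lambda>n. s n (opr X th x))"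
  unfolding qcell_def length_ops[OF th]
 proof (intro ballI allI conjI impI)
  fix n u assume u: "u \<in> fib Y p x \<rightarrow>\<^sub>E simp (lev E n) (sdim X x)"
  show "s n x u \<in> simp (lev E n) (sdim X x)" by (rule assms(2)[OF x u])
  show "s n x u = bas E n (sdim X x)" if "\<forall>y\<in>fib Y p x. u y = bas E n (sdim X x)"
   by (rule assms(4)[OF x u]) (use that in simp)
  show "s n x u = u y" if "y \<in> fib Y p x" "\<forall>z\<in>fib Y p x - {y}. u z = bas E n (sdim X x)" for y
   by (rule assms(5)[OF x u that(1)]) (use that(2) in simp)
  show "s (Suc n) x (\<lambda>y\<in>fib Y p x. sig E n (u y) t) = sig E n (s n x u) t" if "t \<in> simp circle (sdim X x)" for t
   by (rule assms(6)[OF x u that])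
  show "s n (opr X th x) u' = opr (lev E n) th (s n x u)" if "u' \<in> fib Y p (opr X th x) \<rightarrow>\<^sub>E simp (lev E n) l"
   "\<forall>y\<in>fib Y p x. u' (opr Y th y) = opr (lev E n) th (u y)" for u'
   by (rule assms(3)[OF x u th that(1)]) (use that(2) in simp)
 qed
qed

lemma fib_comp:
 assumes "finite_cover Z Y q" "finite_cover Y X p" "y \<in> fib Y p x"
 shows "fib Z q y \<subseteq> fib Z (\<lambda>z. p (q z)) x"
 using assms unfolding fib_def by auto

lemma fib_comp_mem:
 assumes "finite_cover Z Y q" "z \<in> fib Z (\<lambda>z. p (q z)) x"
 shows "q z \<in> fib Y p x \<and> z \<in> fib Z q (q z)"
 using assms smapD(1)[OF finite_coverD(3)[OF assms(1)], of z] unfolding fib_def by auto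

lemma finite_cover_comp:
 assumes c: "finite_cover Z Y q" "finite_cover Y X p"
 shows "finite_cover Z X (\<lambda>z. p (q z))"
proof (rule finite_coverI)
 show "is_sset Z" "is_sset X" by (rule finite_coverD(1)[OF c(1)], rule finite_coverD(2)[OF c(2)])
 show "smap Z X (\<lambda>z. p (q z))" by (rule smap_comp[OF finite_coverD(3)[OF c(1)] finite_coverD(3)[OF c(2)]])
 fix x assume x: "x \<in> cells X"
 have "fib Z (\<lambda>z. p (q z)) x = (\<Union>y\<in>fib Y p x. fib Z q y)"
 proof (intro equalityI subsetI)
  show "z \<in> (\<Union>y\<in>fib Y p x. fib Z q y)" if "z \<in> fib Z (\<lambda>z. p (q z)) x" for z using fib_comp_mem[OF c(1) that] by blast
  show "z \<in> fib Z (\<lambda>z. p (q z)) x" if "z \<in> (\<Union>y\<in>fib Y p x. fib Z q y)" for z using that by (auto simp: fib_def)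
 qed
 moreover have "finite (fib Z q y)" if "y \<in> fib Y p x" for y using finite_fib[OF c(1)] fibD(1)[OF c(2) that] by blast
 ultimately show "finite (fib Z (\<lambda>z. p (q z)) x)" using finite_fib[OF c(2) x] by simp
 fix m th assume th: "th \<in> ops m (sdim X x)"
 have thy: "th \<in> ops m (sdim Y y)" "y \<in> cells Y" if "y \<in> fib Y p x" for y using fibD[OF c(2) that] th by auto
 have qo: "q (opr Z th z) = opr Y th (q z)" if "z \<in> fib Z (\<lambda>z. p (q z)) x" for z
 proof -
  have y: "q z \<in> fib Y p x" "z \<in> fib Z q (q z)" using fib_comp_mem[OF c(1) that] by auto
  thus ?thesis using smapD(3)[OF finite_coverD(3)[OF c(1)] fibD(1)[OF c(1) y(2)], of th m] fibD(3)[OF c(1) y(2)] thy[OF y(1)] by simp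
 qed
 show "z = z'" if z: "z \<in> fib Z (\<lambda>z. p (q z)) x" "z' \<in> fib Z (\<lambda>z. p (q z)) x" "opr Z th z = opr Z th z'" for z z'
 proof -
  note y = fib_comp_mem[OF c(1) z(1)] fib_comp_mem[OF c(1) z(2)]
  have "q z = q z'" using fib_opr_inj[OF c(2) x th, of "q z" "q z'"] y qo[OF z(1)] qo[OF z(2)] z(3) by simp
  thus ?thesis using fib_opr_inj[OF c(1), of "q z" th m z z'] y z(3) thy by auto
 qed
 show "\<exists>y\<in>fib Z (\<lambda>z. p (q z)) x. z = opr Z th y" if z: "z \<in> fib Z (\<lambda>z. p (q z)) (opr X th x)" for z
 proof -
  have y: "q z \<in> fib Y p (opr X th x)" "z \<in> fib Z q (q z)" using fib_comp_mem[OF c(1) z] by auto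
  obtain y0 where y0: "y0 \<in> fib Y p x" "q z = opr Y th y0" using fib_opr_ex[OF c(2) x th y(1)] by blast
  obtain z0 where "z0 \<in> fib Z q y0" "z = opr Z th z0" using fib_opr_ex[OF c(1) thy(2,1)[OF y0(1)], of z] y(2) y0 by auto
  thus ?thesis using fib_comp[OF c y0(1)] by blast
 qed
qed

text \<open>Summing first over the fibres of \<open>q\<close> and then over the fibre of
  \<open>p\<close> meets every condition exactly. For a tuple with a single entry, only one inner
  sum is off the base point.\<close>

lemma fibre_sum_comp:
 assumes sq: "fibre_sum E Z Y q sq" and sp: "fibre_sum E Y X p sp"
 shows "fibre_sum E Z X (\<lambda>z. p (q z)) (\<lambda>n x u. sp n x (\<lambda>y\<in>fib Y p x. sq n y (restrict u (fib Z q y))))"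
proof -
 have c: "finite_cover Z Y q" "finite_cover Y X p" using sq sp by (auto simp: fibre_sum_iff)
 have r: "restrict u (fib Z q y) \<in> fib Z q y \<rightarrow>\<^sub>E S" if "u \<in> fib Z (\<lambda>z. p (q z)) x \<rightarrow>\<^sub>E S" "y \<in> fib Y p x" for u x y S
  using that fib_comp[OF c that(2)] by (auto simp: PiE_def Pi_def)
 have in1: "sq n y (restrict u (fib Z q y)) \<in> simp (lev E n) (sdim X x)"
  if u: "u \<in> fib Z (\<lambda>z. p (q z)) x \<rightarrow>\<^sub>E simp (lev E n) (sdim X x)" and y: "y \<in> fib Y p x" for u x y n
  using fibre_sumD(1)[OF sq fibD(1)[OF c(2) y], of "restrict u (fib Z q y)" n] r[OF u y] fibD(3)[OF c(2) y] by simp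
 have in2: "(\<lambda>y\<in>fib Y p x. sq n y (restrict u (fib Z q y))) \<in> fib Y p x \<rightarrow>\<^sub>E simp (lev E n) (sdim X x)"
  if u: "u \<in> fib Z (\<lambda>z. p (q z)) x \<rightarrow>\<^sub>E simp (lev E n) (sdim X x)" for u x n
  using in1[OF u] by auto
 show ?thesis
 proof (rule fibre_sumI[OF finite_cover_comp[OF c]])
  fix n x u assume x: "x \<in> cells X" and u: "u \<in> fib Z (\<lambda>z. p (q z)) x \<rightarrow>\<^sub>E simp (lev E n) (sdim X x)"
  note P = fibre_sumD[OF sp x in2[OF u]]
  note Q = fibre_sumD[OF sq fibD(1)[OF c(2)], of _ x]
  show "sp n x (\<lambda>y\<in>fib Y p x. sq n y (restrict u (fib Z q y))) \<in> simp (lev E n) (sdim X x)" by (rule P(1))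
  have bas1: "sq n y (restrict u (fib Z q y)) = bas E n (sdim X x)"
   if y: "y \<in> fib Y p x" and b: "!!z. z \<in> fib Z q y ==> u z = bas E n (sdim X x)" for y
   using fibre_sumD(3)[OF sq fibD(1)[OF c(2) y], of "restrict u (fib Z q y)" n] r[OF u y] fibD(3)[OF c(2) y] b by simp
  show "sp n x (\<lambda>y\<in>fib Y p x. sq n y (restrict u (fib Z q y))) = bas E n (sdim X x)"
   if b: "!!z. z \<in> fib Z (\<lambda>z. p (q z)) x ==> u z = bas E n (sdim X x)"
  proof (rule P(3))
   fix y assume y: "y \<in> fib Y p x"
   have "sq n y (restrict u (fib Z q y)) = bas E n (sdim X x)"
    by (rule bas1[OF y]) (use b fib_comp[OF c y] in blast)
   thus "(\<lambda>y\<in>fib Y p x. sq n y (restrict u (fib Z q y))) y = bas E n (sdim X x)" using y by simp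
  qed
  show "sp n x (\<lambda>y\<in>fib Y p x. sq n y (restrict u (fib Z q y))) = u z"
   if z: "z \<in> fib Z (\<lambda>z. p (q z)) x" and b: "!!w. w \<in> fib Z (\<lambda>z. p (q z)) x ==> w \<noteq> z ==> u w = bas E n (sdim X x)" for z
  proof -
   have y: "q z \<in> fib Y p x" "z \<in> fib Z q (q z)" using fib_comp_mem[OF c(1) z] by auto
   have "sp n x (\<lambda>y\<in>fib Y p x. sq n y (restrict u (fib Z q y))) = (\<lambda>y\<in>fib Y p x. sq n y (restrict u (fib Z q y))) (q z)"
   proof (rule P(4)[OF y(1)])
    fix y' assume y': "y' \<in> fib Y p x" "y' \<noteq> q z"
    have "u w = bas E n (sdim X x)" if "w \<in> fib Z q y'" for w
     using b[of w] that y' fib_comp[OF c y'(1)] by (auto simp: fib_def)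
    thus "(\<lambda>y\<in>fib Y p x. sq n y (restrict u (fib Z q y))) y' = bas E n (sdim X x)" using bas1[OF y'(1)] y' by simp
   qed
   also have "\<dots> = sq n (q z) (restrict u (fib Z q (q z)))" using y by simp
   also have "\<dots> = restrict u (fib Z q (q z)) z"
    by (rule fibre_sumD(4)[OF sq fibD(1)[OF c(2) y(1)] _ y(2)])
     (use r[OF u y(1)] fibD(3)[OF c(2) y(1)] b fib_comp[OF c y(1)] in auto)
   finally show ?thesis using y by simp
  qed
  show "sp (Suc n) x (\<lambda>y\<in>fib Y p x. sq (Suc n) y (restrict (\<lambda>z\<in>fib Z (\<lambda>z. p (q z)) x. sig E n (u z) t) (fib Z q y)))
    = sig E n (sp n x (\<lambda>y\<in>fib Y p x. sq n y (restrict u (fib Z q y)))) t" if t: "t \<in> simp circle (sdim X x)" for t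
  proof -
   have "sq (Suc n) y (restrict (\<lambda>z\<in>fib Z (\<lambda>z. p (q z)) x. sig E n (u z) t) (fib Z q y)) = sig E n (sq n y (restrict u (fib Z q y))) t"
    if y: "y \<in> fib Y p x" for y
   proof -
    have "restrict (\<lambda>z\<in>fib Z (\<lambda>z. p (q z)) x. sig E n (u z) t) (fib Z q y) = (\<lambda>z\<in>fib Z q y. sig E n (restrict u (fib Z q y) z) t)"
     by (rule ext) (use fib_comp[OF c y] in \<open>auto simp: restrict_def\<close>)
    thus ?thesis using fibre_sumD(5)[OF sq fibD(1)[OF c(2) y], of "restrict u (fib Z q y)" n t] r[OF u y] fibD(3)[OF c(2) y] t by simp
   qed
   hence "(\<lambda>y\<in>fib Y p x. sq (Suc n) y (restrict (\<lambda>z\<in>fib Z (\<lambda>z. p (q z)) x. sig E n (u z) t) (fib Z q y)))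
    = (\<lambda>y\<in>fib Y p x. sig E n ((\<lambda>y\<in>fib Y p x. sq n y (restrict u (fib Z q y))) y) t)"
    by (auto intro!: restrict_ext)
   thus ?thesis using P(5)[OF t] by simp
  qed
  fix th l u' assume th: "th \<in> ops l (sdim X x)" and u': "u' \<in> fib Z (\<lambda>z. p (q z)) (opr X th x) \<rightarrow>\<^sub>E simp (lev E n) l"
   and m: "!!z. z \<in> fib Z (\<lambda>z. p (q z)) x ==> u' (opr Z th z) = opr (lev E n) th (u z)"
  have xo: "sdim X (opr X th x) = l" using sset_opr[OF finite_coverD(2)[OF c(2)] x th] by simp
  show "sp n (opr X th x) (\<lambda>y\<in>fib Y p (opr X th x). sq n y (restrict u' (fib Z q y)))
    = opr (lev E n) th (sp n x (\<lambda>y\<in>fib Y p x. sq n y (restrict u (fib Z q y))))"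
  proof (rule P(2)[OF th])
   show "(\<lambda>y\<in>fib Y p (opr X th x). sq n y (restrict u' (fib Z q y))) \<in> fib Y p (opr X th x) \<rightarrow>\<^sub>E simp (lev E n) l"
    using in2[of u' "opr X th x" n] u' xo by simp
   fix y assume y: "y \<in> fib Y p x"
   have yo: "opr Y th y \<in> fib Y p (opr X th x)" using fib_opr_mem[OF c(2) x th y] .
   have thy: "th \<in> ops l (sdim Y y)" using fibD(3)[OF c(2) y] th by simp
   have "sq n (opr Y th y) (restrict u' (fib Z q (opr Y th y))) = opr (lev E n) th (sq n y (restrict u (fib Z q y)))"
   proof (rule fibre_sumD(2)[OF sq fibD(1)[OF c(2) y] _ thy])
    show "restrict u (fib Z q y) \<in> fib Z q y \<rightarrow>\<^sub>E simp (lev E n) (sdim Y y)" using r[OF u y] fibD(3)[OF c(2) y] by simp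
    show "restrict u' (fib Z q (opr Y th y)) \<in> fib Z q (opr Y th y) \<rightarrow>\<^sub>E simp (lev E n) l" using r[OF u' yo] .
    fix z assume z: "z \<in> fib Z q y"
    thus "restrict u' (fib Z q (opr Y th y)) (opr Z th z) = opr (lev E n) th (restrict u (fib Z q y) z)"
     using m[of z] fib_comp[OF c y] fib_opr_mem[OF c(1) fibD(1)[OF c(2) y] thy z] by auto
   qed
   thus "(\<lambda>y\<in>fib Y p (opr X th x). sq n y (restrict u' (fib Z q y))) (opr Y th y)
     = opr (lev E n) th ((\<lambda>y\<in>fib Y p x. sq n y (restrict u (fib Z q y))) y)" using y yo by simp
  qed
 qed
qed

text \<open>Since \<open>j\<close> identifies corresponding fibres, tuples can be relabelled along
  it and summed over the fibre in the other cover; \<open>jo\<close> makes the relabelling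
  natural.\<close>

lemma fibre_sum_pullback:
 fixes E :: "'e symspec" and Y' :: "'z sset"
 assumes s: "fibre_sum E Y X p s" and c: "finite_cover Y' X' p'" and g: "smap X' X g"
  and j: "!!x. x \<in> cells X' ==> bij_betw j (fib Y' p' x) (fib Y p (g x))"
  and jo: "!!y m th. y \<in> cells Y' ==> th \<in> ops m (sdim Y' y) ==> j (opr Y' th y) = opr Y th (j y)"
 shows "fibre_sum E Y' X' p' (\<lambda>n x u. s n (g x) (\<lambda>z\<in>fib Y p (g x). u (inv_into (fib Y' p' x) j z)))"
proof -
 have c0: "finite_cover Y X p" using s by (simp add: fibre_sum_iff)
 define tr where "tr x u = (\<lambda>z\<in>fib Y p (g x). u (inv_into (fib Y' p' x) j z))" for x and u :: "'z => 'e"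
 have jm: "j y \<in> fib Y p (g x)" if "x \<in> cells X'" "y \<in> fib Y' p' x" for x y using j[OF that(1)] that(2) bij_betwE by blast
 have jex: "\<exists>y\<in>fib Y' p' x. z = j y" if "x \<in> cells X'" "z \<in> fib Y p (g x)" for x z
  using bij_betw_imp_surj_on[OF j[OF that(1)]] that(2) by blast
 have trj: "tr x u (j y) = u y" if "x \<in> cells X'" "y \<in> fib Y' p' x" for x y u
  using jm[OF that] bij_betw_inv_into_left[OF j[OF that(1)] that(2)] by (simp add: tr_def)
 have trP: "tr x u \<in> fib Y p (g x) \<rightarrow>\<^sub>E S" if x: "x \<in> cells X'" and u: "u \<in> fib Y' p' x \<rightarrow>\<^sub>E S" for x u S
 proof (rule PiE_I)
  fix z assume "z \<in> fib Y p (g x)"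
  then obtain y where "y \<in> fib Y' p' x" "z = j y" using jex[OF x] by blast
  thus "tr x u z \<in> S" using trj[OF x] PiE_mem[OF u] by simp
 qed (simp add: tr_def)
 have "fibre_sum E Y' X' p' (\<lambda>n x u. s n (g x) (tr x u))"
 proof (rule fibre_sumI[OF c])
  fix n x u assume x: "x \<in> cells X'" and u: "u \<in> fib Y' p' x \<rightarrow>\<^sub>E simp (lev E n) (sdim X' x)"
  have gx: "g x \<in> cells X" "sdim X (g x) = sdim X' x" using smapD[OF g x] by auto
  have tu: "tr x u \<in> fib Y p (g x) \<rightarrow>\<^sub>E simp (lev E n) (sdim X (g x))" using trP[OF x u] gx by simp
  note P = fibre_sumD[OF s gx(1) tu]
  show "s n (g x) (tr x u) \<in> simp (lev E n) (sdim X' x)" using P(1) gx by simp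
  show "s n (g x) (tr x u) = bas E n (sdim X' x)" if b: "!!y. y \<in> fib Y' p' x ==> u y = bas E n (sdim X' x)"
  proof -
   have "tr x u z = bas E n (sdim X (g x))" if "z \<in> fib Y p (g x)" for z
    using jex[OF x that] trj[OF x] b gx by auto
   thus ?thesis using P(3) gx by simp
  qed
  show "s n (g x) (tr x u) = u y" if y: "y \<in> fib Y' p' x"
   and b: "!!z. z \<in> fib Y' p' x ==> z \<noteq> y ==> u z = bas E n (sdim X' x)" for y
  proof -
   have "tr x u z = bas E n (sdim X (g x))" if z: "z \<in> fib Y p (g x)" "z \<noteq> j y" for z
   proof -
    obtain w where w: "w \<in> fib Y' p' x" "z = j w" using jex[OF x z(1)] by blast
    hence "w \<noteq> y" using z(2) by auto
    thus ?thesis using trj[OF x w(1)] b[OF w(1)] w(2) gx by simp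
   qed
   thus ?thesis using P(4)[OF jm[OF x y]] trj[OF x y] by simp
  qed
  show "s (Suc n) (g x) (tr x (\<lambda>y\<in>fib Y' p' x. sig E n (u y) t)) = sig E n (s n (g x) (tr x u)) t"
   if t: "t \<in> simp circle (sdim X' x)" for t
  proof -
   have "tr x (\<lambda>y\<in>fib Y' p' x. sig E n (u y) t) = (\<lambda>z\<in>fib Y p (g x). sig E n (tr x u z) t)"
   proof (rule extensionalityI[of _ "fib Y p (g x)"])
    fix z assume z: "z \<in> fib Y p (g x)"
    then obtain y where y: "y \<in> fib Y' p' x" "z = j y" using jex[OF x] by blast
    thus "tr x (\<lambda>y\<in>fib Y' p' x. sig E n (u y) t) z = (\<lambda>z\<in>fib Y p (g x). sig E n (tr x u z) t) z"
     using trj[OF x y(1)] z by simp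
   qed (auto simp: tr_def)
   thus ?thesis using P(5)[of t] t gx by simp
  qed
  fix th l u' assume th: "th \<in> ops l (sdim X' x)" and u': "u' \<in> fib Y' p' (opr X' th x) \<rightarrow>\<^sub>E simp (lev E n) l"
   and m: "!!y. y \<in> fib Y' p' x ==> u' (opr Y' th y) = opr (lev E n) th (u y)"
  have go: "g (opr X' th x) = opr X th (g x)" using smapD(3)[OF g x th] .
  have xo: "opr X' th x \<in> cells X'" using sset_opr[OF finite_coverD(2)[OF c] x th] by simp
  have "s n (opr X th (g x)) (tr (opr X' th x) u') = opr (lev E n) th (s n (g x) (tr x u))"
  proof (rule P(2))
   show "th \<in> ops l (sdim X (g x))" using th gx by simp
   show "tr (opr X' th x) u' \<in> fib Y p (opr X th (g x)) \<rightarrow>\<^sub>E simp (lev E n) l" using trP[OF xo u'] go by simp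
   fix z assume "z \<in> fib Y p (g x)"
   then obtain y where y: "y \<in> fib Y' p' x" "z = j y" using jex[OF x] by blast
   have "opr Y th z = j (opr Y' th y)" using jo[OF fibD(1)[OF c y(1)], of th l] fibD(3)[OF c y(1)] th y(2) by simp
   thus "tr (opr X' th x) u' (opr Y th z) = opr (lev E n) th (tr x u z)"
    using trj[OF xo fib_opr_mem[OF c x th y(1)]] trj[OF x y(1)] m[OF y(1)] y(2) by simp
  qed
  thus "s n (g (opr X' th x)) (tr (opr X' th x) u') = opr (lev E n) th (s n (g x) (tr x u))" using go by simp
 qed
 thus ?thesis by (simp add: tr_def)
qed

text \<open>Here \<open>m\<close> is applied to the entries before summing, in
  \<open>qmap_post\<close> to the sum. On single-entry tuples there is no difference, which is how
  uniqueness produces the projection formula.\<close>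

lemma qmap_pre:
 assumes s: "fibre_sum E Y X p s" and m: "pmap E Y m"
 shows "qmap E Y X p (cells X) m (\<lambda>n x u. s n x (\<lambda>y\<in>fib Y p x. m n y (u y)))"
proof -
 have c: "finite_cover Y X p" using s by (simp add: fibre_sum_iff)
 have mP: "(\<lambda>y\<in>fib Y p x. m n y (u y)) \<in> fib Y p x \<rightarrow>\<^sub>E simp (lev E n) (sdim X x)"
  if "u \<in> fib Y p x \<rightarrow>\<^sub>E simp (lev E n) (sdim X x)" for n x u
  using pmapD(1)[OF m fibD(1)[OF c]] PiE_mem[OF that] fibD(3)[OF c] by auto
 show ?thesis unfolding qmap_def
 proof (intro ballI allI)
  fix x l th assume x: "x \<in> cells X" and th: "th \<in> ops l (sdim X x)"
  have xo: "sdim X (opr X th x) = l" using sset_opr[OF finite_coverD(2)[OF c] x th] by simp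
  show "qcell E Y X p m th x (\<lambda>n u. s n x (\<lambda>y\<in>fib Y p x. m n y (u y))) (\<lambda>n u. s n (opr X th x) (\<lambda>y\<in>fib Y p (opr X th x). m n y (u y)))"
  proof (rule qcellI[OF th])
   fix n u assume u: "u \<in> fib Y p x \<rightarrow>\<^sub>E simp (lev E n) (sdim X x)"
   note P = fibre_sumD[OF s x mP[OF u]]
   have M: "m n y (bas E n (sdim X x)) = bas E n (sdim X x)" if "y \<in> fib Y p x" for y
    using pmapD(3)[OF m fibD(1)[OF c that], of "u y" n] PiE_mem[OF u that] fibD(3)[OF c that] by simp
   show "s n x (\<lambda>y\<in>fib Y p x. m n y (u y)) \<in> simp (lev E n) (sdim X x)" by (rule P(1))
   show "s n x (\<lambda>y\<in>fib Y p x. m n y (u y)) = bas E n (sdim X x)" if "!!y. y \<in> fib Y p x ==> u y = bas E n (sdim X x)"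
    by (rule P(3)) (use that M in auto)
   show "s n x (\<lambda>y\<in>fib Y p x. m n y (u y)) = m n y (u y)" if y: "y \<in> fib Y p x"
    and "!!z. z \<in> fib Y p x ==> z \<noteq> y ==> u z = bas E n (sdim X x)" for y
    using P(4)[OF y] that M y by auto
   show "s (Suc n) x (\<lambda>y\<in>fib Y p x. m (Suc n) y ((\<lambda>y\<in>fib Y p x. sig E n (u y) t) y)) = sig E n (s n x (\<lambda>y\<in>fib Y p x. m n y (u y))) t"
    if t: "t \<in> simp circle (sdim X x)" for t
   proof -
    have "(\<lambda>y\<in>fib Y p x. m (Suc n) y ((\<lambda>y\<in>fib Y p x. sig E n (u y) t) y)) = (\<lambda>y\<in>fib Y p x. sig E n ((\<lambda>y\<in>fib Y p x. m n y (u y)) y) t)"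
     using pmapD(4)[OF m fibD(1)[OF c]] PiE_mem[OF u] fibD(3)[OF c] t by (auto intro!: restrict_ext)
    thus ?thesis using P(5)[OF t] by simp
   qed
   fix u' assume u': "u' \<in> fib Y p (opr X th x) \<rightarrow>\<^sub>E simp (lev E n) l"
    and mm: "!!y. y \<in> fib Y p x ==> u' (opr Y th y) = opr (lev E n) th (u y)"
   show "s n (opr X th x) (\<lambda>y\<in>fib Y p (opr X th x). m n y (u' y)) = opr (lev E n) th (s n x (\<lambda>y\<in>fib Y p x. m n y (u y)))"
   proof (rule P(2)[OF th])
    show "(\<lambda>y\<in>fib Y p (opr X th x). m n y (u' y)) \<in> fib Y p (opr X th x) \<rightarrow>\<^sub>E simp (lev E n) l"
     using mP[of u' "opr X th x" n] u' xo by simp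
    fix y assume y: "y \<in> fib Y p x"
    thus "(\<lambda>y\<in>fib Y p (opr X th x). m n y (u' y)) (opr Y th y) = opr (lev E n) th ((\<lambda>y\<in>fib Y p x. m n y (u y)) y)"
     using pmapD(2)[OF m fibD(1)[OF c y], of "u y" n th l] PiE_mem[OF u y] fibD(3)[OF c y] th mm[OF y] fib_opr_mem[OF c x th y] by simp
   qed
  qed
 qed
qed

lemma qmap_post:
 assumes s: "fibre_sum E Y X p s" and m: "pmap E X m"
 shows "qmap E Y X p (cells X) (\<lambda>n y. m n (p y)) (\<lambda>n x u. m n x (s n x u))"
proof -
 have c: "finite_cover Y X p" using s by (simp add: fibre_sum_iff)
 show ?thesis unfolding qmap_def
 proof (intro ballI allI qcellI)
  fix x l th n u assume x: "x \<in> cells X" and th: "th \<in> ops l (sdim X x)" and u: "u \<in> fib Y p x \<rightarrow>\<^sub>E simp (lev E n) (sdim X x)"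
  note P = fibre_sumD[OF s x u] and M = pmapD[OF m x fibre_sumD(1)[OF s x u]]
  show "m n x (s n x u) \<in> simp (lev E n) (sdim X x)" by (rule M(1))
  show "m n x (s n x u) = bas E n (sdim X x)" if "!!y. y \<in> fib Y p x ==> u y = bas E n (sdim X x)" using P(3) M(3) that by simp
  show "m n x (s n x u) = m n (p y) (u y)" if y: "y \<in> fib Y p x"
   and "!!z. z \<in> fib Y p x ==> z \<noteq> y ==> u z = bas E n (sdim X x)" for y
   using P(4)[OF y] that fibD(2)[OF c y] by simp
  show "m (Suc n) x (s (Suc n) x (\<lambda>y\<in>fib Y p x. sig E n (u y) t)) = sig E n (m n x (s n x u)) t"
   if "t \<in> simp circle (sdim X x)" for t using P(5)[OF that] M(4)[OF that] by simp
  show "m n (opr X th x) (s n (opr X th x) u') = opr (lev E n) th (m n x (s n x u))"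
   if "u' \<in> fib Y p (opr X th x) \<rightarrow>\<^sub>E simp (lev E n) l" "!!y. y \<in> fib Y p x ==> u' (opr Y th y) = opr (lev E n) th (u y)" for u'
   using P(2)[OF th that] M(2)[OF th] by simp
 qed
qed

section \<open>Addition\<close>

lemma cells_disc [simp]: "(x, w) \<in> cells (sprod_disc X W) \<longleftrightarrow> x \<in> cells X \<and> w \<in> W"
 by (simp add: sprod_disc_def)

lemma sdim_disc [simp]: "sdim (sprod_disc X W) (x, w) = sdim X x"
 by (simp add: sprod_disc_def)

lemma opr_disc [simp]: "opr (sprod_disc X W) th (x, w) = (opr X th x, w)"
 by (simp add: sprod_disc_def)

lemma is_sset_disc: "is_sset X ==> is_sset (sprod_disc X W)"
 by (rule is_ssetI) (auto simp: sset_opr sset_comp sset_id split: prod.splits)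

abbreviation dbl :: "'x sset => ('x \<times> bool) sset" where
 "dbl X \<equiv> sprod_disc X UNIV"

lemma smap_discI:
 assumes "!!x w. x \<in> cells X ==> w \<in> W ==> h (x, w) \<in> cells K \<and> sdim K (h (x, w)) = sdim X x"
  and "!!x w m th. x \<in> cells X ==> w \<in> W ==> th \<in> ops m (sdim X x) ==> h (opr X th x, w) = opr K th (h (x, w))"
 shows "smap (sprod_disc X W) K h"
 using assms by (intro smapI) (auto split: prod.splits)

lemma fib_disc: "x \<in> cells X ==> fib (sprod_disc X W) fst x = {x} \<times> W"
 by (auto simp: fib_def)

lemma finite_cover_disc:
 assumes "is_sset X" "finite W"
 shows "finite_cover (sprod_disc X W) X fst"
 by (rule finite_coverI) (use assms is_sset_disc sset_opr[OF assms(1)] in \<open>auto simp: fib_disc intro!: smap_discI\<close>)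

section \<open>Functoriality and base change of transfers, and the addition of classes\<close>

context cof_omega
begin

lemma transfer_comp:
 assumes c: "finite_cover Z Y q" "finite_cover Y X p" and A: "A \<in> cohomology E Z"
 shows "transfer E Z X (\<lambda>z. p (q z)) A = transfer E Y X p (transfer E Z Y q A)"
proof -
 obtain f where f: "smap Z (lev E 0) f" "A = cls Z f" using A by (rule cohomologyE)
 obtain sq where sq: "fibre_sum E Z Y q sq" using fibre_sum_ex[OF c(1)] .
 obtain sp where sp: "fibre_sum E Y X p sp" using fibre_sum_ex[OF c(2)] .
 have af: "smap Y (lev E 0) (along Z q sq 0 f)" using smap_along[OF c(1) _ f(1)] sq by (auto simp: fibre_sum_iff)
 have "along Z (\<lambda>z. p (q z)) (\<lambda>n x u. sp n x (\<lambda>y\<in>fib Y p x. sq n y (restrict u (fib Z q y)))) 0 f = along Y p sp 0 (along Z q sq 0 f)"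
 proof
  fix x
  have "restrict (restrict f (fib Z (\<lambda>z. p (q z)) x)) (fib Z q y) = restrict f (fib Z q y)" if "y \<in> fib Y p x" for y
   using fib_comp[OF c that] by (simp add: Int_absorb1)
  thus "along Z (\<lambda>z. p (q z)) (\<lambda>n x u. sp n x (\<lambda>y\<in>fib Y p x. sq n y (restrict u (fib Z q y)))) 0 f x = along Y p sp 0 (along Z q sq 0 f) x"
   by (simp add: along_def[abs_def] cong: restrict_cong)
 qed
 thus ?thesis unfolding f(2) transfer_eq[OF fibre_sum_comp[OF sq sp] f(1)] transfer_eq[OF sq f(1)] transfer_eq[OF sp af] by simp
qed

text \<open>Base change. In the applications \<open>g\<close> is the inclusion of a sheet of the
  double cover or the identity, and \<open>j\<close> picks out a colour class or permutes
  sheets.\<close>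

lemma transfer_pullback:
 assumes s: "fibre_sum E Y X p s" and c: "finite_cover Y' X' p'" and g: "smap X' X g"
  and j: "!!x. x \<in> cells X' ==> bij_betw j (fib Y' p' x) (fib Y p (g x))"
  and jo: "!!y m th. y \<in> cells Y' ==> th \<in> ops m (sdim Y' y) ==> j (opr Y' th y) = opr Y th (j y)"
  and f: "smap Y (lev E 0) f"
 shows "transfer E Y' X' p' (cls Y' (\<lambda>y. f (j y))) = cls X' (\<lambda>x. along Y p s 0 f (g x))"
proof -
 have c0: "finite_cover Y X p" using s by (simp add: fibre_sum_iff)
 note D = finite_coverD[OF c]
 have py: "p' y \<in> cells X' \<and> y \<in> fib Y' p' (p' y) \<and> sdim X' (p' y) = sdim Y' y" if "y \<in> cells Y'" for y
  using smapD[OF D(3) that] that by (simp add: fib_def)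
 have jy: "j y \<in> cells Y" "sdim Y (j y) = sdim Y' y" if "y \<in> cells Y'" for y
  using bij_betwE[OF j, of "p' y"] py[OF that] fibD[OF c0, of "j y" "g (p' y)"] smapD(2)[OF g, of "p' y"] by auto
 have fj: "smap Y' (lev E 0) (\<lambda>y. f (j y))"
  using jy smapD[OF f] jo by (intro smapI) auto
 have F: "fibre_sum E Y' X' p' (\<lambda>n x u. s n (g x) (\<lambda>z\<in>fib Y p (g x). u (inv_into (fib Y' p' x) j z)))"
  by (rule fibre_sum_pullback[OF s c g j]) (assumption, rule jo)
 hence F': "qmap E Y' X' p' (cells X') (\<lambda>n y e. e) (\<lambda>n x u. s n (g x) (\<lambda>z\<in>fib Y p (g x). u (inv_into (fib Y' p' x) j z)))"
  by (simp add: fibre_sum_iff)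
 have "cls X' (along Y' p' (\<lambda>n x u. s n (g x) (\<lambda>z\<in>fib Y p (g x). u (inv_into (fib Y' p' x) j z))) 0 (\<lambda>y. f (j y)))
   = cls X' (\<lambda>x. along Y p s 0 f (g x))"
 proof (rule hclass_eqI[OF D(2)])
  have e: "along Y' p' (\<lambda>n x u. s n (g x) (\<lambda>z\<in>fib Y p (g x). u (inv_into (fib Y' p' x) j z))) 0 (\<lambda>y. f (j y)) x = along Y p s 0 f (g x)"
   if x: "x \<in> cells X'" for x
  proof -
   have "restrict (\<lambda>y. f (j y)) (fib Y' p' x) (inv_into (fib Y' p' x) j z) = f z" if "z \<in> fib Y p (g x)" for z
    using bij_betw_inv_into_right[OF j[OF x] that] bij_betwE[OF bij_betw_inv_into[OF j[OF x]]] that by simp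
   thus ?thesis by (simp add: along_def cong: restrict_cong)
  qed
  show "hm X' (along Y' p' (\<lambda>n x u. s n (g x) (\<lambda>z\<in>fib Y p (g x). u (inv_into (fib Y' p' x) j z))) 0 (\<lambda>y. f (j y))) (\<lambda>x. along Y p s 0 f (g x))"
   by (rule hrel_cong[OF hrel_refl[OF smap_along[OF c F' fj] D(2)]])
    (use F' e in auto)
 qed
 thus ?thesis unfolding transfer_eq[OF F fj] .
qed

lemma transfer_cong:
 assumes "!!y. y \<in> cells Y ==> p y = p' y" and Y: "is_sset Y"
 shows "transfer E Y X p A = transfer E Y X p' A"
proof -
 have f: "fib Y p = fib Y p'" using assms(1) by (auto simp: fib_def fun_eq_iff)
 have "smap Y X p \<longleftrightarrow> smap Y X p'"
  using smap_cong[OF _ Y, of X p p'] smap_cong[OF _ Y, of X p' p] assms(1) by auto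
 hence "finite_cover Y X p \<longleftrightarrow> finite_cover Y X p'" unfolding finite_cover_def f by simp
 hence "fibre_sum E Y X p = fibre_sum E Y X p'" unfolding fibre_sum_def f by (simp add: fun_eq_iff)
 thus ?thesis unfolding transfer_def f by simp
qed

text \<open>The sum of the cohomology ring without reference to \<open>\<xi>\<close>: the additive
  structure depends on the spectrum alone.\<close>

definition cadd :: "'x sset => ('x => 'e) set => ('x => 'e) set => ('x => 'e) set" where
 "cadd X A B = transfer E (dbl X) X fst {h. (\<lambda>x. h (x, False)) \<in> A \<and> (\<lambda>x. h (x, True)) \<in> B}"

definition czero :: "'x sset => ('x => 'e) set" where
 "czero X = cls X (\<lambda>x. bas E 0 (sdim X x))"

definition cpair :: "('x => 'a) => ('x => 'a) => 'x \<times> bool => 'a" where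
 "cpair f g z = (if snd z then g (fst z) else f (fst z))"

lemma smap_cpair: "smap X K f ==> smap X K g ==> smap (dbl X) K (cpair f g)"
 by (rule smap_discI) (auto simp: cpair_def dest: smapD)

lemma smap_slice: "smap X (sprod_disc X W) (\<lambda>x. (x, w))" if "w \<in> W"
 using that by (intro smapI) auto

text \<open>Homotopies on the two sheets are independent, so the set of all pairs of representatives
  is one homotopy class on the double cover.\<close>

lemma cadd_transfer:
 assumes X: "is_sset X" and f: "smap X (lev E 0) f" and g: "smap X (lev E 0) g"
 shows "cadd X (cls X f) (cls X g) = transfer E (dbl X) X fst (cls (dbl X) (cpair f g))"
proof -
 have D: "is_sset (dbl X)" by (rule is_sset_disc[OF X])
 have "hm X f (\<lambda>x. h (x, False)) \<and> hm X g (\<lambda>x. h (x, True)) \<longleftrightarrow> hm (dbl X) (cpair f g) h" for h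
 proof
  assume "hm (dbl X) (cpair f g) h"
  from hrel_pre[OF this smap_slice D X, of False] hrel_pre[OF this smap_slice D X, of True]
  show "hm X f (\<lambda>x. h (x, False)) \<and> hm X g (\<lambda>x. h (x, True))" by (simp add: cpair_def)
 next
  assume "hm X f (\<lambda>x. h (x, False)) \<and> hm X g (\<lambda>x. h (x, True))"
  then obtain k k' where k: "smap (sprod X I1) (lev E 0) k" "!!b. b \<in> cells X ==> k (b, cst 0 (sdim X b)) = f b"
    "!!b. b \<in> cells X ==> k (b, cst 1 (sdim X b)) = h (b, False)"
   and k': "smap (sprod X I1) (lev E 0) k'" "!!b. b \<in> cells X ==> k' (b, cst 0 (sdim X b)) = g b"
    "!!b. b \<in> cells X ==> k' (b, cst 1 (sdim X b)) = h (b, True)"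
   unfolding hrel_def by blast
  define K where "K = (\<lambda>((x, b), t). if b then k' (x, t) else k (x, t))"
  have "smap (sprod (dbl X) I1) (lev E 0) K"
  proof (rule smap_cylI[OF D])
   fix z t assume "z \<in> cells (dbl X)" "t \<in> ops (sdim (dbl X) z) 1"
   thus "K (z, t) \<in> cells (lev E 0) \<and> sdim (lev E 0) (K (z, t)) = sdim (dbl X) z"
    using smap_cyl[OF k(1) X] smap_cyl[OF k'(1) X] by (cases z) (auto simp: K_def)
  next
   fix z t m th assume "z \<in> cells (dbl X)" "t \<in> ops (sdim (dbl X) z) 1" "th \<in> ops m (sdim (dbl X) z)"
   thus "K (opr (dbl X) th z, t \<odot> th) = opr (lev E 0) th (K (z, t))"
    using smap_cyl[OF k(1) X] smap_cyl[OF k'(1) X] by (cases z) (auto simp: K_def)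
  qed
  thus "hm (dbl X) (cpair f g) h"
   unfolding hrel_def using k k' by (intro exI[of _ K]) (auto simp: K_def cpair_def)
 qed
 hence "{h. (\<lambda>x. h (x, False)) \<in> cls X f \<and> (\<lambda>x. h (x, True)) \<in> cls X g} = cls (dbl X) (cpair f g)"
  using in_hclass[OF X] in_hclass[OF D] by blast
 thus ?thesis by (simp add: cadd_def)
qed

lemma cadd_split:
 assumes X: "is_sset X" and h: "smap (dbl X) (lev E 0) h"
 shows "transfer E (dbl X) X fst (cls (dbl X) h)
  = cadd X (cls X (\<lambda>x. h (x, False))) (cls X (\<lambda>x. h (x, True)))"
proof -
 have s: "smap X (lev E 0) (\<lambda>x. h (x, b))" for b using smap_comp[OF smap_slice h, of b] by simp
 have "cpair (\<lambda>x. h (x, False)) (\<lambda>x. h (x, True)) = h" by (auto simp: cpair_def fun_eq_iff)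
 thus ?thesis using cadd_transfer[OF X s s] by simp
qed

text \<open>Summation along the double cover, written as a binary operation on simplices of
  \<open>E\<close> depending on a simplex of \<open>X\<close>. It is unital and commutes with
  suspension exactly, which lets additive questions be moved one level up, where loops can be
  reversed.\<close>

lemma binop_ex:
 assumes X: "is_sset X"
 obtains op' where
  "!!n x e e'. x \<in> cells X ==> e \<in> simp (lev E n) (sdim X x) ==> e' \<in> simp (lev E n) (sdim X x) ==> op' n x e e' \<in> simp (lev E n) (sdim X x)"
  "!!n x e e' th m. x \<in> cells X ==> e \<in> simp (lev E n) (sdim X x) ==> e' \<in> simp (lev E n) (sdim X x) ==> th \<in> ops m (sdim X x) ==>
    op' n (opr X th x) (opr (lev E n) th e) (opr (lev E n) th e') = opr (lev E n) th (op' n x e e')"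
  "!!n x e. x \<in> cells X ==> e \<in> simp (lev E n) (sdim X x) ==> op' n x e (bas E n (sdim X x)) = e"
  "!!n x e. x \<in> cells X ==> e \<in> simp (lev E n) (sdim X x) ==> op' n x (bas E n (sdim X x)) e = e"
  "!!n x e e' t. x \<in> cells X ==> e \<in> simp (lev E n) (sdim X x) ==> e' \<in> simp (lev E n) (sdim X x) ==> t \<in> ops (sdim X x) 1 ==>
    op' (Suc n) x (sg E n e t) (sg E n e' t) = sg E n (op' n x e e') t"
  "!!f g. smap X (lev E 0) f ==> smap X (lev E 0) g ==>
    cadd X (cls X f) (cls X g) = cls X (\<lambda>x. op' 0 x (f x) (g x))"
proof -
 have c: "finite_cover (dbl X) X fst" by (rule finite_cover_disc[OF X]) simp
 obtain s where s: "fibre_sum E (dbl X) X fst s" using fibre_sum_ex[OF c] .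
 define op' where "op' n x e e' = s n x (\<lambda>z\<in>{x} \<times> UNIV. if snd z then e' else e)" for n x e e'
 have P: "(\<lambda>z\<in>{x} \<times> UNIV. if snd z then e' else e) \<in> fib (dbl X) fst x \<rightarrow>\<^sub>E S" if "x \<in> cells X" "e \<in> S" "e' \<in> S" for x e e' S
  using that by (auto simp: fib_disc)
 show thesis
 proof (rule that[of op'])
  fix n x e e' assume x: "x \<in> cells X" and e: "e \<in> simp (lev E n) (sdim X x)" "e' \<in> simp (lev E n) (sdim X x)"
  note F = fibre_sumD[OF s x P[OF x e]]
  show "op' n x e e' \<in> simp (lev E n) (sdim X x)" using F(1) by (simp add: op'_def)
  show "op' n (opr X th x) (opr (lev E n) th e) (opr (lev E n) th e') = opr (lev E n) th (op' n x e e')" if th: "th \<in> ops m (sdim X x)" for th m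
  proof -
   have xo: "opr X th x \<in> cells X" using sset_opr[OF X x th] by simp
   show ?thesis unfolding op'_def
    by (rule F(2)[OF th P[OF xo opr_simp[OF e(1) th] opr_simp[OF e(2) th]]]) (auto simp: fib_disc[OF x])
  qed
  show "op' (Suc n) x (sg E n e t) (sg E n e' t) = sg E n (op' n x e e') t" if t: "t \<in> ops (sdim X x) 1" for t
  proof -
   have "(\<lambda>z\<in>{x} \<times> UNIV. if snd z then sg E n e' t else sg E n e t) = (\<lambda>z\<in>fib (dbl X) fst x. sig E n ((\<lambda>z\<in>{x} \<times> UNIV. if snd z then e' else e) z) (cl t))"
    unfolding fib_disc[OF x] by (auto simp: sg_def intro!: restrict_ext)
   thus ?thesis using F(5)[OF cl_circle[OF t]] unfolding op'_def by (simp only: sg_def)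
  qed
 next
  fix n x e assume x: "x \<in> cells X" and e: "e \<in> simp (lev E n) (sdim X x)"
  show "op' n x e (bas E n (sdim X x)) = e"
   using fibre_sumD(4)[OF s x P[OF x e bas_simp], of "(x, False)"] by (auto simp: op'_def fib_disc[OF x])
  show "op' n x (bas E n (sdim X x)) e = e"
   using fibre_sumD(4)[OF s x P[OF x bas_simp e], of "(x, True)"] by (auto simp: op'_def fib_disc[OF x])
 next
  fix f g assume f: "smap X (lev E 0) f" and g: "smap X (lev E 0) g"
  have e: "along (dbl X) fst s 0 (cpair f g) x = op' 0 x (f x) (g x)" if "x \<in> cells X" for x
  proof -
   have "restrict (cpair f g) ({x} \<times> UNIV) = (\<lambda>z\<in>{x} \<times> UNIV. if snd z then g x else f x)"
    by (auto simp: cpair_def intro!: restrict_ext)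
   thus ?thesis by (simp add: along_def op'_def fib_disc[OF that])
  qed
  have sm: "smap X (lev E 0) (along (dbl X) fst s 0 (cpair f g))"
   using smap_along[OF c _ smap_cpair[OF f g]] s by (auto simp: fibre_sum_iff)
  have "hm X (along (dbl X) fst s 0 (cpair f g)) (\<lambda>x. op' 0 x (f x) (g x))"
   by (rule hrel_cong[OF hrel_refl[OF sm X]]) (use e in auto)
  thus "cadd X (cls X f) (cls X g) = cls X (\<lambda>x. op' 0 x (f x) (g x))"
   unfolding cadd_transfer[OF X f g] transfer_eq[OF s smap_cpair[OF f g]] by (rule hclass_eqI[OF X])
 qed
qed

lemma smap_bas: "smap X (lev E n) (\<lambda>x. bas E n (sdim X x))" if "is_sset X"
 by (rule smapI) (use basD sset_opr[OF that] in auto)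

lemma czero_closed: "is_sset X ==> czero X \<in> cohomology E X"
 unfolding czero_def by (rule cohomologyI[OF smap_bas])

lemma cadd_closed:
 assumes X: "is_sset X" and A: "A \<in> cohomology E X" "B \<in> cohomology E X"
 shows "cadd X A B \<in> cohomology E X"
proof -
 obtain f where f: "smap X (lev E 0) f" "A = cls X f" using A(1) by (rule cohomologyE)
 obtain g where g: "smap X (lev E 0) g" "B = cls X g" using A(2) by (rule cohomologyE)
 have "finite_cover (dbl X) X fst" by (rule finite_cover_disc[OF X]) simp
 thus ?thesis unfolding f(2) g(2) cadd_transfer[OF X f(1) g(1)]
  by (rule transfer_closed) (rule cohomologyI[OF smap_cpair[OF f(1) g(1)]])
qed

lemma cadd_zero:
 assumes X: "is_sset X" and A: "A \<in> cohomology E X"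
 shows "cadd X A (czero X) = A" "cadd X (czero X) A = A"
proof -
 obtain f where f: "smap X (lev E 0) f" "A = cls X f" using A by (rule cohomologyE)
 have fs: "f x \<in> simp (lev E 0) (sdim X x)" if "x \<in> cells X" for x using smapD[OF f(1) that] by (simp add: simp_def)
 obtain op' where op': "!!n x e. x \<in> cells X ==> e \<in> simp (lev E n) (sdim X x) ==> op' n x e (bas E n (sdim X x)) = e"
   "!!n x e. x \<in> cells X ==> e \<in> simp (lev E n) (sdim X x) ==> op' n x (bas E n (sdim X x)) e = e"
   "!!f g. smap X (lev E 0) f ==> smap X (lev E 0) g ==>
    cadd X (cls X f) (cls X g) = cls X (\<lambda>x. op' 0 x (f x) (g x))"
 proof (rule binop_ex[OF X], goal_cases)
  case (1 op')
  show ?case by (rule 1(1)) (rule 1(4), assumption+, rule 1(5), assumption+, rule 1(7), assumption+)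
 qed
 show "cadd X A (czero X) = A" unfolding f(2) czero_def op'(3)[OF f(1) smap_bas[OF X]]
  by (rule hclass_eqI[OF X], rule hrel_cong[OF hrel_refl[OF f(1) X]]) (use op' fs in auto)
 show "cadd X (czero X) A = A" unfolding f(2) czero_def op'(3)[OF smap_bas[OF X] f(1)]
  by (rule hclass_eqI[OF X], rule hrel_cong[OF hrel_refl[OF f(1) X]]) (use op' fs in auto)
qed

text \<open>The trivial cover with four sheets, read as a double cover of a double cover; base
  change to each inner sheet evaluates the inner transfer.\<close>

lemma cadd_quad:
 assumes X: "is_sset X" and k: "smap (dbl (dbl X)) (lev E 0) k"
 shows "transfer E (dbl (dbl X)) X (\<lambda>z. fst (fst z)) (cls (dbl (dbl X)) k) =
  cadd X (cadd X (cls X (\<lambda>x. k ((x, False), False))) (cls X (\<lambda>x. k ((x, False), True))))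
   (cadd X (cls X (\<lambda>x. k ((x, True), False))) (cls X (\<lambda>x. k ((x, True), True))))"
proof -
 have D: "is_sset (dbl X)" by (rule is_sset_disc[OF X])
 have c: "finite_cover (dbl X) X fst" "finite_cover (dbl (dbl X)) (dbl X) fst"
  by (rule finite_cover_disc[OF X], simp) (rule finite_cover_disc[OF D], simp)
 obtain s where s: "fibre_sum E (dbl (dbl X)) (dbl X) fst s" using fibre_sum_ex[OF c(2)] .
 have sk: "smap (dbl X) (lev E 0) (along (dbl (dbl X)) fst s 0 k)"
  using smap_along[OF c(2) _ k] s by (auto simp: fibre_sum_iff)
 have kb: "smap (dbl X) (lev E 0) (\<lambda>z. k ((fst z, b), snd z))" for b
 proof (rule smap_discI)
  fix x w assume x: "x \<in> cells X"
  note S = smapD[OF k, of "((x, b), w)"]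
  show "k ((fst (x, w), b), snd (x, w)) \<in> cells (lev E 0) \<and> sdim (lev E 0) (k ((fst (x, w), b), snd (x, w))) = sdim X x"
   using S(1,2) x by simp
  fix m th assume "th \<in> ops m (sdim X x)"
  thus "k ((fst (opr X th x, w), b), snd (opr X th x, w)) = opr (lev E 0) th (k ((fst (x, w), b), snd (x, w)))"
   using S(3)[of th m] x by simp
 qed
 have "cls X (\<lambda>x. along (dbl (dbl X)) fst s 0 k (x, b)) = transfer E (dbl X) X fst (cls (dbl X) (\<lambda>z. k ((fst z, b), snd z)))" for b
 proof (rule transfer_pullback[OF s c(1) smap_slice, where j = "\<lambda>z. ((fst z, b), snd z)", symmetric])
  show "bij_betw (\<lambda>z. ((fst z, b), snd z)) (fib (dbl X) fst x) (fib (dbl (dbl X)) fst (x, b))" if x: "x \<in> cells X" for x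
  proof -
   have "(x, b) \<in> cells (dbl X)" using x by simp
   thus ?thesis unfolding fib_disc[OF x] fib_disc[OF \<open>(x, b) \<in> cells (dbl X)\<close>]
    by (intro bij_betw_byWitness[where f' = "\<lambda>z. (fst (fst z), snd z)"]) auto
  qed
  fix y m th show "((fst (opr (dbl X) th y), b), snd (opr (dbl X) th y)) = opr (dbl (dbl X)) th ((fst y, b), snd y)" by (cases y) simp
 qed (simp, rule k)
 moreover have "transfer E (dbl X) X fst (cls (dbl X) (\<lambda>z. k ((fst z, b), snd z)))
   = cadd X (cls X (\<lambda>x. k ((x, b), False))) (cls X (\<lambda>x. k ((x, b), True)))" for b
  using cadd_split[OF X kb, of b] by simp
 ultimately have e: "!!b. cls X (\<lambda>x. along (dbl (dbl X)) fst s 0 k (x, b)) =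
   cadd X (cls X (\<lambda>x. k ((x, b), False))) (cls X (\<lambda>x. k ((x, b), True)))" by simp
 show ?thesis unfolding transfer_comp[OF c(2,1) cohomologyI[OF k]] transfer_eq[OF s k] cadd_split[OF X sk] e ..
qed

text \<open>Exchanging the two sheet coordinates is an automorphism of the trivial cover with four
  sheets, so it does not affect the transfer. Commutativity and associativity follow from this by
  the Eckmann-Hilton argument.\<close>

lemma cadd_interchange:
 assumes X: "is_sset X" and "A \<in> cohomology E X" "B \<in> cohomology E X" "C \<in> cohomology E X" "D \<in> cohomology E X"
 shows "cadd X (cadd X A B) (cadd X C D) = cadd X (cadd X A C) (cadd X B D)"
proof -
 obtain a where a: "smap X (lev E 0) a" "A = cls X a" using assms(2) by (rule cohomologyE)
 obtain b where b: "smap X (lev E 0) b" "B = cls X b" using assms(3) by (rule cohomologyE)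
 obtain c where c: "smap X (lev E 0) c" "C = cls X c" using assms(4) by (rule cohomologyE)
 obtain d where d: "smap X (lev E 0) d" "D = cls X d" using assms(5) by (rule cohomologyE)
 define k where "k z = cpair (cpair a b) (cpair c d) ((fst (fst z), snd z), snd (fst z))" for z
 have k: "smap (dbl (dbl X)) (lev E 0) k"
 proof (rule smap_discI)
  fix z w assume "z \<in> cells (dbl X)"
  thus "k (z, w) \<in> cells (lev E 0) \<and> sdim (lev E 0) (k (z, w)) = sdim (dbl X) z"
   using smapD(1,2)[OF a(1)] smapD(1,2)[OF b(1)] smapD(1,2)[OF c(1)] smapD(1,2)[OF d(1)] by (cases z) (auto simp: k_def cpair_def)
  fix m th assume "th \<in> ops m (sdim (dbl X) z)"
  thus "k (opr (dbl X) th z, w) = opr (lev E 0) th (k (z, w))"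
   using \<open>z \<in> cells (dbl X)\<close> smapD(3)[OF a(1)] smapD(3)[OF b(1)] smapD(3)[OF c(1)] smapD(3)[OF d(1)] by (cases z) (auto simp: k_def cpair_def)
 qed
 let ?j = "\<lambda>z :: ('b \<times> bool) \<times> bool. ((fst (fst z), snd z), snd (fst z))"
 have k': "smap (dbl (dbl X)) (lev E 0) (\<lambda>z. k (?j z))"
 proof (rule smap_discI)
  fix z w assume z: "z \<in> cells (dbl X)"
  thus "k (?j (z, w)) \<in> cells (lev E 0) \<and> sdim (lev E 0) (k (?j (z, w))) = sdim (dbl X) z"
   using smapD(1,2)[OF k, of "?j (z, w)"] by (cases z) auto
  fix m th assume "th \<in> ops m (sdim (dbl X) z)"
  thus "k (?j (opr (dbl X) th z, w)) = opr (lev E 0) th (k (?j (z, w)))"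
   using z smapD(3)[OF k, of "?j (z, w)" th m] by (cases z) auto
 qed
 have DD: "is_sset (dbl X)" by (rule is_sset_disc[OF X])
 have cov: "finite_cover (dbl X) X fst" "finite_cover (dbl (dbl X)) (dbl X) fst"
  by (rule finite_cover_disc[OF X], simp) (rule finite_cover_disc[OF DD], simp)
 note cc = finite_cover_comp[OF cov(2,1)]
 obtain s where s: "fibre_sum E (dbl (dbl X)) X (\<lambda>z. fst (fst z)) s" using fibre_sum_ex[OF cc] .
 have ff: "fib (dbl (dbl X)) (\<lambda>z. fst (fst z)) x = ({x} \<times> UNIV) \<times> UNIV" if "x \<in> cells X" for x using that by (auto simp: fib_def)
 have "transfer E (dbl (dbl X)) X (\<lambda>z. fst (fst z)) (cls (dbl (dbl X)) (\<lambda>z. k (?j z)))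
   = cls X (\<lambda>x. along (dbl (dbl X)) (\<lambda>z. fst (fst z)) s 0 k x)"
 proof (rule transfer_pullback[OF s cc _ _ _ k])
  show "smap X X (\<lambda>x. x)" by (rule smapI) auto
  show "bij_betw ?j (fib (dbl (dbl X)) (\<lambda>z. fst (fst z)) x) (fib (dbl (dbl X)) (\<lambda>z. fst (fst z)) x)" if "x \<in> cells X" for x
   unfolding ff[OF that] by (auto simp: bij_betw_def inj_on_def image_iff)
 qed auto
 hence "transfer E (dbl (dbl X)) X (\<lambda>z. fst (fst z)) (cls (dbl (dbl X)) (\<lambda>z. k (?j z)))
   = transfer E (dbl (dbl X)) X (\<lambda>z. fst (fst z)) (cls (dbl (dbl X)) k)"
  unfolding transfer_eq[OF s k] .
 thus ?thesis unfolding cadd_quad[OF X k] cadd_quad[OF X k'] using a b c d by (simp add: k_def cpair_def)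
qed

text \<open>Eckmann-Hilton: the interchange law with zero in the first and last place.\<close>

lemma cadd_commute:
 assumes "is_sset X" "A \<in> cohomology E X" "B \<in> cohomology E X"
 shows "cadd X A B = cadd X B A"
 using cadd_interchange[OF assms(1) czero_closed[OF assms(1)] assms(2,3) czero_closed[OF assms(1)]] assms by (simp add: cadd_zero)

lemma cadd_assoc:
 assumes "is_sset X" "A \<in> cohomology E X" "B \<in> cohomology E X" "C \<in> cohomology E X"
 shows "cadd X (cadd X A B) C = cadd X A (cadd X B C)"
 using cadd_interchange[OF assms(1-3) czero_closed[OF assms(1)] assms(4)] assms by (simp add: cadd_zero cadd_closed)

text \<open>Suspension is injective on homotopy classes. The homotopy between the suspensions, with
  time and loop coordinate exchanged, is a family of loops over the cylinder of \<open>X\<close>. It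
  is desuspended relative to the two ends, where desuspensions \<open>u\<close> and \<open>v\<close>
  are given.\<close>

lemma hrel_of_sg:
 assumes X: "is_sset X" and u: "smap X (lev E n) u" "smap X (lev E n) v"
  and h: "hrel (sprod X I1) (rim X {}) (lev E (Suc n)) (\<lambda>(x, t). sg E n (u x) t) (\<lambda>(x, t). sg E n (v x) t)"
 shows "hrel X {} (lev E n) u v"
proof -
 let ?P = "sprod X I1"
 have P: "is_sset ?P" using X by simp
 obtain k where k: "smap (sprod ?P I1) (lev E (Suc n)) k" "!!z. z \<in> cells ?P ==> k (z, cst 0 (sdim ?P z)) = sg E n (u (fst z)) (snd z)"
  "!!z. z \<in> cells ?P ==> k (z, cst 1 (sdim ?P z)) = sg E n (v (fst z)) (snd z)"
  "!!z y. z \<in> rim X {} ==> y \<in> ops (sdim ?P z) 1 ==> k (z, y) = sg E n (u (fst z)) (snd z)"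
  using h unfolding hrel_def by (auto simp: case_prod_beta')
 define g where "g = (\<lambda>((x, z), t). k ((x, t), z))"
 define phi where "phi = (\<lambda>(x, z). if z = cst 0 (sdim X x) then u x else v x)"
 have R: "subc ?P (rim X {})" by (rule subc_rim[OF X subc_empty])
 have Rc: "x \<in> cells X \<and> z \<in> ops (sdim X x) 1 \<and> (z = cst 0 (sdim X x) \<and> phi (x, z) = u x \<or> z = cst 1 (sdim X x) \<and> phi (x, z) = v x)"
  if "(x, z) \<in> rim X {}" for x z using that X unfolding rim_def by (auto simp: phi_def)
 obtain s where s: "smap ?P (lev E n) s" "!!z. z \<in> rim X {} ==> s z = phi z"
 proof (rule lift_sg[OF P R])
  show "smap (sprod ?P I1) (lev E (Suc n)) g"
  proof (rule smap_cylI[OF P])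
   fix b t assume b: "b \<in> cells ?P" "t \<in> ops (sdim ?P b) 1"
   thus "g (b, t) \<in> cells (lev E (Suc n)) \<and> sdim (lev E (Suc n)) (g (b, t)) = sdim ?P b"
    using smap_cyl(1,2)[OF k(1) P, of "(fst b, t)" "snd b"] X by (cases b) (auto simp: g_def)
   fix m th assume "th \<in> ops m (sdim ?P b)"
   thus "g (opr ?P th b, t \<odot> th) = opr (lev E (Suc n)) th (g (b, t))"
    using b smap_cyl(3)[OF k(1) P, of "(fst b, t)" "snd b" th m] X by (cases b) (auto simp: g_def)
  qed
  show "g (b, cst i (sdim ?P b)) = bas E (Suc n) (sdim ?P b)" if b: "b \<in> cells ?P" "i \<le> 1" for b i
  proof -
   obtain x z where bb: "b = (x, z)" by (cases b)
   have x: "x \<in> cells X" "z \<in> ops (sdim X x) 1" using b bb X by auto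
   have "i = 0 \<or> i = 1" using b by auto
   hence "(x, cst i (sdim X x)) \<in> rim X {}" using x X unfolding rim_def by auto
   hence "g (b, cst i (sdim ?P b)) = sg E n (u x) (cst i (sdim X x))" using k(4)[of "(x, cst i (sdim X x))" z] x bb by (simp add: g_def)
   thus ?thesis using sg_base[OF smapD(1,2)[OF u(1) x(1)]] bb by simp
  qed
  show "smap_on (rim X {}) ?P (lev E n) phi"
  proof (rule smap_onI)
   fix z assume z: "z \<in> rim X {}"
   obtain x t where zz: "z = (x, t)" by (cases z)
   show "phi z \<in> cells (lev E n) \<and> sdim (lev E n) (phi z) = sdim ?P z"
    using Rc[of x t] z zz smapD(1,2)[OF u(1), of x] smapD(1,2)[OF u(2), of x] by auto
   fix m th assume "th \<in> ops m (sdim ?P z)"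
   hence th: "th \<in> ops m (sdim X x)" using zz by simp
   have x: "x \<in> cells X" using Rc[of x t] z zz by auto
   show "phi (opr ?P th z) = opr (lev E n) th (phi z)"
    using Rc[of x t] z zz smapD(3)[OF u(1) x th] smapD(3)[OF u(2) x th] sset_opr[OF X x th] by (auto simp: phi_def cst_pull[OF th])
  qed
  show "g (b, t) = sg E n (phi b) t" if b: "b \<in> rim X {}" and t: "t \<in> ops (sdim ?P b) 1" for b t
  proof -
   obtain x z where bb: "b = (x, z)" by (cases b)
   have x: "(x, t) \<in> cells ?P" using Rc[of x z] b bb t X by auto
   show ?thesis using Rc[of x z] b bb k(2,3)[OF x] by (auto simp: g_def)
  qed
 qed blast
 thus ?thesis unfolding hrel_def using X by (intro exI[of _ s]) (auto simp: rim_def phi_def)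
qed

text \<open>In level 1 the class becomes a family of loops, which can be reversed; a desuspension of
  the reversed loops represents the negative. That the sum vanishes is shown in level 1 and brought
  back by \<open>hrel_of_sg\<close>.\<close>

lemma cadd_inverse:
 assumes X: "is_sset X" and A: "A \<in> cohomology E X"
 shows "\<exists>B\<in>cohomology E X. cadd X A B = czero X"
proof -
 obtain f where f: "smap X (lev E 0) f" "A = cls X f" using A by (rule cohomologyE)
 let ?P = "sprod X I1" and ?K = "lev E (Suc 0)" and ?b = "\<lambda>x. bas E (Suc 0) (sdim X x)"
 have P: "is_sset ?P" using X by simp
 define a where "a = (\<lambda>(x, t). sg E 0 (f x) t)"
 have fs: "f x \<in> simp (lev E 0) (sdim X x)" if "x \<in> cells X" for x using smapD[OF f(1) that] by (simp add: simp_def)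
 have a: "smap ?P ?K a" unfolding a_def by (rule smap_cylI[OF X]) (use sgD smapD[OF f(1)] in auto)
 have ae: "a (x, cst i (sdim X x)) = ?b x" if "x \<in> cells X" for x i using sg_cst[OF fs[OF that]] by (simp add: a_def)
 have c: "smap ?P ?K (\<lambda>(x, t). ?b x)" by (rule smap_cylI[OF X]) (use smapD[OF smap_bas[OF X]] in auto)
 \<comment> \<open>A square with left side \<open>a\<close>, whose bottom and right side are the
   base point. Its top edge \<open>b\<close> is therefore a reversal of \<open>a\<close>, and the
   square itself contracts \<open>a\<close> followed by \<open>b\<close>.\<close>
 obtain H where H: "smap (sprod ?P I1) ?K H"
  "!!b x. b \<in> cells X ==> x \<in> ops (sdim X b) 1 ==> H ((b, x), cst 0 (sdim X b)) = ?b b"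
  "!!b y. b \<in> cells X ==> y \<in> ops (sdim X b) 1 ==> H ((b, cst 0 (sdim X b)), y) = a (b, y)"
  "!!b y. b \<in> cells X ==> y \<in> ops (sdim X b) 1 ==> H ((b, cst 1 (sdim X b)), y) = ?b b"
  by (rule box[OF prism_lev X subc_empty c a c, of undefined]) (use ae in auto)
 define b where "b z = H (z, cst 1 (sdim ?P z))" for z
 have bs: "smap ?P ?K b" unfolding b_def using smap_end[OF H(1) P, of 1] by simp
 have be: "b (x, cst i (sdim X x)) = ?b x" if x: "x \<in> cells X" "i \<le> 1" for x i
  using H(3,4)[OF x(1), of "cst 1 (sdim X x)"] ae[OF x(1), of 1] x(2) by (cases "i = 0") (auto simp: b_def le_Suc_eq One_nat_def)
 obtain f' where f': "smap X (lev E 0) f'" "hrel ?P (rim X {}) ?K (\<lambda>(x, t). sg E 0 (f' x) t) b"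
  by (rule lift_sg[OF X subc_empty bs, where phi = undefined]) (use be in \<open>auto simp: smap_on_def\<close>)
 obtain k where k: "smap (sprod ?P I1) ?K k" "!!z. z \<in> cells ?P ==> k (z, cst 0 (sdim ?P z)) = sg E 0 (f' (fst z)) (snd z)"
  "!!z. z \<in> cells ?P ==> k (z, cst 1 (sdim ?P z)) = b z"
  "!!z y. z \<in> rim X {} ==> y \<in> ops (sdim ?P z) 1 ==> k (z, y) = sg E 0 (f' (fst z)) (snd z)"
  using f'(2) unfolding hrel_def by (auto simp: case_prod_beta')
 have R: "subc ?P (rim X {})" by (rule subc_rim[OF X subc_empty])
 have Rc: "x \<in> cells X \<and> t \<in> ops (sdim X x) 1 \<and> (t = cst 0 (sdim X x) \<or> t = cst 1 (sdim X x))" if "(x, t) \<in> rim X {}" for x t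
  using that X unfolding rim_def by auto
 have f's: "f' x \<in> simp (lev E 0) (sdim X x)" if "x \<in> cells X" for x using smapD[OF f'(1) that] by (simp add: simp_def)
 show ?thesis
 proof (rule binop_ex[OF X])
  fix op'
  assume o1: "!!n x e e'. x \<in> cells X ==> e \<in> simp (lev E n) (sdim X x) ==> e' \<in> simp (lev E n) (sdim X x) ==> op' n x e e' \<in> simp (lev E n) (sdim X x)"
  and o2: "!!n x e e' th m. x \<in> cells X ==> e \<in> simp (lev E n) (sdim X x) ==> e' \<in> simp (lev E n) (sdim X x) ==> th \<in> ops m (sdim X x) ==>
    op' n (opr X th x) (opr (lev E n) th e) (opr (lev E n) th e') = opr (lev E n) th (op' n x e e')"
  and o3: "!!n x e. x \<in> cells X ==> e \<in> simp (lev E n) (sdim X x) ==> op' n x e (bas E n (sdim X x)) = e"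
   "!!n x e. x \<in> cells X ==> e \<in> simp (lev E n) (sdim X x) ==> op' n x (bas E n (sdim X x)) e = e"
  and o4: "!!n x e e' t. x \<in> cells X ==> e \<in> simp (lev E n) (sdim X x) ==> e' \<in> simp (lev E n) (sdim X x) ==> t \<in> ops (sdim X x) 1 ==>
    op' (Suc n) x (sg E n e t) (sg E n e' t) = sg E n (op' n x e e') t"
  and o5: "!!f g. smap X (lev E 0) f ==> smap X (lev E 0) g ==>
    cadd X (cls X f) (cls X g) = cls X (\<lambda>x. op' 0 x (f x) (g x))"
  \<comment> \<open>Holding \<open>b\<close> back to the minimum of \<open>p\<close> and
    \<open>q\<close> deforms the pointwise sum of \<open>a\<close> and \<open>b\<close> at
    \<open>q = 1\<close> to \<open>a\<close> at \<open>q = 0\<close>. Along \<open>p = 1\<close> it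
    runs through \<open>b\<close>. \<open>?H\<close> has the same values at \<open>q = 0\<close> and
    on the rim and ends at the base point, so \<open>hrel_end\<close> contracts the sum.\<close>
  let ?M = "\<lambda>((x, p), q). op' (Suc 0) x (a (x, p)) (b (x, map2 min p q))"
  let ?M2 = "\<lambda>((x, p), q). op' (Suc 0) x (a (x, p)) (k ((x, p), q))"
  let ?H = "\<lambda>((x, p), q). H ((x, q), p)"
  have av: "a (x, t) \<in> simp ?K (sdim X x)" if "x \<in> cells X" "t \<in> ops (sdim X x) 1" for x t
   using smap_cyl(1,2)[OF a X that] by (simp add: simp_def)
  have bv: "b (x, t) \<in> simp ?K (sdim X x)" if "x \<in> cells X" "t \<in> ops (sdim X x) 1" for x t
   using smap_cyl(1,2)[OF bs X that] by (simp add: simp_def)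
  have kv: "k ((x, t), y) \<in> simp ?K (sdim X x)" if "x \<in> cells X" "t \<in> ops (sdim X x) 1" "y \<in> ops (sdim X x) 1" for x t y
   using smap_cyl(1,2)[OF k(1) P, of "(x, t)" y] that X by (simp add: simp_def)
  have op_smap: "smap (sprod ?P I1) ?K (\<lambda>((x, p), q). op' (Suc 0) x (a (x, p)) (d x p q))"
   if d: "!!x p q. x \<in> cells X ==> p \<in> ops (sdim X x) 1 ==> q \<in> ops (sdim X x) 1 ==> d x p q \<in> simp ?K (sdim X x)"
    "!!x p q th m. x \<in> cells X ==> p \<in> ops (sdim X x) 1 ==> q \<in> ops (sdim X x) 1 ==> th \<in> ops m (sdim X x) ==>
      d (opr X th x) (p \<odot> th) (q \<odot> th) = opr ?K th (d x p q)" for d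
  proof (rule smap_cylI[OF P])
   let ?D = "\<lambda>((x, p), q). op' (Suc 0) x (a (x, p)) (d x p q)"
   fix z q assume z: "z \<in> cells ?P" "q \<in> ops (sdim ?P z) 1"
   obtain x p where zz: "z = (x, p)" by (cases z)
   have x: "x \<in> cells X" "p \<in> ops (sdim X x) 1" "q \<in> ops (sdim X x) 1" using z zz X by auto
   show "?D (z, q) \<in> cells ?K \<and>
    sdim ?K (?D (z, q)) = sdim ?P z"
    using o1[OF x(1) av[OF x(1,2)] d(1)[OF x]] zz by (simp add: simp_def)
   fix m th assume "th \<in> ops m (sdim ?P z)"
   hence th: "th \<in> ops m (sdim X x)" using zz by simp
   show "?D (opr ?P th z, q \<odot> th) =
    opr ?K th (?D (z, q))"
    using o2[OF x(1) av[OF x(1,2)] d(1)[OF x] th] d(2)[OF x th] smap_cyl(3)[OF a X x(1,2) th] zz by simp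
  qed
  have m: "smap (sprod ?P I1) ?K ?M"
   by (rule op_smap) (use bv map2_min_ops smap_cyl(3)[OF bs X] in \<open>auto simp: map2_min_pull\<close>)
  have H': "smap (sprod ?P I1) ?K ?H"
  proof (rule smap_cylI[OF P])
   fix z q assume z: "z \<in> cells ?P" "q \<in> ops (sdim ?P z) 1"
   thus "?H (z, q) \<in> cells ?K \<and> sdim ?K (?H (z, q)) = sdim ?P z"
    using smap_cyl(1,2)[OF H(1) P, of "(fst z, q)" "snd z"] X by (cases z) auto
   fix m th assume "th \<in> ops m (sdim ?P z)"
   thus "?H (opr ?P th z, q \<odot> th) = opr ?K th (?H (z, q))"
    using z smap_cyl(3)[OF H(1) P, of "(fst z, q)" "snd z" th m] X by (cases z) auto
  qed
  have min0: "map2 min (cst 0 l) q = cst 0 l" "map2 min (cst 1 l) q = q" if "q \<in> ops l 1" for l q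
   using ops_length[OF that] ops_nth_le[OF that] by (auto intro!: nth_equalityI simp: less_Suc_eq_le)
  have r1: "hrel ?P (rim X {}) ?K (\<lambda>z. ?M (z, cst 1 (sdim ?P z)))
    (\<lambda>z. ?H (z, cst 1 (sdim ?P z)))"
  proof (rule hrel_end[OF prism_lev P R m H'])
   fix z q assume z: "z \<in> rim X {}" "q \<in> ops (sdim ?P z) 1"
   obtain x p where zz: "z = (x, p)" by (cases z)
   have x: "x \<in> cells X" and q: "q \<in> ops (sdim X x) 1" and p: "p = cst 0 (sdim X x) \<or> p = cst 1 (sdim X x)"
    using Rc[of x p] z zz by auto
   show "?M (z, q) = ?H (z, q)"
    using p
   proof
    assume "p = cst 0 (sdim X x)"
    thus ?thesis using zz ae[OF x] be[OF x, of 0] min0(1)[OF q] o3(1)[OF x bas_simp] H(2)[OF x q] by simp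
   next
    assume "p = cst 1 (sdim X x)"
    thus ?thesis using zz ae[OF x] min0(2)[OF q] o3(2)[OF x bv[OF x q]] by (simp add: b_def)
   qed
  next
   fix z assume z: "z \<in> cells ?P"
   obtain x p where zz: "z = (x, p)" by (cases z)
   have x: "x \<in> cells X" "p \<in> ops (sdim X x) 1" using z zz X by auto
   show "?M (z, cst 0 (sdim ?P z)) = ?H (z, cst 0 (sdim ?P z))"
    using zz map2_min_cst0[OF x(2)] be[OF x(1), of 0] o3(1)[OF x(1) av[OF x]] H(3)[OF x] by simp
  qed
  hence r1: "hrel ?P (rim X {}) ?K (\<lambda>(x, p). op' (Suc 0) x (a (x, p)) (b (x, p))) (\<lambda>(x, p). ?b x)"
   by (rule hrel_cong) (use subc_sub[OF R] X H(4) map2_min_cst1 in auto)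
  have m2: "smap (sprod ?P I1) ?K ?M2"
   by (rule op_smap) (use kv smap_cyl(3)[OF k(1) P] X in auto)
  \<comment> \<open>The loops \<open>b\<close> are suspensions only up to the homotopy
    \<open>k\<close>; adding \<open>a\<close> to that homotopy replaces \<open>b\<close> by the
    suspension of \<open>f'\<close>.\<close>
  have r2: "hrel ?P (rim X {}) ?K (\<lambda>(x, p). op' (Suc 0) x (a (x, p)) (sg E 0 (f' x) p)) (\<lambda>(x, p). op' (Suc 0) x (a (x, p)) (b (x, p)))"
   unfolding hrel_def
  proof (intro exI conjI ballI)
   show "smap (sprod ?P I1) ?K ?M2" by (rule m2)
   fix z assume "z \<in> cells ?P"
   thus "?M2 (z, cst 0 (sdim ?P z)) = (\<lambda>(x, p). op' (Suc 0) x (a (x, p)) (sg E 0 (f' x) p)) z"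
    "?M2 (z, cst 1 (sdim ?P z)) = (\<lambda>(x, p). op' (Suc 0) x (a (x, p)) (b (x, p))) z"
    using k(2)[of z] k(3)[of z] by (cases z; simp)+
  next
   fix z q assume "z \<in> rim X {}" "q \<in> ops (sdim ?P z) 1"
   thus "?M2 (z, q) = (\<lambda>(x, p). op' (Suc 0) x (a (x, p)) (sg E 0 (f' x) p)) z"
    using k(4)[of z q] by (cases z) simp
  qed
  have u: "smap X (lev E 0) (\<lambda>x. op' 0 x (f x) (f' x))"
   by (rule smapI) (use o1[of _ _ 0] o2[of _ _ 0] fs f's smapD(3)[OF f(1)] smapD(3)[OF f'(1)] in \<open>auto simp: simp_def\<close>)
  have "hrel ?P (rim X {}) ?K (\<lambda>(x, p). sg E 0 (op' 0 x (f x) (f' x)) p) (\<lambda>(x, p). sg E 0 (bas E 0 (sdim X x)) p)"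
   by (rule hrel_cong[OF hrel_trans[OF prism_lev P R r2 r1]])
    (use subc_sub[OF R] X o4[OF _ fs f's] sg_bas in \<open>auto simp: a_def\<close>)
  hence "hm X (\<lambda>x. op' 0 x (f x) (f' x)) (\<lambda>x. bas E 0 (sdim X x))" by (rule hrel_of_sg[OF X u smap_bas[OF X]])
  hence "cadd X A (cls X f') = czero X"
   unfolding f(2) czero_def o5[OF f(1) f'(1)] by (rule hclass_eqI[OF X])
  thus ?thesis using cohomologyI[OF f'(1)] by blast
 qed
qed

end

section \<open>Additivity of the transfer and the projection formula\<close>

abbreviation part :: "'y sset => ('y => bool) => 'y sset" where
 "part Y c \<equiv> Y\<lparr>cells := {y \<in> cells Y. c y}\<rparr>"

lemma finite_cover_part:
 assumes c: "finite_cover Y X p"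
  and inv: "!!y m th. y \<in> cells Y ==> th \<in> ops m (sdim Y y) ==> c (opr Y th y) = c y"
 shows "finite_cover (part Y c) X p"
proof (rule finite_coverI)
 note D = finite_coverD[OF c]
 show "is_sset X" by (rule D)
 show "is_sset (part Y c)"
  by (rule is_ssetI) (use sset_opr[OF D(1)] sset_comp[OF D(1)] sset_id[OF D(1)] inv in auto)
 show "smap (part Y c) X p" by (rule smapI) (use smapD[OF D(3)] in auto)
 fix x assume x: "x \<in> cells X"
 have sub: "fib (part Y c) p x' \<subseteq> fib Y p x'" for x' by (auto simp: fib_def)
 show "finite (fib (part Y c) p x)" using finite_subset[OF sub finite_fib[OF c x]] .
 fix m th assume th: "th \<in> ops m (sdim X x)"
 show "y = y'" if "y \<in> fib (part Y c) p x" "y' \<in> fib (part Y c) p x" "opr (part Y c) th y = opr (part Y c) th y'" for y y'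
  using fib_opr_inj[OF c x th, of y y'] that sub by auto
 show "\<exists>y\<in>fib (part Y c) p x. z = opr (part Y c) th y" if z: "z \<in> fib (part Y c) p (opr X th x)" for z
 proof -
  obtain y where y: "y \<in> fib Y p x" "z = opr Y th y" using fib_opr_ex[OF c x th, of z] z sub by auto
  have "c y" using inv[of y th m] fibD[OF c y(1)] th z y by (auto simp: fib_def)
  thus ?thesis using y by (auto simp: fib_def)
 qed
qed

lemma finite_cover_colour:
 assumes c: "finite_cover Y X p"
  and inv: "!!y m th. y \<in> cells Y ==> th \<in> ops m (sdim Y y) ==> c (opr Y th y) = c y"
 shows "finite_cover Y (dbl X) (\<lambda>y. (p y, c y))"
proof (rule finite_coverI)
 note D = finite_coverD[OF c]
 show "is_sset Y" "is_sset (dbl X)" using D is_sset_disc by auto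
 show "smap Y (dbl X) (\<lambda>y. (p y, c y))" by (rule smapI) (use smapD[OF D(3)] inv in auto)
 have f: "fib Y (\<lambda>y. (p y, c y)) (x, b) = fib (part Y (\<lambda>y. c y = b)) p x" for x b by (auto simp: fib_def)
 have cb: "finite_cover (part Y (\<lambda>y. c y = b)) X p" for b by (rule finite_cover_part[OF c]) (simp add: inv)
 fix z assume "z \<in> cells (dbl X)"
 then obtain x b where z: "z = (x, b)" "x \<in> cells X" by (cases z) auto
 show "finite (fib Y (\<lambda>y. (p y, c y)) z)" unfolding z f by (rule finite_fib[OF cb z(2)])
 fix m th assume "th \<in> ops m (sdim (dbl X) z)"
 hence th: "th \<in> ops m (sdim X x)" using z by simp
 show "y = y'" if "y \<in> fib Y (\<lambda>y. (p y, c y)) z" "y' \<in> fib Y (\<lambda>y. (p y, c y)) z" "opr Y th y = opr Y th y'" for y y'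
  using fib_opr_inj[OF cb z(2) th, of y b y'] that unfolding z f by simp
 show "\<exists>y\<in>fib Y (\<lambda>y. (p y, c y)) z. w = opr Y th y" if "w \<in> fib Y (\<lambda>y. (p y, c y)) (opr (dbl X) th z)" for w
  using fib_opr_ex[OF cb z(2) th, of w b] that unfolding z opr_disc f by simp
qed

context cof_omega
begin

text \<open>The colouring \<open>c\<close> factors \<open>p\<close> through the trivial double cover
  of \<open>X\<close>, and a transfer from there is a sum over the sheets. The colour classes are
  allowed as abstract copies \<open>Y' b\<close>, so that the sheets of a double cover can be used
  as well as parts of \<open>Y\<close>.\<close>

lemma transfer_split:
 assumes c: "finite_cover Y X p"
  and inv: "!!y m th. y \<in> cells Y ==> th \<in> ops m (sdim Y y) ==> c (opr Y th y) = c y"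
  and c': "!!b. finite_cover (Y' b) X (p' b)"
  and j: "!!x b. x \<in> cells X ==> bij_betw (j b) (fib (Y' b) (p' b) x) {y \<in> fib Y p x. c y = b}"
  and jo: "!!y m th b. y \<in> cells (Y' b) ==> th \<in> ops m (sdim (Y' b) y) ==> j b (opr (Y' b) th y) = opr Y th (j b y)"
  and f: "smap Y (lev E 0) f"
 shows "transfer E Y X p (cls Y f) =
  cadd X (transfer E (Y' False) X (p' False) (cls (Y' False) (\<lambda>y. f (j False y))))
   (transfer E (Y' True) X (p' True) (cls (Y' True) (\<lambda>y. f (j True y))))"
proof -
 note D = finite_coverD[OF c]
 have q: "finite_cover Y (dbl X) (\<lambda>y. (p y, c y))" by (rule finite_cover_colour[OF c inv])
 have d: "finite_cover (dbl X) X fst" by (rule finite_cover_disc[OF D(2)]) simp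
 obtain s where s: "fibre_sum E Y (dbl X) (\<lambda>y. (p y, c y)) s" using fibre_sum_ex[OF q] .
 have h: "smap (dbl X) (lev E 0) (along Y (\<lambda>y. (p y, c y)) s 0 f)"
  using smap_along[OF q _ f] s by (auto simp: fibre_sum_iff)
 have e: "cls X (\<lambda>x. along Y (\<lambda>y. (p y, c y)) s 0 f (x, b)) =
  transfer E (Y' b) X (p' b) (cls (Y' b) (\<lambda>y. f (j b y)))" for b
 proof (rule transfer_pullback[OF s c' smap_slice, symmetric])
  show "bij_betw (j b) (fib (Y' b) (p' b) x) (fib Y (\<lambda>y. (p y, c y)) (x, b))" if "x \<in> cells X" for x
  proof -
   have "{y \<in> fib Y p x. c y = b} = fib Y (\<lambda>y. (p y, c y)) (x, b)" by (auto simp: fib_def)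
   thus ?thesis using j[OF that, of b] by simp
  qed
 qed (use jo f in auto)
 have "transfer E Y X p (cls Y f) = transfer E (dbl X) X fst (transfer E Y (dbl X) (\<lambda>y. (p y, c y)) (cls Y f))"
  using transfer_comp[OF q d cohomologyI[OF f]] by simp
 thus ?thesis unfolding transfer_eq[OF s f] cadd_split[OF D(2) h] e .
qed

text \<open>A sum on \<open>Y\<close> is a transfer from its double cover. Composing with
  \<open>p\<close> and colouring by sheets writes it as a sum of transfers to
  \<open>X\<close>.\<close>

lemma transfer_cadd:
 assumes c: "finite_cover Y X p" and A: "A \<in> cohomology E Y" "B \<in> cohomology E Y"
 shows "transfer E Y X p (cadd Y A B) = cadd X (transfer E Y X p A) (transfer E Y X p B)"
proof -
 note D = finite_coverD[OF c]
 obtain f where f: "smap Y (lev E 0) f" "A = cls Y f" using A(1) by (rule cohomologyE)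
 obtain g where g: "smap Y (lev E 0) g" "B = cls Y g" using A(2) by (rule cohomologyE)
 have d: "finite_cover (dbl Y) Y fst" by (rule finite_cover_disc[OF D(1)]) simp
 note s = smap_cpair[OF f(1) g(1)]
 have "transfer E (dbl Y) X (\<lambda>z. p (fst z)) (cls (dbl Y) (cpair f g)) =
  cadd X (transfer E Y X p (cls Y (\<lambda>y. cpair f g (y, False)))) (transfer E Y X p (cls Y (\<lambda>y. cpair f g (y, True))))"
 proof (rule transfer_split[OF finite_cover_comp[OF d c], where c = snd and Y' = "\<lambda>_. Y" and p' = "\<lambda>_. p" and j = "\<lambda>b y. (y, b)"])
  show "bij_betw (\<lambda>y. (y, b)) (fib Y p x) {y \<in> fib (dbl Y) (\<lambda>z. p (fst z)) x. snd y = b}" for x b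
   by (rule bij_betw_byWitness[where f' = fst]) (auto simp: fib_def)
  show "snd (opr (dbl Y) th y) = snd y" for th and y :: "'a \<times> bool" by (cases y) simp
 qed (use c s in auto)
 thus ?thesis unfolding f(2) g(2) cadd_transfer[OF D(1) f(1) g(1)] using transfer_comp[OF d c cohomologyI[OF s]]
  by (simp add: cpair_def)
qed

lemma transfer_empty:
 assumes c: "finite_cover Y X p" and e: "cells Y = {}" and A: "A \<in> cohomology E Y"
 shows "transfer E Y X p A = czero X"
proof -
 obtain f where f: "smap Y (lev E 0) f" "A = cls Y f" using A by (rule cohomologyE)
 note X = finite_coverD(2)[OF c]
 obtain s where s: "fibre_sum E Y X p s" using fibre_sum_ex[OF c] .
 have "smap X (lev E 0) (along Y p s 0 f)" using smap_along[OF c _ f(1)] s by (auto simp: fibre_sum_iff)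
 from hrel_refl[OF this X] have "hm X (along Y p s 0 f) (\<lambda>x. bas E 0 (sdim X x))"
 proof (rule hrel_cong)
  fix x assume x: "x \<in> cells X"
  have "fib Y p x = {}" using e by (simp add: fib_def)
  hence "s 0 x (restrict f (fib Y p x)) = bas E 0 (sdim X x)"
   by (intro fibre_sumD(3)[OF s x]) auto
  thus "along Y p s 0 f x = bas E 0 (sdim X x)" by (simp add: along_def)
 qed auto
 thus ?thesis unfolding f(2) transfer_eq[OF s f(1)] czero_def by (rule hclass_eqI[OF X])
qed

text \<open>One colour is split off at a time by the additivity for two colours. The target
  \<open>K\<close> is any set closed under sums and containing zero; later it is an ideal.\<close>

lemma transfer_colours:
 assumes "finite I" and "finite_cover Y X p" and "!!y. y \<in> cells Y ==> c y \<in> I"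
  and "!!y m th. y \<in> cells Y ==> th \<in> ops m (sdim Y y) ==> c (opr Y th y) = c y"
  and "!!i f. i \<in> I ==> smap (part Y (\<lambda>y. c y = i)) (lev E 0) f ==>
   transfer E (part Y (\<lambda>y. c y = i)) X p (cls (part Y (\<lambda>y. c y = i)) f) \<in> K"
  and K: "czero X \<in> K" "!!A B. A \<in> K ==> B \<in> K ==> cadd X A B \<in> K"
  and "smap Y (lev E 0) f"
 shows "transfer E Y X p (cls Y f) \<in> K"
 using assms(1-5,8)
proof (induction I arbitrary: Y f rule: finite_induct)
 case empty
 hence "cells Y = {}" by blast
 thus ?case using transfer_empty[OF empty(1) _ cohomologyI[OF empty(5)]] K(1) by simp
next
 case (insert i I)
 let ?Y = "\<lambda>b. part Y (\<lambda>y. (c y = i) = b)"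
 have cov: "finite_cover (?Y b) X p" for b
 proof (rule finite_cover_part[OF insert.prems(1)])
  show "((c (opr Y th y) = i) = b) = ((c y = i) = b)" if "y \<in> cells Y" "th \<in> ops m (sdim Y y)" for y m th
   using insert.prems(3)[OF that] by simp
 qed
 have sm: "smap (?Y b) (lev E 0) f" for b by (rule smapI) (use smapD[OF insert.prems(5)] in auto)
 have "transfer E Y X p (cls Y f) =
  cadd X (transfer E (?Y False) X p (cls (?Y False) f)) (transfer E (?Y True) X p (cls (?Y True) f))"
 proof (rule transfer_split[OF insert.prems(1) _ cov, where j = "\<lambda>_ y. y" and c = "\<lambda>y. c y = i"])
  show "bij_betw (\<lambda>y. y) (fib (?Y b) p x) {y \<in> fib Y p x. (c y = i) = b}" for x b
   by (rule bij_betw_byWitness[where f' = "\<lambda>y. y"]) (auto simp: fib_def)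
  show "(c (opr Y th y) = i) = (c y = i)" if "y \<in> cells Y" "th \<in> ops m (sdim Y y)" for y m th
   using insert.prems(3)[OF that] by simp
 qed (use insert.prems(5) in auto)
 moreover have "transfer E (?Y True) X p (cls (?Y True) f) \<in> K"
  using insert.prems(4)[of i f] sm[of True] by simp
 moreover have "transfer E (?Y False) X p (cls (?Y False) f) \<in> K"
 proof (rule insert.IH[OF cov])
  show "c y \<in> I" if "y \<in> cells (?Y False)" for y using that insert.prems(2)[of y] by auto
  show "c (opr (?Y False) th y) = c y" if "y \<in> cells (?Y False)" "th \<in> ops m (sdim (?Y False) y)" for y m th
   using that insert.prems(3)[of y th m] by simp
  show "transfer E (part (?Y False) (\<lambda>y. c y = k)) X p (cls (part (?Y False) (\<lambda>y. c y = k)) g) \<in> K"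
   if k: "k \<in> I" and g: "smap (part (?Y False) (\<lambda>y. c y = k)) (lev E 0) g" for k g
  proof -
   have "(c y \<noteq> i \<and> c y = k) = (c y = k)" for y using k insert.hyps(2) by auto
   hence "part (?Y False) (\<lambda>y. c y = k) = part Y (\<lambda>y. c y = k)" by simp
   thus ?thesis using insert.prems(4)[of k g] k g by simp
  qed
 qed (rule sm)
 ultimately show ?case using K(2) by simp
qed

text \<open>\<open>m\<close> stands for multiplication by a fixed class. The extensions from
  \<open>qmap_post\<close> and \<open>qmap_pre\<close> have the same single-entry data, so by
  uniqueness they induce homotopic maps.\<close>

lemma projection_formula:
 assumes s: "fibre_sum E Y X p s" and m: "pmap E X m" and f: "smap Y (lev E 0) f"
 shows "smap Y (lev E 0) (\<lambda>y. m 0 (p y) (f y))"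
  "cls X (\<lambda>x. m 0 x (along Y p s 0 f x)) = transfer E Y X p (cls Y (\<lambda>y. m 0 (p y) (f y)))"
proof -
 have c: "finite_cover Y X p" using s by (simp add: fibre_sum_iff)
 note D = finite_coverD[OF c]
 have pm: "pmap E Y (\<lambda>n y. m n (p y))"
  unfolding pmap_def
 proof (intro allI ballI conjI)
  fix n y e assume y: "y \<in> cells Y" and e: "e \<in> simp (lev E n) (sdim Y y)"
  have e': "e \<in> simp (lev E n) (sdim X (p y))" using e smapD(2)[OF D(3) y] by simp
  note M = pmapD[OF m smapD(1)[OF D(3) y] e']
  show "m n (p y) e \<in> simp (lev E n) (sdim Y y)" "m n (p y) (bas E n (sdim Y y)) = bas E n (sdim Y y)"
   using M(1,3) smapD(2)[OF D(3) y] by auto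
  show "m n (p (opr Y th y)) (opr (lev E n) th e) = opr (lev E n) th (m n (p y) e)" if "th \<in> ops l (sdim Y y)" for l th
   using M(2)[of th l] smapD(2,3)[OF D(3) y] that by auto
  show "m (Suc n) (p y) (sig E n e t) = sig E n (m n (p y) e) t" if "t \<in> simp circle (sdim Y y)" for t
   using M(4)[of t] smapD(2)[OF D(3) y] that by auto
 qed
 have fs: "f y \<in> simp (lev E 0) (sdim Y y)" if "y \<in> cells Y" for y using smapD[OF f that] by (simp add: simp_def)
 show mf: "smap Y (lev E 0) (\<lambda>y. m 0 (p y) (f y))"
  by (rule smapI) (use pmapD(1,2)[OF pm _ fs] smapD(3)[OF f] in \<open>auto simp: simp_def\<close>)
 let ?s' = "\<lambda>n x u. s n x (\<lambda>y\<in>fib Y p x. m n (p y) (u y))"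
 have "hm X (along Y p (\<lambda>n x u. m n x (s n x u)) 0 f) (along Y p ?s' 0 f)"
  by (rule qmap_unique[OF c pm qmap_post[OF s m] qmap_pre[OF s pm] hrel_refl[OF f D(1)]])
 moreover have "along Y p ?s' 0 f = along Y p s 0 (\<lambda>y. m 0 (p y) (f y))"
  unfolding along_def by (intro ext) (simp cong: restrict_cong)
 moreover have "along Y p (\<lambda>n x u. m n x (s n x u)) 0 f = (\<lambda>x. m 0 x (along Y p s 0 f x))"
  by (simp add: along_def fun_eq_iff)
 ultimately have "hm X (\<lambda>x. m 0 x (along Y p s 0 f x)) (along Y p s 0 (\<lambda>y. m 0 (p y) (f y)))" by simp
 thus "cls X (\<lambda>x. m 0 x (along Y p s 0 f x)) = transfer E Y X p (cls Y (\<lambda>y. m 0 (p y) (f y)))"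
  unfolding transfer_eq[OF s mf] by (rule hclass_eqI[OF D(2)])
qed

end

section \<open>The cohomology ring\<close>

lemma is_sset_EG: "is_sset (EG G)"
proof (rule is_ssetI)
 fix x m th assume x: "x \<in> cells (EG G)" and th: "th \<in> ops m (sdim (EG G) x)"
 have "th ! i < length x" if "i < length th" for i
  using ops_nth_le[OF th, of i] x ops_length[OF th] that by (cases x) (auto simp: EG_def less_Suc_eq_le)
 hence "set (x \<odot> th) \<subseteq> set x" by (fastforce simp: set_conv_nth)
 thus "opr (EG G) th x \<in> cells (EG G) \<and> sdim (EG G) (opr (EG G) th x) = m"
  using x ops_length[OF th] by (auto simp: EG_def)
 fix l phi assume "phi \<in> ops l m"
 thus "opr (EG G) (th \<odot> phi) x = opr (EG G) phi (opr (EG G) th x)"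
  using pull_assoc[OF th, of phi l x] by (simp add: EG_def)
next
 fix x assume "x \<in> cells (EG G)"
 thus "opr (EG G) (idl (sdim (EG G) x)) x = x"
  by (auto simp: EG_def intro!: nth_equalityI)
qed

lemma smap_replicate:
 assumes "is_sset X" "g \<in> carrier G"
 shows "smap X (EG G) (\<lambda>x. replicate (Suc (sdim X x)) g)"
proof (rule smapI)
 fix x m th assume "x \<in> cells X" and th: "th \<in> ops m (sdim X x)"
 hence "sdim X (opr X th x) = m" using sset_opr[OF assms(1)] by auto
 thus "replicate (Suc (sdim X (opr X th x))) g = opr (EG G) th (replicate (Suc (sdim X x)) g)"
  using ops_length[OF th] ops_nth_le[OF th] by (auto simp: EG_def intro!: nth_equalityI simp: less_Suc_eq_le)
qed (use assms in \<open>auto simp: EG_def\<close>)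

lemma args_map:
 assumes "length fs = j" "\<forall>f\<in>set fs. smap X (lev E 0) f" "x \<in> cells X"
 shows "args E j (sdim X x) (replicate j 0) (map (\<lambda>f. f x) fs)"
proof -
 have "(fs ! i) x \<in> simp (lev E 0) (sdim X x)" if "i < j" for i
  using smapD(1,2)[of X "lev E 0" "fs ! i", OF _ assms(3)] assms(1,2) that by (simp add: simp_def)
 thus ?thesis using assms(1) by (simp add: args_def)
qed

lemma multimapD:
 assumes "multimap E P j b" "w \<in> simp P k" "args E j k ps es"
 shows "b w ps es \<in> simp (lev E (sum_list ps)) k"
  "th \<in> ops l k ==> b (opr P th w) ps (map2 (\<lambda>p. opr (lev E p) th) ps es) = opr (lev E (sum_list ps)) th (b w ps es)"
  "i < j ==> es ! i = bas E (ps ! i) k ==> b w ps es = bas E (sum_list ps) k"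
  "i < j ==> t \<in> simp circle k ==> b w (ps[i := Suc (ps ! i)]) (es[i := sig E (ps ! i) (es ! i) t]) =
    act E (Suc (sum_list ps)) (insert_cycle (sum_list ps) (sum_list (take i ps) + ps ! i)) (sig E (sum_list ps) (b w ps es) t)"
 using assms unfolding multimap_def Let_def by blast+

lemma multimap_smap:
 assumes b: "multimap E P j b" and W: "smap X P W" and X: "is_sset X"
  and fs: "length fs = j" "\<forall>f\<in>set fs. smap X (lev E 0) f"
 shows "smap X (lev E 0) (\<lambda>x. b (W x) (replicate j 0) (map (\<lambda>f. f x) fs))"
proof (rule smapI)
 fix x assume x: "x \<in> cells X"
 have Wx: "W x \<in> simp P (sdim X x)" using smapD(1,2)[OF W x] by (simp add: simp_def)
 have s: "sum_list (replicate j (0::nat)) = 0" by (induction j) (simp_all add: replicate_Suc)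
 note B = multimapD[OF b Wx args_map[where E = E, OF fs x], unfolded s]
 show "b (W x) (replicate j 0) (map (\<lambda>f. f x) fs) \<in> cells (lev E 0) \<and>
  sdim (lev E 0) (b (W x) (replicate j 0) (map (\<lambda>f. f x) fs)) = sdim X x"
  using B(1) by (simp add: simp_def)
 fix m th assume th: "th \<in> ops m (sdim X x)"
 have "map2 (\<lambda>p. opr (lev E p) th) (replicate j 0) (map (\<lambda>f. f x) fs) = map (\<lambda>f. f (opr X th x)) fs"
 proof (rule nth_equalityI)
  fix i assume "i < length (map2 (\<lambda>p. opr (lev E p) th) (replicate j 0) (map (\<lambda>f. f x) fs))"
  thus "map2 (\<lambda>p. opr (lev E p) th) (replicate j 0) (map (\<lambda>f. f x) fs) ! i = map (\<lambda>f. f (opr X th x)) fs ! i"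
   using fs smapD(3)[of X "lev E 0" "fs ! i", OF _ x th] by simp
 qed (use fs in simp)
 thus "b (W (opr X th x)) (replicate j 0) (map (\<lambda>f. f (opr X th x)) fs) = opr (lev E 0) th (b (W x) (replicate j 0) (map (\<lambda>f. f x) fs))"
  using B(2)[OF th] smapD(3)[OF W x th] by simp
qed

text \<open>A diagram of maps out of extended powers is evaluated in level 0, on maps from
  \<open>X\<close> and at a simplex of the parameter space chosen naturally by \<open>W\<close>.
  This is how the axioms for \<open>\<xi>\<close> become identities between classes.\<close>

lemma power_homotopic_hrel:
 assumes h: "power_homotopic E P S j b c" and W: "smap X P W" and X: "is_sset X"
  and fs: "length fs = j" "\<forall>f\<in>set fs. smap X (lev E 0) f"
 shows "hrel X {} (lev E 0) (\<lambda>x. b (W x) (replicate j 0) (map (\<lambda>f. f x) fs)) (\<lambda>x. c (W x) (replicate j 0) (map (\<lambda>f. f x) fs))"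
proof -
 obtain k where k: "multimap E (sprod P I1) j k"
  "!!n w ps es. w \<in> simp P n ==> args E j n ps es ==> k (w, replicate (Suc n) 0) ps es = b w ps es \<and> k (w, replicate (Suc n) 1) ps es = c w ps es"
 proof -
  obtain k where k: "power_map E (sprod P I1) ((\<lambda>(a, \<rho>). (\<lambda>(w, t). (a w, t), \<rho>)) ` S) j k"
   "\<forall>n. \<forall>w\<in>simp P n. \<forall>ps es. args E j n ps es -->
      k (w, replicate (Suc n) 0) ps es = b w ps es \<and> k (w, replicate (Suc n) 1) ps es = c w ps es"
   using h unfolding power_homotopic_def by blast
  show thesis by (rule that[of k]) (use k in \<open>auto simp: power_map_def\<close>)
 qed
 let ?X = "sprod X I1"
 have W': "smap ?X (sprod P I1) (\<lambda>z. (W (fst z), snd z))"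
  by (rule smap_cylI[OF X]) (use smapD[OF W] in \<open>auto simp: sprod_def ops_length std_simplex_def\<close>)
 have pr: "smap ?X X fst" by (rule smap_cylI[OF X]) auto
 have "smap ?X (lev E 0) (\<lambda>z. k (W (fst z), snd z) (replicate j 0) (map (\<lambda>f. f z) (map (\<lambda>f z. f (fst z)) fs)))"
  by (rule multimap_smap[OF k(1) W' is_sset_cyl[OF X]]) (use fs smap_comp[OF pr] in auto)
 thus ?thesis unfolding hrel_def
  by (intro exI[of _ "\<lambda>z. k (W (fst z), snd z) (replicate j 0) (map (\<lambda>f. f (fst z)) fs)"])
   (use k(2)[OF _ args_map[where E = E, OF fs]] smapD(1,2)[OF W] in \<open>auto simp: simp_def map_map o_def\<close>)
qed

locale E_ring = cof_omega E for E :: "'e symspec" +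
 fixes \<xi> :: "'e power_ops"
 assumes ring: "H_infinity_ring_spectrum E \<xi>"
begin

abbreviation "\<mu> k \<equiv> \<xi> 2 (replicate (Suc k) id)"

text \<open>The product of a list of maps, formed in one step by \<open>\<xi>\<close> at a constant
  simplex of the identity. Products of all lengths, including 0 and 1, allow bracketings to be
  compared through the unbracketed product.\<close>

definition pow :: "'x sset => ('x => 'e) list => 'x => 'e" where
 "pow X fs x = \<xi> (length fs) (replicate (Suc (sdim X x)) id) (replicate (length fs) 0) (map (\<lambda>f. f x) fs)"

lemma mm: "multimap E (ES j) j (\<xi> j)"
 using ring by (simp add: H_infinity_ring_spectrum_def power_map_def)

lemma id_in: "id \<in> carrier (sym_group j)"
 by (simp add: in_sym_group permutes_id)

lemma smap_pow: "is_sset X ==> (!!f. f \<in> set fs ==> smap X (lev E 0) f) ==> smap X (lev E 0) (pow X fs)"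
 unfolding pow_def[abs_def] by (rule multimap_smap[OF mm smap_replicate[OF _ id_in]]) auto

text \<open>The axiom comparing with \<open>D\<^sub>j E \<and> D\<^sub>k E\<close>, at constant
  simplices, where the block sums of permutations are identities.\<close>

lemma pow_alpha:
 assumes X: "is_sset X" and fs: "!!f. f \<in> set (fs @ gs) ==> smap X (lev E 0) f"
 shows "hm X (pow X (fs @ gs)) (pow X [pow X fs, pow X gs])"
proof -
 let ?j = "length fs" and ?k = "length gs"
 let ?W = "\<lambda>x. (replicate (Suc (sdim X x)) (id :: nat => nat), replicate (Suc (sdim X x)) (id :: nat => nat))"
 have W: "smap X (sprod (ES ?j) (ES ?k)) ?W"
  using smapD[OF smap_replicate[OF X id_in[of ?j]]] smapD[OF smap_replicate[OF X id_in[of ?k]]]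
  by (intro smapI) (auto simp: sprod_def)
 have z: "sum_list (replicate n (0::nat)) = 0" for n by (induction n) (simp_all add: replicate_Suc)
 have m: "map2 (block_sum ?j) (replicate n id) (replicate n id) = replicate n id" for n
  by (rule nth_equalityI) auto
 have h: "power_homotopic E (sprod (ES ?j) (ES ?k)) (DDgrp ?j ?k) (?j + ?k)
    (\<lambda>(v, w) ps es. \<xi> (?j + ?k) (map2 (block_sum ?j) v w) ps es)
    (\<lambda>(v, w) ps es. \<xi> 2 (replicate (length v) id)
      [sum_list (take ?j ps), sum_list (drop ?j ps)]
      [\<xi> ?j v (take ?j ps) (take ?j es), \<xi> ?k w (drop ?j ps) (drop ?j es)])"
  using ring by (simp add: H_infinity_ring_spectrum_def)
 have "map (\<lambda>f. f x) (fs @ gs) = map (\<lambda>f. f x) fs @ map (\<lambda>f. f x) gs" for x by simp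
 thus ?thesis
  using power_homotopic_hrel[OF h W X, of "fs @ gs"] fs
  by (simp add: pow_def[abs_def] m z numeral_2_eq_2 replicate_Suc)
qed

lemma pow_one:
 assumes X: "is_sset X" and f: "smap X (lev E 0) f"
 shows "hm X (pow X [f]) f"
proof -
 have h: "power_homotopic E (ES 1) (Dgrp 1) 1 (\<xi> 1) (\<lambda>w ps es. hd es)"
  using ring by (simp add: H_infinity_ring_spectrum_def)
 show ?thesis
  using power_homotopic_hrel[OF h smap_replicate[OF X id_in] X, of "[f]"] f by (simp add: pow_def[abs_def] One_nat_def replicate_Suc)
qed

lemma pow_cong:
 assumes X: "is_sset X" and h: "hm X f f'" "hm X g g'"
 shows "hm X (pow X [f, g]) (pow X [f', g'])"
proof -
 obtain k k' where k: "smap (sprod X I1) (lev E 0) k" "!!b. b \<in> cells X ==> k (b, cst 0 (sdim X b)) = f b \<and> k (b, cst 1 (sdim X b)) = f' b"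
  and k': "smap (sprod X I1) (lev E 0) k'" "!!b. b \<in> cells X ==> k' (b, cst 0 (sdim X b)) = g b \<and> k' (b, cst 1 (sdim X b)) = g' b"
  using h unfolding hrel_def by blast
 have "smap (sprod X I1) (lev E 0) (pow (sprod X I1) [k, k'])" by (rule smap_pow) (use X k k' in auto)
 thus ?thesis unfolding hrel_def
  by (intro exI[of _ "pow (sprod X I1) [k, k']"]) (use k(2) k'(2) in \<open>auto simp: pow_def\<close>)
qed

abbreviation R :: "'x sset => ('x => 'e) set ring" where
 "R X \<equiv> cohomology_ring E \<xi> X"

lemma R_simps [simp]: "carrier (R X) = cohomology E X" "zero (R X) = czero X" "add (R X) = cadd X"
  "one (R X) = cls X (pow X [])"
 by (simp_all add: cohomology_ring_def czero_def cadd_def[abs_def] pow_def[abs_def])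

lemma mult_eq:
 assumes X: "is_sset X" and f: "smap X (lev E 0) f" and g: "smap X (lev E 0) g"
 shows "mult (R X) (cls X f) (cls X g) = cls X (pow X [f, g])"
proof -
 have p: "(\<lambda>x. \<mu> (sdim X x) [0, 0] [f' x, g' x]) = pow X [f', g']" for f' g'
  by (simp add: pow_def[abs_def] numeral_2_eq_2 replicate_Suc)
 have "cls X (pow X [f', g']) = cls X (pow X [f, g])"
  if "f' \<in> cls X f" "g' \<in> cls X g" for f' g'
  using hclass_eqI[OF X pow_cong[OF X, of f f' g g']] that in_hclass[OF X] by simp
 hence "(\<Union>f'\<in>cls X f. \<Union>g'\<in>cls X g. cls X (pow X [f', g'])) = cls X (pow X [f, g])"
  using hclass_self[OF X f] hclass_self[OF X g] by blast
 thus ?thesis by (simp add: cohomology_ring_def p)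
qed

text \<open>The fixed factor lies in level 0, so the sphere coordinate introduced by suspending the
  other factor is already last. The cycle in \<open>multimap\<close> is then the identity, and
  multiplication commutes with the structure maps.\<close>

lemma pmap_pow:
 assumes X: "is_sset X" and f: "smap X (lev E 0) f"
 shows "pmap E X (\<lambda>n x e. \<mu> (sdim X x) [0, n] [f x, e])"
  "pmap E X (\<lambda>n x e. \<mu> (sdim X x) [n, 0] [e, f x])"
proof -
 have ic: "insert_cycle n n = id" for n by (auto simp: insert_cycle_def fun_eq_iff)
 have sd: "sdim X (opr X th x) = l" if "x \<in> cells X" "th \<in> ops l (sdim X x)" for x th l using sset_opr[OF X that] by simp
 have B: "\<mu> (sdim X x) [p, q] [d, e] \<in> simp (lev E (p + q)) (sdim X x) \<and>
   (\<forall>l. \<forall>th\<in>ops l (sdim X x). \<mu> l [p, q] [opr (lev E p) th d, opr (lev E q) th e]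
     = opr (lev E (p + q)) th (\<mu> (sdim X x) [p, q] [d, e])) \<and>
   (d = bas E p (sdim X x) \<or> e = bas E q (sdim X x) --> \<mu> (sdim X x) [p, q] [d, e] = bas E (p + q) (sdim X x)) \<and>
   (\<forall>t\<in>simp circle (sdim X x). \<mu> (sdim X x) [Suc p, q] [sig E p d t, e]
     = act E (Suc (p + q)) (insert_cycle (p + q) p) (sig E (p + q) (\<mu> (sdim X x) [p, q] [d, e]) t) \<and>
    \<mu> (sdim X x) [p, Suc q] [d, sig E q e t]
     = act E (Suc (p + q)) (insert_cycle (p + q) (p + q)) (sig E (p + q) (\<mu> (sdim X x) [p, q] [d, e]) t))"
  if x: "x \<in> cells X" and d: "d \<in> simp (lev E p) (sdim X x)" "e \<in> simp (lev E q) (sdim X x)" for x p q d e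
 proof -
  let ?w = "replicate (Suc (sdim X x)) (id :: nat => nat)"
  have w: "?w \<in> simp (ES 2) (sdim X x)" using id_in[of 2] by (simp add: simp_def EG_def)
  have a: "args E 2 (sdim X x) [p, q] [d, e]" using d by (auto simp: args_def less_2_cases_iff)
  note M = multimapD[OF mm w a]
  have nat: "\<mu> l [p, q] [opr (lev E p) th d, opr (lev E q) th e] = opr (lev E (p + q)) th (\<mu> (sdim X x) [p, q] [d, e])"
   if th: "th \<in> ops l (sdim X x)" for l th
  proof -
   have "opr (ES 2) th ?w = replicate (Suc l) id"
    using smapD(3)[OF smap_replicate[OF X id_in[of 2]] x th] sset_opr[OF X x th] by simp
   thus ?thesis using M(2)[OF th] by simp
  qed
  have M0: "(d = bas E p (sdim X x) --> \<mu> (sdim X x) [p, q] [d, e] = bas E (p + q) (sdim X x)) \<and>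
    (\<forall>t\<in>simp circle (sdim X x). \<mu> (sdim X x) [Suc p, q] [sig E p d t, e] = act E (Suc (p + q)) (insert_cycle (p + q) p) (sig E (p + q) (\<mu> (sdim X x) [p, q] [d, e]) t))"
   using M(3,4)[of 0] by simp
  have M1: "(e = bas E q (sdim X x) --> \<mu> (sdim X x) [p, q] [d, e] = bas E (p + q) (sdim X x)) \<and>
    (\<forall>t\<in>simp circle (sdim X x). \<mu> (sdim X x) [p, Suc q] [d, sig E q e t] = act E (Suc (p + q)) (insert_cycle (p + q) (p + q)) (sig E (p + q) (\<mu> (sdim X x) [p, q] [d, e]) t))"
   using M(3,4)[of 1] by (simp add: One_nat_def)
  show ?thesis using M(1) nat M0 M1 by simp
 qed
 have fs: "f x \<in> simp (lev E 0) (sdim X x)" if "x \<in> cells X" for x using smapD[OF f that] by (simp add: simp_def)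
 have act1: "act E (Suc n) id (sig E n e t) = sig E n e t" if "e \<in> simp (lev E n) k" "t \<in> simp circle k" for n e t k
  using act_id sig_simp[OF that] by (simp add: simp_def)
 show "pmap E X (\<lambda>n x e. \<mu> (sdim X x) [0, n] [f x, e])"
  unfolding pmap_def
 proof (intro allI ballI conjI)
  fix n x e assume x: "x \<in> cells X" and e: "e \<in> simp (lev E n) (sdim X x)"
  note C = B[OF x fs[OF x] e, unfolded add_0]
  show c: "\<mu> (sdim X x) [0, n] [f x, e] \<in> simp (lev E n) (sdim X x)" using C by blast
  show "\<mu> (sdim X x) [0, n] [f x, bas E n (sdim X x)] = bas E n (sdim X x)"
   using B[OF x fs[OF x] bas_simp, of n] by simp
  show "\<mu> (sdim X (opr X th x)) [0, n] [f (opr X th x), opr (lev E n) th e] =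
    opr (lev E n) th (\<mu> (sdim X x) [0, n] [f x, e])" if th: "th \<in> ops l (sdim X x)" for l th
   unfolding sd[OF x th] smapD(3)[OF f x th] using C th by blast
  show "\<mu> (sdim X x) [0, Suc n] [f x, sig E n e t] =
    sig E n (\<mu> (sdim X x) [0, n] [f x, e]) t" if t: "t \<in> simp circle (sdim X x)" for t
  proof -
   have "\<mu> (sdim X x) [0, Suc n] [f x, sig E n e t] =
    act E (Suc n) (insert_cycle n n) (sig E n (\<mu> (sdim X x) [0, n] [f x, e]) t)" using C t by blast
   thus ?thesis unfolding ic act1[OF c t] .
  qed
 qed
 show "pmap E X (\<lambda>n x e. \<mu> (sdim X x) [n, 0] [e, f x])"
  unfolding pmap_def
 proof (intro allI ballI conjI)
  fix n x e assume x: "x \<in> cells X" and e: "e \<in> simp (lev E n) (sdim X x)"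
  note C = B[OF x e fs[OF x], unfolded add_0_right]
  show c: "\<mu> (sdim X x) [n, 0] [e, f x] \<in> simp (lev E n) (sdim X x)" using C by blast
  show "\<mu> (sdim X x) [n, 0] [bas E n (sdim X x), f x] = bas E n (sdim X x)"
   using B[OF x bas_simp fs[OF x], of n] by simp
  show "\<mu> (sdim X (opr X th x)) [n, 0] [opr (lev E n) th e, f (opr X th x)] =
    opr (lev E n) th (\<mu> (sdim X x) [n, 0] [e, f x])" if th: "th \<in> ops l (sdim X x)" for l th
   unfolding sd[OF x th] smapD(3)[OF f x th] using C th by blast
  show "\<mu> (sdim X x) [Suc n, 0] [sig E n e t, f x] =
    sig E n (\<mu> (sdim X x) [n, 0] [e, f x]) t" if t: "t \<in> simp circle (sdim X x)" for t
  proof -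
   have "\<mu> (sdim X x) [Suc n, 0] [sig E n e t, f x] =
    act E (Suc n) (insert_cycle n n) (sig E n (\<mu> (sdim X x) [n, 0] [e, f x]) t)" using C t by blast
   thus ?thesis unfolding ic act1[OF c t] .
  qed
 qed
qed

lemma mult_transfer:
 assumes c: "finite_cover Y X p" and a: "smap X (lev E 0) a" and f: "smap Y (lev E 0) f"
 shows "mult (R X) (cls X a) (transfer E Y X p (cls Y f)) =
   transfer E Y X p (mult (R Y) (cls Y (\<lambda>y. a (p y))) (cls Y f))"
  "mult (R X) (transfer E Y X p (cls Y f)) (cls X a) =
   transfer E Y X p (mult (R Y) (cls Y f) (cls Y (\<lambda>y. a (p y))))"
proof -
 note D = finite_coverD[OF c]
 obtain s where s: "fibre_sum E Y X p s" using fibre_sum_ex[OF c] .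
 have af: "smap X (lev E 0) (along Y p s 0 f)" using smap_along[OF c _ f] s by (auto simp: fibre_sum_iff)
 have ap: "smap Y (lev E 0) (\<lambda>y. a (p y))" by (rule smap_comp[OF D(3) a])
 have eq: "cls Y (\<lambda>y. \<mu> (sdim X (p y)) [0, 0] [u y, v y]) = cls Y (pow Y [u, v])"
  if uv: "smap Y (lev E 0) (\<lambda>y. \<mu> (sdim X (p y)) [0, 0] [u y, v y])" for u v
  by (rule hclass_eqI[OF D(1)], rule hrel_cong[OF hrel_refl[OF uv D(1)]])
   (use smapD(2)[OF D(3)] in \<open>auto simp: pow_def numeral_2_eq_2 replicate_Suc\<close>)
 have p: "(\<lambda>x. \<mu> (sdim X x) [0, 0] [u x, v x]) = pow X [u, v]" for u v
  by (simp add: pow_def[abs_def] numeral_2_eq_2 replicate_Suc)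
 note F1 = projection_formula[OF s pmap_pow(1)[OF D(2) a] f] and F2 = projection_formula[OF s pmap_pow(2)[OF D(2) a] f]
 show "mult (R X) (cls X a) (transfer E Y X p (cls Y f)) =
   transfer E Y X p (mult (R Y) (cls Y (\<lambda>y. a (p y))) (cls Y f))"
  unfolding mult_eq[OF D(1) ap f] transfer_eq[OF s f] mult_eq[OF D(2) a af] eq[OF F1(1), symmetric] F1(2)[symmetric] p ..
 show "mult (R X) (transfer E Y X p (cls Y f)) (cls X a) =
   transfer E Y X p (mult (R Y) (cls Y f) (cls Y (\<lambda>y. a (p y))))"
  unfolding mult_eq[OF D(1) f ap] transfer_eq[OF s f] mult_eq[OF D(2) af a] eq[OF F2(1), symmetric] F2(2)[symmetric] p ..
qed

lemma mult_closed:
 assumes X: "is_sset X" and "A \<in> cohomology E X" "B \<in> cohomology E X"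
 shows "mult (R X) A B \<in> cohomology E X"
proof -
 obtain a where a: "smap X (lev E 0) a" "A = cls X a" using assms(2) by (rule cohomologyE)
 obtain b where b: "smap X (lev E 0) b" "B = cls X b" using assms(3) by (rule cohomologyE)
 show ?thesis unfolding a(2) b(2) mult_eq[OF X a(1) b(1)] by (rule cohomologyI[OF smap_pow[OF X]]) (use a b in auto)
qed

text \<open>Both bracketings are homotopic to the product of three factors formed in one step, after
  the product of length 1 has been removed by \<open>pow_one\<close>.\<close>

lemma mult_assoc:
 assumes X: "is_sset X" and "A \<in> cohomology E X" "B \<in> cohomology E X" "C \<in> cohomology E X"
 shows "mult (R X) (mult (R X) A B) C = mult (R X) A (mult (R X) B C)"
proof -
 obtain a where a: "smap X (lev E 0) a" "A = cls X a" using assms(2) by (rule cohomologyE)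
 obtain b where b: "smap X (lev E 0) b" "B = cls X b" using assms(3) by (rule cohomologyE)
 obtain c where c: "smap X (lev E 0) c" "C = cls X c" using assms(4) by (rule cohomologyE)
 note s = smap_pow[OF X]
 have ab: "smap X (lev E 0) (pow X [a, b])" and bc: "smap X (lev E 0) (pow X [b, c])"
  by (rule s, use a b c in auto)+
 have "hm X (pow X [a, b, c]) (pow X [pow X [a, b], pow X [c]])" using pow_alpha[OF X, of "[a, b]" "[c]"] a b c by auto
 from hm_trans[OF X this pow_cong[OF X hrel_refl[OF ab X] pow_one[OF X c(1)]]]
 have 1: "hm X (pow X [a, b, c]) (pow X [pow X [a, b], c])" .
 have "hm X (pow X [a, b, c]) (pow X [pow X [a], pow X [b, c]])" using pow_alpha[OF X, of "[a]" "[b, c]"] a b c by auto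
 from hm_trans[OF X this pow_cong[OF X pow_one[OF X a(1)] hrel_refl[OF bc X]]]
 have 2: "hm X (pow X [a, b, c]) (pow X [a, pow X [b, c]])" .
 show ?thesis unfolding a(2) b(2) c(2) mult_eq[OF X a(1) b(1)] mult_eq[OF X b(1) c(1)] mult_eq[OF X ab c(1)] mult_eq[OF X a(1) bc]
  using hclass_eqI[OF X 1] hclass_eqI[OF X 2] by simp
qed

lemma mult_one:
 assumes X: "is_sset X" and "A \<in> cohomology E X"
 shows "mult (R X) (cls X (pow X [])) A = A" "mult (R X) A (cls X (pow X [])) = A"
proof -
 obtain a where a: "smap X (lev E 0) a" "A = cls X a" using assms(2) by (rule cohomologyE)
 have u: "smap X (lev E 0) (pow X [])" by (rule smap_pow[OF X]) simp
 note r = hrel_refl[OF u X] and o = pow_one[OF X a(1)]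
 have 1: "hm X (pow X [a]) (pow X [pow X [], a])"
  using hm_trans[OF X pow_alpha[OF X, of "[]" "[a]"] pow_cong[OF X r o]] a by auto
 show "mult (R X) (cls X (pow X [])) A = A"
  unfolding a(2) mult_eq[OF X u a(1)] using hclass_eqI[OF X 1] hclass_eqI[OF X o] by simp
 have 2: "hm X (pow X [a]) (pow X [a, pow X []])"
  using hm_trans[OF X pow_alpha[OF X, of "[a]" "[]"] pow_cong[OF X o r]] a by auto
 show "mult (R X) A (cls X (pow X [])) = A"
  unfolding a(2) mult_eq[OF X a(1) u] using hclass_eqI[OF X 2] hclass_eqI[OF X o] by simp
qed

text \<open>As sums are transfers along the double cover, distributivity is the projection formula
  for that cover.\<close>

lemma mult_cadd:
 assumes X: "is_sset X" and "A \<in> cohomology E X" "B \<in> cohomology E X" "C \<in> cohomology E X"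
 shows "mult (R X) A (cadd X B C) = cadd X (mult (R X) A B) (mult (R X) A C)"
  "mult (R X) (cadd X B C) A = cadd X (mult (R X) B A) (mult (R X) C A)"
proof -
 obtain a where a: "smap X (lev E 0) a" "A = cls X a" using assms(2) by (rule cohomologyE)
 obtain b where b: "smap X (lev E 0) b" "B = cls X b" using assms(3) by (rule cohomologyE)
 obtain c where c: "smap X (lev E 0) c" "C = cls X c" using assms(4) by (rule cohomologyE)
 have d: "finite_cover (dbl X) X fst" by (rule finite_cover_disc[OF X]) simp
 note D = finite_coverD[OF d]
 note bc = smap_cpair[OF b(1) c(1)]
 have af: "smap (dbl X) (lev E 0) (\<lambda>y. a (fst y))" by (rule smap_comp[OF D(3) a(1)])
 have sl: "(\<lambda>x. pow (dbl X) [u, v] (x, i)) = pow X [\<lambda>x. u (x, i), \<lambda>x. v (x, i)]" for u v i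
  by (simp add: pow_def fun_eq_iff)
 have s: "smap (dbl X) (lev E 0) (pow (dbl X) [\<lambda>y. a (fst y), cpair b c])" "smap (dbl X) (lev E 0) (pow (dbl X) [cpair b c, \<lambda>y. a (fst y)])"
  by (rule smap_pow[OF D(1)], use af bc in auto)+
 show "mult (R X) A (cadd X B C) = cadd X (mult (R X) A B) (mult (R X) A C)"
  unfolding a(2) b(2) c(2) cadd_transfer[OF X b(1) c(1)] mult_transfer(1)[OF d a(1) bc] mult_eq[OF D(1) af bc] cadd_split[OF X s(1)] sl
  unfolding mult_eq[OF X a(1) b(1)] mult_eq[OF X a(1) c(1)] by (simp add: cpair_def)
 show "mult (R X) (cadd X B C) A = cadd X (mult (R X) B A) (mult (R X) C A)"
  unfolding a(2) b(2) c(2) cadd_transfer[OF X b(1) c(1)] mult_transfer(2)[OF d a(1) bc] mult_eq[OF D(1) bc af] cadd_split[OF X s(2)] sl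
  unfolding mult_eq[OF X b(1) a(1)] mult_eq[OF X c(1) a(1)] by (simp add: cpair_def)
qed

lemma cohomology_ring:
 assumes X: "is_sset X"
 shows "Ring.ring (R X)"
proof (rule ringI)
 show "abelian_group (R X)"
 proof (rule abelian_groupI)
  show "\<exists>y\<in>carrier (R X). y \<oplus>\<^bsub>R X\<^esub> x = \<zero>\<^bsub>R X\<^esub>" if "x \<in> carrier (R X)" for x
   using cadd_inverse[OF X, of x] cadd_commute[OF X, of x] that by auto
 qed (simp_all add: X cadd_closed czero_closed cadd_assoc cadd_zero cadd_commute[OF X])
 have one: "cls X (pow X []) \<in> cohomology E X" by (rule cohomologyI[OF smap_pow[OF X]]) simp
 show "Group.monoid (R X)"
  by (rule monoidI) (simp_all add: X mult_closed mult_assoc mult_one one)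
qed (simp_all add: X mult_cadd)

text \<open>Additivity of the transfer gives closure under sums, and the projection formula gives
  closure under multiplication from both sides; zero and negatives are obtained as
  multiples.\<close>

lemma transfer_ideal:
 assumes c: "finite_cover Y X p"
 shows "ideal (transfer E Y X p ` cohomology E Y) (R X)"
proof -
 note D = finite_coverD[OF c]
 interpret ring "R X" by (rule cohomology_ring[OF D(2)])
 have m: "x \<otimes>\<^bsub>R X\<^esub> a \<in> transfer E Y X p ` cohomology E Y" "a \<otimes>\<^bsub>R X\<^esub> x \<in> transfer E Y X p ` cohomology E Y"
  if a: "a \<in> transfer E Y X p ` cohomology E Y" and x: "x \<in> cohomology E X" for a x
 proof -
  obtain f where f: "smap Y (lev E 0) f" "a = transfer E Y X p (cls Y f)" using a by (auto elim: cohomologyE)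
  obtain g where g: "smap X (lev E 0) g" "x = cls X g" using x by (rule cohomologyE)
  note M = mult_closed[OF D(1)] cohomologyI[OF f(1)] cohomologyI[OF smap_comp[OF D(3) g(1)]]
  show "x \<otimes>\<^bsub>R X\<^esub> a \<in> transfer E Y X p ` cohomology E Y" "a \<otimes>\<^bsub>R X\<^esub> x \<in> transfer E Y X p ` cohomology E Y"
   unfolding f(2) g(2) mult_transfer[OF c g(1) f(1)] using M by auto
 qed
 have cl: "transfer E Y X p ` cohomology E Y \<subseteq> cohomology E X" using transfer_closed[OF c] by auto
 \<comment> \<open>Any element of the image serves, since multiplying it by zero stays in the
   image.\<close>
 have z: "czero X \<in> transfer E Y X p ` cohomology E Y"
 proof -
  have "transfer E Y X p (czero Y) \<in> transfer E Y X p ` cohomology E Y" using czero_closed[OF D(1)] by blast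
  thus ?thesis using m(1)[of "transfer E Y X p (czero Y)" "czero X"] czero_closed[OF D(2)] l_null cl by auto
 qed
 show ?thesis
 proof (rule idealI[OF cohomology_ring[OF D(2)]])
  show "subgroup (transfer E Y X p ` cohomology E Y) (add_monoid (R X))"
  proof (rule add.subgroupI)
   fix a assume a: "a \<in> transfer E Y X p ` cohomology E Y"
   hence "a \<in> carrier (R X)" using cl by auto
   \<comment> \<open>The negative is a multiple by minus one, so closure under multiplication
     provides it.\<close>
   hence "(\<ominus>\<^bsub>R X\<^esub> \<one>\<^bsub>R X\<^esub>) \<otimes>\<^bsub>R X\<^esub> a = \<ominus>\<^bsub>R X\<^esub> a" using l_minus[OF one_closed, of a] l_one[of a] by (simp only:)
   thus "\<ominus>\<^bsub>R X\<^esub> a \<in> transfer E Y X p ` cohomology E Y" using m(1)[OF a, of "\<ominus>\<^bsub>R X\<^esub> \<one>\<^bsub>R X\<^esub>"] a_inv_closed[OF one_closed] by simp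
   fix b assume "b \<in> transfer E Y X p ` cohomology E Y"
   with a show "a \<oplus>\<^bsub>R X\<^esub> b \<in> transfer E Y X p ` cohomology E Y"
    using transfer_cadd[OF c] cadd_closed[OF D(1)] by (auto simp flip: transfer_cadd[OF c])
  qed (use cl z in auto)
 qed (use m in auto)
qed

end

section \<open>Quotients and finite covers\<close>

definition gact :: "('g, 'm) monoid_scheme => 'w set => ('g => 'w => 'w) => bool" where
 "gact \<Gamma> W a \<longleftrightarrow> (\<forall>w\<in>W. a \<one>\<^bsub>\<Gamma>\<^esub> w = w \<and>
   (\<forall>g\<in>carrier \<Gamma>. a g w \<in> W \<and> (\<forall>h\<in>carrier \<Gamma>. a (h \<otimes>\<^bsub>\<Gamma>\<^esub> g) w = a h (a g w))))"

abbreviation orb :: "('g => 'w => 'w) => 'g set => 'w => 'w set" where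
 "orb a L x \<equiv> (\<lambda>g. a g x) ` L"

lemma gactD:
 assumes "gact \<Gamma> W a" "w \<in> W"
 shows "a \<one>\<^bsub>\<Gamma>\<^esub> w = w" "g \<in> carrier \<Gamma> ==> a g w \<in> W"
  "g \<in> carrier \<Gamma> ==> h \<in> carrier \<Gamma> ==> a (h \<otimes>\<^bsub>\<Gamma>\<^esub> g) w = a h (a g w)"
 using assms unfolding gact_def by blast+

lemma orb_self: "gact \<Gamma> W a ==> subgroup L \<Gamma> ==> x \<in> W ==> x \<in> orb a L x"
 using gactD(1) subgroup.one_closed by (metis image_eqI)

lemma orb_eq:
 assumes \<Gamma>: "group \<Gamma>" "gact \<Gamma> W a" "subgroup L \<Gamma>" and x: "x \<in> W" and g: "g \<in> L"
 shows "orb a L (a g x) = orb a L x"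
proof (intro equalityI image_subsetI)
 note L = subgroup.mem_carrier[OF \<Gamma>(3)] subgroup.m_closed[OF \<Gamma>(3)] subgroup.m_inv_closed[OF \<Gamma>(3)]
 fix h assume h: "h \<in> L"
 show "a h (a g x) \<in> orb a L x" using gactD(3)[OF \<Gamma>(2) x, of g h] L g h by (metis image_eqI)
 interpret group \<Gamma> by (rule assms(1))
 have "h \<otimes>\<^bsub>\<Gamma>\<^esub> inv\<^bsub>\<Gamma>\<^esub> g \<otimes>\<^bsub>\<Gamma>\<^esub> g = h" using L(1) g h by (simp add: m_assoc)
 hence "a h x = a (h \<otimes>\<^bsub>\<Gamma>\<^esub> inv\<^bsub>\<Gamma>\<^esub> g) (a g x)" using gactD(3)[OF \<Gamma>(2) x, of g "h \<otimes>\<^bsub>\<Gamma>\<^esub> inv\<^bsub>\<Gamma>\<^esub> g"] L g h by simp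
 thus "a h x \<in> orb a L (a g x)" using L g h by blast
qed

definition sact :: "('g, 'm) monoid_scheme => 'w sset => ('g => 'w => 'w) => bool" where
 "sact \<Gamma> T a \<longleftrightarrow> is_sset T \<and> gact \<Gamma> (cells T) a \<and> (\<forall>g\<in>carrier \<Gamma>. \<forall>x\<in>cells T. sdim T (a g x) = sdim T x \<and>
   (\<forall>m. \<forall>th\<in>ops m (sdim T x). opr T th (a g x) = a g (opr T th x)))"

lemma sactD:
 assumes "sact \<Gamma> T a"
 shows "is_sset T" "gact \<Gamma> (cells T) a"
  "g \<in> carrier \<Gamma> ==> x \<in> cells T ==> sdim T (a g x) = sdim T x"
  "g \<in> carrier \<Gamma> ==> x \<in> cells T ==> th \<in> ops m (sdim T x) ==> opr T th (a g x) = a g (opr T th x)"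
 using assms unfolding sact_def by blast+

lemma cells_quot: "cells (quot T a L) = orb a L ` cells T"
 by (auto simp: quot_def)

locale quotient =
 fixes \<Gamma> :: "('g, 'm) monoid_scheme" and T :: "'w sset" and a and L
 assumes grp: "group \<Gamma>" and act: "sact \<Gamma> T a" and sub: "subgroup L \<Gamma>"
begin

lemmas L_carrier = subgroup.mem_carrier[OF sub]
lemmas self = orb_self[OF sactD(2)[OF act] sub]

lemma orbE: "y \<in> orb a L x ==> x \<in> cells T ==> orb a L y = orb a L x"
 using orb_eq[OF grp sactD(2)[OF act] sub] by blast

lemma quot_sdim: "x \<in> cells T ==> sdim (quot T a L) (orb a L x) = sdim T x"
proof -
 assume x: "x \<in> cells T"
 have "sdim T ` orb a L x = {sdim T x}"
  using self[OF x] sactD(3)[OF act L_carrier x] by (auto simp: image_iff)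
 thus ?thesis by (simp add: quot_def)
qed

lemma quot_opr:
 assumes x: "x \<in> cells T" and th: "th \<in> ops m (sdim T x)"
 shows "opr (quot T a L) th (orb a L x) = orb a L (opr T th x)"
 using sactD(4)[OF act L_carrier x th] by (auto simp: quot_def image_image intro!: image_cong)

lemma is_sset_quot: "is_sset (quot T a L)"
proof (rule is_ssetI)
 note T = sactD(1)[OF act]
 fix z m th assume "z \<in> cells (quot T a L)" and z: "th \<in> ops m (sdim (quot T a L) z)"
 then obtain x where x: "x \<in> cells T" "z = orb a L x" unfolding cells_quot by blast
 have th: "th \<in> ops m (sdim T x)" using z quot_sdim x by simp
 note o = sset_opr[OF T x(1) th]
 show "opr (quot T a L) th z \<in> cells (quot T a L) \<and> sdim (quot T a L) (opr (quot T a L) th z) = m"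
  using o quot_sdim quot_opr[OF x(1) th] x unfolding cells_quot by simp
 fix l phi assume phi: "phi \<in> ops l m"
 show "opr (quot T a L) (th \<odot> phi) z = opr (quot T a L) phi (opr (quot T a L) th z)"
  using quot_opr[OF x(1) pull_ops[OF th phi]] quot_opr[OF x(1) th] quot_opr[of "opr T th x" phi l] o phi sset_comp[OF T x(1) th phi] x by simp
next
 fix z assume "z \<in> cells (quot T a L)"
 then obtain x where x: "x \<in> cells T" "z = orb a L x" unfolding cells_quot by blast
 show "opr (quot T a L) (idl (sdim (quot T a L) z)) z = z"
  using x quot_sdim[OF x(1)] quot_opr[OF x(1) idl_ops] sset_id[OF sactD(1)[OF act] x(1)] by simp
qed

lemma the_elem_orb:
 assumes "x \<in> cells T" "!!g. g \<in> L ==> \<pi> (a g x) = \<pi> x"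
 shows "the_elem (\<pi> ` orb a L x) = \<pi> x"
proof -
 have "\<pi> ` orb a L x = {\<pi> x}" using self[OF assms(1)] assms(2) by (auto simp: image_iff)
 thus ?thesis by simp
qed

lemma smap_quot:
 assumes X: "smap T X \<pi>" and inv: "!!x g. x \<in> cells T ==> g \<in> L ==> \<pi> (a g x) = \<pi> x"
 shows "smap (quot T a L) X (\<lambda>O'. the_elem (\<pi> ` O'))"
proof (rule smapI)
 have te: "the_elem (\<pi> ` orb a L x) = \<pi> x" if x: "x \<in> cells T" for x by (rule the_elem_orb[OF x inv[OF x]])
 fix z assume "z \<in> cells (quot T a L)"
 then obtain x where x: "x \<in> cells T" "z = orb a L x" unfolding cells_quot by blast
 show "the_elem (\<pi> ` z) \<in> cells X \<and> sdim X (the_elem (\<pi> ` z)) = sdim (quot T a L) z"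
  using x te[OF x(1)] smapD(1,2)[OF X x(1)] quot_sdim[OF x(1)] by simp
 fix m th assume "th \<in> ops m (sdim (quot T a L) z)"
 hence th: "th \<in> ops m (sdim T x)" using x quot_sdim by simp
 have o: "opr T th x \<in> cells T" using sset_opr[OF sactD(1)[OF act] x(1) th] by simp
 show "the_elem (\<pi> ` opr (quot T a L) th z) = opr X th (the_elem (\<pi> ` z))"
  unfolding x(2) quot_opr[OF x(1) th] te[OF x(1)] te[OF o] by (rule smapD(3)[OF X x(1) th])
qed

text \<open>The covering conditions expressed on representatives: \<open>I\<close> is uniqueness of
  lifts modulo \<open>L\<close>, \<open>S\<close> is their existence, and \<open>F\<close> is
  finiteness of the fibres.\<close>

lemma quot_cover:
 assumes X: "is_sset X" "smap T X \<pi>" and inv: "!!x g. x \<in> cells T ==> g \<in> L ==> \<pi> (a g x) = \<pi> x"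
  and I: "!!y y' th m. y \<in> cells T ==> y' \<in> cells T ==> \<pi> y = \<pi> y' ==> th \<in> ops m (sdim T y) ==>
   opr T th y' \<in> orb a L (opr T th y) ==> y' \<in> orb a L y"
  and S: "!!x w th m. x \<in> cells X ==> th \<in> ops m (sdim X x) ==> w \<in> cells T ==> \<pi> w = opr X th x ==>
   \<exists>y\<in>cells T. \<pi> y = x \<and> opr T th y = w"
  and F: "!!x. x \<in> cells X ==> finite (orb a L ` {y \<in> cells T. \<pi> y = x})"
 shows "finite_cover (quot T a L) X (\<lambda>O'. the_elem (\<pi> ` O'))"
proof (rule finite_coverI[OF is_sset_quot X(1) smap_quot[OF X(2) inv]])
 have te: "the_elem (\<pi> ` orb a L x) = \<pi> x" if x: "x \<in> cells T" for x by (rule the_elem_orb[OF x inv[OF x]])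
 note T = sactD(1)[OF act]
 fix x assume x: "x \<in> cells X"
 have fib: "fib (quot T a L) (\<lambda>O'. the_elem (\<pi> ` O')) x' = orb a L ` {y \<in> cells T. \<pi> y = x'}" for x'
  using te unfolding fib_def cells_quot by auto
 show "finite (fib (quot T a L) (\<lambda>O'. the_elem (\<pi> ` O')) x)" unfolding fib by (rule F[OF x])
 fix m th assume th: "th \<in> ops m (sdim X x)"
 have thy: "th \<in> ops m (sdim T y)" if "y \<in> cells T" "\<pi> y = x" for y using smapD(2)[OF X(2) that(1)] that th by simp
 show "z = z'" if z: "z \<in> fib (quot T a L) (\<lambda>O'. the_elem (\<pi> ` O')) x" "z' \<in> fib (quot T a L) (\<lambda>O'. the_elem (\<pi> ` O')) x"
  "opr (quot T a L) th z = opr (quot T a L) th z'" for z z'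
 proof -
  obtain y where y: "y \<in> cells T" "\<pi> y = x" "z = orb a L y" using z(1) unfolding fib by blast
  obtain y' where y': "y' \<in> cells T" "\<pi> y' = x" "z' = orb a L y'" using z(2) unfolding fib by blast
  have "orb a L (opr T th y) = orb a L (opr T th y')"
   using z(3) quot_opr[OF y(1) thy[OF y(1,2)]] quot_opr[OF y'(1) thy[OF y'(1,2)]] y(3) y'(3) by simp
  hence "opr T th y' \<in> orb a L (opr T th y)" using self sset_opr[OF T y'(1) thy[OF y'(1,2)]] by simp
  from I[OF y(1) y'(1) _ thy[OF y(1,2)] this] show ?thesis using y y' orbE by simp
 qed
 show "\<exists>y\<in>fib (quot T a L) (\<lambda>O'. the_elem (\<pi> ` O')) x. z = opr (quot T a L) th y"
  if z: "z \<in> fib (quot T a L) (\<lambda>O'. the_elem (\<pi> ` O')) (opr X th x)" for z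
 proof -
  obtain w where w: "w \<in> cells T" "\<pi> w = opr X th x" "z = orb a L w" using z unfolding fib by blast
  obtain y where y: "y \<in> cells T" "\<pi> y = x" "opr T th y = w" using S[OF x th w(1,2)] by blast
  have "orb a L y \<in> fib (quot T a L) (\<lambda>O'. the_elem (\<pi> ` O')) x" unfolding fib using y by blast
  moreover have "z = opr (quot T a L) th (orb a L y)" using quot_opr[OF y(1) thy[OF y(1,2)]] y w by simp
  ultimately show ?thesis by blast
 qed
qed

end

text \<open>Lifts are found in \<open>Z\<close> over \<open>X\<close>. Such a lift maps to the right
  simplex of \<open>Y\<close> because lifts along \<open>q\<close> are unique.\<close>

lemma finite_cover_over:
 assumes p: "finite_cover Z X p" and q: "finite_cover Y X q" and r: "smap Z Y r"
  and qr: "!!z. z \<in> cells Z ==> q (r z) = p z"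
 shows "finite_cover Z Y r"
proof (rule finite_coverI[OF finite_coverD(1)[OF p] finite_coverD(1)[OF q] r])
 fix y assume y: "y \<in> cells Y"
 note qy = smapD[OF finite_coverD(3)[OF q] y]
 have sub: "z \<in> fib Z p (q y)" if "z \<in> fib Z r y" for z using that qr by (auto simp: fib_def)
 show "finite (fib Z r y)" by (rule finite_subset[OF _ finite_fib[OF p qy(1)]]) (use sub in blast)
 fix m th assume "th \<in> ops m (sdim Y y)"
 hence th: "th \<in> ops m (sdim Y y)" "th \<in> ops m (sdim X (q y))" using qy by auto
 show "z = z'" if "z \<in> fib Z r y" "z' \<in> fib Z r y" "opr Z th z = opr Z th z'" for z z'
  by (rule fib_opr_inj[OF p qy(1) th(2) sub[OF that(1)] sub[OF that(2)] that(3)])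
 show "\<exists>z\<in>fib Z r y. w = opr Z th z" if w: "w \<in> fib Z r (opr Y th y)" for w
 proof -
  have "w \<in> fib Z p (opr X th (q y))" using w qr[of w] qy(3)[OF th(1)] by (auto simp: fib_def)
  then obtain z where z: "z \<in> fib Z p (q y)" "w = opr Z th z" using fib_opr_ex[OF p qy(1) th(2)] by blast
  have zc: "z \<in> cells Z" "p z = q y" "sdim Z z = sdim X (q y)" using z(1) smapD(2)[OF finite_coverD(3)[OF p], of z] by (auto simp: fib_def)
  have thz: "th \<in> ops m (sdim Z z)" using th(2) zc by simp
  have "r z = y"
  proof (rule fib_opr_inj[OF q qy(1) th(2)])
   show "r z \<in> fib Y q (q y)" using zc qr smapD(1)[OF r zc(1)] by (simp add: fib_def)
   show "y \<in> fib Y q (q y)" using y by (simp add: fib_def)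
   show "opr Y th (r z) = opr Y th y" using smapD(3)[OF r zc(1) thz] w z(2) by (simp add: fib_def)
  qed
  thus ?thesis using z zc by (auto simp: fib_def)
 qed
qed

lemma cells_EG: "gs \<in> cells (EG G) \<longleftrightarrow> gs \<noteq> [] \<and> set gs \<subseteq> carrier G"
 by (simp add: EG_def)

lemma sdim_EG [simp]: "sdim (EG G) gs = length gs - 1"
 by (simp add: EG_def)

lemma opr_EG [simp]: "opr (EG G) th gs = gs \<odot> th"
 by (simp add: EG_def)

lemma sact_EG:
 assumes "group G"
 shows "sact G (EG G) (ltrans G)"
 unfolding sact_def gact_def
proof (intro conjI ballI allI)
 interpret group G by (rule assms)
 show "is_sset (EG G)" by (rule is_sset_EG)
 fix x assume x: "x \<in> cells (EG G)"
 show "ltrans G \<one>\<^bsub>G\<^esub> x = x" unfolding ltrans_def by (rule map_idI) (use x in \<open>auto simp: cells_EG\<close>)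
 fix g assume g: "g \<in> carrier G"
 show "ltrans G g x \<in> cells (EG G)" "sdim (EG G) (ltrans G g x) = sdim (EG G) x"
  using x g by (auto simp: cells_EG ltrans_def)
 show "ltrans G (h \<otimes>\<^bsub>G\<^esub> g) x = ltrans G h (ltrans G g x)" if "h \<in> carrier G" for h
  using x g that by (auto simp: cells_EG ltrans_def map_map m_assoc)
 fix m th assume "th \<in> ops m (sdim (EG G) x)"
 hence "th ! i < length x" if "i < length th" for i
  using ops_nth_le[of th m _ i] ops_length[of th m] x that by (cases x) (auto simp: cells_EG less_Suc_eq_le)
 thus "opr (EG G) th (ltrans G g x) = ltrans G g (opr (EG G) th x)"
  by (auto simp: ltrans_def map_map in_set_conv_nth)
qed

lemma sact_disc:
 assumes "sact G T a" "gact G W b"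
 shows "sact G (sprod_disc T W) (\<lambda>g (x, w). (a g x, b g w))"
 unfolding sact_def gact_def
 using is_sset_disc[OF sactD(1)[OF assms(1)]] sactD(3,4)[OF assms(1)] gactD[OF sactD(2)[OF assms(1)]] gactD[OF assms(2)]
 by (auto simp: sprod_disc_def)

lemma ltrans_inj:
 assumes "group G" "gs \<in> cells (EG G)" "g \<in> carrier G" "h \<in> carrier G" "ltrans G g gs = ltrans G h gs"
 shows "g = h"
 using assms group.right_cancel[of G "hd gs" g h] by (cases gs) (auto simp: cells_EG ltrans_def)

section \<open>Covers of the product of the two classifying spaces\<close>

locale cover_base =
 fixes G :: "('g, 'b) monoid_scheme" and m :: nat
 assumes grpG: "group G" and finG: "finite (carrier G)"
begin

abbreviation \<Gamma> where "\<Gamma> \<equiv> G \<times>\<times> sym_group m"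

lemma grp\<Gamma>: "group \<Gamma>"
 by (rule DirProd_group[OF grpG sym_group_is_group])

lemma fin\<Gamma>: "finite (carrier \<Gamma>)"
proof -
 have "carrier (sym_group m) = {p. p permutes {1..m}}" by (auto simp: in_sym_group)
 thus ?thesis using finG by (simp add: DirProd_def finite_permutations)
qed

sublocale qG: quotient G "EG G" "ltrans G" "carrier G"
 by (rule quotient.intro[OF grpG sact_EG[OF grpG] group.subgroup_self[OF grpG]])

sublocale qS: quotient "sym_group m" "ES m" "ltrans (sym_group m)" "carrier (sym_group m)"
 by (rule quotient.intro[OF sym_group_is_group sact_EG[OF sym_group_is_group] group.subgroup_self[OF sym_group_is_group]])

lemma is_sset_BGS: "is_sset (BGS G m)"
 using is_sset_sprod qG.is_sset_quot qS.is_sset_quot by (simp add: BG_def)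

lemma parts:
 assumes "ks \<in> cells (EG \<Gamma>)"
 shows "map fst ks \<in> cells (EG G)" "map snd ks \<in> cells (ES m)"
 using assms by (auto simp: cells_EG DirProd_def)

lemma to_BGS_eq: "to_BGS G m ks = (orb (ltrans G) (carrier G) (map fst ks), orb (ltrans (sym_group m)) (carrier (sym_group m)) (map snd ks))"
 by (simp add: to_BGS_def)

lemma parts_ltrans:
 "map fst (ltrans \<Gamma> (g, \<sigma>) ks) = ltrans G g (map fst ks)" "map snd (ltrans \<Gamma> (g, \<sigma>) ks) = ltrans (sym_group m) \<sigma> (map snd ks)"
 by (induction ks) (auto simp: ltrans_def DirProd_def)

lemma smap_to_BGS: "smap (EG \<Gamma>) (BGS G m) (to_BGS G m)"
proof (rule smapI)
 fix ks assume ks: "ks \<in> cells (EG \<Gamma>)"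
 note P = parts[OF ks]
 show "to_BGS G m ks \<in> cells (BGS G m) \<and> sdim (BGS G m) (to_BGS G m ks) = sdim (EG \<Gamma>) ks"
  using qG.quot_sdim[OF P(1)] qS.quot_sdim[OF P(2)] P by (simp add: to_BGS_eq sprod_def BG_def cells_quot)
 fix l th assume th: "th \<in> ops l (sdim (EG \<Gamma>) ks)"
 have "th ! i < length ks" if "i < length th" for i
  using ops_nth_le[OF th, of i] ops_length[OF th] ks that by (cases ks) (auto simp: cells_EG less_Suc_eq_le)
 hence "map fst (ks \<odot> th) = map fst ks \<odot> th" "map snd (ks \<odot> th) = map snd ks \<odot> th"
  by (auto simp: map_map in_set_conv_nth)
 thus "to_BGS G m (opr (EG \<Gamma>) th ks) = opr (BGS G m) th (to_BGS G m ks)"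
  using qG.quot_opr[OF P(1), of th l] qS.quot_opr[OF P(2), of th l] th by (simp add: to_BGS_eq sprod_def BG_def)
qed

lemma to_BGS_ltrans:
 assumes "ks \<in> cells (EG \<Gamma>)" "\<gamma> \<in> carrier \<Gamma>"
 shows "to_BGS G m (ltrans \<Gamma> \<gamma> ks) = to_BGS G m ks"
proof -
 obtain g \<sigma> where \<gamma>: "\<gamma> = (g, \<sigma>)" "g \<in> carrier G" "\<sigma> \<in> carrier (sym_group m)" using assms(2) by (auto simp: DirProd_def)
 show ?thesis unfolding \<gamma>(1) to_BGS_eq parts_ltrans
  using qG.orbE[OF imageI[OF \<gamma>(2)] parts(1)[OF assms(1)]] qS.orbE[OF imageI[OF \<gamma>(3)] parts(2)[OF assms(1)]] by simp
qed

text \<open>A simplex of the contractible space of \<open>\<Gamma>\<close> is a pair of lists of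
  equal length, and the two components may be translated independently. So the fibres of
  \<open>to_BGS\<close> are orbits of the product group.\<close>

lemma to_BGS_eqD:
 assumes ks: "ks \<in> cells (EG \<Gamma>)" "ks' \<in> cells (EG \<Gamma>)" and e: "to_BGS G m ks' = to_BGS G m ks"
 obtains \<gamma> where "\<gamma> \<in> carrier \<Gamma>" "ks' = ltrans \<Gamma> \<gamma> ks"
proof -
 have "map fst ks' \<in> orb (ltrans G) (carrier G) (map fst ks)" "map snd ks' \<in> orb (ltrans (sym_group m)) (carrier (sym_group m)) (map snd ks)"
  using e qG.self[OF parts(1)[OF ks(2)]] qS.self[OF parts(2)[OF ks(2)]] by (auto simp: to_BGS_eq)
 then obtain g \<sigma> where g: "g \<in> carrier G" "\<sigma> \<in> carrier (sym_group m)"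
  "map fst ks' = ltrans G g (map fst ks)" "map snd ks' = ltrans (sym_group m) \<sigma> (map snd ks)" by blast
 hence "ks' = ltrans \<Gamma> (g, \<sigma>) ks" by (intro pair_list_eqI) (simp_all only: parts_ltrans)
 thus thesis using that[of "(g, \<sigma>)"] g by (simp add: DirProd_def)
qed

lemma to_BGS_surj:
 assumes "x \<in> cells (BGS G m)"
 obtains ks where "ks \<in> cells (EG \<Gamma>)" "x = to_BGS G m ks"
proof -
 obtain xs ys where x: "x = (orb (ltrans G) (carrier G) xs, orb (ltrans (sym_group m)) (carrier (sym_group m)) ys)"
  "xs \<in> cells (EG G)" "ys \<in> cells (ES m)" and "sdim (BG G) (fst x) = sdim (BG (sym_group m)) (snd x)"
  using assms by (auto simp: sprod_def BG_def cells_quot)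
 hence "length xs - 1 = length ys - 1" using qG.quot_sdim qS.quot_sdim by (simp add: BG_def)
 hence l: "length xs = length ys" using x(2,3) by (cases xs; cases ys) (auto simp: cells_EG)
 show thesis
 proof (rule that[of "zip xs ys"])
  show "zip xs ys \<in> cells (EG \<Gamma>)" using x(2,3) l by (cases xs; cases ys) (auto simp: cells_EG DirProd_def dest: set_zip_leftD set_zip_rightD)
  show "x = to_BGS G m (zip xs ys)" using x(1) l by (simp add: to_BGS_eq)
 qed
qed

text \<open>The hypotheses say that \<open>(e, c)\<close> identifies \<open>T\<close> with the
  contractible space times a finite discrete set of colours. With one colour this gives the Young
  covers; with the tuples as colours and all of \<open>\<Gamma>\<close> divided out it gives the
  space \<open>Z\<close>.\<close>

lemma cover_BGS:
 assumes act: "sact \<Gamma> T a" and L: "subgroup L \<Gamma>" and e: "smap T (EG \<Gamma>) e"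
  and ea: "!!g y. g \<in> carrier \<Gamma> ==> y \<in> cells T ==> e (a g y) = ltrans \<Gamma> g (e y)"
  and c: "finite (c ` cells T)" "!!y th l. y \<in> cells T ==> th \<in> ops l (sdim T y) ==> c (opr T th y) = c y"
  and inj: "!!y y'. y \<in> cells T ==> y' \<in> cells T ==> e y = e y' ==> c y = c y' ==> y = y'"
  and ex: "!!y ks. y \<in> cells T ==> ks \<in> cells (EG \<Gamma>) ==> \<exists>y'\<in>cells T. e y' = ks \<and> c y' = c y"
  and \<pi>: "!!y. \<pi> y = to_BGS G m (e y)"
 shows "finite_cover (quot T a L) (BGS G m) (\<lambda>O'. the_elem (\<pi> ` O'))"
proof -
 interpret quotient \<Gamma> T a L by (rule quotient.intro[OF grp\<Gamma> act L])
 note T = sactD(1)[OF act] and A = sactD(3,4)[OF act] and g = gactD[OF sactD(2)[OF act]]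
 note EA = sactD[OF sact_EG[OF grp\<Gamma>]]
 have \<pi>': "\<pi> = (\<lambda>y. to_BGS G m (e y))" using \<pi> by auto
 show ?thesis
 proof (rule quot_cover[OF is_sset_BGS])
  show "smap T (BGS G m) \<pi>" unfolding \<pi>' by (rule smap_comp[OF e smap_to_BGS])
  show "\<pi> (a l x) = \<pi> x" if "x \<in> cells T" "l \<in> L" for x l
   unfolding \<pi> ea[OF L_carrier[OF that(2)] that(1)] by (rule to_BGS_ltrans[OF smapD(1)[OF e that(1)] L_carrier[OF that(2)]])
 next
  fix y y' th n assume y: "y \<in> cells T" "y' \<in> cells T" "\<pi> y = \<pi> y'" and th: "th \<in> ops n (sdim T y)"
   and o: "opr T th y' \<in> orb a L (opr T th y)"
  obtain l where l: "l \<in> L" "opr T th y' = a l (opr T th y)" using o by blast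
  obtain \<gamma> where \<gamma>: "\<gamma> \<in> carrier \<Gamma>" "e y' = ltrans \<Gamma> \<gamma> (e y)"
   using to_BGS_eqD[OF smapD(1)[OF e y(1)] smapD(1)[OF e y(2)]] y(3) by (auto simp: \<pi>)
  have ey: "e y \<in> cells (EG \<Gamma>)" "sdim (EG \<Gamma>) (e y) = sdim T y" using smapD[OF e y(1)] by auto
  have "sdim T y' = sdim T y" using smapD(2)[OF e y(2)] EA(3)[OF \<gamma>(1) ey(1)] ey(2) \<gamma>(2) by simp
  hence th': "th \<in> ops n (sdim T y')" using th by simp
  have oy: "opr T th y \<in> cells T" using sset_opr[OF T y(1) th] by simp
  have th_e: "th \<in> ops n (sdim (EG \<Gamma>) (e y))" using th ey by simp
  \<comment> \<open>Translation is free, so comparing after applying \<open>th\<close> already shows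
    that the element relating \<open>e y\<close> and \<open>e y'\<close> is \<open>l\<close>, which
    lies in \<open>L\<close>.\<close>
  have "ltrans \<Gamma> \<gamma> (opr (EG \<Gamma>) th (e y)) = ltrans \<Gamma> l (opr (EG \<Gamma>) th (e y))"
   using EA(4)[OF \<gamma>(1) ey(1) th_e] smapD(3)[OF e y(2) th'] smapD(3)[OF e y(1) th] l(2) ea[OF L_carrier[OF l(1)] oy] \<gamma>(2) by metis
  hence \<gamma>l: "\<gamma> = l" using ltrans_inj[OF grp\<Gamma> _ \<gamma>(1) L_carrier[OF l(1)]] sset_opr[OF is_sset_EG ey(1) th_e] by blast
  have aly: "a l y \<in> cells T" using g(2)[OF y(1) L_carrier[OF l(1)]] .
  have "y' = a l y"
  proof (rule inj[OF y(2) aly])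
   show "e y' = e (a l y)" using \<gamma>(2) \<gamma>l ea[OF L_carrier[OF l(1)] y(1)] by simp
   have "c y' = c (a l (opr T th y))" using c(2)[OF y(2) th'] l(2) by simp
   also have "\<dots> = c (a l y)" using c(2)[OF aly, of th n] A(2)[OF L_carrier[OF l(1)] y(1) th] A(1)[OF L_carrier[OF l(1)] y(1)] th by simp
   finally show "c y' = c (a l y)" .
  qed
  thus "y' \<in> orb a L y" using l by blast
 next
  fix x w th n assume x: "x \<in> cells (BGS G m)" and th: "th \<in> ops n (sdim (BGS G m) x)" and w: "w \<in> cells T" "\<pi> w = opr (BGS G m) th x"
  obtain ks where ks: "ks \<in> cells (EG \<Gamma>)" "x = to_BGS G m ks" using to_BGS_surj[OF x] .
  have thk: "th \<in> ops n (sdim (EG \<Gamma>) ks)" using th ks smapD(2)[OF smap_to_BGS ks(1)] by simp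
  have ok: "opr (EG \<Gamma>) th ks \<in> cells (EG \<Gamma>)" using sset_opr[OF is_sset_EG ks(1) thk] by simp
  obtain \<gamma> where \<gamma>: "\<gamma> \<in> carrier \<Gamma>" "e w = ltrans \<Gamma> \<gamma> (opr (EG \<Gamma>) th ks)"
   using to_BGS_eqD[OF ok smapD(1)[OF e w(1)]] w(2) ks(2) smapD(3)[OF smap_to_BGS ks(1) thk] by (auto simp: \<pi>)
  have gk: "ltrans \<Gamma> \<gamma> ks \<in> cells (EG \<Gamma>)" using gactD(2)[OF EA(2) ks(1) \<gamma>(1)] .
  obtain y where y: "y \<in> cells T" "e y = ltrans \<Gamma> \<gamma> ks" "c y = c w" using ex[OF w(1) gk] by blast
  have thy: "th \<in> ops n (sdim T y)" using smapD(2)[OF e y(1)] y(2) EA(3)[OF \<gamma>(1) ks(1)] thk by simp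
  have "opr T th y = w"
  proof (rule inj)
   show "opr T th y \<in> cells T" using sset_opr[OF T y(1) thy] by simp
   show "e (opr T th y) = e w" using smapD(3)[OF e y(1) thy] y(2) EA(4)[OF \<gamma>(1) ks(1) thk] \<gamma>(2) by simp
   show "c (opr T th y) = c w" using c(2)[OF y(1) thy] y(3) by simp
  qed (rule w)
  moreover have "\<pi> y = x" using to_BGS_ltrans[OF ks(1) \<gamma>(1)] y(2) ks(2) by (simp add: \<pi>)
  ultimately show "\<exists>y\<in>cells T. \<pi> y = x \<and> opr T th y = w" using y(1) by blast
 next
  fix x assume x: "x \<in> cells (BGS G m)"
  obtain ks where ks: "ks \<in> cells (EG \<Gamma>)" "x = to_BGS G m ks" using to_BGS_surj[OF x] .
  have "finite {y \<in> cells T. \<pi> y = x}"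
  proof (rule finite_imageD)
   have "(\<lambda>y. (e y, c y)) ` {y \<in> cells T. \<pi> y = x} \<subseteq> (\<lambda>\<gamma>. ltrans \<Gamma> \<gamma> ks) ` carrier \<Gamma> \<times> c ` cells T"
   proof (rule image_subsetI)
    fix y assume "y \<in> {y \<in> cells T. \<pi> y = x}"
    hence y: "y \<in> cells T" "to_BGS G m (e y) = to_BGS G m ks" using ks by (auto simp: \<pi>)
    obtain \<gamma> where "\<gamma> \<in> carrier \<Gamma>" "e y = ltrans \<Gamma> \<gamma> ks" using to_BGS_eqD[OF ks(1) smapD(1)[OF e y(1)] y(2)] .
    thus "(e y, c y) \<in> (\<lambda>\<gamma>. ltrans \<Gamma> \<gamma> ks) ` carrier \<Gamma> \<times> c ` cells T" using y(1) by blast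
   qed
   thus "finite ((\<lambda>y. (e y, c y)) ` {y \<in> cells T. \<pi> y = x})" by (rule finite_subset) (use fin\<Gamma> c(1) in simp)
   show "inj_on (\<lambda>y. (e y, c y)) {y \<in> cells T. \<pi> y = x}" by (rule inj_onI) (use inj in auto)
  qed
  thus "finite (orb a L ` {y \<in> cells T. \<pi> y = x})" by simp
 qed
qed

end

section \<open>The two ideals\<close>

lemma ex_permutes_image:
 assumes "finite X" "A \<subseteq> X" "B \<subseteq> X" "card A = card B"
 obtains p where "p permutes X" "p ` A = B"
proof -
 have "finite A" "finite B" using assms finite_subset by auto
 obtain f where f: "bij_betw f A B" using finite_same_card_bij \<open>finite A\<close> \<open>finite B\<close> assms(4) by blast
 have "card (X - A) = card (X - B)" using assms card_Diff_subset[of A X] card_Diff_subset[of B X] \<open>finite A\<close> \<open>finite B\<close> by simp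
 then obtain g where g: "bij_betw g (X - A) (X - B)" using finite_same_card_bij assms(1) by blast
 define p where "p x = (if x \<in> A then f x else if x \<in> X then g x else x)" for x
 have pA: "bij_betw p A B" using f by (simp add: p_def cong: bij_betw_cong)
 have "bij_betw p (X - A) (X - B)" using g bij_betw_cong[of "X - A" p g] by (simp add: p_def)
 from bij_betw_combine[OF pA this] have "bij_betw p X X" using assms by (simp add: Un_absorb1 Un_Diff_cancel)
 hence "p permutes X" by (rule bij_imp_permutes) (use assms in \<open>auto simp: p_def\<close>)
 thus thesis using that pA by (simp add: bij_betw_def)
qed

context ring
begin

lemma finsum_in_ideal:
 assumes "ideal J R" "finite I" "!!i. i \<in> I ==> t i \<in> J"
 shows "finsum R t I \<in> J"
 using assms(2,3)
proof (induction I rule: finite_induct)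
 interpret J: ideal J R by (rule assms(1))
 case empty
 thus ?case by simp
next
 interpret J: ideal J R by (rule assms(1))
 case (insert i I)
 hence "finsum R t (insert i I) = t i \<oplus> finsum R t I" by (intro finsum_insert) (use J.Icarr in auto)
 thus ?case using J.a_closed insert by simp
qed

text \<open>A finite sum of ideals is an ideal. \<open>I_Tr\<close> is defined as a set of sums of
  transfers, and this applies with the images of the single transfers as summands.\<close>

lemma ideal_finsum:
 assumes I: "finite I" and T: "!!i. i \<in> I ==> ideal (T i) R"
 shows "ideal {finsum R t I | t. \<forall>i\<in>I. t i \<in> T i} R" (is "ideal ?S R")
proof (rule idealI[OF ring_axioms])
 have c: "t \<in> I \<rightarrow> carrier R" if "\<forall>i\<in>I. t i \<in> T i" for t using ideal.Icarr[OF T] that by blast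
 have m: "x \<otimes> a \<in> ?S" "a \<otimes> x \<in> ?S" if a: "a \<in> ?S" and x: "x \<in> carrier R" for a x
 proof -
  obtain t where t: "a = finsum R t I" "\<forall>i\<in>I. t i \<in> T i" using a by blast
  show "x \<otimes> a \<in> ?S" using finsum_rdistr[OF I x c[OF t(2)]] t ideal.I_l_closed[OF T _ x] by auto
  show "a \<otimes> x \<in> ?S" using finsum_ldistr[OF I x c[OF t(2)]] t ideal.I_r_closed[OF T _ x] by auto
 qed
 thus "!!a x. a \<in> ?S ==> x \<in> carrier R ==> x \<otimes> a \<in> ?S" "!!a x. a \<in> ?S ==> x \<in> carrier R ==> a \<otimes> x \<in> ?S" by blast+
 show "subgroup ?S (add_monoid R)"
 proof (rule add.subgroupI)
  show S: "?S \<subseteq> carrier R" using c by auto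
  show "?S \<noteq> {}" using additive_subgroup.zero_closed[OF ideal.axioms(1)[OF T]] by (auto intro!: exI[of _ "\<lambda>_. \<zero>"])
  fix a assume a: "a \<in> ?S"
  have "(\<ominus> \<one>) \<otimes> a = \<ominus> a" using l_minus[OF one_closed, of a] l_one[of a] subsetD[OF S a] by (simp only:)
  thus "\<ominus> a \<in> ?S" using m(1)[OF a, of "\<ominus> \<one>"] by simp
  fix b assume b: "b \<in> ?S"
  obtain t where t: "a = finsum R t I" "\<forall>i\<in>I. t i \<in> T i" using a by blast
  obtain u where u: "b = finsum R u I" "\<forall>i\<in>I. u i \<in> T i" using b by blast
  have "a \<oplus> b = finsum R (\<lambda>i. t i \<oplus> u i) I" unfolding t(1) u(1) by (rule finsum_addf[OF c[OF t(2)] c[OF u(2)], symmetric])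
  moreover have "\<forall>i\<in>I. t i \<oplus> u i \<in> T i" using t(2) u(2) additive_subgroup.a_closed[OF ideal.axioms(1)[OF T]] by blast
  ultimately show "a \<oplus> b \<in> ?S" by blast
 qed
qed

end

context cover_base
begin

lemma subgroup_young: "subgroup (young G m i) \<Gamma>"
proof -
 interpret S: group "sym_group m" by (rule sym_group_is_group)
 have "subgroup {\<sigma> \<in> carrier (sym_group m). \<sigma> ` {1..i} = {1..i}} (sym_group m)"
 proof (rule S.subgroupI)
  fix \<sigma> assume s: "\<sigma> \<in> {\<sigma> \<in> carrier (sym_group m). \<sigma> ` {1..i} = {1..i}}"
  hence p: "\<sigma> permutes {1..m}" by (simp add: in_sym_group)
  have "pinv \<sigma> ` \<sigma> ` {1..i} = {1..i}" using permutes_inverses(2)[OF p] by (simp add: image_image)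
  thus "inv\<^bsub>sym_group m\<^esub> \<sigma> \<in> {\<sigma> \<in> carrier (sym_group m). \<sigma> ` {1..i} = {1..i}}"
   using s permutes_inv[OF p] by (simp add: sym_group_inv_equality in_sym_group)
  fix tau assume t: "tau \<in> {\<sigma> \<in> carrier (sym_group m). \<sigma> ` {1..i} = {1..i}}"
  hence "(\<sigma> \<circ> tau) ` {1..i} = {1..i}" using s unfolding image_comp[symmetric] by simp
  thus "\<sigma> \<otimes>\<^bsub>sym_group m\<^esub> tau \<in> {\<sigma> \<in> carrier (sym_group m). \<sigma> ` {1..i} = {1..i}}"
   using s t by (simp add: sym_group_def permutes_compose)
 next
  show "{\<sigma> \<in> carrier (sym_group m). \<sigma> ` {1..i} = {1..i}} \<noteq> {}" by (auto simp: in_sym_group intro!: exI[of _ id] permutes_id)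
 qed auto
 thus ?thesis unfolding young_def
  by (intro DirProd_subgroups[OF grpG group.subgroup_self[OF grpG] sym_group_is_group])
qed

sublocale qY: quotient \<Gamma> "EG \<Gamma>" "ltrans \<Gamma>" "young G m i" for i
 by (rule quotient.intro[OF grp\<Gamma> sact_EG[OF grp\<Gamma>] subgroup_young])

lemma young_cover:
 "finite_cover (BG_sub \<Gamma> (young G m i)) (BGS G m) (\<lambda>O'. the_elem (to_BGS G m ` O'))"
 unfolding BG_sub_def
proof (rule cover_BGS[OF sact_EG[OF grp\<Gamma>] subgroup_young, where e = "\<lambda>y. y" and c = "\<lambda>_. ()"])
 show "smap (EG \<Gamma>) (EG \<Gamma>) (\<lambda>y. y)" by (rule smapI) auto
qed (auto intro: finite_subset[of _ UNIV])

end

section \<open>Nondiagonal tuples and the equivariant choice of a block of indices\<close>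

locale Z_base = cover_base G m for G :: "('g, 'b) monoid_scheme" and m +
 fixes H :: "'g set"
 assumes m: "m \<ge> 1" and normal: "H \<lhd> G" and coprime: "coprime m (order (G Mod H))"
begin

definition "W = coset_tuples G H m - coset_diagonal G H m"

lemma sub_H: "H \<subseteq> carrier G"
 using normal by (simp add: normal_def subgroup.subset)

lemma gact_tuples: "gact \<Gamma> (coset_tuples G H m) (tuple_action G m)"
 unfolding gact_def
proof (intro ballI conjI)
 interpret group G by (rule grpG)
 fix x assume x: "x \<in> coset_tuples G H m"
 hence xe: "x \<in> extensional {1..m}" by (auto simp: coset_tuples_def PiE_def)
 have xi: "\<exists>a\<in>carrier G. x i = a <#\<^bsub>G\<^esub> H" "x i \<subseteq> carrier G" if "i \<in> {1..m}" for i
 proof -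
  show 1: "\<exists>a\<in>carrier G. x i = a <#\<^bsub>G\<^esub> H" using PiE_mem[OF x[unfolded coset_tuples_def] that] by blast
  show "x i \<subseteq> carrier G" using 1 l_coset_subset_G[OF sub_H] by auto
 qed
 show "tuple_action G m \<one>\<^bsub>\<Gamma>\<^esub> x = x"
 proof (rule extensionalityI[OF _ xe])
  show "tuple_action G m \<one>\<^bsub>\<Gamma>\<^esub> x i = x i" if "i \<in> {1..m}" for i
   using that lcos_mult_one[OF xi(2)[OF that]] by (simp add: tuple_action_def DirProd_def sym_group_def)
 qed (simp add: tuple_action_def DirProd_def)
 fix \<gamma> assume "\<gamma> \<in> carrier \<Gamma>"
 then obtain g \<sigma> where \<gamma>: "\<gamma> = (g, \<sigma>)" "g \<in> carrier G" "\<sigma> permutes {1..m}" by (auto simp: DirProd_def in_sym_group)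
 have si: "pinv \<sigma> i \<in> {1..m}" if "i \<in> {1..m}" for i using permutes_in_image[OF permutes_inv[OF \<gamma>(3)]] that by simp
 show "tuple_action G m \<gamma> x \<in> coset_tuples G H m"
  unfolding coset_tuples_def tuple_action_def \<gamma>(1) prod.case
 proof (rule restrict_PiE_iff[THEN iffD2, rule_format])
  fix i assume "i \<in> {1..m}"
  then obtain a where "a \<in> carrier G" "x (pinv \<sigma> i) = a <#\<^bsub>G\<^esub> H" using xi(1)[OF si] by blast
  thus "g <#\<^bsub>G\<^esub> x (pinv \<sigma> i) \<in> {g <#\<^bsub>G\<^esub> H |g. g \<in> carrier G}" using lcos_m_assoc[OF sub_H \<gamma>(2)] \<gamma>(2) by auto
 qed
 fix \<delta> assume "\<delta> \<in> carrier \<Gamma>"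
 then obtain h tau where \<delta>: "\<delta> = (h, tau)" "h \<in> carrier G" "tau permutes {1..m}" by (auto simp: DirProd_def in_sym_group)
 have "pinv (tau \<circ> \<sigma>) i = pinv \<sigma> (pinv tau i)" for i using o_inv_distrib[OF permutes_bij[OF \<delta>(3)] permutes_bij[OF \<gamma>(3)]] by simp
 moreover have "pinv tau i \<in> {1..m}" if "i \<in> {1..m}" for i using permutes_in_image[OF permutes_inv[OF \<delta>(3)]] that by simp
 moreover have "(h \<otimes>\<^bsub>G\<^esub> g) <#\<^bsub>G\<^esub> x j = h <#\<^bsub>G\<^esub> (g <#\<^bsub>G\<^esub> x j)" if "j \<in> {1..m}" for j
  using lcos_m_assoc[OF xi(2)[OF that] \<delta>(2) \<gamma>(2)] by simp
 ultimately show "tuple_action G m (\<delta> \<otimes>\<^bsub>\<Gamma>\<^esub> \<gamma>) x = tuple_action G m \<delta> (tuple_action G m \<gamma> x)"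
  using si by (auto simp: tuple_action_def \<gamma>(1) \<delta>(1) DirProd_def sym_group_def intro!: restrict_ext)
qed

lemma diagonal_closed:
 assumes "x \<in> coset_diagonal G H m" "\<gamma> \<in> carrier \<Gamma>"
 shows "tuple_action G m \<gamma> x \<in> coset_diagonal G H m"
proof -
 interpret group G by (rule grpG)
 obtain a where a: "a \<in> carrier G" "x = (\<lambda>i\<in>{1..m}. a <#\<^bsub>G\<^esub> H)" using assms(1) by (auto simp: coset_diagonal_def)
 obtain g \<sigma> where \<gamma>: "\<gamma> = (g, \<sigma>)" "g \<in> carrier G" "\<sigma> permutes {1..m}" using assms(2) by (auto simp: DirProd_def in_sym_group)
 have "pinv \<sigma> i \<in> {1..m}" if "i \<in> {1..m}" for i using permutes_in_image[OF permutes_inv[OF \<gamma>(3)]] that by simp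
 hence "tuple_action G m \<gamma> x = (\<lambda>i\<in>{1..m}. (g \<otimes>\<^bsub>G\<^esub> a) <#\<^bsub>G\<^esub> H)"
  using lcos_m_assoc[OF sub_H \<gamma>(2) a(1)] by (auto simp: tuple_action_def \<gamma>(1) a(2) intro!: restrict_ext)
 thus ?thesis using a(1) \<gamma>(2) by (auto simp: coset_diagonal_def)
qed

lemma gact_W: "gact \<Gamma> W (tuple_action G m)"
 unfolding gact_def
proof (intro ballI conjI)
 interpret \<Gamma>: group \<Gamma> by (rule grp\<Gamma>)
 note A = gactD[OF gact_tuples]
 fix x assume "x \<in> W"
 hence x: "x \<in> coset_tuples G H m" "x \<notin> coset_diagonal G H m" by (auto simp: W_def)
 show "tuple_action G m \<one>\<^bsub>\<Gamma>\<^esub> x = x" by (rule A(1)[OF x(1)])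
 fix \<gamma> assume \<gamma>: "\<gamma> \<in> carrier \<Gamma>"
 have "tuple_action G m (inv\<^bsub>\<Gamma>\<^esub> \<gamma>) (tuple_action G m \<gamma> x) = x"
  using A(3)[OF x(1) \<gamma> \<Gamma>.inv_closed[OF \<gamma>]] A(1)[OF x(1)] \<Gamma>.l_inv[OF \<gamma>] by simp
 thus "tuple_action G m \<gamma> x \<in> W"
  using diagonal_closed[OF _ \<Gamma>.inv_closed[OF \<gamma>], of "tuple_action G m \<gamma> x"] A(2)[OF x(1) \<gamma>] x(2) by (auto simp: W_def)
 show "tuple_action G m (\<delta> \<otimes>\<^bsub>\<Gamma>\<^esub> \<gamma>) x = tuple_action G m \<delta> (tuple_action G m \<gamma> x)" if "\<delta> \<in> carrier \<Gamma>" for \<delta>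
  by (rule A(3)[OF x(1) \<gamma> that])
qed

text \<open>
 If the stabiliser of a tuple is transitive on the indices, then all cosets that occur have the same
 multiplicity, and they form one orbit of a subgroup of \<open>G/H\<close>. Their number divides both \<open>m\<close> and the
 order of \<open>G/H\<close>.
\<close>

lemma transitive_imp_diagonal:
 assumes w: "w \<in> coset_tuples G H m"
  and trans: "!!j. j \<in> {1..m} ==> \<exists>g\<in>carrier G. \<exists>\<sigma>. \<sigma> permutes {1..m} \<and> tuple_action G m (g, \<sigma>) w = w \<and> \<sigma> 1 = j"
 shows "w \<in> coset_diagonal G H m"
proof -
 interpret group G by (rule grpG)
 interpret N: normal H G by (rule normal)
 interpret Q: group "G Mod H" by (rule N.factorgroup_is_group)
 have Qc: "carrier (G Mod H) = {g <#\<^bsub>G\<^esub> H |g. g \<in> carrier G}"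
  using N.coset_eq by (auto simp: carrier_FactGroup)
 have finQ: "finite (carrier (G Mod H))" using finG by (simp add: carrier_FactGroup)
 \<comment> \<open>By normality, translating a coset by \<open>g\<close> is multiplication in the
   quotient group by the class of \<open>g\<close>; this makes Lagrange's theorem available.\<close>
 have act: "g <#\<^bsub>G\<^esub> q = (g <#\<^bsub>G\<^esub> H) \<otimes>\<^bsub>G Mod H\<^esub> q" if g: "g \<in> carrier G" and q: "q \<in> carrier (G Mod H)" for g q
 proof -
  obtain a where a: "a \<in> carrier G" "q = a <#\<^bsub>G\<^esub> H" using q Qc by auto
  have e: "x <#\<^bsub>G\<^esub> H = H #>\<^bsub>G\<^esub> x" if "x \<in> carrier G" for x using N.coset_eq that by simp
  have "g <#\<^bsub>G\<^esub> q = (g \<otimes>\<^bsub>G\<^esub> a) <#\<^bsub>G\<^esub> H" using lcos_m_assoc[OF sub_H g a(1)] a(2) by simp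
  thus ?thesis using N.rcos_sum[OF g a(1)] a g by (simp add: e)
 qed
 define A where "A = w ` {1..m}"
 have wQ: "w i \<in> carrier (G Mod H)" if "i \<in> {1..m}" for i
  using PiE_mem[OF w[unfolded coset_tuples_def] that] Qc by simp
 have AQ: "A \<subseteq> carrier (G Mod H)" using wQ by (auto simp: A_def)
 have finA: "finite A" by (simp add: A_def)
 have one: "1 \<in> {1..m}" using m by simp
 \<comment> \<open>All classes that multiply the set of occurring cosets into itself. As that set is
   finite and cancellation holds, they permute it and form a subgroup.\<close>
 define S where "S = {s \<in> carrier (G Mod H). \<forall>x\<in>A. s \<otimes>\<^bsub>G Mod H\<^esub> x \<in> A}"
 have cancel: "x = y" if "s \<otimes>\<^bsub>G Mod H\<^esub> x = s \<otimes>\<^bsub>G Mod H\<^esub> y" "s \<in> carrier (G Mod H)" "x \<in> carrier (G Mod H)" "y \<in> carrier (G Mod H)" for s x y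
  using that Q.Units_l_cancel[of s x y] Q.Units_eq by (simp del: mult_FactGroup)
 have inj: "inj_on (\<lambda>x. s \<otimes>\<^bsub>G Mod H\<^esub> x) A" if "s \<in> S" for s
  by (rule inj_onI, rule cancel[of s]) (use that AQ in \<open>auto simp: S_def\<close>)
 have sub: "subgroup S (G Mod H)"
 proof (rule Q.subgroupI)
  show "S \<subseteq> carrier (G Mod H)" by (auto simp: S_def)
  have "\<one>\<^bsub>G Mod H\<^esub> \<in> S" unfolding S_def using Q.l_one Q.one_closed AQ by (simp add: subset_iff del: one_FactGroup mult_FactGroup)
  thus "S \<noteq> {}" by blast
  fix s assume s: "s \<in> S"
  hence sQ: "s \<in> carrier (G Mod H)" by (simp add: S_def)
  have "(\<lambda>x. s \<otimes>\<^bsub>G Mod H\<^esub> x) ` A = A" by (rule endo_inj_surj[OF finA _ inj[OF s]]) (use s in \<open>auto simp: S_def\<close>)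
  hence "inv\<^bsub>G Mod H\<^esub> s \<otimes>\<^bsub>G Mod H\<^esub> x \<in> A" if "x \<in> A" for x
  proof -
   obtain y where y: "y \<in> A" "x = s \<otimes>\<^bsub>G Mod H\<^esub> y" using \<open>_ ` A = A\<close> \<open>x \<in> A\<close> by blast
   have "inv\<^bsub>G Mod H\<^esub> s \<otimes>\<^bsub>G Mod H\<^esub> x = y"
    using Q.inv_solve_left'[of y s x] y sQ AQ by (auto simp del: mult_FactGroup)
   thus ?thesis using y by simp
  qed
  thus "inv\<^bsub>G Mod H\<^esub> s \<in> S" using Q.inv_closed[OF sQ] by (simp add: S_def)
  fix t assume t: "t \<in> S"
  hence tQ: "t \<in> carrier (G Mod H)" by (simp add: S_def)
  have "(s \<otimes>\<^bsub>G Mod H\<^esub> t) \<otimes>\<^bsub>G Mod H\<^esub> x \<in> A" if "x \<in> A" for x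
   using Q.m_assoc[OF sQ tQ, of x] AQ that s t by (auto simp: S_def simp del: mult_FactGroup)
  thus "s \<otimes>\<^bsub>G Mod H\<^esub> t \<in> S" using Q.m_closed[OF sQ tQ] by (simp add: S_def)
 qed
 have move: "w (\<sigma> i) = (g <#\<^bsub>G\<^esub> H) \<otimes>\<^bsub>G Mod H\<^esub> w i"
  if g: "g \<in> carrier G" "\<sigma> permutes {1..m}" "tuple_action G m (g, \<sigma>) w = w" and i: "i \<in> {1..m}" for g \<sigma> i
 proof -
  have "\<sigma> i \<in> {1..m}" using permutes_in_image[OF g(2)] i by simp
  hence "w (\<sigma> i) = g <#\<^bsub>G\<^esub> w i" using fun_cong[OF g(3), of "\<sigma> i"] permutes_inverses(2)[OF g(2)] by (simp add: tuple_action_def)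
  thus ?thesis using act[OF g(1) wQ[OF i]] by simp
 qed
 have inS: "(g <#\<^bsub>G\<^esub> H) \<in> S"
  if g: "g \<in> carrier G" "\<sigma> permutes {1..m}" "tuple_action G m (g, \<sigma>) w = w" for g \<sigma>
 proof -
  have "(g <#\<^bsub>G\<^esub> H) \<otimes>\<^bsub>G Mod H\<^esub> w i \<in> A" if "i \<in> {1..m}" for i
  proof -
   have "\<sigma> i \<in> {1..m}" using permutes_in_image[OF g(2)] that by simp
   hence "w (\<sigma> i) \<in> A" unfolding A_def by (rule imageI)
   thus ?thesis using move[OF g that] by simp
  qed
  thus ?thesis using g(1) Qc by (auto simp: S_def A_def)
 qed
 \<comment> \<open>An element of the stabiliser taking index 1 to \<open>j\<close> has its class in
   \<open>S\<close>, and that class multiplies \<open>w 1\<close> to \<open>w j\<close>. So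
   transitivity gives every occurring coset, and there are as many as elements of
   \<open>S\<close>.\<close>
 have "A = (\<lambda>s. s \<otimes>\<^bsub>G Mod H\<^esub> w 1) ` S"
 proof
  show "(\<lambda>s. s \<otimes>\<^bsub>G Mod H\<^esub> w 1) ` S \<subseteq> A" using one by (auto simp: S_def A_def)
  show "A \<subseteq> (\<lambda>s. s \<otimes>\<^bsub>G Mod H\<^esub> w 1) ` S"
  proof
   fix x assume "x \<in> A"
   then obtain j where j: "j \<in> {1..m}" "x = w j" by (auto simp: A_def)
   obtain g \<sigma> where g: "g \<in> carrier G" "\<sigma> permutes {1..m}" "tuple_action G m (g, \<sigma>) w = w" "\<sigma> 1 = j" using trans[OF j(1)] by blast
   thus "x \<in> (\<lambda>s. s \<otimes>\<^bsub>G Mod H\<^esub> w 1) ` S" using move[OF g(1-3) one] inS[OF g(1-3)] j(2) by auto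
  qed
 qed
 moreover have "inj_on (\<lambda>s. s \<otimes>\<^bsub>G Mod H\<^esub> w 1) S"
  using Q.right_cancel[OF wQ[OF one]] by (auto simp: inj_on_def S_def)
 ultimately have cA: "card A = card S" by (simp add: card_image)
 have "card S dvd order (G Mod H)" using Q.lagrange[OF sub] by (metis dvd_triv_right)
 moreover have "card A dvd m"
 proof -
  \<comment> \<open>The permutation taking 1 to \<open>j\<close> carries the indices with value
    \<open>w 1\<close> onto those with value \<open>w j\<close>. Equal multiplicities then make the
    number of cosets a divisor of \<open>m\<close>.\<close>
  have "card {i \<in> {1..m}. w i = x} = card {i \<in> {1..m}. w i = w 1}" if x: "x \<in> A" for x
  proof -
   obtain j where j: "j \<in> {1..m}" "x = w j" using x by (auto simp: A_def)
   obtain g \<sigma> where g: "g \<in> carrier G" "\<sigma> permutes {1..m}" "tuple_action G m (g, \<sigma>) w = w" "\<sigma> 1 = j" using trans[OF j(1)] by blast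
   note mv = move[OF g(1-3)]
   have gQ: "g <#\<^bsub>G\<^esub> H \<in> carrier (G Mod H)" using g(1) Qc by blast
   have "\<sigma> ` {i \<in> {1..m}. w i = w 1} = {i \<in> {1..m}. w i = x}"
   proof (intro equalityI subsetI)
    fix i assume "i \<in> \<sigma> ` {i \<in> {1..m}. w i = w 1}"
    then obtain k where k: "k \<in> {1..m}" "w k = w 1" "i = \<sigma> k" by blast
    thus "i \<in> {i \<in> {1..m}. w i = x}" using mv[OF k(1)] mv[OF one] permutes_in_image[OF g(2)] j g(4) by simp
   next
    fix i assume "i \<in> {i \<in> {1..m}. w i = x}"
    hence i: "i \<in> {1..m}" "w i = w j" using j by auto
    have k: "pinv \<sigma> i \<in> {1..m}" "\<sigma> (pinv \<sigma> i) = i"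
     using permutes_in_image[OF permutes_inv[OF g(2)]] i(1) permutes_inverses(1)[OF g(2)] by auto
    have "w (pinv \<sigma> i) = w 1"
     using cancel[OF _ gQ wQ[OF k(1)] wQ[OF one]] mv[OF k(1)] mv[OF one] i(2) g(4) k(2) by simp
    thus "i \<in> \<sigma> ` {i \<in> {1..m}. w i = w 1}" using k by (intro image_eqI[of _ _ "pinv \<sigma> i"]) auto
   qed
   thus ?thesis using card_image[OF inj_on_subset[OF permutes_inj[OF g(2)] subset_UNIV]] by metis
  qed
  moreover have "card {1..m} = (\<Sum>x\<in>A. card {i \<in> {1..m}. w i = x})"
   using sum.image_gen[of "{1..m}" "\<lambda>_. 1 :: nat" w] by (simp add: A_def)
  ultimately have "m = card A * card {i \<in> {1..m}. w i = w 1}" by simp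
  thus ?thesis by (metis dvd_triv_left)
 qed
 ultimately have "is_unit (card A)" using coprime_common_divisor[OF coprime] cA by metis
 hence "card A = 1" by simp
 then obtain q where q: "A = {q}" by (rule card_1_singletonE)
 hence wq: "w i = q" if "i \<in> {1..m}" for i using that unfolding A_def by blast
 hence "w i = w 1" if "i \<in> {1..m}" for i using wq[OF that] wq[OF one] by simp
 moreover obtain a where "a \<in> carrier G" "w 1 = a <#\<^bsub>G\<^esub> H" using wQ[OF one] Qc by auto
 moreover have "w \<in> extensional {1..m}" using w by (auto simp: coset_tuples_def PiE_def)
 ultimately have "w = (\<lambda>i\<in>{1..m}. a <#\<^bsub>G\<^esub> H)" by (intro extensionalityI[of _ "{1..m}"]) auto
 thus ?thesis using \<open>a \<in> carrier G\<close> by (auto simp: coset_diagonal_def)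
qed

text \<open>The choice depends on the orbit as a set only, hence is the same for all tuples in one
  orbit; this is what makes \<open>block\<close> equivariant.\<close>

definition "rep w = (SOME w'. w' \<in> orb (tuple_action G m) (carrier \<Gamma>) w)"

text \<open>
 The orbit of the index \<open>1\<close> under the stabiliser, transported from a representative of the orbit of
 \<open>w\<close> so as to be equivariant in \<open>w\<close>.
\<close>

definition "block w = {\<sigma> 1 | g \<sigma>. (g, \<sigma>) \<in> carrier \<Gamma> \<and> tuple_action G m (g, \<sigma>) (rep w) = w}"

lemma
 assumes w: "w \<in> W"
 shows rep_W: "rep w \<in> W" and rep_ex: "\<exists>\<gamma>\<in>carrier \<Gamma>. tuple_action G m \<gamma> (rep w) = w"
proof -
 interpret \<Gamma>: group \<Gamma> by (rule grp\<Gamma>)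
 have "rep w \<in> orb (tuple_action G m) (carrier \<Gamma>) w"
  unfolding rep_def by (rule someI[of "\<lambda>w'. w' \<in> orb (tuple_action G m) (carrier \<Gamma>) w", OF orb_self[OF gact_W \<Gamma>.subgroup_self w]])
 then obtain \<gamma> where \<gamma>: "\<gamma> \<in> carrier \<Gamma>" "rep w = tuple_action G m \<gamma> w" by blast
 show "rep w \<in> W" using gactD(2)[OF gact_W w \<gamma>(1)] \<gamma>(2) by simp
 have "tuple_action G m (inv\<^bsub>\<Gamma>\<^esub> \<gamma>) (rep w) = w"
  using gactD(3)[OF gact_W w \<gamma>(1) \<Gamma>.inv_closed[OF \<gamma>(1)]] gactD(1)[OF gact_W w] \<Gamma>.l_inv[OF \<gamma>(1)] \<gamma>(2) by simp
 thus "\<exists>\<gamma>\<in>carrier \<Gamma>. tuple_action G m \<gamma> (rep w) = w" using \<Gamma>.inv_closed[OF \<gamma>(1)] by blast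
qed

text \<open>A tuple and its translate have the same representative, and the elements carrying it to
  the translate are those carrying it to \<open>w\<close> followed by
  \<open>(g, \<sigma>)\<close>.\<close>

lemma block_equivariant:
 assumes w: "w \<in> W" and g: "(g, \<sigma>) \<in> carrier \<Gamma>"
 shows "block (tuple_action G m (g, \<sigma>) w) = \<sigma> ` block w"
proof -
 interpret \<Gamma>: group \<Gamma> by (rule grp\<Gamma>)
 note A = gactD[OF gact_W]
 let ?w = "tuple_action G m (g, \<sigma>) w"
 have r: "rep ?w = rep w" unfolding rep_def using orb_eq[OF grp\<Gamma> gact_W \<Gamma>.subgroup_self w g] by simp
 have \<sigma>: "\<sigma> permutes {1..m}" "g \<in> carrier G" using g by (auto simp: DirProd_def in_sym_group)
 note rw = rep_W[OF w]
 show ?thesis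
 proof (intro equalityI subsetI)
  fix j assume "j \<in> block ?w"
  then obtain h tau where h: "j = tau 1" "(h, tau) \<in> carrier \<Gamma>" "tuple_action G m (h, tau) (rep w) = ?w" unfolding block_def r by blast
  define \<delta> where "\<delta> = inv\<^bsub>\<Gamma>\<^esub> (g, \<sigma>) \<otimes>\<^bsub>\<Gamma>\<^esub> (h, tau)"
  have d: "\<delta> \<in> carrier \<Gamma>" unfolding \<delta>_def by (rule \<Gamma>.m_closed[OF \<Gamma>.inv_closed[OF g] h(2)])
  have "tuple_action G m \<delta> (rep w) = tuple_action G m (inv\<^bsub>\<Gamma>\<^esub> (g, \<sigma>)) ?w"
   unfolding \<delta>_def using A(3)[OF rw h(2) \<Gamma>.inv_closed[OF g]] h(3) by simp
  also have "\<dots> = w" using A(3)[OF w g \<Gamma>.inv_closed[OF g]] A(1)[OF w] \<Gamma>.l_inv[OF g] by simp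
  finally have "snd \<delta> 1 \<in> block w" unfolding block_def using d by (cases \<delta>) auto
  moreover have "snd \<delta> = pinv \<sigma> \<circ> tau"
   using \<sigma> unfolding \<delta>_def inv_DirProd[OF grpG sym_group_is_group \<sigma>(2) in_sym_group[THEN iffD2, OF \<sigma>(1)]]
   by (simp add: DirProd_def sym_group_inv_equality in_sym_group) (simp add: sym_group_def)
  ultimately show "j \<in> \<sigma> ` block w" using h(1) permutes_inverses(1)[OF \<sigma>(1), of j] by (intro image_eqI[of _ _ "snd \<delta> 1"]) auto
 next
  fix j assume "j \<in> \<sigma> ` block w"
  then obtain h tau where h: "j = \<sigma> (tau 1)" "(h, tau) \<in> carrier \<Gamma>" "tuple_action G m (h, tau) (rep w) = w" unfolding block_def by blast
  have "tuple_action G m ((g, \<sigma>) \<otimes>\<^bsub>\<Gamma>\<^esub> (h, tau)) (rep w) = ?w" using A(3)[OF rw h(2) g] h(3) by simp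
  moreover have "(g, \<sigma>) \<otimes>\<^bsub>\<Gamma>\<^esub> (h, tau) = (g \<otimes>\<^bsub>G\<^esub> h, \<sigma> \<circ> tau)" by (simp add: DirProd_def sym_group_def)
  moreover have "(g, \<sigma>) \<otimes>\<^bsub>\<Gamma>\<^esub> (h, tau) \<in> carrier \<Gamma>" by (rule \<Gamma>.m_closed[OF g h(2)])
  ultimately have "tuple_action G m (g \<otimes>\<^bsub>G\<^esub> h, \<sigma> \<circ> tau) (rep w) = ?w" "(g \<otimes>\<^bsub>G\<^esub> h, \<sigma> \<circ> tau) \<in> carrier \<Gamma>" by simp_all
  thus "j \<in> block ?w" unfolding block_def r mem_Collect_eq using h(1)
   by (intro exI[of _ "g \<otimes>\<^bsub>G\<^esub> h"] exI[of _ "\<sigma> \<circ> tau"]) (simp del: carrier_DirProd)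
 qed
qed

text \<open>If the block were everything, the elements carrying the representative to
  \<open>w\<close> would move 1 to every index. Composed with the inverse of one that fixes 1, they
  would make the stabiliser of \<open>w\<close> transitive, so that \<open>w\<close> would be
  diagonal.\<close>

lemma block_proper:
 assumes w: "w \<in> W"
 shows "block w \<subseteq> {1..m}" "card (block w) \<in> {1..<m}"
proof -
 interpret \<Gamma>: group \<Gamma> by (rule grp\<Gamma>)
 note A = gactD[OF gact_W]
 have one: "1 \<in> {1..m}" using m by simp
 have car: "\<sigma> permutes {1..m} \<and> g \<in> carrier G" if "(g, \<sigma>) \<in> carrier \<Gamma>" for g \<sigma> using that by (auto simp: DirProd_def in_sym_group)
 show sub: "block w \<subseteq> {1..m}" using car permutes_in_image one unfolding block_def by fastforce
 have ne: "block w \<noteq> {}" using rep_ex[OF w] unfolding block_def by fastforce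
 have "block w \<noteq> {1..m}"
 proof
  assume full: "block w = {1..m}"
  note rw = rep_W[OF w]
  have "1 \<in> block w" using full one by simp
  then obtain g0 \<sigma>0 where g0: "(g0, \<sigma>0) \<in> carrier \<Gamma>" "tuple_action G m (g0, \<sigma>0) (rep w) = w" "\<sigma>0 1 = 1"
   unfolding block_def by auto
  have bk: "tuple_action G m (inv\<^bsub>\<Gamma>\<^esub> (g0, \<sigma>0)) w = rep w"
   using A(3)[OF rw g0(1) \<Gamma>.inv_closed[OF g0(1)]] A(1)[OF rw] \<Gamma>.l_inv[OF g0(1)] g0(2) by simp
  have "w \<in> coset_diagonal G H m"
  proof (rule transitive_imp_diagonal)
   show "w \<in> coset_tuples G H m" using w by (simp add: W_def)
   fix j assume "j \<in> {1..m}"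
   hence "j \<in> block w" using full by simp
   then obtain h tau where h: "j = tau 1" "(h, tau) \<in> carrier \<Gamma>" "tuple_action G m (h, tau) (rep w) = w" unfolding block_def by blast
   define \<delta> where "\<delta> = (h, tau) \<otimes>\<^bsub>\<Gamma>\<^esub> inv\<^bsub>\<Gamma>\<^esub> (g0, \<sigma>0)"
   have d: "\<delta> \<in> carrier \<Gamma>" unfolding \<delta>_def by (rule \<Gamma>.m_closed[OF h(2) \<Gamma>.inv_closed[OF g0(1)]])
   have dw: "tuple_action G m \<delta> w = w" unfolding \<delta>_def using A(3)[OF w \<Gamma>.inv_closed[OF g0(1)] h(2)] bk h(3) by simp
   have "snd \<delta> = tau \<circ> pinv \<sigma>0"
    using conjunct1[OF car[OF g0(1)]]
    unfolding \<delta>_def inv_DirProd[OF grpG sym_group_is_group conjunct2[OF car[OF g0(1)]] in_sym_group[THEN iffD2, OF conjunct1[OF car[OF g0(1)]]]]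
    by (simp add: DirProd_def sym_group_inv_equality in_sym_group) (simp add: sym_group_def)
   hence "snd \<delta> 1 = j" using permutes_inverses(2)[OF conjunct1[OF car[OF g0(1)]], of 1] g0(3) h(1) by simp
   thus "\<exists>g\<in>carrier G. \<exists>\<sigma>. \<sigma> permutes {1..m} \<and> tuple_action G m (g, \<sigma>) w = w \<and> \<sigma> 1 = j"
    using car[of "fst \<delta>" "snd \<delta>"] d dw by (intro bexI[of _ "fst \<delta>"] exI[of _ "snd \<delta>"]) auto
  qed
  thus False using w by (simp add: W_def)
 qed
 thus "card (block w) \<in> {1..<m}" using psubset_card_mono[of "{1..m}" "block w"] sub ne card_gt_0_iff[of "block w"] finite_subset[OF sub] by auto
qed

end

section \<open>The map from a part of \<open>Z\<close> to the cover of a Young subgroup\<close>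

context Z_base
begin

abbreviation "T \<equiv> sprod_disc (EG \<Gamma>) W"
abbreviation "aT \<equiv> \<lambda>g (gs, w). (ltrans \<Gamma> g gs, tuple_action G m g w)"
abbreviation "Z \<equiv> Z_space G H m"
abbreviation "pZ \<equiv> \<lambda>O'. the_elem ((\<lambda>(ks, x). to_BGS G m ks) ` O')"
abbreviation "pY \<equiv> \<lambda>O'. the_elem (to_BGS G m ` O')"

lemma Z_def: "Z = quot T aT (carrier \<Gamma>)"
 by (simp add: Z_space_def homotopy_orbits_def W_def)

lemma sact_T: "sact \<Gamma> T aT"
 by (rule sact_disc[OF sact_EG[OF grp\<Gamma>] gact_W])

sublocale qZ: quotient \<Gamma> T aT "carrier \<Gamma>"
 by (rule quotient.intro[OF grp\<Gamma> sact_T group.subgroup_self[OF grp\<Gamma>]])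

lemma Z_cover: "finite_cover Z (BGS G m) pZ"
 unfolding Z_def
proof (rule cover_BGS[OF sact_T group.subgroup_self[OF grp\<Gamma>], where e = fst and c = snd])
 show "smap T (EG \<Gamma>) fst" by (rule smap_discI) auto
 have "finite {g <#\<^bsub>G\<^esub> H |g. g \<in> carrier G}" using finG by simp
 hence "finite (coset_tuples G H m)" unfolding coset_tuples_def by (intro finite_PiE) auto
 hence "finite W" unfolding W_def by simp
 thus "finite (snd ` cells T)" by (rule finite_subset[rotated]) auto
 show "\<exists>y'\<in>cells T. fst y' = ks \<and> snd y' = snd y" if "y \<in> cells T" "ks \<in> cells (EG \<Gamma>)" for y ks
  using that by (intro bexI[of _ "(ks, snd y)"]) (cases y; auto)+
qed (auto split: prod.splits)

lemma block_orb:
 assumes "(ks, w) \<in> cells T"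
 shows "the_elem ((\<lambda>(ks, w). card (block w)) ` orb aT (carrier \<Gamma>) (ks, w)) = card (block w)"
proof -
 have "card (block (tuple_action G m \<gamma> w)) = card (block w)" if \<gamma>: "\<gamma> \<in> carrier \<Gamma>" for \<gamma>
 proof -
  obtain g \<sigma> where g: "\<gamma> = (g, \<sigma>)" "(g, \<sigma>) \<in> carrier \<Gamma>" using \<gamma> by (cases \<gamma>) simp
  hence "inj \<sigma>" by (auto simp: DirProd_def in_sym_group permutes_inj)
  thus ?thesis using block_equivariant[OF _ g(2), of w] assms g(1) by (simp add: card_image inj_on_subset)
 qed
 thus ?thesis using qZ.the_elem_orb[OF assms, of "\<lambda>(ks, w). card (block w)"] by simp
qed

abbreviation "colour \<equiv> \<lambda>O'. the_elem ((\<lambda>(ks, w). card (block w)) ` O')"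
abbreviation "Zi i \<equiv> part Z (\<lambda>O'. colour O' = i)"

text \<open>The orbit is cut down to its pairs in standard position, with block an initial segment;
  forgetting the tuple leaves an orbit of the Young subgroup. Defining it from the orbit as a set
  avoids a choice of representative.\<close>

definition "to_young i O' = {ks. \<exists>w. (ks, w) \<in> O' \<and> block w = {1..i}}"

text \<open>The block has as many elements as the initial segment, so some permutation takes one to
  the other. By equivariance it brings any representative into standard position.\<close>

lemma cells_Zi:
 assumes "z \<in> cells (Zi i)"
 obtains ks w where "ks \<in> cells (EG \<Gamma>)" "w \<in> W" "z = orb aT (carrier \<Gamma>) (ks, w)" "block w = {1..i}"
proof -
 obtain ks w where k: "(ks, w) \<in> cells T" "z = orb aT (carrier \<Gamma>) (ks, w)" "colour z = i"
  using assms by (auto simp: Z_def cells_quot)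
 hence kw: "ks \<in> cells (EG \<Gamma>)" "w \<in> W" by auto
 have "card (block w) = card {1..i}" "{1..i} \<subseteq> {1..m}" using block_orb[OF k(1)] k(2,3) block_proper(2)[OF kw(2)] by auto
 then obtain \<sigma> where \<sigma>: "\<sigma> permutes {1..m}" "\<sigma> ` block w = {1..i}"
  using ex_permutes_image[OF _ block_proper(1)[OF kw(2)]] by blast
 have g: "(\<one>\<^bsub>G\<^esub>, \<sigma>) \<in> carrier \<Gamma>" using \<sigma>(1) monoid.one_closed[OF group.is_monoid[OF grpG]] by (simp add: DirProd_def in_sym_group)
 let ?y = "aT (\<one>\<^bsub>G\<^esub>, \<sigma>) (ks, w)"
 show thesis
 proof (rule that[of "ltrans \<Gamma> (\<one>\<^bsub>G\<^esub>, \<sigma>) ks" "tuple_action G m (\<one>\<^bsub>G\<^esub>, \<sigma>) w"])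
  show "ltrans \<Gamma> (\<one>\<^bsub>G\<^esub>, \<sigma>) ks \<in> cells (EG \<Gamma>)" by (rule gactD(2)[OF sactD(2)[OF sact_EG[OF grp\<Gamma>]] kw(1) g])
  show "tuple_action G m (\<one>\<^bsub>G\<^esub>, \<sigma>) w \<in> W" by (rule gactD(2)[OF gact_W kw(2) g])
  show "z = orb aT (carrier \<Gamma>) (ltrans \<Gamma> (\<one>\<^bsub>G\<^esub>, \<sigma>) ks, tuple_action G m (\<one>\<^bsub>G\<^esub>, \<sigma>) w)"
   using qZ.orbE[OF imageI[OF g] k(1)] k(2) by simp
  show "block (tuple_action G m (\<one>\<^bsub>G\<^esub>, \<sigma>) w) = {1..i}" using block_equivariant[OF kw(2) g] \<sigma>(2) by simp
 qed
qed

text \<open>Once the block of \<open>w\<close> is the initial segment, equivariance shows that a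
  group element keeps it there precisely if its permutation preserves that segment, that is, if it
  lies in the Young subgroup.\<close>

lemma to_young_orb:
 assumes "ks \<in> cells (EG \<Gamma>)" "w \<in> W" "block w = {1..i}"
 shows "to_young i (orb aT (carrier \<Gamma>) (ks, w)) = orb (ltrans \<Gamma>) (young G m i) ks"
proof (intro equalityI subsetI)
 fix x assume "x \<in> to_young i (orb aT (carrier \<Gamma>) (ks, w))"
 then obtain \<gamma> where \<gamma>: "\<gamma> \<in> carrier \<Gamma>" "x = ltrans \<Gamma> \<gamma> ks" "block (tuple_action G m \<gamma> w) = {1..i}" by (auto simp: to_young_def)
 obtain g \<sigma> where g: "\<gamma> = (g, \<sigma>)" "(g, \<sigma>) \<in> carrier \<Gamma>" using \<gamma>(1) by (cases \<gamma>) simp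
 hence "\<gamma> \<in> young G m i" using block_equivariant[OF assms(2) g(2)] \<gamma>(3) assms(3) by (simp add: young_def DirProd_def)
 thus "x \<in> orb (ltrans \<Gamma>) (young G m i) ks" using \<gamma>(2) by blast
next
 fix x assume "x \<in> orb (ltrans \<Gamma>) (young G m i) ks"
 then obtain g \<sigma> where g: "(g, \<sigma>) \<in> young G m i" "x = ltrans \<Gamma> (g, \<sigma>) ks" by auto
 hence c: "(g, \<sigma>) \<in> carrier \<Gamma>" "\<sigma> ` {1..i} = {1..i}" by (auto simp: young_def DirProd_def)
 have "(x, tuple_action G m (g, \<sigma>) w) \<in> orb aT (carrier \<Gamma>) (ks, w)" using c(1) g(2) by (intro image_eqI[of _ _ "(g, \<sigma>)"]) auto
 moreover have "block (tuple_action G m (g, \<sigma>) w) = {1..i}" using block_equivariant[OF assms(2) c(1)] assms(3) c(2) by simp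
 ultimately show "x \<in> to_young i (orb aT (carrier \<Gamma>) (ks, w))" unfolding to_young_def by blast
qed

lemma colour_opr:
 assumes z: "z \<in> cells Z" and th: "th \<in> ops l (sdim Z z)"
 shows "colour (opr Z th z) = colour z"
proof -
 obtain ks w where k: "(ks, w) \<in> cells T" "z = orb aT (carrier \<Gamma>) (ks, w)" using z by (auto simp: Z_def cells_quot)
 have th': "th \<in> ops l (sdim T (ks, w))" using th qZ.quot_sdim[OF k(1)] k(2) by (simp add: Z_def)
 have o: "(opr (EG \<Gamma>) th ks, w) \<in> cells T" using sset_opr[OF sactD(1)[OF sact_T] k(1) th'] by simp
 show ?thesis using qZ.quot_opr[OF k(1) th'] block_orb[OF k(1)] block_orb[OF o] k(2) by (simp add: Z_def)
qed

lemma
 shows smap_to_young: "smap (Zi i) (BG_sub \<Gamma> (young G m i)) (to_young i)"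
  and pY_to_young: "z \<in> cells (Zi i) ==> pY (to_young i z) = pZ z"
proof -
 let ?Y = "BG_sub \<Gamma> (young G m i)"
 have K: "to_young i z \<in> cells ?Y \<and> sdim ?Y (to_young i z) = sdim Z z \<and> pY (to_young i z) = pZ z \<and>
   (\<forall>l. \<forall>th\<in>ops l (sdim Z z). to_young i (opr Z th z) = opr ?Y th (to_young i z))" if zi: "z \<in> cells (Zi i)" for z
 proof -
  obtain ks w where k: "ks \<in> cells (EG \<Gamma>)" "w \<in> W" "z = orb aT (carrier \<Gamma>) (ks, w)" "block w = {1..i}" using cells_Zi[OF zi] .
  have kT: "(ks, w) \<in> cells T" using k by simp
  note r = to_young_orb[OF k(1,2,4)]
  have "pZ z = to_BGS G m ks"
   unfolding k(3) using qZ.the_elem_orb[OF kT, of "\<lambda>(ks, x). to_BGS G m ks"] to_BGS_ltrans[OF k(1)] by simp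
  moreover have "pY (orb (ltrans \<Gamma>) (young G m i) ks) = to_BGS G m ks"
   by (rule qY.the_elem_orb[OF k(1)]) (use to_BGS_ltrans[OF k(1)] qY.L_carrier in blast)
  moreover have "to_young i (opr Z th z) = opr ?Y th (to_young i z)" if th: "th \<in> ops l (sdim Z z)" for l th
  proof -
   have th': "th \<in> ops l (sdim T (ks, w))" using th qZ.quot_sdim[OF kT] k(3) by (simp add: Z_def)
   hence thk: "th \<in> ops l (sdim (EG \<Gamma>) ks)" by simp
   have o: "opr (EG \<Gamma>) th ks \<in> cells (EG \<Gamma>)" using sset_opr[OF is_sset_EG k(1) thk] by simp
   have "opr Z th z = orb aT (carrier \<Gamma>) (opr (EG \<Gamma>) th ks, w)" using qZ.quot_opr[OF kT th'] k(3) by (simp add: Z_def)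
   thus ?thesis using to_young_orb[OF o k(2,4)] qY.quot_opr[OF k(1) thk, of i] r k(3) by (simp add: BG_sub_def)
  qed
  moreover have "to_young i z \<in> cells ?Y" using r k(1,3) by (simp add: BG_sub_def cells_quot)
  moreover have "sdim ?Y (to_young i z) = sdim Z z"
   using r k(3) qY.quot_sdim[OF k(1), of i] qZ.quot_sdim[OF kT] by (simp add: BG_sub_def Z_def)
  ultimately show ?thesis using r k(3) by simp
 qed
 show "smap (Zi i) ?Y (to_young i)" by (rule smapI) (use K in auto)
 show "pY (to_young i z) = pZ z" if "z \<in> cells (Zi i)" using K[OF that] by blast
qed

end

context E_ring
begin

text \<open>Only closure of \<open>K\<close> under sums and the presence of zero matter besides the
  Young transfers: each colour part contributes a Young transfer of another transfer, and these
  contributions are added up.\<close>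

lemma Z_transfer_in_ideal:
 assumes "Z_base G m H" and K: "ideal K (R (BGS G m))"
  and y: "!!i A. i \<in> {1..<m} ==> A \<in> cohomology E (BG_sub (G \<times>\<times> sym_group m) (young G m i)) ==> young_transfer E G m i A \<in> K"
  and A: "A \<in> cohomology E (Z_space G H m)"
 shows "Z_transfer E G H m A \<in> K"
proof -
 interpret Z_base G m H by (rule assms(1))
 obtain f where f: "smap Z (lev E 0) f" "A = cls Z f" using A by (rule cohomologyE)
 note addK = additive_subgroup.a_closed[OF ideal.axioms(1)[OF K]] additive_subgroup.zero_closed[OF ideal.axioms(1)[OF K]]
 show ?thesis unfolding Z_transfer_def f(2)
 proof (rule transfer_colours[OF _ Z_cover, where I = "{1..<m}" and c = colour])
  show "colour z \<in> {1..<m}" if z: "z \<in> cells Z" for z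
  proof -
   obtain ks w where k: "(ks, w) \<in> cells T" "z = orb aT (carrier \<Gamma>) (ks, w)" using z by (auto simp: Z_def cells_quot)
   show ?thesis unfolding k(2) block_orb[OF k(1)] using block_proper(2)[of w] k(1) by simp
  qed
  show "colour (opr Z th z) = colour z" if "z \<in> cells Z" "th \<in> ops l (sdim Z z)" for z l th
   by (rule colour_opr[OF that])
  show "transfer E (Zi i) (BGS G m) pZ (cls (Zi i) f) \<in> K"
   if i: "i \<in> {1..<m}" and f: "smap (Zi i) (lev E 0) f" for i f
  proof -
   have c: "finite_cover (Zi i) (BGS G m) pZ" by (rule finite_cover_part[OF Z_cover]) (use colour_opr in auto)
   have r: "finite_cover (Zi i) (BG_sub \<Gamma> (young G m i)) (to_young i)"
    by (rule finite_cover_over[OF c young_cover smap_to_young pY_to_young])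
   have "transfer E (Zi i) (BGS G m) pZ (cls (Zi i) f) = transfer E (Zi i) (BGS G m) (\<lambda>z. pY (to_young i z)) (cls (Zi i) f)"
    by (rule transfer_cong[OF pY_to_young[symmetric] finite_coverD(1)[OF c]])
   also have "\<dots> = young_transfer E G m i (transfer E (Zi i) (BG_sub \<Gamma> (young G m i)) (to_young i) (cls (Zi i) f))"
    unfolding young_transfer_def by (rule transfer_comp[OF r young_cover cohomologyI[OF f]])
   also have "\<dots> \<in> K" by (rule y[OF i transfer_closed[OF r cohomologyI[OF f]]])
   finally show ?thesis .
  qed
  show "czero (BGS G m) \<in> K" using addK(2) by simp
  show "cadd (BGS G m) A B \<in> K" if "A \<in> K" "B \<in> K" for A B using addK(1)[OF that] by simp
 qed (use f in auto)
qed

text \<open>The set of sums defining \<open>I_Tr\<close> is an ideal containing all generators of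
  \<open>J_ideal\<close>, by \<open>Z_transfer_in_ideal\<close> for the generators from
  \<open>Z\<close>; conversely such a sum lies in every ideal containing the Young
  transfers.\<close>

lemma ideals_eq:
 assumes Z: "Z_base G m H"
 shows "ideal (I_Tr E \<xi> G m) (R (BGS G m)) \<and> J_ideal E \<xi> G H m = I_Tr E \<xi> G m"
proof -
 interpret Z_base G m H by (rule Z)
 interpret ring "R (BGS G m)" by (rule cohomology_ring[OF is_sset_BGS])
 let ?Y = "\<lambda>i. BG_sub \<Gamma> (young G m i)"
 define T where "T i = young_transfer E G m i ` cohomology E (?Y i)" for i
 have T: "ideal (T i) (R (BGS G m))" for i
  unfolding T_def young_transfer_def[abs_def] by (rule transfer_ideal[OF young_cover])
 note Tc = ideal.Icarr[OF T]
 have I: "I_Tr E \<xi> G m = {finsum (R (BGS G m)) t {1..<m} | t. \<forall>i\<in>{1..<m}. t i \<in> T i}"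
 proof (intro equalityI subsetI)
  fix x assume "x \<in> I_Tr E \<xi> G m"
  then obtain a where a: "x = finsum (R (BGS G m)) (\<lambda>i. young_transfer E G m i (a i)) {1..<m}" "\<forall>i\<in>{1..<m}. a i \<in> cohomology E (?Y i)"
   unfolding I_Tr_def by blast
  thus "x \<in> {finsum (R (BGS G m)) t {1..<m} | t. \<forall>i\<in>{1..<m}. t i \<in> T i}" by (auto simp: T_def)
 next
  fix x assume "x \<in> {finsum (R (BGS G m)) t {1..<m} | t. \<forall>i\<in>{1..<m}. t i \<in> T i}"
  then obtain t where t: "x = finsum (R (BGS G m)) t {1..<m}" "\<forall>i\<in>{1..<m}. t i \<in> T i" by blast
  have "\<forall>i. \<exists>a. i \<in> {1..<m} --> a \<in> cohomology E (?Y i) \<and> t i = young_transfer E G m i a" using t(2) by (auto simp: T_def)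
  then obtain a where a: "!!i. i \<in> {1..<m} ==> a i \<in> cohomology E (?Y i) \<and> t i = young_transfer E G m i (a i)" by metis
  have "x = finsum (R (BGS G m)) (\<lambda>i. young_transfer E G m i (a i)) {1..<m}"
   unfolding t(1) by (rule finsum_cong'[OF HOL.refl]) (use a t(2) Tc in auto)
  thus "x \<in> I_Tr E \<xi> G m" unfolding I_Tr_def using a by blast
 qed
 have ideal: "ideal (I_Tr E \<xi> G m) (R (BGS G m))"
  unfolding I by (rule ideal_finsum[OF _ T]) simp
 \<comment> \<open>A single transfer is a sum of the required form, with zero in all other places;
   zero is itself a transfer there because the image is an ideal.\<close>
 have in_I: "young_transfer E G m i A \<in> I_Tr E \<xi> G m" if i: "i \<in> {1..<m}" and A: "A \<in> cohomology E (?Y i)" for i A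
 proof -
  let ?t = "\<lambda>j. if i = j then young_transfer E G m i A else \<zero>\<^bsub>R (BGS G m)\<^esub>"
  have tA: "young_transfer E G m i A \<in> T i" using A by (simp add: T_def)
  have "finsum (R (BGS G m)) (\<lambda>j. if i = j then (\<lambda>_. young_transfer E G m i A) j else \<zero>\<^bsub>R (BGS G m)\<^esub>) {1..<m} = (\<lambda>_. young_transfer E G m i A) i"
   by (rule finsum_singleton[OF i]) (use Tc[OF tA] in auto)
  moreover have "?t j \<in> T j" for j
   using tA additive_subgroup.zero_closed[OF ideal.axioms(1)[OF T[of j]]] by (cases "i = j") simp_all
  ultimately show ?thesis unfolding I by (intro CollectI exI[of _ ?t]) simp
 qed
 let ?S = "(\<Union>i\<in>{1..<m}. young_transfer E G m i ` cohomology E (?Y i)) \<union> Z_transfer E G H m ` cohomology E Z"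
 have S: "?S \<subseteq> I_Tr E \<xi> G m" using in_I Z_transfer_in_ideal[OF Z ideal in_I] by blast
 have Sc: "?S \<subseteq> carrier (R (BGS G m))" using S ideal.Icarr[OF ideal] by blast
 have J: "J_ideal E \<xi> G H m = Idl\<^bsub>R (BGS G m)\<^esub> ?S" by (simp add: J_ideal_def)
 have "I_Tr E \<xi> G m \<subseteq> Idl\<^bsub>R (BGS G m)\<^esub> ?S"
 proof
  fix x assume "x \<in> I_Tr E \<xi> G m"
  then obtain t where t: "x = finsum (R (BGS G m)) t {1..<m}" "\<forall>i\<in>{1..<m}. t i \<in> T i" unfolding I by blast
  have "T i \<subseteq> ?S" if "i \<in> {1..<m}" for i using that by (auto simp: T_def)
  thus "x \<in> Idl\<^bsub>R (BGS G m)\<^esub> ?S" unfolding t(1)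
   by (intro finsum_in_ideal[OF genideal_ideal[OF Sc]]) (use t(2) genideal_self[OF Sc] in blast)+
 qed
 thus ?thesis unfolding J using genideal_minimal[OF ideal S] ideal by blast
qed

end

theorem corollary2p45:
  fixes E :: "'e symspec"
    and \<xi> :: "'e power_ops"
    and G :: "('g, 'b) monoid_scheme"
    and H :: "'g set"
    and m :: nat
  assumes "H_infinity_ring_spectrum E \<xi>"
    and "group G" and "finite (carrier G)"
    and "m \<ge> 1"
    and "H \<lhd> G"
    and "coprime m (order (G Mod H))"
  shows "ideal (I_Tr E \<xi> G m) (cohomology_ring E \<xi> (BGS G m))
       \<and> J_ideal E \<xi> G H m = I_Tr E \<xi> G m"
proof -
 interpret E_ring E \<xi>
  by unfold_locales (use assms(1) in \<open>auto simp: H_infinity_ring_spectrum_def\<close>)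
 have "Z_base G m H"
  by (rule Z_base.intro, rule cover_base.intro, (rule assms)+, rule Z_base_axioms.intro, (rule assms)+)
 thus ?thesis by (rule ideals_eq)
qed

end
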